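(* Let $A(x,D_x)$ be an $m\times m$ matrix of generalised pseudodifferential operators with symbol (entries) in $\mathcal{G}_{S^0(\mathbb{R}^{2n})}$. If there exist a representative $(A_\varepsilon)_\varepsilon$ of $A(x,\xi)$ and strictly nonzero nets $(c_\varepsilon)_\varepsilon$ and $(r_\varepsilon)_\varepsilon$ such that $$\mathrm{Re}\,A_\varepsilon(x,\xi)\ge c_\varepsilon I\quad\text{for }|\xi|\ge r_\varepsilon,$$ then there exists a moderate net $(c_{1,\varepsilon})_\varepsilon$ such that $$\mathrm{Re}(A_\varepsilon(x,D_x)u,u)\ge c_\varepsilon\|u\|_0^2-c_{1,\varepsilon}\|u\|_{-1/2}^2$$ for all vectors $u$ with components in $\mathscr{S}(\mathbb{R}^n)$ and all $\varepsilon\in(0,1]$.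
   Context: Nets are indexed by $\varepsilon\in(0,1]$; $O$-estimates are as $\varepsilon\to0$. A net of numbers $(u_\varepsilon)_\varepsilon$ is moderate if $|u_\varepsilon|=O(\varepsilon^{-N})$ for some $N\in\mathbb{N}$, and strictly nonzero if there are $r>0$, $\eta\in(0,1]$ with $|u_\varepsilon|\ge\varepsilon^r$ for all $\varepsilon\in(0,\eta]$. $S^0(\mathbb{R}^{2n})$ is the space of symbols with finite seminorms $|a|^{(0)}_l=\sup_{(x,\xi)\in\mathbb{R}^{2n},|\alpha+\beta|\le l}\langle\xi\rangle^{|\alpha|}|\partial_\xi^\alpha\partial_x^\beta a(x,\xi)|$, where $\langle\xi\rangle=(1+|\xi|^2)^{1/2}$. $\mathcal{G}_{S^0(\mathbb{R}^{2n})}=\mathcal{M}_{S^0}/\mathcal{N}_{S^0}$, where $\mathcal{M}_{S^0}$ consists of the nets $(a_\varepsilon)_\varepsilon$ in $S^0(\mathbb{R}^{2n})$ such that for each $l$ there is $N\in\mathbb{N}$ with $|a_\varepsilon|^{(0)}_l=O(\varepsilon^{-N})$, and $\mathcal{N}_{S^0}$ of the nets with $|a_\varepsilon|^{(0)}_l=O(\varepsilon^q)$ for all $l,q\in\mathbb{N}$. For matrices, $A^\ast=\overline{A}^{T}$, $\mathrm{Re}\,A=(A+A^\ast)/2$, and $A\ge B$ means $\overline{z}^{T}(A-B)z\ge0$ for all $z\in\mathbb{C}^m$, $z\ne0$. $(\cdot,\cdot)$ is the scalar product of $L^2(\mathbb{R}^n)^m$ and $\|u\|_s=\|\langle D_x\rangle^su\|_{L^2}$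 is the Sobolev norm of order $s$, $\langle D_x\rangle^s$ being the pseudodifferential operator with symbol $\langle\xi\rangle^s$.
   Formalization: The net (r_ε) is additionally assumed to be moderate; without this the claim fails, e.g. for A_ε = ψ(ξ/e^{1/ε}) with ψ = −1 for |ξ| ≤ 1 and ψ = 1 for |ξ| ≥ 2, where no moderate (c_{1,ε}) exists. *)

theory Defs
  imports "HOL-Analysis.Analysis" "HOL-Library.Landau_Symbols"
begin

text \<open>
  Nets indexed by \<open>\<epsilon> \<in> (0,1]\<close> are functions on \<^typ>\<open>real\<close> whose values outside
  \<open>{0<..1}\<close> are never used.
\<close>

definition moderate :: "(real \<Rightarrow> 'a::real_normed_vector) \<Rightarrow> bool" where
  "moderate u \<longleftrightarrow> (\<exists>N::nat. (\<lambda>\<epsilon>. norm (u \<epsilon>)) \<in> O[at_right 0](\<lambda>\<epsilon>. \<epsilon> powr (- real N)))"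

definition strictly_nonzero :: "(real \<Rightarrow> 'a::real_normed_vector) \<Rightarrow> bool" where
  "strictly_nonzero u \<longleftrightarrow>
     (\<exists>r>0. \<exists>\<eta>\<in>{0<..1}. \<forall>\<epsilon>\<in>{0<..\<eta>}. norm (u \<epsilon>) \<ge> \<epsilon> powr r)"

text \<open>
  Iterated directional derivative along the vectors in \<open>vs\<close>. A multi-index of length \<open>k\<close> is
  encoded by a list of \<open>k\<close> coordinates; for smooth functions the order of the list is immaterial,
  so suprema over such lists are suprema over multi-indices.
\<close>

definition iter_deriv ::
  "'a::euclidean_space list \<Rightarrow> ('a \<Rightarrow> 'b::real_normed_vector) \<Rightarrow> 'a \<Rightarrow> 'b" where
  "iter_deriv vs f = foldr (\<lambda>v g z. frechet_derivative g (at z) v) vs f"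

definition smooth :: "('a::euclidean_space \<Rightarrow> 'b::real_normed_vector) \<Rightarrow> bool" where
  "smooth f \<longleftrightarrow> (\<forall>vs. set vs \<subseteq> Basis \<longrightarrow> (\<forall>z. iter_deriv vs f differentiable (at z)))"

definition jbracket :: "real^'n \<Rightarrow> real" where
  "jbracket \<xi> = sqrt (1 + (norm \<xi>)\<^sup>2)"

definition schwartz :: "(real^'n \<Rightarrow> complex) \<Rightarrow> bool" where
  "schwartz u \<longleftrightarrow> smooth u \<and>
     (\<forall>(k::nat) (\<beta>::'n list).
        bdd_above (range (\<lambda>x. jbracket x ^ k * norm (iter_deriv (map (\<lambda>i. axis i 1) \<beta>) u x))))"

text \<open>Symbols are functions of the pair \<open>(x, \<xi>)\<close>.\<close>

type_synonym 'n symbol = "(real^'n) \<times> (real^'n) \<Rightarrow> complex"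

definition symbol_deriv :: "'n::finite list \<Rightarrow> 'n list \<Rightarrow> 'n symbol \<Rightarrow> 'n symbol" where
  "symbol_deriv \<alpha> \<beta> a =
     iter_deriv (map (\<lambda>i. (0, axis i 1)) \<alpha> @ map (\<lambda>i. (axis i 1, 0)) \<beta>) a"

definition S0_values :: "nat \<Rightarrow> 'n::finite symbol \<Rightarrow> real set" where
  "S0_values l a =
     {jbracket \<xi> ^ length \<alpha> * norm (symbol_deriv \<alpha> \<beta> a (x, \<xi>)) | x \<xi> \<alpha> \<beta>.
        length \<alpha> + length \<beta> \<le> l}"

definition S0_seminorm :: "nat \<Rightarrow> 'n::finite symbol \<Rightarrow> real" where
  "S0_seminorm l a = Sup (S0_values l a)"

definition S0 :: "'n::finite symbol set" where
  "S0 = {a. smooth a \<and> (\<forall>l. bdd_above (S0_values l a))}"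

definition M_S0 :: "(real \<Rightarrow> 'n::finite symbol) set" where
  "M_S0 = {a. (\<forall>\<epsilon>\<in>{0<..1}. a \<epsilon> \<in> S0) \<and>
     (\<forall>l. \<exists>N::nat. (\<lambda>\<epsilon>. S0_seminorm l (a \<epsilon>)) \<in> O[at_right 0](\<lambda>\<epsilon>. \<epsilon> powr (- real N)))}"

definition N_S0 :: "(real \<Rightarrow> 'n::finite symbol) set" where
  "N_S0 = {a. (\<forall>\<epsilon>\<in>{0<..1}. a \<epsilon> \<in> S0) \<and>
     (\<forall>l (q::nat). (\<lambda>\<epsilon>. S0_seminorm l (a \<epsilon>)) \<in> O[at_right 0](\<lambda>\<epsilon>. \<epsilon> ^ q))}"

definition S0_rel :: "((real \<Rightarrow> 'n::finite symbol) \<times> (real \<Rightarrow> 'n symbol)) set" where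
  "S0_rel = {(a, b). a \<in> M_S0 \<and> b \<in> M_S0 \<and> (\<lambda>\<epsilon> z. a \<epsilon> z - b \<epsilon> z) \<in> N_S0}"

definition G_S0 :: "(real \<Rightarrow> 'n::finite symbol) set set" where
  "G_S0 = M_S0 // S0_rel"

definition represents ::
  "(real \<Rightarrow> (real^'n) \<times> (real^'n) \<Rightarrow> complex^'m^'m) \<Rightarrow> ((real \<Rightarrow> 'n::finite symbol) set)^'m^'m \<Rightarrow> bool"
  where "represents A\<epsilon> A \<longleftrightarrow> (\<forall>i j. (\<lambda>\<epsilon> z. A\<epsilon> \<epsilon> z $ i $ j) \<in> A $ i $ j)"

definition adjoint_mat :: "complex^'m^'m \<Rightarrow> complex^'m^'m" where
  "adjoint_mat M = (\<chi> i j. cnj (M $ j $ i))"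

definition Re_mat :: "complex^'m^'m \<Rightarrow> complex^'m^'m" where
  "Re_mat M = (1 / 2) *\<^sub>R (M + adjoint_mat M)"

text \<open>Membership in \<open>\<real>\<^sub>\<ge>\<^sub>0\<close> says that the complex number \<open>z\<^sup>*(M - N)z\<close> is real and nonnegative.\<close>

definition mat_ge :: "complex^'m^'m \<Rightarrow> complex^'m^'m \<Rightarrow> bool" where
  "mat_ge M N \<longleftrightarrow>
     (\<forall>z. z \<noteq> 0 \<longrightarrow> (\<Sum>i\<in>UNIV. cnj (z $ i) * (((M - N) *v z) $ i)) \<in> \<real>\<^sub>\<ge>\<^sub>0)"

definition fourier :: "(real^'n \<Rightarrow> complex) \<Rightarrow> real^'n \<Rightarrow> complex" where
  "fourier u \<xi> = (LINT x|lborel. cis (- (x \<bullet> \<xi>)) * u x)"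

definition psdo :: "'n::finite symbol \<Rightarrow> (real^'n \<Rightarrow> complex) \<Rightarrow> real^'n \<Rightarrow> complex" where
  "psdo a u x =
     (1 / (2 * pi) ^ CARD('n)) *\<^sub>R (LINT \<xi>|lborel. cis (x \<bullet> \<xi>) * a (x, \<xi>) * fourier u \<xi>)"

definition psdo_mat ::
  "((real^'n) \<times> (real^'n) \<Rightarrow> complex^'m^'m) \<Rightarrow> (real^'n \<Rightarrow> complex^'m) \<Rightarrow> real^'n \<Rightarrow> complex^'m"
  where "psdo_mat A u x = (\<chi> i. \<Sum>j\<in>UNIV. psdo (\<lambda>z. A z $ i $ j) (\<lambda>y. u y $ j) x)"

definition L2_inner :: "(real^'n \<Rightarrow> complex^'m) \<Rightarrow> (real^'n \<Rightarrow> complex^'m) \<Rightarrow> complex" where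
  "L2_inner u v = (LINT x|lborel. (\<Sum>i\<in>UNIV. u x $ i * cnj (v x $ i)))"

definition L2_norm :: "(real^'n \<Rightarrow> complex^'m) \<Rightarrow> real" where
  "L2_norm u = sqrt (LINT x|lborel. (norm (u x))\<^sup>2)"

definition sobolev_norm :: "real \<Rightarrow> (real^'n \<Rightarrow> complex^'m) \<Rightarrow> real" where
  "sobolev_norm s u =
     L2_norm (\<lambda>x. \<chi> j. psdo (\<lambda>(y, \<xi>). complex_of_real (jbracket \<xi> powr s)) (\<lambda>y. u y $ j) x)"

end

(*
  Proof idea.  Since Re A <= S for a finite sum S of seminorms of A, one may replace c by
  max c (-S) and then A by A - c; for |xi| < r the loss of positivity is at most
  kappa / <xi> with kappa = 2 S (1 + |r|).  It remains to prove a sharp Garding inequality whose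
  constant is linear in S and kappa.

  Localise in x with the weight lam y x = prod_b 1 / (1 + ((x - y).b)^2).  Its inverse is a
  polynomial, so lam y * Op(a) u = Op(a + lower order terms) (lam y * u) is an exact identity with
  finitely many terms.  After localisation the symbol has a rapidly decreasing Fourier transform in
  x, and the form becomes an integral kernel on the Fourier side.  Comparing it with the Friedrichs
  symmetrisation, built from Gaussian frequency windows of width <xi>^(1/2), the difference of
  the kernels is O(<eta - xi>^(-N) <xi>^(-1)), which Schur's test bounds by the norm of order -1/2.
  The symmetrised form inherits the lower bound of the symbol.  Integrating over y, Plancherel in y
  reassembles the localised norms.
*)

theory Submission
  imports Defs "HOL-Probability.Probability"
begin


section \<open>Lebesgue integrals on Euclidean spaces\<close>

text \<open>The constant of the theorem has to be moderate, so the bounds that feed it must be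
  explicit in finitely many seminorms. This excludes asymptotic expansions with unspecified
  remainders and motivates the rational weight: each complex linear factor of its inverse costs one
  integration by parts in xi and yields an exact commutator. A weight is needed at all because a
  symbol of order 0 does not decay in x, so its Fourier transform in x is in general only a
  distribution. The truncation of c at -S is forced by c being bounded above by S through
  ellipticity but possibly very negative; raising it only strengthens the inequality. The window
  width <xi>^(1/2) balances two errors: for windows of variance V, the second-order Taylor term of
  the symbol costs V / <xi>^2, and exchanging the window at xi for the one at eta costs |eta - xi|^2
  / V. Both are of order 1 / <xi> exactly for V = <xi>. An error kernel of size 1 / <xi> is what the
  square of a norm of order -1/2 absorbs.\<close>

lemma lborel_integral_affine:
  fixes f :: "'a::euclidean_space \<Rightarrow> 'b::{banach,second_countable_topology}"
  assumes c: "c \<noteq> 0" and [measurable]: "f \<in> borel_measurable borel"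
  shows "integrable lborel (\<lambda>x. f (t + c *\<^sub>R x)) \<longleftrightarrow> integrable lborel f"
    and "(\<integral>x. f (t + c *\<^sub>R x) \<partial>lborel) = (1 / \<bar>c\<bar> ^ DIM('a)) *\<^sub>R (\<integral>x. f x \<partial>lborel)"
proof -
  have i: "integrable lborel f \<longleftrightarrow> integrable (density (distr lborel borel (\<lambda>x. t + c *\<^sub>R x)) (\<lambda>_. ennreal (\<bar>c\<bar> ^ DIM('a)))) f"
    using lborel_affine[OF c, of t] by simp
  also have "\<dots> \<longleftrightarrow> integrable (distr lborel borel (\<lambda>x. t + c *\<^sub>R x)) (\<lambda>x. (\<bar>c\<bar> ^ DIM('a)) *\<^sub>R f x)"
    by (intro integrable_density) auto
  also have "\<dots> \<longleftrightarrow> integrable lborel (\<lambda>x. (\<bar>c\<bar> ^ DIM('a)) *\<^sub>R f (t + c *\<^sub>R x))"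
    by (intro integrable_distr_eq) auto
  also have "\<dots> \<longleftrightarrow> integrable lborel (\<lambda>x. f (t + c *\<^sub>R x))"
  proof
    assume "integrable lborel (\<lambda>x. \<bar>c\<bar> ^ DIM('a) *\<^sub>R f (t + c *\<^sub>R x))"
    then have "integrable lborel (\<lambda>x. (1 / \<bar>c\<bar> ^ DIM('a)) *\<^sub>R \<bar>c\<bar> ^ DIM('a) *\<^sub>R f (t + c *\<^sub>R x))"
      by (rule integrable_scaleR_right)
    then show "integrable lborel (\<lambda>x. f (t + c *\<^sub>R x))" using c by simp
  qed simp
  finally show "integrable lborel (\<lambda>x. f (t + c *\<^sub>R x)) \<longleftrightarrow> integrable lborel f" by simp
  have "integral\<^sup>L lborel f = integral\<^sup>L (density (distr lborel borel (\<lambda>x. t + c *\<^sub>R x)) (\<lambda>_. ennreal (\<bar>c\<bar> ^ DIM('a)))) f"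
    using lborel_affine[OF c, of t] by simp
  also have "\<dots> = integral\<^sup>L (distr lborel borel (\<lambda>x. t + c *\<^sub>R x)) (\<lambda>x. (\<bar>c\<bar> ^ DIM('a)) *\<^sub>R f x)"
    by (intro integral_density) auto
  also have "\<dots> = (\<integral>x. (\<bar>c\<bar> ^ DIM('a)) *\<^sub>R f (t + c *\<^sub>R x) \<partial>lborel)"
    by (intro integral_distr) auto
  finally show "(\<integral>x. f (t + c *\<^sub>R x) \<partial>lborel) = (1 / \<bar>c\<bar> ^ DIM('a)) *\<^sub>R (\<integral>x. f x \<partial>lborel)"
    using c by simp
qed

lemma lborel_integral_shift:
  fixes f :: "'a::euclidean_space \<Rightarrow> 'b::{banach,second_countable_topology}"
  assumes [measurable]: "f \<in> borel_measurable borel"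
  shows "integrable lborel (\<lambda>x. f (x + t)) \<longleftrightarrow> integrable lborel f"
    and "integrable lborel (\<lambda>x. f (x - t)) \<longleftrightarrow> integrable lborel f"
    and "integrable lborel (\<lambda>x. f (t - x)) \<longleftrightarrow> integrable lborel f"
    and "(\<integral>x. f (x + t) \<partial>lborel) = (\<integral>x. f x \<partial>lborel)"
    and "(\<integral>x. f (x - t) \<partial>lborel) = (\<integral>x. f x \<partial>lborel)"
    and "(\<integral>x. f (t - x) \<partial>lborel) = (\<integral>x. f x \<partial>lborel)"
  using lborel_integral_affine[of 1 f t] lborel_integral_affine[of 1 f "-t"]
    lborel_integral_affine[of "-1" f t]
  by (simp_all add: add.commute)

lemma lborel_integral_prod:
  fixes f :: "'a::euclidean_space \<Rightarrow> real \<Rightarrow> 'b::{real_normed_field,banach,second_countable_topology}"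
  assumes "\<And>b. b \<in> Basis \<Longrightarrow> integrable lborel (f b)"
  shows "integrable lborel (\<lambda>x. \<Prod>b\<in>Basis. f b (x \<bullet> b))"
    and "(\<integral>x. (\<Prod>b\<in>Basis. f b (x \<bullet> b)) \<partial>lborel) = (\<Prod>b\<in>Basis. \<integral>x. f b x \<partial>lborel)"
proof -
  interpret P: product_sigma_finite "\<lambda>_::'a. lborel :: real measure"
    by standard
  have [measurable]: "b \<in> Basis \<Longrightarrow> f b \<in> borel_measurable borel" for b
    using borel_measurable_integrable[OF assms] by simp
  have m[measurable]: "(\<lambda>x::'a. \<Prod>b\<in>Basis. f b (x \<bullet> b)) \<in> borel_measurable borel"
    by measurable
  have eq: "(\<Prod>b\<in>Basis. f b ((\<Sum>b\<in>Basis. g b *\<^sub>R b) \<bullet> b)) = (\<Prod>b\<in>Basis. f b (g b))" for g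
    by (intro prod.cong) auto
  have dm: "(\<lambda>g. \<Sum>b\<in>Basis. g b *\<^sub>R (b::'a)) \<in> measurable (\<Pi>\<^sub>M b\<in>Basis. lborel) borel"
    by measurable
  have "integrable (\<Pi>\<^sub>M b\<in>Basis. lborel) (\<lambda>g. \<Prod>b\<in>(Basis::'a set). f b (g b))"
    by (intro P.product_integrable_prod assms) auto
  then show "integrable lborel (\<lambda>x::'a. \<Prod>b\<in>Basis. f b (x \<bullet> b))"
    by (subst lborel_eq, subst integrable_distr_eq[OF dm m]) (simp add: eq)
  have "(\<integral>x. (\<Prod>b\<in>Basis. f b (x \<bullet> b)) \<partial>lborel)
      = (\<integral>g. (\<Prod>b\<in>Basis. f b (g b)) \<partial>(\<Pi>\<^sub>M b\<in>(Basis::'a set). lborel))"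
    by (subst lborel_eq, subst integral_distr[OF dm m]) (simp add: eq)
  also have "\<dots> = (\<Prod>b\<in>Basis. \<integral>x. f b x \<partial>lborel)"
    by (intro P.product_integral_prod assms) auto
  finally show "(\<integral>x. (\<Prod>b\<in>Basis. f b (x \<bullet> b)) \<partial>lborel) = (\<Prod>b\<in>Basis. \<integral>x. f b x \<partial>lborel)" .
qed

lemma continuous_integral_dominated:
  fixes f :: "'p::metric_space \<Rightarrow> 'a \<Rightarrow> 'b::{banach,second_countable_topology}"
  assumes m: "\<And>p. f p \<in> borel_measurable M"
    and c: "\<And>x. continuous_on UNIV (\<lambda>p. f p x)"
    and b: "\<And>p x. norm (f p x) \<le> g x" and g: "integrable M g"
  shows "continuous_on UNIV (\<lambda>p. \<integral>x. f p x \<partial>M)"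
  unfolding continuous_on_sequentially o_def
proof safe
  fix p X assume X: "X \<longlonglongrightarrow> (p::'p)"
  have "(\<lambda>n. f (X n) x) \<longlonglongrightarrow> f p x" for x
    using c[of x] X unfolding continuous_on_sequentially o_def by auto
  then show "(\<lambda>n. \<integral>x. f (X n) x \<partial>M) \<longlonglongrightarrow> (\<integral>x. f p x \<partial>M)"
    by (intro integral_dominated_convergence[OF m m g]) (auto simp: b)
qed

text \<open>The mean value inequality turns the bound on the derivative into a Lipschitz bound with
  constant \<open>g x\<close>, so \<open>2 * g\<close> dominates the error of the difference
  quotients. Dominated convergence then applies along every sequence tending to 0.\<close>

lemma has_vector_derivative_integral_dominated:
  fixes f :: "real \<Rightarrow> 'a \<Rightarrow> 'b::{banach,second_countable_topology}"
  assumes i: "\<And>s. integrable M (f s)" and m: "f' s \<in> borel_measurable M"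
    and d: "\<And>x s. ((\<lambda>s. f s x) has_vector_derivative f' s x) (at s)"
    and b: "\<And>s x. norm (f' s x) \<le> g x" and g: "integrable M g"
  shows "((\<lambda>s. \<integral>x. f s x \<partial>M) has_vector_derivative (\<integral>x. f' s x \<partial>M)) (at s)"
proof -
  have i': "integrable M (f' s)"
    by (rule Bochner_Integration.integrable_bound[OF g m]) (simp add: order_trans[OF b abs_ge_self])
  let ?q = "\<lambda>h x. norm (f (s + h) x - f s x - h *\<^sub>R f' s x) / norm h"
  have lip: "norm (f (s + h) x - f s x) \<le> g x * norm h" for h x
  proof -
    have "norm (f (s + h) x - f s x) \<le> g x * norm ((s + h) - s)"
    proof (rule differentiable_bound[of UNIV "\<lambda>s. f s x" "\<lambda>s h. h *\<^sub>R f' s x" "g x" "s+h" s])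
      show "onorm (\<lambda>h. h *\<^sub>R f' s x) \<le> g x" for s
        by (rule onorm_le) (simp add: mult.commute mult_left_mono[OF b])
    qed (use d in \<open>auto simp: has_vector_derivative_def\<close>)
    then show ?thesis by simp
  qed
  have qb: "norm (?q h x) \<le> 2 * g x" if "h \<noteq> 0" for h x
  proof -
    have "norm (f (s + h) x - f s x - h *\<^sub>R f' s x) \<le> g x * norm h + norm h * g x"
      by (rule order_trans[OF norm_triangle_ineq4], rule add_mono)
        (use lip[of h x] b[of s x] in \<open>simp_all add: mult_left_mono\<close>)
    then show ?thesis using that by (simp add: divide_le_eq mult_ac)
  qed
  have "(\<lambda>n. \<integral>x. ?q (X n) x \<partial>M) \<longlonglongrightarrow> (\<integral>x. 0 \<partial>M)" if X: "X \<longlonglongrightarrow> 0" "\<And>n. X n \<noteq> 0" for X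
  proof (rule integral_dominated_convergence)
    show "integrable M (\<lambda>x. 2 * g x)" using g by simp
    show "AE x in M. (\<lambda>n. ?q (X n) x) \<longlonglongrightarrow> 0"
    proof (rule AE_I2)
      fix x
      have "((\<lambda>h. ?q h x) \<longlongrightarrow> 0) (at 0)"
        using d[of x s] unfolding has_vector_derivative_def has_derivative_at by auto
      then show "(\<lambda>n. ?q (X n) x) \<longlonglongrightarrow> 0"
        using X by (auto simp: tendsto_at_iff_sequentially o_def)
    qed
    show "\<And>n. AE x in M. norm (?q (X n) x) \<le> 2 * g x" using qb X by auto
  qed (use i i' in auto)
  then have lim: "((\<lambda>h. \<integral>x. ?q h x \<partial>M) \<longlongrightarrow> 0) (at 0)"
    by (auto simp: tendsto_at_iff_sequentially o_def)
  have le: "norm ((\<integral>x. f (s + h) x \<partial>M) - (\<integral>x. f s x \<partial>M) - h *\<^sub>R (\<integral>x. f' s x \<partial>M)) / norm h \<le> (\<integral>x. ?q h x \<partial>M)" for h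
  proof -
    have "norm ((\<integral>x. f (s + h) x \<partial>M) - (\<integral>x. f s x \<partial>M) - h *\<^sub>R (\<integral>x. f' s x \<partial>M))
        = norm (\<integral>x. (f (s + h) x - f s x - h *\<^sub>R f' s x) \<partial>M)"
      using i i' by simp
    also have "\<dots> \<le> (\<integral>x. norm (f (s + h) x - f s x - h *\<^sub>R f' s x) \<partial>M)"
      by (rule integral_norm_bound)
    finally show ?thesis by (simp only: integral_divide_zero divide_right_mono norm_ge_zero)
  qed
  have "((\<lambda>h. norm ((\<integral>x. f (s + h) x \<partial>M) - (\<integral>x. f s x \<partial>M) - h *\<^sub>R (\<integral>x. f' s x \<partial>M)) / norm h) \<longlongrightarrow> 0) (at 0)"
    by (rule Lim_null_comparison[OF always_eventually lim]) (use le in \<open>simp only: real_norm_def abs_divide abs_norm_cancel abs_abs HOL.simp_thms\<close>)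
  then show ?thesis
    unfolding has_vector_derivative_def has_derivative_at
    by (auto intro: bounded_linear_scaleR_left)
qed

lemma integrable_lborel_prod_bound:
  fixes f :: "'a::euclidean_space \<times> 'b::euclidean_space \<Rightarrow> 'c::{banach,second_countable_topology}"
  assumes [measurable]: "f \<in> borel_measurable borel"
    and g: "integrable lborel g" and h: "integrable lborel h"
    and b: "\<And>x y. norm (f (x, y)) \<le> (g x :: real) * h y"
  shows "integrable lborel f"
proof -
  have [measurable]: "g \<in> borel_measurable borel" "h \<in> borel_measurable borel"
    using g h by auto
  have "integrable (lborel \<Otimes>\<^sub>M lborel) (\<lambda>p. g (fst p) * h (snd p))"
    by (rule lborel_pair.Fubini_integrable) (use g h in \<open>auto simp: abs_mult\<close>)
  then have "integrable lborel (\<lambda>p. g (fst p) * h (snd p))" by (simp add: lborel_prod)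
  then show ?thesis
    by (rule Bochner_Integration.integrable_bound)
      (auto simp: order_trans[OF b abs_ge_self])
qed

lemma lborel_fubini:
  fixes f :: "'a::euclidean_space \<times> 'b::euclidean_space \<Rightarrow> 'c::{banach,second_countable_topology}"
  assumes f: "integrable lborel f"
  shows "(\<integral>x. (\<integral>y. f (x, y) \<partial>lborel) \<partial>lborel) = integral\<^sup>L lborel f"
    and "(\<integral>y. (\<integral>x. f (x, y) \<partial>lborel) \<partial>lborel) = integral\<^sup>L lborel f"
    and "integrable lborel (\<lambda>x. \<integral>y. f (x, y) \<partial>lborel)"
    and "integrable lborel (\<lambda>y. \<integral>x. f (x, y) \<partial>lborel)"
proof -
  have f': "integrable (lborel \<Otimes>\<^sub>M lborel) (\<lambda>(x, y). f (x, y))" using f by (simp add: lborel_prod)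
  show "(\<integral>x. (\<integral>y. f (x, y) \<partial>lborel) \<partial>lborel) = integral\<^sup>L lborel f"
    using lborel_pair.integral_fst'[OF f'] by (simp add: lborel_prod)
  show "(\<integral>y. (\<integral>x. f (x, y) \<partial>lborel) \<partial>lborel) = integral\<^sup>L lborel f"
    using lborel_pair.integral_snd[OF f'] by (simp add: lborel_prod)
  show "integrable lborel (\<lambda>x. \<integral>y. f (x, y) \<partial>lborel)"
    using lborel_pair.integrable_fst'[OF f'] by simp
  show "integrable lborel (\<lambda>y. \<integral>x. f (x, y) \<partial>lborel)"
    using lborel_pair.integrable_snd[OF f'] by simp
qed

lemma lborel_integral_times:
  fixes f :: "'a::euclidean_space \<Rightarrow> 'c::{real_normed_field,banach,second_countable_topology}"
    and g :: "'b::euclidean_space \<Rightarrow> 'c"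
  assumes f: "integrable lborel f" and g: "integrable lborel g"
  shows "integrable lborel (\<lambda>p. f (fst p) * g (snd p))"
    and "(\<integral>p. f (fst p) * g (snd p) \<partial>lborel) = integral\<^sup>L lborel f * integral\<^sup>L lborel g"
proof -
  have [measurable]: "f \<in> borel_measurable borel" "g \<in> borel_measurable borel"
    using f g by auto
  show i: "integrable lborel (\<lambda>p. f (fst p) * g (snd p))"
  proof (rule integrable_lborel_prod_bound[where g="\<lambda>x. norm (f x)" and h="\<lambda>x. norm (g x)"])
    show "(\<lambda>p. f (fst p) * g (snd p)) \<in> borel_measurable borel"
      unfolding borel_prod[symmetric] by measurable
  qed (use f g in \<open>auto simp: norm_mult\<close>)
  show "(\<integral>p. f (fst p) * g (snd p) \<partial>lborel) = integral\<^sup>L lborel f * integral\<^sup>L lborel g"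
    using lborel_fubini(1)[OF i] by simp
qed

text \<open>This is the integration by parts used throughout. Integrating f(x + v) - f(x) = int_0^1
  f'(x + s v) ds over x gives 0 on the left by translation invariance, and the integral of f' on the
  right after Fubini. Integrability of both functions replaces any discussion of boundary
  terms.\<close>

lemma integral_directional_derivative_zero:
  fixes f :: "'a::euclidean_space \<Rightarrow> 'b::euclidean_space"
  assumes f: "integrable lborel f" and f': "integrable lborel f'" and c: "continuous_on UNIV f'"
    and d: "\<And>x. ((\<lambda>s. f (x + s *\<^sub>R v)) has_vector_derivative f' x) (at 0)"
  shows "(\<integral>x. f' x \<partial>lborel) = 0"
proof -
  have [measurable]: "f \<in> borel_measurable borel" using f by simp
  have [measurable]: "f' \<in> borel_measurable borel" using f' by simp
  have d': "((\<lambda>s. f (x + s *\<^sub>R v)) has_vector_derivative f' (x + s *\<^sub>R v)) (at s)" for x s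
  proof -
    have "((\<lambda>h. f ((x + s *\<^sub>R v) + h *\<^sub>R v)) has_vector_derivative f' (x + s *\<^sub>R v)) (at (s - s))"
      using d[of "x + s *\<^sub>R v"] by simp
    then have "((\<lambda>h. f ((x + s *\<^sub>R v) + h *\<^sub>R v)) \<circ> (\<lambda>r. r - s) has_vector_derivative (1 *\<^sub>R f' (x + s *\<^sub>R v))) (at s)"
      by (intro vector_diff_chain_at) (auto intro!: derivative_eq_intros)
    then show ?thesis by (simp add: o_def algebra_simps)
  qed
  have ftc: "f (x + v) - f x = (\<integral>s\<in>{0..1}. f' (x + s *\<^sub>R v) \<partial>lborel)" for x
  proof -
    have cc: "continuous_on {0..1} (\<lambda>s. f' (x + s *\<^sub>R v))"
      by (rule continuous_on_compose2[OF c]) (auto intro!: continuous_intros)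
    have hi: "((\<lambda>s. f' (x + s *\<^sub>R v)) has_integral (f (x + 1 *\<^sub>R v) - f (x + 0 *\<^sub>R v))) {0..1}"
      by (rule fundamental_theorem_of_calculus) (auto intro: d' has_vector_derivative_at_within)
    have si: "set_integrable lborel {0..1} (\<lambda>s. f' (x + s *\<^sub>R v))"
      by (rule borel_integrable_atLeastAtMost') (rule cc)
    show ?thesis
      using set_borel_integral_eq_integral(2)[OF si] integral_unique[OF hi] by simp
  qed
  define P where "P = (\<lambda>(s::real, x). indicator {0..1} s *\<^sub>R f' (x + s *\<^sub>R v))"
  have Pm[measurable]: "P \<in> borel_measurable (lborel \<Otimes>\<^sub>M lborel)"
    unfolding P_def by measurable
  have i: "integrable lborel (\<lambda>x. f' (x + t))" for t
    using lborel_integral_shift(1)[of f' t] f' by simp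
  have n: "(\<integral>x. norm (f' (x + t)) \<partial>lborel) = (\<integral>x. norm (f' x) \<partial>lborel)" for t
    by (rule lborel_integral_shift(4)) simp
  have Pi: "integrable (lborel \<Otimes>\<^sub>M lborel) P"
  proof (rule lborel_pair.Fubini_integrable[OF Pm])
    have "(\<lambda>x. \<integral>y. norm (P (x, y)) \<partial>lborel) = (\<lambda>s. indicator {0..1} s *\<^sub>R (\<integral>x. norm (f' x) \<partial>lborel))"
      by (auto simp: P_def n fun_eq_iff)
    then show "integrable lborel (\<lambda>x. \<integral>y. norm (P (x, y)) \<partial>lborel)"
      by (simp add: integrable_real_mult_indicator mult.commute)
    show "AE x in lborel. integrable lborel (\<lambda>y. P (x, y))"
      by (auto simp: P_def i)
  qed
  have "0 = (\<integral>x. f (x + v) - f x \<partial>lborel)"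
    using f lborel_integral_shift[of f v] by simp
  also have "\<dots> = (\<integral>x. (\<integral>s. P (s, x) \<partial>lborel) \<partial>lborel)"
    unfolding ftc by (simp add: P_def set_lebesgue_integral_def)
  also have "\<dots> = (\<integral>s. (\<integral>x. P (s, x) \<partial>lborel) \<partial>lborel)"
    using lborel_fubini[of P] Pi by (simp add: lborel_prod)
  also have "\<dots> = (\<integral>s. indicator {0..1::real} s *\<^sub>R (\<integral>x. f' x \<partial>lborel) \<partial>lborel)"
    by (simp add: P_def lborel_integral_shift)
  also have "\<dots> = (\<integral>x. f' x \<partial>lborel)"
    by simp
  finally show ?thesis by simp
qed

section \<open>Gaussian integrals\<close>

text \<open>Read off from the characteristic function of the standard normal distribution by the
  scaling x -> sqrt(2 \<alpha>) x.\<close>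

lemma gauss_fourier_real:
  assumes a: "\<alpha> > 0"
  shows "integrable lborel (\<lambda>x. complex_of_real (exp (- \<alpha> * x\<^sup>2)))"
    and "(\<integral>x. cis (x * \<xi>) * complex_of_real (exp (- \<alpha> * x\<^sup>2)) \<partial>lborel)
       = complex_of_real (sqrt (pi / \<alpha>) * exp (- \<xi>\<^sup>2 / (4 * \<alpha>)))"
proof -
  define c where "c = sqrt (2 * \<alpha>)"
  have c: "c > 0" "c\<^sup>2 = 2 * \<alpha>" using a by (auto simp: c_def)
  have i0: "integrable lborel (\<lambda>x. std_normal_density x)" by simp
  have eq: "exp (- \<alpha> * x\<^sup>2) = sqrt (2 * pi) * std_normal_density (0 + c *\<^sub>R x)" for x
    using c by (simp add: normal_density_def power_mult_distrib)
  have i1: "integrable lborel (\<lambda>x. std_normal_density (0 + c *\<^sub>R x))"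
    by (subst lborel_integral_affine) (use c i0 in auto)
  show i: "integrable lborel (\<lambda>x. complex_of_real (exp (- \<alpha> * x\<^sup>2)))"
    unfolding eq using i1 by (intro integrable_of_real) auto
  define t where "t = \<xi> / c"
  have "char std_normal_distribution t = (\<integral>x. std_normal_density x *\<^sub>R iexp (t * x) \<partial>lborel)"
    unfolding char_def by (subst integral_density) (auto simp: normal_density_nonneg)
  then have ch: "(\<integral>x. std_normal_density x *\<^sub>R iexp (t * x) \<partial>lborel) = complex_of_real (exp (- (t\<^sup>2) / 2))"
    by (simp add: char_std_normal_distribution)
  have "(\<integral>x. cis (x * \<xi>) * complex_of_real (exp (- \<alpha> * x\<^sup>2)) \<partial>lborel)
      = (\<integral>x. complex_of_real (sqrt (2 * pi)) * (\<lambda>x. std_normal_density x *\<^sub>R iexp (t * x)) (0 + c *\<^sub>R x) \<partial>lborel)"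
    unfolding eq using c by (intro Bochner_Integration.integral_cong) (auto simp: t_def cis_conv_exp scaleR_conv_of_real mult_ac)
  also have "\<dots> = complex_of_real (sqrt (2 * pi)) * (\<integral>x. (\<lambda>x. std_normal_density x *\<^sub>R iexp (t * x)) (0 + c *\<^sub>R x) \<partial>lborel)"
    by (rule integral_mult_right_zero)
  also have "\<dots> = complex_of_real (sqrt (2 * pi)) * ((1 / \<bar>c\<bar> ^ DIM(real)) *\<^sub>R complex_of_real (exp (- (t\<^sup>2) / 2)))"
    by (subst lborel_integral_affine(2)) (use c ch in auto)
  also have "\<dots> = complex_of_real (sqrt (pi / \<alpha>) * exp (- \<xi>\<^sup>2 / (4 * \<alpha>)))"
  proof -
    have "sqrt (2 * pi) / c = sqrt (pi / \<alpha>)" using a by (simp add: c_def real_sqrt_divide real_sqrt_mult)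
    moreover have "- (t\<^sup>2) / 2 = - \<xi>\<^sup>2 / (4 * \<alpha>)" using c by (simp add: t_def power_divide)
    ultimately have "sqrt (2 * pi) * (1 / \<bar>c\<bar> ^ DIM(real)) * exp (- (t\<^sup>2) / 2)
        = sqrt (pi / \<alpha>) * exp (- \<xi>\<^sup>2 / (4 * \<alpha>))"
      using c(1) by simp
    then show ?thesis
      by (simp only: scaleR_conv_of_real of_real_mult[symmetric] mult.assoc[symmetric])
  qed
  finally show "(\<integral>x. cis (x * \<xi>) * complex_of_real (exp (- \<alpha> * x\<^sup>2)) \<partial>lborel)
       = complex_of_real (sqrt (pi / \<alpha>) * exp (- \<xi>\<^sup>2 / (4 * \<alpha>)))" .
qed

lemma norm_sq_sum_Basis: "(norm x)\<^sup>2 = (\<Sum>b\<in>Basis. (x \<bullet> b)\<^sup>2)" for x :: "'a::euclidean_space"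
  unfolding power2_norm_eq_inner by (subst euclidean_inner) (simp add: power2_eq_square)

lemma cis_sum: "finite A \<Longrightarrow> cis (\<Sum>b\<in>A. f b) = (\<Prod>b\<in>A. cis (f b))"
  by (induction A rule: finite_induct) (auto simp: cis_mult[symmetric])

lemma gauss_fourier:
  fixes \<xi> :: "'a::euclidean_space"
  assumes a: "\<alpha> > 0"
  shows "integrable lborel (\<lambda>x::'a. exp (- \<alpha> * (norm x)\<^sup>2))"
    and "(\<integral>x. cis (x \<bullet> \<xi>) * complex_of_real (exp (- \<alpha> * (norm x)\<^sup>2)) \<partial>lborel)
       = complex_of_real (sqrt (pi / \<alpha>) ^ DIM('a) * exp (- (norm \<xi>)\<^sup>2 / (4 * \<alpha>)))"
    and "(\<integral>x. exp (- \<alpha> * (norm (x::'a))\<^sup>2) \<partial>lborel) = sqrt (pi / \<alpha>) ^ DIM('a)"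
proof -
  have eq: "cis (x \<bullet> \<xi>) * complex_of_real (exp (- \<alpha> * (norm x)\<^sup>2))
      = (\<Prod>b\<in>Basis. (\<lambda>t. cis (t * (\<xi> \<bullet> b)) * complex_of_real (exp (- \<alpha> * t\<^sup>2))) (x \<bullet> b))" for x \<xi> :: 'a
  proof -
    have "x \<bullet> \<xi> = (\<Sum>b\<in>Basis. (x \<bullet> b) * (\<xi> \<bullet> b))" by (rule euclidean_inner)
    moreover have "exp (- \<alpha> * (norm x)\<^sup>2) = (\<Prod>b\<in>Basis. exp (- \<alpha> * (x \<bullet> b)\<^sup>2))"
      by (subst exp_sum[symmetric]) (auto simp: norm_sq_sum_Basis sum_distrib_left sum_negf)
    ultimately show ?thesis by (simp add: cis_sum prod.distrib)
  qed
  have i1: "integrable lborel (\<lambda>t. cis (t * z) * complex_of_real (exp (- \<alpha> * t\<^sup>2)))" for z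
    by (rule Bochner_Integration.integrable_bound[OF gauss_fourier_real(1)[OF a]]) (auto simp: norm_mult intro!: borel_measurable_times borel_measurable_continuous_onI continuous_intros)
  have main: "(\<integral>x. cis (x \<bullet> \<xi>) * complex_of_real (exp (- \<alpha> * (norm x)\<^sup>2)) \<partial>lborel)
       = complex_of_real (sqrt (pi / \<alpha>) ^ DIM('a) * exp (- (norm \<xi>)\<^sup>2 / (4 * \<alpha>)))" for \<xi> :: 'a
  proof -
    have "(\<integral>x. cis (x \<bullet> \<xi>) * complex_of_real (exp (- \<alpha> * (norm x)\<^sup>2)) \<partial>lborel)
      = (\<Prod>b\<in>(Basis::'a set). complex_of_real (sqrt (pi / \<alpha>) * exp (- (\<xi> \<bullet> b)\<^sup>2 / (4 * \<alpha>))))"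
      unfolding eq by (subst lborel_integral_prod(2)[OF i1]) (simp only: gauss_fourier_real(2)[OF a])
    also have "\<dots> = complex_of_real (\<Prod>b\<in>(Basis::'a set). sqrt (pi / \<alpha>) * exp (- (\<xi> \<bullet> b)\<^sup>2 / (4 * \<alpha>)))"
      by simp
    also have "(\<Prod>b\<in>(Basis::'a set). sqrt (pi / \<alpha>) * exp (- (\<xi> \<bullet> b)\<^sup>2 / (4 * \<alpha>)))
        = sqrt (pi / \<alpha>) ^ DIM('a) * exp (- (norm \<xi>)\<^sup>2 / (4 * \<alpha>))"
      by (simp add: prod.distrib norm_sq_sum_Basis exp_sum[symmetric] sum_divide_distrib sum_negf)
    finally show ?thesis .
  qed
  show "(\<integral>x. cis (x \<bullet> \<xi>) * complex_of_real (exp (- \<alpha> * (norm x)\<^sup>2)) \<partial>lborel)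
       = complex_of_real (sqrt (pi / \<alpha>) ^ DIM('a) * exp (- (norm \<xi>)\<^sup>2 / (4 * \<alpha>)))" by (rule main)
  have "integrable lborel (\<lambda>x. cis (x \<bullet> 0) * complex_of_real (exp (- \<alpha> * (norm (x::'a))\<^sup>2)))"
    unfolding eq by (rule lborel_integral_prod(1)[OF i1])
  then have ic: "integrable lborel (\<lambda>x::'a. complex_of_real (exp (- \<alpha> * (norm x)\<^sup>2)))" by simp
  then show "integrable lborel (\<lambda>x::'a. exp (- \<alpha> * (norm x)\<^sup>2))"
    using complex_of_real_integrable_eq by blast
  show "(\<integral>x. exp (- \<alpha> * (norm (x::'a))\<^sup>2) \<partial>lborel) = sqrt (pi / \<alpha>) ^ DIM('a)"
    using main[of 0] by (simp del: of_real_exp of_real_power add: integral_complex_of_real of_real_eq_iff flip: of_real_mult)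
qed

section \<open>Functions with controlled derivatives\<close>

definition pd :: "'a::euclidean_space \<Rightarrow> ('a \<Rightarrow> 'b::real_normed_vector) \<Rightarrow> 'a \<Rightarrow> 'b" where
  "pd v f z = frechet_derivative f (at z) v"

lemma pd_eq: "(f has_derivative f') (at z) \<Longrightarrow> pd v f z = f' v"
  unfolding pd_def by (metis frechet_derivative_at)

lemma has_derivative_pd: "f differentiable at z \<Longrightarrow> (f has_derivative (\<lambda>v. pd v f z)) (at z)"
  unfolding pd_def using frechet_derivative_works by blast

lemma has_vector_derivative_pd:
  assumes "f differentiable at (z + s *\<^sub>R v)"
  shows "((\<lambda>s. f (z + s *\<^sub>R v)) has_vector_derivative pd v f (z + s *\<^sub>R v)) (at s)"
proof -
  have "((\<lambda>s. z + s *\<^sub>R v) has_derivative (\<lambda>h. h *\<^sub>R v)) (at s)"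
    by (auto intro!: derivative_eq_intros)
  then have "((\<lambda>s. f (z + s *\<^sub>R v)) has_derivative (\<lambda>h. pd (h *\<^sub>R v) f (z + s *\<^sub>R v))) (at s)"
    by (rule has_derivative_compose) (rule has_derivative_pd[OF assms])
  moreover have "pd (h *\<^sub>R v) f (z + s *\<^sub>R v) = h *\<^sub>R pd v f (z + s *\<^sub>R v)" for h
    using linear_scale[OF has_derivative_linear[OF has_derivative_pd[OF assms]]] by simp
  ultimately show ?thesis unfolding has_vector_derivative_def by simp
qed

lemma iter_deriv_Nil: "iter_deriv [] f = f"
  and iter_deriv_Cons: "iter_deriv (v # vs) f = pd v (iter_deriv vs f)"
  by (auto simp: iter_deriv_def pd_def fun_eq_iff)

text \<open>Both orders of differentiation describe the same second difference over a parallelogram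
  with sides s u and s v. Two applications of the mean value theorem write it as s^2 times a mixed
  derivative at a point tending to z, once for each order; dividing by s^2 and letting s tend to 0
  identifies the two by continuity.\<close>

lemma pd_commute_real:
  fixes f :: "'a::euclidean_space \<Rightarrow> real"
  assumes f: "\<And>z. f differentiable at z"
    and u: "\<And>z. pd u f differentiable at z" and v: "\<And>z. pd v f differentiable at z"
    and cu: "continuous_on UNIV (pd v (pd u f))" and cv: "continuous_on UNIV (pd u (pd v f))"
  shows "pd u (pd v f) z = pd v (pd u f) z"
proof -
  have mean: "\<exists>t1 t2. 0 < t1 \<and> t1 < s \<and> 0 < t2 \<and> t2 < s \<and>
      f (z + s *\<^sub>R u + s *\<^sub>R v) - f (z + s *\<^sub>R u) - f (z + s *\<^sub>R v) + f z
      = s\<^sup>2 * pd v (pd u f) (z + t1 *\<^sub>R u + t2 *\<^sub>R v)"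
    if s: "s > 0" and u: "\<And>z. pd u f differentiable at z" for s and u v :: 'a
  proof -
    let ?\<phi> = "\<lambda>t. f ((z + s *\<^sub>R v) + t *\<^sub>R u) - f (z + t *\<^sub>R u)"
    have "(?\<phi> has_real_derivative pd u f ((z + s *\<^sub>R v) + t *\<^sub>R u) - pd u f (z + t *\<^sub>R u)) (at t)" for t
      using has_vector_derivative_diff[OF has_vector_derivative_pd[where z="z + s *\<^sub>R v" and s=t and v=u, OF f]
          has_vector_derivative_pd[where z=z and s=t and v=u, OF f]]
      by (simp add: has_real_derivative_iff_has_vector_derivative)
    from MVT2[OF s this] obtain t1 where t1: "0 < t1" "t1 < s" and e1:
      "?\<phi> s - ?\<phi> 0 = (s - 0) * (pd u f ((z + s *\<^sub>R v) + t1 *\<^sub>R u) - pd u f (z + t1 *\<^sub>R u))" by blast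
    have "((\<lambda>t. pd u f ((z + t1 *\<^sub>R u) + t *\<^sub>R v)) has_real_derivative pd v (pd u f) ((z + t1 *\<^sub>R u) + t *\<^sub>R v)) (at t)" for t
      using has_vector_derivative_pd[OF u] by (simp add: has_real_derivative_iff_has_vector_derivative)
    from MVT2[OF s this] obtain t2 where t2: "0 < t2" "t2 < s" and e2:
      "pd u f ((z + t1 *\<^sub>R u) + s *\<^sub>R v) - pd u f ((z + t1 *\<^sub>R u) + 0 *\<^sub>R v)
        = (s - 0) * pd v (pd u f) ((z + t1 *\<^sub>R u) + t2 *\<^sub>R v)" by blast
    have "pd u f ((z + s *\<^sub>R v) + t1 *\<^sub>R u) - pd u f (z + t1 *\<^sub>R u) = s * pd v (pd u f) (z + t1 *\<^sub>R u + t2 *\<^sub>R v)"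
      using e2 by (simp add: algebra_simps)
    with e1 have "f (z + s *\<^sub>R u + s *\<^sub>R v) - f (z + s *\<^sub>R u) - f (z + s *\<^sub>R v) + f z
      = s\<^sup>2 * pd v (pd u f) (z + t1 *\<^sub>R u + t2 *\<^sub>R v)"
      by (simp add: algebra_simps power2_eq_square)
    with t1 t2 show ?thesis by blast
  qed
  define s where "s n = 1 / real (Suc n)" for n
  have s: "s n > 0" for n by (simp add: s_def)
  have s0: "s \<longlonglongrightarrow> 0"
    unfolding s_def using LIMSEQ_inverse_real_of_nat by (simp add: inverse_eq_divide)
  obtain t1 t2 where t: "\<And>n. 0 < t1 n \<and> t1 n < s n \<and> 0 < t2 n \<and> t2 n < s n"
    and t': "\<And>n. f (z + s n *\<^sub>R u + s n *\<^sub>R v) - f (z + s n *\<^sub>R u) - f (z + s n *\<^sub>R v) + f z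
      = (s n)\<^sup>2 * pd v (pd u f) (z + t1 n *\<^sub>R u + t2 n *\<^sub>R v)"
    using mean[OF s u, where v=v] by metis
  obtain r1 r2 where r: "\<And>n. 0 < r1 n \<and> r1 n < s n \<and> 0 < r2 n \<and> r2 n < s n"
    and r': "\<And>n. f (z + s n *\<^sub>R v + s n *\<^sub>R u) - f (z + s n *\<^sub>R v) - f (z + s n *\<^sub>R u) + f z
      = (s n)\<^sup>2 * pd u (pd v f) (z + r1 n *\<^sub>R v + r2 n *\<^sub>R u)"
    using mean[OF s v, where v=u] by metis
  have eq: "pd v (pd u f) (z + t1 n *\<^sub>R u + t2 n *\<^sub>R v) = pd u (pd v f) (z + r1 n *\<^sub>R v + r2 n *\<^sub>R u)" for n
  proof -
    have "(s n)\<^sup>2 * pd v (pd u f) (z + t1 n *\<^sub>R u + t2 n *\<^sub>R v) = (s n)\<^sup>2 * pd u (pd v f) (z + r1 n *\<^sub>R v + r2 n *\<^sub>R u)"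
      unfolding t'[symmetric] r'[symmetric] by (simp add: algebra_simps)
    then show ?thesis using s[of n] by simp
  qed
  have sq: "X \<longlonglongrightarrow> 0" if "\<And>n. 0 < X n \<and> X n < s n" for X :: "nat \<Rightarrow> real"
    by (rule tendsto_sandwich[OF _ _ tendsto_const s0])
      (use that in \<open>auto intro!: always_eventually intro: less_imp_le\<close>)
  have tt: "t1 \<longlonglongrightarrow> 0" "t2 \<longlonglongrightarrow> 0" "r1 \<longlonglongrightarrow> 0" "r2 \<longlonglongrightarrow> 0"
    by (rule sq, use t r in simp)+
  have "(\<lambda>n. z + t1 n *\<^sub>R u + t2 n *\<^sub>R v) \<longlonglongrightarrow> z + 0 *\<^sub>R u + 0 *\<^sub>R v"
    "(\<lambda>n. z + r1 n *\<^sub>R v + r2 n *\<^sub>R u) \<longlonglongrightarrow> z + 0 *\<^sub>R v + 0 *\<^sub>R u"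
    by (rule tendsto_add tendsto_scaleR tendsto_const tt)+
  then have "(\<lambda>n. pd v (pd u f) (z + t1 n *\<^sub>R u + t2 n *\<^sub>R v)) \<longlonglongrightarrow> pd v (pd u f) z"
    "(\<lambda>n. pd u (pd v f) (z + r1 n *\<^sub>R v + r2 n *\<^sub>R u)) \<longlonglongrightarrow> pd u (pd v f) z"
    using cu cv unfolding continuous_on_sequentially o_def by simp_all
  then show ?thesis unfolding eq by (rule LIMSEQ_unique[symmetric])
qed

lemma pd_bounded_linear:
  assumes "bounded_linear l" "f differentiable at z"
  shows "pd v (\<lambda>x. l (f x)) z = l (pd v f z)"
  using bounded_linear.has_derivative[OF assms(1) has_derivative_pd[OF assms(2)]] by (rule pd_eq)

text \<open>The mean value theorem with an intermediate point is a real statement, so real and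
  imaginary part are treated separately as bounded linear images of f.\<close>

lemma pd_commute:
  fixes f :: "'a::euclidean_space \<Rightarrow> complex"
  assumes f: "\<And>z. f differentiable at z"
    and u: "\<And>z. pd u f differentiable at z" and v: "\<And>z. pd v f differentiable at z"
    and cu: "continuous_on UNIV (pd v (pd u f))" and cv: "continuous_on UNIV (pd u (pd v f))"
  shows "pd u (pd v f) = pd v (pd u f)"
proof
  fix z
  have *: "l (pd u (pd v f) z) = l (pd v (pd u f) z)" if l: "bounded_linear l" for l :: "complex \<Rightarrow> real"
  proof -
    have e: "pd v (\<lambda>x. l (f x)) = (\<lambda>x. l (pd v f x))" for v
      using pd_bounded_linear[OF l f] by auto
    have e1: "pd v (\<lambda>x. l (pd u f x)) = (\<lambda>x. l (pd v (pd u f) x))"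
      using pd_bounded_linear[OF l u] by auto
    have e2: "pd u (\<lambda>x. l (pd v f x)) = (\<lambda>x. l (pd u (pd v f) x))"
      using pd_bounded_linear[OF l v] by auto
    have d: "g differentiable at z \<Longrightarrow> (\<lambda>x. l (g x)) differentiable at z" for g :: "'a \<Rightarrow> complex" and z
      unfolding differentiable_def using bounded_linear.has_derivative[OF l] by blast
    have "pd u (pd v (\<lambda>x. l (f x))) z = pd v (pd u (\<lambda>x. l (f x))) z"
      by (rule pd_commute_real)
        (auto simp: e e1 e2 intro!: d f u v continuous_on_compose2[OF linear_continuous_on[OF l] cu] continuous_on_compose2[OF linear_continuous_on[OF l] cv])
    then show ?thesis by (simp add: e e1 e2)
  qed
  show "pd u (pd v f) z = pd v (pd u f) z"
    using *[OF bounded_linear_Re] *[OF bounded_linear_Im] by (rule complex_eqI)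
qed

section \<open>Reordering iterated derivatives of smooth functions\<close>

lemma smooth_iter_deriv_differentiable:
  "smooth f \<Longrightarrow> set vs \<subseteq> Basis \<Longrightarrow> iter_deriv vs f differentiable at z"
  unfolding smooth_def by blast

lemma smooth_iter_deriv_continuous:
  "smooth f \<Longrightarrow> set vs \<subseteq> Basis \<Longrightarrow> continuous_on UNIV (iter_deriv vs f)"
  using smooth_iter_deriv_differentiable[of f vs]
  by (simp add: continuous_at_imp_continuous_on differentiable_imp_continuous_within)

lemma iter_deriv_swap:
  fixes f :: "'a::euclidean_space \<Rightarrow> complex"
  assumes f: "smooth f" and "u \<in> Basis" "v \<in> Basis" "set vs \<subseteq> Basis"
  shows "iter_deriv (u # v # vs) f = iter_deriv (v # u # vs) f"
  unfolding iter_deriv_Cons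
proof (rule pd_commute)
  fix z
  show "iter_deriv vs f differentiable at z" "pd u (iter_deriv vs f) differentiable at z"
    "pd v (iter_deriv vs f) differentiable at z"
    using assms smooth_iter_deriv_differentiable[OF f, of vs z]
      smooth_iter_deriv_differentiable[OF f, of "u # vs" z] smooth_iter_deriv_differentiable[OF f, of "v # vs" z]
    by (simp_all add: iter_deriv_Cons)
  show "continuous_on UNIV (pd v (pd u (iter_deriv vs f)))" "continuous_on UNIV (pd u (pd v (iter_deriv vs f)))"
    using assms smooth_iter_deriv_continuous[OF f, of "u # v # vs"] smooth_iter_deriv_continuous[OF f, of "v # u # vs"]
    by (simp_all add: iter_deriv_Cons)
qed

lemma iter_deriv_move:
  fixes f :: "'a::euclidean_space \<Rightarrow> complex"
  assumes f: "smooth f" and v: "v \<in> Basis" and "set us \<subseteq> Basis" "set vs \<subseteq> Basis"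
  shows "iter_deriv (v # us @ vs) f = iter_deriv (us @ v # vs) f"
  using assms(3)
proof (induction us)
  case (Cons u us)
  have "iter_deriv (v # (u # us) @ vs) f = iter_deriv (u # v # us @ vs) f"
    using iter_deriv_swap[OF f v, of u "us @ vs"] Cons.prems assms by auto
  also have "\<dots> = iter_deriv ((u # us) @ v # vs) f"
    using Cons by (simp add: iter_deriv_Cons)
  finally show ?case .
qed simp

text \<open>With P selecting the xi-directions, this brings derivatives taken in any order into the
  order xi before x of the list in \<open>symbol_deriv\<close>, the only one that the seminorms
  see.\<close>

lemma iter_deriv_filter:
  fixes f :: "'a::euclidean_space \<Rightarrow> complex"
  assumes f: "smooth f" and vs: "set vs \<subseteq> Basis"
  shows "iter_deriv vs f = iter_deriv (filter P vs @ filter (\<lambda>v. \<not> P v) vs) f"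
  using vs
proof (induction vs)
  case (Cons v vs)
  then have "iter_deriv (v # vs) f = iter_deriv (v # filter P vs @ filter (\<lambda>v. \<not> P v) vs) f"
    by (simp add: iter_deriv_Cons)
  also have "\<dots> = iter_deriv (filter P (v # vs) @ filter (\<lambda>v. \<not> P v) (v # vs)) f"
    using iter_deriv_move[OF f, of v "filter P vs" "filter (\<lambda>v. \<not> P v) vs"] Cons.prems by auto
  finally show ?case .
qed simp

text \<open>
  In \<open>wb d m C W f\<close> every derivative of \<open>f\<close> of order at most \<open>m\<close> is bounded by \<open>C * W k\<close>,
  where \<open>k\<close> adds up the degrees \<open>d v\<close> of the directions of differentiation.
\<close>

primrec wb :: "('a::euclidean_space \<Rightarrow> nat) \<Rightarrow> nat \<Rightarrow> real \<Rightarrow> (nat \<Rightarrow> 'a \<Rightarrow> real) \<Rightarrow> ('a \<Rightarrow> complex) \<Rightarrow> bool" where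
  "wb d 0 C W f \<longleftrightarrow> continuous_on UNIV f \<and> (\<forall>x. norm (f x) \<le> C * W 0 x)"
| "wb d (Suc m) C W f \<longleftrightarrow> continuous_on UNIV f \<and> (\<forall>x. norm (f x) \<le> C * W 0 x) \<and>
     (\<forall>x. f differentiable at x) \<and> (\<forall>v\<in>Basis. wb d m C (\<lambda>k. W (k + d v)) (pd v f))"

lemma wb_continuous: "wb d m C W f \<Longrightarrow> continuous_on UNIV f"
  and wb_bound: "wb d m C W f \<Longrightarrow> norm (f x) \<le> C * W 0 x"
  by (cases m; simp)+

lemma wb_differentiable: "wb d (Suc m) C W f \<Longrightarrow> f differentiable at x"
  and wb_pd: "wb d (Suc m) C W f \<Longrightarrow> v \<in> Basis \<Longrightarrow> wb d m C (\<lambda>k. W (k + d v)) (pd v f)"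
  by auto

section \<open>The calculus of the classes \<open>wb\<close>\<close>

lemma wb_mono:
  "wb d m C W f \<Longrightarrow> m' \<le> m \<Longrightarrow> (\<And>k x. C * W k x \<le> C' * W' k x) \<Longrightarrow> wb d m' C' W' f"
proof (induction m arbitrary: m' W W' f)
  case 0
  then show ?case by (auto intro: order_trans)
next
  case (Suc m)
  then show ?case by (cases m') (auto intro: order_trans)
qed

lemma pd_add: "f differentiable at z \<Longrightarrow> g differentiable at z \<Longrightarrow> pd v (\<lambda>x. f x + g x) z = pd v f z + pd v g z"
  using has_derivative_add[OF has_derivative_pd has_derivative_pd, of f z g] by (rule pd_eq)

lemma pd_mult:
  fixes f g :: "'a::euclidean_space \<Rightarrow> complex"
  shows "f differentiable at z \<Longrightarrow> g differentiable at z \<Longrightarrow> pd v (\<lambda>x. f x * g x) z = pd v f z * g z + f z * pd v g z"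
  using pd_eq[OF has_derivative_mult[OF has_derivative_pd has_derivative_pd, of f z g], of v] by (simp add: add.commute)

lemma wb_add:
  "wb d m C W f \<Longrightarrow> wb d m C' W g \<Longrightarrow> wb d m (C + C') W (\<lambda>x. f x + g x)"
proof (induction m arbitrary: W f g)
  case 0
  then show ?case by (auto intro!: continuous_intros norm_triangle_le add_mono simp: distrib_right)
next
  case (Suc m)
  have "pd v (\<lambda>x. f x + g x) = (\<lambda>x. pd v f x + pd v g x)" for v
    using Suc.prems by (auto simp: pd_add)
  then show ?case using Suc
    by (auto intro!: continuous_intros norm_triangle_le add_mono simp: distrib_right)
qed

lemma wb_zero: "(\<And>k x. 0 \<le> C * W k x) \<Longrightarrow> wb d m C W (\<lambda>x. 0)"
proof (induction m arbitrary: W)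
  case (Suc m)
  have "pd v (\<lambda>x. 0::complex) = (\<lambda>x. 0)" for v :: 'a
    using pd_eq[OF has_derivative_const] by auto
  then show ?case using Suc by auto
qed auto

lemma wb_const:
  assumes "\<And>x. norm c \<le> C * W 0 x" "\<And>k x. 0 \<le> C * W k x"
  shows "wb d m C W (\<lambda>x. c)"
proof (cases m)
  case (Suc m')
  have "pd v (\<lambda>x. c) = (\<lambda>x. 0)" for v :: 'a
    using pd_eq[OF has_derivative_const] by auto
  then show ?thesis using Suc assms wb_zero[of C _ d m'] by auto
qed (use assms in auto)

lemma wb_cmult: "wb d m C W f \<Longrightarrow> wb d m (norm c * C) W (\<lambda>x. c * f x)"
proof (induction m arbitrary: W f)
  case 0
  then show ?case by (auto intro!: continuous_intros mult_left_mono simp: norm_mult mult.assoc)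
next
  case (Suc m)
  have "pd v (\<lambda>x. c * f x) = (\<lambda>x. c * pd v f x)" for v
    using Suc.prems pd_bounded_linear[OF bounded_linear_mult_right[of c], of f] by (simp add: fun_eq_iff)
  moreover have "norm (c * f x) \<le> norm c * C * W 0 x" for x
    using mult_left_mono[OF wb_bound[OF Suc.prems], of "norm c" x] by (simp add: norm_mult mult.assoc)
  ultimately show ?case using Suc
    by (auto intro!: continuous_intros differentiable_mult differentiable_const)
qed

text \<open>Leibniz rule: each differentiation doubles the number of terms, whence the factor 2^m.
  The submultiplicativity of the weights makes the degrees of the two factors add, so a single
  weight \<open>W''\<close> serves all terms of the same total degree.\<close>

lemma wb_mult:
  assumes "wb d m C W f" "wb d m C' W' g" "0 \<le> C" "0 \<le> C'"
    and "\<And>k x. 0 \<le> W k x" "\<And>k x. 0 \<le> W' k x" "\<And>k l x. W k x * W' l x \<le> W'' (k + l) x"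
  shows "wb d m (2 ^ m * (C * C')) W'' (\<lambda>x. f x * g x)"
  using assms(1,2,5-)
proof (induction m arbitrary: W W' W'' f g)
  case 0
  have "norm (f x * g x) \<le> C * C' * W'' 0 x" for x
  proof -
    have "norm (f x * g x) \<le> (C * W 0 x) * (C' * W' 0 x)"
      unfolding norm_mult using 0 assms by (intro mult_mono) auto
    also have "\<dots> = C * C' * (W 0 x * W' 0 x)" by simp
    also have "\<dots> \<le> C * C' * W'' 0 x"
      using 0(5)[of 0 x 0] assms by (intro mult_left_mono) auto
    finally show ?thesis .
  qed
  then show ?case using 0 by (auto intro!: continuous_intros)
next
  case (Suc m)
  have W'': "0 \<le> W'' k x" for k x
    using order_trans[OF mult_nonneg_nonneg[OF Suc.prems(3)[of k x] Suc.prems(4)[of 0 x]] Suc.prems(5)[of k x 0]]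
    by (simp only: add_0_right)
  have bd: "norm (f x * g x) \<le> 2 ^ Suc m * (C * C') * W'' 0 x" for x
  proof -
    have "norm (f x * g x) \<le> (C * W 0 x) * (C' * W' 0 x)"
      unfolding norm_mult
      by (rule mult_mono[OF wb_bound[OF Suc.prems(1)] wb_bound[OF Suc.prems(2)]
            mult_nonneg_nonneg[OF assms(3) Suc.prems(3)] norm_ge_zero])
    also have "\<dots> = C * C' * (W 0 x * W' 0 x)" by (simp only: ac_simps)
    also have "\<dots> \<le> C * C' * W'' (0 + 0) x"
      by (rule mult_left_mono[OF Suc.prems(5) mult_nonneg_nonneg[OF assms(3,4)]])
    also have "\<dots> = 1 * (C * C' * W'' 0 x)" by (simp only: add_0_right mult_1_left)
    also have "\<dots> \<le> 2 ^ Suc m * (C * C' * W'' 0 x)"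
      by (rule mult_right_mono[OF one_le_power mult_nonneg_nonneg[OF mult_nonneg_nonneg[OF assms(3,4)] W'']]) simp
    finally show ?thesis by (simp only: mult.assoc)
  qed
  have "wb d m (2 ^ Suc m * (C * C')) (\<lambda>k. W'' (k + d v)) (pd v (\<lambda>x. f x * g x))" if v: "v \<in> Basis" for v
  proof -
    have eq: "pd v (\<lambda>x. f x * g x) = (\<lambda>x. pd v f x * g x + f x * pd v g x)"
      using pd_mult[OF wb_differentiable[OF Suc.prems(1)] wb_differentiable[OF Suc.prems(2)]] by (simp add: fun_eq_iff)
    have f: "wb d m C W f" and g: "wb d m C' W' g"
      using wb_mono[OF Suc.prems(1), of m C W] wb_mono[OF Suc.prems(2), of m C' W'] by auto
    have "wb d m (2 ^ m * (C * C')) (\<lambda>k. W'' (k + d v)) (\<lambda>x. pd v f x * g x)"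
    proof (rule Suc.IH)
      show "wb d m C (\<lambda>k. W (k + d v)) (pd v f)" using wb_pd[OF Suc.prems(1) v] .
      show "W (k + d v) x * W' l x \<le> W'' (k + l + d v) x" for k l x
        using Suc.prems(5)[of "k + d v" x l] by (simp add: ac_simps)
    qed (rule g Suc.prems)+
    moreover have "wb d m (2 ^ m * (C * C')) (\<lambda>k. W'' (k + d v)) (\<lambda>x. f x * pd v g x)"
    proof (rule Suc.IH)
      show "wb d m C' (\<lambda>k. W' (k + d v)) (pd v g)" using wb_pd[OF Suc.prems(2) v] .
      show "W k x * W' (l + d v) x \<le> W'' (k + l + d v) x" for k l x
        using Suc.prems(5)[of k x "l + d v"] by (simp add: ac_simps)
    qed (rule f Suc.prems)+
    ultimately have "wb d m (2 ^ m * (C * C') + 2 ^ m * (C * C')) (\<lambda>k. W'' (k + d v)) (pd v (\<lambda>x. f x * g x))"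
      unfolding eq by (rule wb_add)
    moreover have "2 ^ m * (C * C') + 2 ^ m * (C * C') = 2 ^ Suc m * (C * C')" by simp
    ultimately show ?thesis by (simp only:)
  qed
  then show ?case
    using wb_continuous[OF Suc.prems(1)] wb_continuous[OF Suc.prems(2)] bd
      wb_differentiable[OF Suc.prems(1)] wb_differentiable[OF Suc.prems(2)]
    by (simp add: continuous_on_mult differentiable_mult)
qed

section \<open>Weights\<close>

lemma jbracket_ge_1: "1 \<le> jbracket x"
  by (simp add: jbracket_def)

lemma jbracket_pos: "0 < jbracket x"
  using jbracket_ge_1[of x] by linarith

lemma jbracket_nonzero[simp]: "jbracket x \<noteq> 0"
  using jbracket_pos[of x] by simp

lemma norm_le_jbracket: "norm x \<le> jbracket x"
  unfolding jbracket_def by (rule real_le_rsqrt) simp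

lemma jbracket_le: "jbracket x \<le> 1 + norm x"
  unfolding jbracket_def by (rule real_le_lsqrt) (auto simp: power2_eq_square algebra_simps)

lemma jbracket_minus: "jbracket (x - y) = jbracket (y - x)"
  by (simp add: jbracket_def norm_minus_commute)

lemma jbracket_add_le: "jbracket (x + y) \<le> jbracket x + norm y"
proof -
  have "(norm (x + y))\<^sup>2 \<le> (norm x + norm y)\<^sup>2"
    by (intro power_mono norm_triangle_ineq) simp
  moreover have "norm x * norm y \<le> jbracket x * norm y"
    by (intro mult_right_mono norm_le_jbracket) simp
  moreover have "(jbracket x)\<^sup>2 = 1 + (norm x)\<^sup>2" by (simp add: jbracket_def)
  ultimately have "1 + (norm (x + y))\<^sup>2 \<le> (jbracket x + norm y)\<^sup>2"
    by (simp add: power2_sum)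
  then show ?thesis
    unfolding jbracket_def[of "x + y"] using jbracket_pos[of x] by (intro real_le_lsqrt) auto
qed

lemma jbracket_peetre: "jbracket \<eta> \<le> 2 * jbracket (\<eta> - \<xi>) * jbracket \<xi>"
proof -
  have "jbracket \<eta> \<le> jbracket \<xi> + jbracket (\<eta> - \<xi>)"
    using jbracket_add_le[of \<xi> "\<eta> - \<xi>"] norm_le_jbracket[of "\<eta> - \<xi>"] by simp
  moreover have "jbracket \<xi> \<le> jbracket (\<eta> - \<xi>) * jbracket \<xi>" "jbracket (\<eta> - \<xi>) \<le> jbracket (\<eta> - \<xi>) * jbracket \<xi>"
    using jbracket_ge_1[of \<xi>] jbracket_ge_1[of "\<eta> - \<xi>"]
    by (metis mult_right_mono jbracket_pos less_imp_le mult_1, metis mult_left_mono jbracket_pos less_imp_le mult_1_right)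
  ultimately show ?thesis by linarith
qed

lemma continuous_on_jbracket[continuous_intros]:
  "continuous_on S f \<Longrightarrow> continuous_on S (\<lambda>x. jbracket (f x))"
  unfolding jbracket_def by (intro continuous_intros)

section \<open>The localisation weight and its integrability\<close>

definition lam :: "'a::euclidean_space \<Rightarrow> 'a \<Rightarrow> real" where
  "lam y x = (\<Prod>b\<in>Basis. 1 / (1 + ((x - y) \<bullet> b)\<^sup>2))"

lemma lam_pos: "0 < lam y x"
  unfolding lam_def by (intro prod_pos divide_pos_pos ballI) (auto intro: add_pos_nonneg)

lemma lam_le_1: "lam y x \<le> 1"
  unfolding lam_def by (intro prod_le_1) (auto simp: divide_le_eq add_pos_nonneg)

lemma lam_translate: "lam y x = lam 0 (x - y)" "lam y x = lam 0 (y - x)"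
  by (auto simp: lam_def inner_diff_left power2_commute)

lemma borel_measurable_lam[measurable]:
  "(\<lambda>x. lam y x) \<in> borel_measurable borel"
  unfolding lam_def by measurable

lemma fixes y :: "'a::euclidean_space"
  shows lam_integrable: "integrable lborel (lam y)"
    and lam_integral_const: "integral\<^sup>L lborel (lam y) = integral\<^sup>L lborel (lam (0::'a))"
proof -
  have i: "integrable lborel (\<lambda>t::real. 1 / (1 + t\<^sup>2))"
    using integrable_inverse_1_plus_square
    by (simp add: set_integrable_def einterval_def divide_inverse)
  have i0: "integrable lborel (lam (0::'a))"
    using lborel_integral_prod(1)[of "\<lambda>_ t. 1 / (1 + t\<^sup>2)", OF i] unfolding lam_def by simp
  have eq: "lam y = (\<lambda>x. lam 0 (x - y))" by (auto simp: lam_translate(1)[of y])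
  show "integrable lborel (lam y)"
    unfolding eq by (subst lborel_integral_shift(2)) (use i0 in auto)
  show "integral\<^sup>L lborel (lam y) = integral\<^sup>L lborel (lam (0::'a))"
    unfolding eq by (subst lborel_integral_shift(5)) auto
qed

lemma jbracket_power_le_lam:
  fixes x :: "real^'n"
  shows "1 / jbracket x ^ (2 * CARD('n)) \<le> lam 0 x"
proof -
  have "(\<Prod>b\<in>Basis. 1 + (x \<bullet> b)\<^sup>2) \<le> (\<Prod>b\<in>(Basis::(real^'n) set). (jbracket x)\<^sup>2)"
  proof (rule prod_mono)
    fix b :: "real^'n" assume "b \<in> Basis"
    then have "\<bar>x \<bullet> b\<bar>\<^sup>2 \<le> (norm x)\<^sup>2" by (intro power_mono Basis_le_norm) auto
    then show "0 \<le> 1 + (x \<bullet> b)\<^sup>2 \<and> 1 + (x \<bullet> b)\<^sup>2 \<le> (jbracket x)\<^sup>2" by (simp add: jbracket_def)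
  qed
  also have "\<dots> = jbracket x ^ (2 * CARD('n))" by (simp add: power_mult)
  finally have "(\<Prod>b\<in>Basis. 1 + (x \<bullet> b)\<^sup>2) \<le> jbracket x ^ (2 * CARD('n))" .
  moreover have "0 < (\<Prod>b\<in>(Basis::(real^'n) set). 1 + (x \<bullet> b)\<^sup>2)"
    by (intro prod_pos) (auto intro: add_pos_nonneg)
  ultimately show ?thesis
    unfolding lam_def by (simp add: prod_dividef frac_le)
qed

text \<open>Comparison with the product \<open>lam\<close> reduces the claim to one dimension and
  avoids polar coordinates. The exponent 2n is larger than necessary for integrability; the decay
  that it requires is bought with a few more derivatives of the symbol.\<close>

lemma integrable_jbracket:
  assumes "2 * CARD('n) \<le> k"
  shows "integrable lborel (\<lambda>x::real^'n. 1 / jbracket x ^ k)"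
proof (rule Bochner_Integration.integrable_bound[OF lam_integrable[of 0]])
  show "(\<lambda>x::real^'n. 1 / jbracket x ^ k) \<in> borel_measurable lborel"
    by (simp, intro borel_measurable_continuous_onI continuous_intros) simp
  have "1 / jbracket x ^ k \<le> lam 0 x" for x :: "real^'n"
    by (rule order_trans[OF _ jbracket_power_le_lam])
      (intro divide_left_mono power_increasing assms jbracket_ge_1 mult_pos_pos zero_less_power jbracket_pos; simp)
  then have "norm (1 / jbracket x ^ k) \<le> norm (lam 0 x)" for x :: "real^'n"
    by (simp add: abs_of_pos[OF zero_less_power[OF jbracket_pos]] abs_of_pos[OF lam_pos])
  then show "AE x in lborel. norm (1 / jbracket x ^ k) \<le> norm (lam 0 (x::real^'n))"
    by (rule AE_I2)
qed

text \<open>One complex linear factor of the weight: 1 / (1 + t^2) = 1 / (1 + i t) * 1 / (1 - i t),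
  where the second factor belongs to the direction -e and the offset -c. The reciprocal of
  \<open>om\<close> is affine in z, so multiplying by it is a first-order differential operator on
  the Fourier side.\<close>

definition om :: "'a::euclidean_space \<Rightarrow> real \<Rightarrow> 'a \<Rightarrow> complex" where
  "om e c z = 1 / (1 + \<i> * complex_of_real (z \<bullet> e - c))"

lemma om_denom_nonzero: "1 + \<i> * complex_of_real t \<noteq> 0"
  by (simp add: complex_eq_iff)

lemma om_mult_denom: "om e c z * (1 + \<i> * complex_of_real (z \<bullet> e - c)) = 1"
  unfolding om_def using om_denom_nonzero by (simp del: of_real_diff)

lemma om_norm_le_1: "norm (om e c z) \<le> 1"
proof -
  have "1 \<le> norm (1 + \<i> * complex_of_real (z \<bullet> e - c))"
    using complex_Re_le_cmod[of "1 + \<i> * complex_of_real (z \<bullet> e - c)"] by simp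
  then show ?thesis unfolding om_def by (simp add: norm_divide divide_le_eq)
qed

lemma om_power_has_derivative:
  "((\<lambda>z. om e c z ^ q) has_derivative (\<lambda>h. - \<i> * of_nat q * complex_of_real (h \<bullet> e) * om e c z ^ Suc q)) (at z)"
proof -
  let ?g = "\<lambda>z. 1 + \<i> * complex_of_real (z \<bullet> e - c)"
  have g: "(?g has_derivative (\<lambda>h. \<i> * complex_of_real (h \<bullet> e))) (at z)"
    by (auto intro!: derivative_eq_intros)
  have "((\<lambda>w. 1 / w) has_field_derivative (- ((1 / ?g z)\<^sup>2))) (at (?g z))"
    using om_denom_nonzero[of "z \<bullet> e - c"]
    by (auto intro!: derivative_eq_intros simp: power2_eq_square simp del: of_real_diff)
  note d1 = DERIV_power[OF this, of q]
  have "of_nat q * (- (u\<^sup>2) * u ^ (q - Suc 0)) = - of_nat q * u ^ Suc q" for u :: complex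
    by (cases q) (simp_all add: power2_eq_square algebra_simps)
  from d1[unfolded this]
  have "((\<lambda>w. (1 / w) ^ q) has_field_derivative (- of_nat q * (1 / ?g z) ^ Suc q)) (at (?g z))"
    .
  from has_derivative_compose[OF g this[unfolded has_field_derivative_def]]
  show ?thesis by (simp add: om_def mult_ac)
qed

text \<open>Differentiating raises the power of \<open>om\<close>, and since its modulus is at most
  1, every derivative is still bounded by the first power of that modulus; the numerical factors are
  each at most q + 1 + m. The weight vanishes for k > 0 because directions of positive degree are
  orthogonal to e and annihilate the function. On phase space this says that a factor depending on x
  alone has no xi-derivatives.\<close>

lemma om_power_wb:
  fixes e :: "'a::euclidean_space"
  assumes e: "norm e \<le> 1" and d: "\<And>v. v \<in> Basis \<Longrightarrow> d v \<noteq> 0 \<Longrightarrow> v \<bullet> e = 0"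
  shows "wb d m (real (Suc q + m) ^ m) (\<lambda>k z. if k = 0 then norm (om e c z) else 0) (\<lambda>z. om e c z ^ Suc q)"
proof (induction m arbitrary: q)
  case 0
  have "norm (om e c x ^ Suc q) \<le> norm (om e c x)" for x
    using mult_left_mono[OF power_le_one[OF norm_ge_zero om_norm_le_1, of e c x q] norm_ge_zero[of "om e c x"]]
    by (simp add: norm_mult norm_power)
  moreover have "continuous_on UNIV (\<lambda>z. om e c z ^ Suc q)"
    unfolding om_def by (intro continuous_intros ballI om_denom_nonzero)
  ultimately show ?case by simp
next
  case (Suc m)
  have ge1: "1 \<le> real (Suc q + Suc m) ^ Suc m" by (rule one_le_power) simp
  have b: "norm (om e c x ^ Suc q) \<le> real (Suc q + Suc m) ^ Suc m * norm (om e c x)" for x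
  proof -
    have "norm (om e c x ^ Suc q) \<le> 1 * norm (om e c x)"
      using mult_left_mono[OF power_le_one[OF norm_ge_zero om_norm_le_1, of e c x q] norm_ge_zero[of "om e c x"]]
      by (simp add: norm_mult norm_power)
    also have "\<dots> \<le> real (Suc q + Suc m) ^ Suc m * norm (om e c x)"
      by (rule mult_right_mono[OF ge1 norm_ge_zero])
    finally show ?thesis .
  qed
  have c: "continuous_on UNIV (\<lambda>z. om e c z ^ Suc q)"
    unfolding om_def by (intro continuous_intros ballI om_denom_nonzero)
  have diff: "(\<lambda>z. om e c z ^ Suc q) differentiable at x" for x
    using om_power_has_derivative unfolding differentiable_def by blast
  have "wb d m (real (Suc q + Suc m) ^ Suc m) (\<lambda>k z. if k + d v = 0 then norm (om e c z) else 0)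
      (pd v (\<lambda>z. om e c z ^ Suc q))" if v: "v \<in> Basis" for v
  proof -
    define t where "t = - \<i> * of_nat (Suc q) * complex_of_real (v \<bullet> e)"
    have pd: "pd v (\<lambda>z. om e c z ^ Suc q) = (\<lambda>z. t * om e c z ^ Suc (Suc q))"
      unfolding t_def using pd_eq[OF om_power_has_derivative] by blast
    show ?thesis
    proof (cases "d v = 0")
      case True
      have "\<bar>v \<bullet> e\<bar> \<le> 1" using Basis_le_norm[OF v, of e] e by (simp add: inner_commute)
      then have t: "norm t \<le> real (Suc q + Suc m)"
        using mult_mono[of "real (Suc q)" "real (Suc q + Suc m)" "\<bar>v \<bullet> e\<bar>" 1]
        unfolding t_def by (simp add: norm_mult del: of_nat_Suc)
      have "wb d m (norm t * real (Suc (Suc q) + m) ^ m) (\<lambda>k z. if k = 0 then norm (om e c z) else 0)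
          (\<lambda>z. t * om e c z ^ Suc (Suc q))"
        by (rule wb_cmult[OF Suc.IH])
      then have "wb d m (real (Suc q + Suc m) ^ Suc m) (\<lambda>k z. if k = 0 then norm (om e c z) else 0)
          (\<lambda>z. t * om e c z ^ Suc (Suc q))"
      proof (rule wb_mono)
        have "norm t * real (Suc (Suc q) + m) ^ m \<le> real (Suc q + Suc m) * real (Suc (Suc q) + m) ^ m"
          by (rule mult_right_mono[OF t]) simp
        then have "norm t * real (Suc (Suc q) + m) ^ m \<le> real (Suc q + Suc m) ^ Suc m" by simp
        then show "norm t * real (Suc (Suc q) + m) ^ m * (if k = 0 then norm (om e c x) else 0)
          \<le> real (Suc q + Suc m) ^ Suc m * (if k = 0 then norm (om e c x) else 0)" for k x
          by (rule mult_right_mono) simp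
      qed simp
      then show ?thesis unfolding pd using True by simp
    next
      case False
      then have "t = 0" using d[OF v] by (simp add: t_def)
      then show ?thesis unfolding pd using False by (auto intro!: wb_zero)
    qed
  qed
  then show ?case using b c diff by (auto simp del: power_Suc)
qed

lemma om_wb:
  fixes e :: "'a::euclidean_space"
  assumes e: "norm e \<le> 1" and d: "\<And>v. v \<in> Basis \<Longrightarrow> d v \<noteq> 0 \<Longrightarrow> v \<bullet> e = 0"
  shows "wb d m (real (Suc m) ^ m) (\<lambda>k z. if k = 0 then norm (om e c z) else 0) (om e c)"
  using om_power_wb[OF assms, of d m 0 c] by simp

lemma wb_om_mult:
  fixes e :: "'a::euclidean_space"
  assumes f: "wb d m C W f" and e: "norm e \<le> 1" and d: "\<And>v. v \<in> Basis \<Longrightarrow> d v \<noteq> 0 \<Longrightarrow> v \<bullet> e = 0"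
    and C: "0 \<le> C" and W: "\<And>k x. 0 \<le> W k x"
  shows "wb d m (2 ^ m * (real (Suc m) ^ m * C)) W (\<lambda>z. om e c z * f z)"
proof (rule wb_mult[OF om_wb[OF e d] f _ C])
  show "(if k = 0 then norm (om e c x) else 0) * W l x \<le> W (k + l) x" for k l x
    using mult_right_mono[OF om_norm_le_1 W, of e c x l] W[of "k + l" x] by simp
qed (auto simp: W)

text \<open>Every basis vector occurs together with its opposite, so that the conjugate factors
  \<open>om\<close> pair up to real ones and multiply to \<open>lam\<close>. A list rather than a
  set is needed because the conjugation by the factors is defined by recursion.\<close>

definition basis_dirs :: "'a::euclidean_space list" where
  "basis_dirs = (SOME bs. set bs = Basis \<and> distinct bs) @ map uminus (SOME bs. set bs = Basis \<and> distinct bs)"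

lemma basis_dirs_norm: "e \<in> set basis_dirs \<Longrightarrow> norm (e::'a::euclidean_space) = 1"
  and om_prod_lam: "prod_list (map (\<lambda>e. om e (y \<bullet> e) x) basis_dirs) = complex_of_real (lam y (x::'a))"
proof -
  define bs where "bs = (SOME bs. set bs = (Basis::'a set) \<and> distinct bs)"
  have "\<exists>bs. set bs = (Basis::'a set) \<and> distinct bs" using finite_distinct_list[OF finite_Basis] by blast
  from someI_ex[OF this] have bs: "set bs = Basis" "distinct bs" unfolding bs_def by blast+
  show "norm e = 1" if "e \<in> set basis_dirs" for e :: 'a
    using that bs unfolding basis_dirs_def bs_def[symmetric] by auto
  have "om e (y \<bullet> e) x * om (- e) (y \<bullet> (- e)) x = complex_of_real (1 / (1 + ((x - y) \<bullet> e)\<^sup>2))" for e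
    using om_denom_nonzero[of "(x - y) \<bullet> e"] om_denom_nonzero[of "- ((x - y) \<bullet> e)"]
    by (simp add: om_def inner_diff_left field_simps power2_eq_square)
  then have "prod_list (map (\<lambda>e. om e (y \<bullet> e) x) bs) * prod_list (map (\<lambda>e. om e (y \<bullet> e) x) (map uminus bs))
      = (\<Prod>b\<in>Basis. complex_of_real (1 / (1 + ((x - y) \<bullet> b)\<^sup>2)))"
    using bs by (simp add: prod.distinct_set_conv_list[symmetric] o_def prod.distrib[symmetric])
  then show "prod_list (map (\<lambda>e. om e (y \<bullet> e) x) basis_dirs) = complex_of_real (lam y x)"
    unfolding basis_dirs_def bs_def[symmetric] by (simp add: lam_def)
qed

lemma om_prod_wb:
  assumes "\<And>e. e \<in> set es \<Longrightarrow> norm (e::'a::euclidean_space) \<le> 1"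
  shows "\<exists>C\<ge>0. \<forall>y. wb (\<lambda>_. 0) m C (\<lambda>_ x. norm (prod_list (map (\<lambda>e. om e (y \<bullet> e) x) es)))
            (\<lambda>x. prod_list (map (\<lambda>e. om e (y \<bullet> e) x) es))"
  using assms
proof (induction es)
  case Nil
  have "wb (\<lambda>_::'a. 0) m 1 (\<lambda>_ x. norm (1::complex)) (\<lambda>x. 1)" by (rule wb_const) auto
  then show ?case by (intro exI[of _ 1]) auto
next
  case (Cons e es)
  then obtain C where C: "C \<ge> 0" and w: "\<And>y. wb (\<lambda>_. 0) m C (\<lambda>_ x. norm (prod_list (map (\<lambda>e. om e (y \<bullet> e) x) es)))
            (\<lambda>x. prod_list (map (\<lambda>e. om e (y \<bullet> e) x) es))" by auto
  have "wb (\<lambda>_. 0) m (2 ^ m * (real (Suc m) ^ m * C)) (\<lambda>_ x. norm (prod_list (map (\<lambda>e. om e (y \<bullet> e) x) (e # es))))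
            (\<lambda>x. om e (y \<bullet> e) x * prod_list (map (\<lambda>e. om e (y \<bullet> e) x) es))" for y
    by (rule wb_mult[OF om_wb w]) (use Cons.prems C in \<open>auto simp: norm_mult\<close>)
  then show ?case using C by (intro exI[of _ "2 ^ m * (real (Suc m) ^ m * C)"]) auto
qed

text \<open>The constant is uniform in y, which matters because y is integrated over in the end.
  Having \<open>lam y\<close> itself as the weight keeps the derivatives integrable, with an
  integral independent of y.\<close>

lemma lam_wb: "\<exists>C\<ge>0. \<forall>y::'a::euclidean_space. wb (\<lambda>_. 0) m C (\<lambda>_. lam y) (\<lambda>x. complex_of_real (lam y x))"
proof -
  have n: "norm e \<le> 1" if "e \<in> set basis_dirs" for e :: 'a using basis_dirs_norm[OF that] by simp
  from om_prod_wb[where es=basis_dirs and m=m, OF n] show ?thesis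
    by (simp add: om_prod_lam abs_of_pos[OF lam_pos])
qed

section \<open>The Fourier transform\<close>

lemma fourier_integrable:
  assumes "integrable lborel f"
  shows "integrable lborel (\<lambda>x. cis (- (x \<bullet> \<xi>)) * f x)" "integrable lborel (\<lambda>x. cis (x \<bullet> \<xi>) * f x)"
proof -
  have [measurable]: "f \<in> borel_measurable borel" using assms by simp
  have [measurable]: "(\<lambda>x. cis (- (x \<bullet> \<xi>))) \<in> borel_measurable borel" "(\<lambda>x. cis (x \<bullet> \<xi>)) \<in> borel_measurable borel"
    by (intro borel_measurable_continuous_onI continuous_intros)+
  have "(\<lambda>x. cis (- (x \<bullet> \<xi>)) * f x) \<in> borel_measurable borel" "(\<lambda>x. cis (x \<bullet> \<xi>) * f x) \<in> borel_measurable borel"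
    by measurable
  then show "integrable lborel (\<lambda>x. cis (- (x \<bullet> \<xi>)) * f x)" "integrable lborel (\<lambda>x. cis (x \<bullet> \<xi>) * f x)"
    by (auto simp: norm_mult intro!: Bochner_Integration.integrable_bound[OF assms])
qed

lemma fourier_norm_le: "integrable lborel W \<Longrightarrow> (\<And>x. norm (f x) \<le> W x) \<Longrightarrow> norm (fourier f \<xi>) \<le> integral\<^sup>L lborel W"
proof -
  assume W: "integrable lborel W" and b: "\<And>x. norm (f x) \<le> W x"
  have "norm (fourier f \<xi>) \<le> (\<integral>x. norm (cis (- (x \<bullet> \<xi>)) * f x) \<partial>lborel)"
    unfolding fourier_def by (rule integral_norm_bound)
  also have "\<dots> \<le> integral\<^sup>L lborel W"
    using b order_trans[OF norm_ge_zero b] by (intro integral_mono' W) (auto simp: norm_mult)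
  finally show ?thesis .
qed

lemma fourier_continuous: "integrable lborel f \<Longrightarrow> continuous_on UNIV (fourier f)"
  unfolding fourier_def
  by (rule continuous_integral_dominated[where g="\<lambda>x. norm (f x)", OF borel_measurable_integrable[OF fourier_integrable(1)]])
    (auto simp: norm_mult intro!: continuous_intros)

lemma has_vector_derivative_cis_affine:
  "((\<lambda>s. cis (\<alpha> + s * \<beta>)) has_vector_derivative \<i> * complex_of_real \<beta> * cis (\<alpha> + s * \<beta>)) (at s)"
proof -
  have "((\<lambda>w. exp (\<i> * (complex_of_real \<alpha> + w * complex_of_real \<beta>))) has_field_derivative
      \<i> * complex_of_real \<beta> * exp (\<i> * (complex_of_real \<alpha> + complex_of_real s * complex_of_real \<beta>))) (at (complex_of_real s))"
    by (auto intro!: derivative_eq_intros)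
  from has_vector_derivative_real_field[OF this] show ?thesis by (simp add: cis_conv_exp)
qed

lemma wb_integrable:
  assumes "wb d m C W f" "integrable lborel (W 0)"
  shows "integrable lborel f"
proof (rule Bochner_Integration.integrable_bound)
  show "integrable lborel (\<lambda>x. C * W 0 x)" using assms by simp
  show "f \<in> borel_measurable lborel"
    using borel_measurable_continuous_onI[OF wb_continuous[OF assms(1)]] by simp
  show "AE x in lborel. norm (f x) \<le> norm (C * W 0 x)"
    using order_trans[OF wb_bound[OF assms(1)] abs_ge_self] by auto
qed

lemma fourier_pd:
  assumes f: "wb (\<lambda>_. 0) (Suc m) C (\<lambda>_. W) f" and W: "integrable lborel W" and b: "b \<in> Basis"
  shows "fourier (pd b f) \<xi> = \<i> * complex_of_real (b \<bullet> \<xi>) * fourier f \<xi>"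
proof -
  have fi: "integrable lborel f" using wb_integrable[OF f] W by simp
  have pf: "wb (\<lambda>_. 0) m C (\<lambda>_. W) (pd b f)" using wb_pd[OF f b] by simp
  have pi: "integrable lborel (pd b f)" using wb_integrable[OF pf] W by simp
  define g' where "g' x = - \<i> * complex_of_real (b \<bullet> \<xi>) * (cis (- (x \<bullet> \<xi>)) * f x) + cis (- (x \<bullet> \<xi>)) * pd b f x" for x
  have "(\<integral>x. g' x \<partial>lborel) = 0"
  proof (rule integral_directional_derivative_zero)
    show "integrable lborel (\<lambda>x. cis (- (x \<bullet> \<xi>)) * f x)" by (rule fourier_integrable(1)[OF fi])
    show "integrable lborel g'" unfolding g'_def
      using fourier_integrable(1)[OF fi] fourier_integrable(1)[OF pi] by simp
    show "continuous_on UNIV g'" unfolding g'_def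
      by (intro continuous_intros wb_continuous[OF f] wb_continuous[OF pf])
    show "((\<lambda>s. cis (- ((x + s *\<^sub>R b) \<bullet> \<xi>)) * f (x + s *\<^sub>R b)) has_vector_derivative g' x) (at 0)" for x
    proof -
      have d: "((\<lambda>s. f (x + s *\<^sub>R b)) has_vector_derivative pd b f (x + 0 *\<^sub>R b)) (at 0)"
        by (rule has_vector_derivative_pd) (rule wb_differentiable[OF f])
      have e: "((\<lambda>s. cis (- ((x + s *\<^sub>R b) \<bullet> \<xi>))) has_vector_derivative - \<i> * complex_of_real (b \<bullet> \<xi>) * cis (- (x \<bullet> \<xi>))) (at 0)"
        using has_vector_derivative_cis_affine[of "- (x \<bullet> \<xi>)" "- (b \<bullet> \<xi>)" 0] by (simp add: inner_add_left)
      show ?thesis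
        unfolding g'_def using has_vector_derivative_mult[OF e d] by (simp add: add.commute mult_ac)
    qed
  qed
  then have "- \<i> * complex_of_real (b \<bullet> \<xi>) * (\<integral>x. cis (- (x \<bullet> \<xi>)) * f x \<partial>lborel) + (\<integral>x. cis (- (x \<bullet> \<xi>)) * pd b f x \<partial>lborel) = 0"
    unfolding g'_def using fourier_integrable(1)[OF fi] fourier_integrable(1)[OF pi] by simp
  then show ?thesis unfolding fourier_def by (simp add: algebra_simps eq_neg_iff_add_eq_0)
qed

lemma fourier_decay_basis:
  assumes "wb (\<lambda>_. 0) m C (\<lambda>_. W) f" and W: "integrable lborel W" and b: "b \<in> Basis"
  shows "\<bar>b \<bullet> \<xi>\<bar> ^ m * norm (fourier f \<xi>) \<le> C * integral\<^sup>L lborel W"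
  using assms(1)
proof (induction m arbitrary: f)
  case 0
  then show ?case using fourier_norm_le[of "\<lambda>x. C * W x" f \<xi>] W by simp
next
  case (Suc m)
  have "\<bar>b \<bullet> \<xi>\<bar> ^ Suc m * norm (fourier f \<xi>) = \<bar>b \<bullet> \<xi>\<bar> ^ m * norm (fourier (pd b f) \<xi>)"
    unfolding fourier_pd[OF Suc.prems W b] by (simp add: norm_mult)
  also have "\<dots> \<le> C * integral\<^sup>L lborel W"
    using Suc.IH[of "pd b f"] wb_pd[OF Suc.prems b] by simp
  finally show ?case .
qed

text \<open>The constant is linear in C, and W enters only through its integral; both facts are
  needed for a final bound that is linear in the seminorms and uniform in y.\<close>

lemma fourier_decay:
  fixes f :: "real^'n \<Rightarrow> complex"
  assumes f: "wb (\<lambda>_. 0) m C (\<lambda>_. W) f" and W: "integrable lborel W"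
  shows "norm (fourier f \<xi>) \<le> 2 ^ m * (1 + real CARD('n) ^ m) * (C * integral\<^sup>L lborel W) / jbracket \<xi> ^ m"
proof -
  let ?B = "C * integral\<^sup>L lborel W" and ?n = "real CARD('n)"
  have b0: "norm (fourier f \<xi>) \<le> ?B"
    using fourier_norm_le[of "\<lambda>x. C * W x" f \<xi>] W wb_bound[OF f] by simp
  have B: "0 \<le> ?B" using order_trans[OF norm_ge_zero b0] .
  \<comment> \<open>A coordinate of maximal modulus carries at least the share 1/n of the norm, so
    decay in this one direction is decay in \<open>\<xi>\<close>.\<close>
  obtain b :: "real^'n" where b: "b \<in> Basis" "norm \<xi> \<le> ?n * \<bar>b \<bullet> \<xi>\<bar>"
  proof -
    obtain b :: "real^'n" where b: "b \<in> Basis" and mx: "\<And>b'. b' \<in> Basis \<Longrightarrow> \<bar>\<xi> \<bullet> b'\<bar> \<le> \<bar>\<xi> \<bullet> b\<bar>"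
      using Max_in[of "(\<lambda>b. \<bar>\<xi> \<bullet> b\<bar>) ` Basis"] Max_ge[of "(\<lambda>b. \<bar>\<xi> \<bullet> b\<bar>) ` Basis"] by fastforce
    have "norm \<xi> \<le> (\<Sum>b\<in>Basis. \<bar>\<xi> \<bullet> b\<bar>)" by (rule norm_le_l1)
    also have "\<dots> \<le> (\<Sum>b'\<in>(Basis::(real^'n) set). \<bar>\<xi> \<bullet> b\<bar>)" by (intro sum_mono mx)
    also have "\<dots> = ?n * \<bar>b \<bullet> \<xi>\<bar>" by (simp add: inner_commute)
    finally show ?thesis using b that by blast
  qed
  have "norm \<xi> ^ m * norm (fourier f \<xi>) \<le> (?n * \<bar>b \<bullet> \<xi>\<bar>) ^ m * norm (fourier f \<xi>)"
    by (intro mult_right_mono power_mono b) auto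
  also have "\<dots> = ?n ^ m * (\<bar>b \<bullet> \<xi>\<bar> ^ m * norm (fourier f \<xi>))" by (simp add: power_mult_distrib)
  also have "\<dots> \<le> ?n ^ m * ?B"
    by (intro mult_left_mono fourier_decay_basis[OF f W b(1)]) auto
  finally have b1: "norm \<xi> ^ m * norm (fourier f \<xi>) \<le> ?n ^ m * ?B" .
  have "jbracket \<xi> ^ m \<le> (2 * max 1 (norm \<xi>)) ^ m"
    using jbracket_pos[of \<xi>] jbracket_le[of \<xi>] by (intro power_mono) auto
  also have "\<dots> \<le> 2 ^ m * (1 + norm \<xi> ^ m)"
    unfolding power_mult_distrib by (intro mult_left_mono) (auto simp: max_def)
  finally have "jbracket \<xi> ^ m * norm (fourier f \<xi>) \<le> 2 ^ m * (1 + norm \<xi> ^ m) * norm (fourier f \<xi>)"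
    by (rule mult_right_mono) simp
  also have "\<dots> = 2 ^ m * (norm (fourier f \<xi>) + norm \<xi> ^ m * norm (fourier f \<xi>))" by (simp add: algebra_simps)
  also have "\<dots> \<le> 2 ^ m * (?B + ?n ^ m * ?B)" by (intro mult_left_mono add_mono b0 b1) auto
  finally show ?thesis using jbracket_pos[of \<xi>] by (simp add: pos_le_divide_eq algebra_simps)
qed

section \<open>Schwartz functions and symbols\<close>

text \<open>Generalised over the list \<open>us\<close> of derivatives already taken, since
  \<open>wb\<close> descends through one derivative at a time; the case of interest is the empty
  list.\<close>

lemma wb_iter_deriv:
  assumes f: "smooth f"
    and b: "\<And>vs x. set vs \<subseteq> Basis \<Longrightarrow> length vs \<le> M \<Longrightarrow> norm (iter_deriv vs f x) \<le> C * W (sum_list (map d vs)) x"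
  shows "set us \<subseteq> Basis \<Longrightarrow> length us + m \<le> M \<Longrightarrow> wb d m C (\<lambda>k. W (k + sum_list (map d us))) (iter_deriv us f)"
proof (induction m arbitrary: us)
  case 0
  then show ?case using b[of us] smooth_iter_deriv_continuous[OF f] by simp
next
  case (Suc m)
  have "wb d m C (\<lambda>k. W (k + d v + sum_list (map d us))) (pd v (iter_deriv us f))" if "v \<in> Basis" for v
    using Suc.IH[of "v # us"] Suc.prems that by (simp add: iter_deriv_Cons add.assoc)
  then show ?case
    using b[of us] Suc.prems smooth_iter_deriv_continuous[OF f] smooth_iter_deriv_differentiable[OF f]
    by simp
qed

text \<open>The Schwartz condition restated through \<open>wb\<close>, so that stability under
  multiplication by \<open>om\<close> and by coordinates is a case of the product rule.\<close>

definition rapid :: "(real^'n \<Rightarrow> complex) \<Rightarrow> bool" where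
  "rapid f \<longleftrightarrow> (\<forall>m k. \<exists>C\<ge>0. wb (\<lambda>_. 0) m C (\<lambda>_ x. 1 / jbracket x ^ k) f)"

lemma axis_list:
  assumes "set vs \<subseteq> (Basis :: (real^'n) set)"
  obtains \<beta> where "vs = map (\<lambda>i. axis i 1) \<beta>"
proof -
  have "\<forall>v\<in>set vs. \<exists>i. v = axis i 1" using assms by (auto simp: Basis_vec_def)
  then have "vs \<in> map (\<lambda>i. axis i 1) ` UNIV"
    by (induction vs) (auto simp: image_iff, metis list.simps(9))
  then show ?thesis using that by blast
qed

lemma schwartz_rapid:
  fixes u :: "real^'n::finite \<Rightarrow> complex"
  assumes "schwartz u" shows "rapid u"
  unfolding rapid_def
proof (intro allI)
  fix m k
  define S where "S \<beta> = (SUP x. jbracket x ^ k * norm (iter_deriv (map (\<lambda>i. axis i 1) \<beta>) u x))" for \<beta>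
  define L where "L = {\<beta> :: 'n list. length \<beta> \<le> m}"
  define C where "C = (\<Sum>\<beta>\<in>L. \<bar>S \<beta>\<bar>)"
  have fin: "finite L" unfolding L_def using finite_lists_length_le[of "UNIV :: 'n set" m] by simp
  have u: "smooth u" and bd: "\<And>\<beta>. bdd_above (range (\<lambda>x. jbracket x ^ k * norm (iter_deriv (map (\<lambda>i. axis i 1) \<beta>) u x)))"
    using assms unfolding schwartz_def by auto
  have "norm (iter_deriv vs u x) \<le> C * (1 / jbracket x ^ k)" if vs: "set vs \<subseteq> Basis" "length vs \<le> m" for vs x
  proof -
    obtain \<beta> where \<beta>: "vs = map (\<lambda>i. axis i 1) \<beta>" using axis_list[OF vs(1)] by blast
    have "jbracket x ^ k * norm (iter_deriv vs u x) \<le> S \<beta>"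
      unfolding S_def \<beta> by (rule cSUP_upper[OF UNIV_I bd])
    also have "\<dots> \<le> \<bar>S \<beta>\<bar>" by simp
    also have "\<dots> \<le> C" unfolding C_def
      by (rule member_le_sum[of \<beta> L "\<lambda>\<beta>. \<bar>S \<beta>\<bar>"]) (use vs \<beta> fin in \<open>auto simp: L_def\<close>)
    finally show ?thesis using jbracket_pos[of x] by (simp add: pos_le_divide_eq mult.commute)
  qed
  then have "wb (\<lambda>_. 0) m C (\<lambda>_ x. 1 / jbracket x ^ k) (iter_deriv [] u)"
    using wb_iter_deriv[OF u, of m C "\<lambda>_ x. 1 / jbracket x ^ k" "\<lambda>_. 0" "[]" m] by simp
  moreover have "0 \<le> C" unfolding C_def by (rule sum_nonneg) simp
  ultimately show "\<exists>C\<ge>0. wb (\<lambda>_. 0) m C (\<lambda>_ x. 1 / jbracket x ^ k) u"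
    by (auto simp: iter_deriv_Nil)
qed

text \<open>On the basis of the product space this distinguishes xi-directions (degree 1) from
  x-directions (degree 0). Hence \<open>wb xi_deg m C xi_weight\<close> is the symbol estimate of
  order 0 up to m derivatives, and shifting the weight by \<open>Suc\<close> gives order -1.\<close>

definition xi_deg :: "'a::real_vector \<times> 'b::real_vector \<Rightarrow> nat" where
  "xi_deg v = (if fst v = 0 then 1 else 0)"

abbreviation xi_weight :: "nat \<Rightarrow> (real^'n) \<times> (real^'n) \<Rightarrow> real" where
  "xi_weight k z \<equiv> 1 / jbracket (snd z) ^ k"

lemma S0_values_le:
  assumes "a \<in> S0" "length \<alpha> + length \<beta> \<le> l"
  shows "jbracket \<xi> ^ length \<alpha> * norm (symbol_deriv \<alpha> \<beta> a (x, \<xi>)) \<le> S0_seminorm l a"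
  unfolding S0_seminorm_def
  by (rule cSup_upper) (use assms in \<open>auto simp: S0_values_def S0_def\<close>)

lemma S0_seminorm_nonneg: "a \<in> S0 \<Longrightarrow> 0 \<le> S0_seminorm l a"
  using S0_values_le[of a "[]" "[]" l] by (auto intro: order_trans[OF norm_ge_zero])

text \<open>The seminorm itself serves as the constant. Derivatives in mixed order are first sorted
  by \<open>iter_deriv_filter\<close> into the shape of \<open>symbol_deriv\<close>; the degree of
  the list is then the length of its xi-part.\<close>

lemma S0_wb:
  fixes a :: "'n::finite symbol"
  assumes a: "a \<in> S0"
  shows "wb xi_deg m (S0_seminorm m a) xi_weight a"
proof -
  have sm: "smooth a" using a by (simp add: S0_def)
  have "norm (iter_deriv vs a z) \<le> S0_seminorm m a * xi_weight (sum_list (map xi_deg vs)) z"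
    if vs: "set vs \<subseteq> Basis" "length vs \<le> m" for vs z
  proof -
    let ?P = "\<lambda>v :: (real^'n) \<times> (real^'n). fst v = 0"
    obtain x \<xi> where z: "z = (x, \<xi>)" by (cases z)
    have "\<forall>v\<in>set (filter ?P vs). v = (0, snd v) \<and> snd v \<in> Basis"
      using vs by (auto simp: Basis_prod_def)
    then have e1: "filter ?P vs = map (\<lambda>w. (0, w)) (map snd (filter ?P vs))" and s1: "set (map snd (filter ?P vs)) \<subseteq> Basis"
      by (auto simp: o_def intro!: map_idI[symmetric])
    have "\<forall>v\<in>set (filter (\<lambda>v. \<not> ?P v) vs). v = (fst v, 0) \<and> fst v \<in> Basis"
      using vs by (auto simp: Basis_prod_def)
    then have e2: "filter (\<lambda>v. \<not> ?P v) vs = map (\<lambda>w. (w, 0)) (map fst (filter (\<lambda>v. \<not> ?P v) vs))"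
      and s2: "set (map fst (filter (\<lambda>v. \<not> ?P v) vs)) \<subseteq> Basis"
      by (auto simp: o_def intro!: map_idI[symmetric])
    obtain \<alpha> where \<alpha>: "map snd (filter ?P vs) = map (\<lambda>i. axis i 1) \<alpha>" using axis_list[OF s1] by blast
    obtain \<beta> where \<beta>: "map fst (filter (\<lambda>v. \<not> ?P v) vs) = map (\<lambda>i. axis i 1) \<beta>" using axis_list[OF s2] by blast
    have it: "iter_deriv vs a = symbol_deriv \<alpha> \<beta> a"
      unfolding symbol_deriv_def iter_deriv_filter[OF sm vs(1), of ?P]
      by (subst e1, subst e2) (simp only: \<alpha> \<beta> map_map o_def)
    have la: "length \<alpha> = length (filter ?P vs)" using arg_cong[OF \<alpha>, of length] by simp
    have lb: "length \<beta> = length (filter (\<lambda>v. \<not> ?P v) vs)" using arg_cong[OF \<beta>, of length] by simp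
    have "length \<alpha> + length \<beta> = length vs" unfolding la lb by (rule sum_length_filter_compl)
    then have "jbracket \<xi> ^ length \<alpha> * norm (symbol_deriv \<alpha> \<beta> a (x, \<xi>)) \<le> S0_seminorm m a"
      using S0_values_le[OF a] vs by simp
    moreover have "sum_list (map xi_deg vs) = length \<alpha>"
      unfolding la by (induction vs) (auto simp: xi_deg_def)
    ultimately show ?thesis
      unfolding it z using jbracket_pos[of \<xi>] by (simp add: pos_le_divide_eq mult.commute)
  qed
  then show ?thesis
    using wb_iter_deriv[OF sm, of m "S0_seminorm m a" xi_weight xi_deg "[]" m] by (simp add: iter_deriv_Nil)
qed

lemma rapid_wb: "rapid f \<Longrightarrow> \<exists>C\<ge>0. wb (\<lambda>_. 0) m C (\<lambda>_ x. 1 / jbracket x ^ k) f"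
  unfolding rapid_def by blast

lemma rapid_integrable:
  fixes f :: "real^'n \<Rightarrow> complex"
  assumes "rapid f" shows "integrable lborel f"
  using rapid_wb[OF assms, of 0 "2 * CARD('n)"] wb_integrable integrable_jbracket[of "2 * CARD('n)", where 'n='n] by blast

lemma rapid_continuous: "rapid f \<Longrightarrow> continuous_on UNIV f"
  using rapid_wb[of f 0 0] wb_continuous by blast

lemma rapid_bound: "rapid f \<Longrightarrow> \<exists>C\<ge>0. \<forall>x. norm (f x) \<le> C / jbracket x ^ k"
  using rapid_wb[of f 0 k] wb_bound by fastforce

lemma rapid_fourier_bound:
  fixes f :: "real^'n \<Rightarrow> complex"
  assumes "rapid f"
  shows "\<exists>C\<ge>0. \<forall>\<xi>. norm (fourier f \<xi>) \<le> C / jbracket \<xi> ^ k"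
proof -
  obtain C where C: "C \<ge> 0" "wb (\<lambda>_. 0) k C (\<lambda>_ x. 1 / jbracket x ^ (2 * CARD('n))) f"
    using rapid_wb[OF assms] by blast
  have i: "integrable lborel (\<lambda>x::real^'n. 1 / jbracket x ^ (2 * CARD('n)))" by (rule integrable_jbracket) simp
  have "0 \<le> integral\<^sup>L lborel (\<lambda>x::real^'n. 1 / jbracket x ^ (2 * CARD('n)))"
    by (rule integral_nonneg_AE) (simp add: less_imp_le[OF jbracket_pos])
  then show ?thesis
    using fourier_decay[OF C(2) i] C(1)
    by (intro exI[of _ "2 ^ k * (1 + real CARD('n) ^ k) * (C * integral\<^sup>L lborel (\<lambda>x::real^'n. 1 / jbracket x ^ (2 * CARD('n))))"]) auto
qed

lemma integrable_of_jbracket_bound: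
  fixes G :: "real^'n \<Rightarrow> 'b::{banach,second_countable_topology}"
  assumes [measurable]: "G \<in> borel_measurable borel" and b: "\<And>\<xi>. norm (G \<xi>) \<le> C / jbracket \<xi> ^ (2 * CARD('n))"
  shows "integrable lborel G"
proof (rule Bochner_Integration.integrable_bound)
  show "integrable lborel (\<lambda>\<xi>::real^'n. C * (1 / jbracket \<xi> ^ (2 * CARD('n))))"
    by (intro integrable_mult_right integrable_jbracket) simp
  show "AE \<xi> in lborel. norm (G \<xi>) \<le> norm (C * (1 / jbracket \<xi> ^ (2 * CARD('n))))"
    using order_trans[OF b abs_ge_self] by simp
qed simp

lemma rapid_fourier_continuous: "rapid f \<Longrightarrow> continuous_on UNIV (fourier f)"
  by (rule fourier_continuous[OF rapid_integrable])

lemma rapid_fourier_integrable: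
  fixes f :: "real^'n \<Rightarrow> complex"
  assumes "rapid f" shows "integrable lborel (fourier f)"
  using rapid_fourier_bound[OF assms, of "2 * CARD('n)"] rapid_fourier_continuous[OF assms]
  by (auto intro: integrable_of_jbracket_bound borel_measurable_continuous_onI)

lemma rapid_om:
  assumes f: "rapid f" and e: "norm e \<le> 1"
  shows "rapid (\<lambda>x. om e c x * f x)"
  unfolding rapid_def
proof (intro allI)
  fix m k
  obtain C where C: "C \<ge> 0" "wb (\<lambda>_. 0) m C (\<lambda>_ x. 1 / jbracket x ^ k) f"
    using rapid_wb[OF f] by blast
  have "wb (\<lambda>_. 0) m (2 ^ m * (real (Suc m) ^ m * C)) (\<lambda>_ x. 1 / jbracket x ^ k) (\<lambda>x. om e c x * f x)"
    by (rule wb_om_mult[OF C(2) e _ C(1)]) (simp_all add: less_imp_le[OF jbracket_pos])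
  then show "\<exists>C\<ge>0. wb (\<lambda>_. 0) m C (\<lambda>_ x. 1 / jbracket x ^ k) (\<lambda>x. om e c x * f x)"
    using C(1) by (intro exI[of _ "2 ^ m * (real (Suc m) ^ m * C)"]) simp
qed

lemma rapid_coord:
  assumes f: "rapid f" and e: "norm e \<le> 1"
  shows "rapid (\<lambda>x. complex_of_real (x \<bullet> e) * f x)"
  unfolding rapid_def
proof (intro allI)
  fix m k
  have w: "wb (\<lambda>_. 0) m 1 (\<lambda>_. jbracket) (\<lambda>x. complex_of_real (x \<bullet> e))"
  proof (cases m)
    case 0
    have "\<bar>x \<bullet> e\<bar> \<le> jbracket x" for x
      using Cauchy_Schwarz_ineq2[of x e] mult_left_mono[OF e norm_ge_zero[of x]] norm_le_jbracket[of x] by simp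
    then show ?thesis using 0 by (auto intro!: continuous_intros)
  next
    case (Suc m')
    have b: "\<bar>x \<bullet> e\<bar> \<le> jbracket x" for x
      using Cauchy_Schwarz_ineq2[of x e] mult_left_mono[OF e norm_ge_zero[of x]] norm_le_jbracket[of x] by simp
    have d: "((\<lambda>x. complex_of_real (x \<bullet> e)) has_derivative (\<lambda>h. complex_of_real (h \<bullet> e))) (at x)" for x
      by (auto intro!: derivative_eq_intros)
    have "wb (\<lambda>_. 0) m' 1 (\<lambda>_. jbracket) (\<lambda>x. complex_of_real (v \<bullet> e))" if v: "v \<in> Basis" for v
    proof (rule wb_const)
      have "\<bar>v \<bullet> e\<bar> \<le> 1" using Basis_le_norm[OF v, of e] e by (simp add: inner_commute)
      then show "norm (complex_of_real (v \<bullet> e)) \<le> 1 * jbracket x" for x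
        using jbracket_ge_1[of x] by simp
    qed (simp add: less_imp_le[OF jbracket_pos])
    moreover have "pd v (\<lambda>x. complex_of_real (x \<bullet> e)) = (\<lambda>x. complex_of_real (v \<bullet> e))" for v
      using pd_eq[OF d] by blast
    moreover have "(\<lambda>x. complex_of_real (x \<bullet> e)) differentiable at x" for x
      using d differentiable_def by blast
    ultimately show ?thesis using Suc b
      by (auto intro!: continuous_intros)
  qed
  \<comment> \<open>One additional power of decay of f absorbs the growth of the coordinate, whose
    weight is \<open>jbracket\<close>.\<close>
  obtain C where C: "C \<ge> 0" "wb (\<lambda>_. 0) m C (\<lambda>_ x. 1 / jbracket x ^ Suc k) f"
    using rapid_wb[OF f] by blast
  have "wb (\<lambda>_. 0) m (2 ^ m * (1 * C)) (\<lambda>_ x. 1 / jbracket x ^ k) (\<lambda>x. complex_of_real (x \<bullet> e) * f x)"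
    by (rule wb_mult[OF w C(2) _ C(1)]) (simp_all add: less_imp_le[OF jbracket_pos] field_simps)
  then show "\<exists>C\<ge>0. wb (\<lambda>_. 0) m C (\<lambda>_ x. 1 / jbracket x ^ k) (\<lambda>x. complex_of_real (x \<bullet> e) * f x)"
    using C(1) by (intro exI[of _ "2 ^ m * (1 * C)"]) simp
qed

lemma fourier_has_vector_derivative:
  assumes f: "rapid f" and e: "norm e \<le> 1"
  shows "((\<lambda>s. fourier f (\<xi> + s *\<^sub>R e)) has_vector_derivative - \<i> * fourier (\<lambda>x. complex_of_real (x \<bullet> e) * f x) (\<xi> + s *\<^sub>R e)) (at s)"
proof -
  have xi: "integrable lborel (\<lambda>x. complex_of_real (x \<bullet> e) * f x)" by (rule rapid_integrable[OF rapid_coord[OF f e]])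
  have "((\<lambda>s. \<integral>x. cis (- (x \<bullet> (\<xi> + s *\<^sub>R e))) * f x \<partial>lborel) has_vector_derivative
      (\<integral>x. - \<i> * (cis (- (x \<bullet> (\<xi> + s *\<^sub>R e))) * (complex_of_real (x \<bullet> e) * f x)) \<partial>lborel)) (at s)"
  proof (rule has_vector_derivative_integral_dominated[where g = "\<lambda>x. norm (complex_of_real (x \<bullet> e) * f x)"])
    show "integrable lborel (\<lambda>x. cis (- (x \<bullet> (\<xi> + s *\<^sub>R e))) * f x)" for s
      by (rule fourier_integrable(1)[OF rapid_integrable[OF f]])
    show "(\<lambda>x. - \<i> * (cis (- (x \<bullet> (\<xi> + s *\<^sub>R e))) * (complex_of_real (x \<bullet> e) * f x))) \<in> borel_measurable lborel"
      using fourier_integrable(1)[OF xi] by (intro borel_measurable_integrable integrable_mult_right) simp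
    show "((\<lambda>s. cis (- (x \<bullet> (\<xi> + s *\<^sub>R e))) * f x) has_vector_derivative
        - \<i> * (cis (- (x \<bullet> (\<xi> + s *\<^sub>R e))) * (complex_of_real (x \<bullet> e) * f x))) (at s)" for x s
      using has_vector_derivative_mult_left[OF has_vector_derivative_cis_affine[of "- (x \<bullet> \<xi>)" "- (x \<bullet> e)" s], of "f x"]
      by (simp add: inner_add_right mult_ac)
    show "norm (- \<i> * (cis (- (x \<bullet> (\<xi> + s *\<^sub>R e))) * (complex_of_real (x \<bullet> e) * f x))) \<le> norm (complex_of_real (x \<bullet> e) * f x)" for s x
      by (simp add: norm_mult)
    show "integrable lborel (\<lambda>x. norm (complex_of_real (x \<bullet> e) * f x))" using xi by (rule integrable_norm)
  qed
  then show ?thesis unfolding fourier_def by simp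
qed

section \<open>Conjugating a pseudodifferential operator by polynomial weights\<close>

lemma psdo_integrable:
  fixes a :: "'n::finite symbol"
  assumes c: "continuous_on UNIV a" and b: "\<And>z. norm (a z) \<le> C" and G: "integrable lborel G"
  shows "integrable lborel (\<lambda>\<xi>. cis (x \<bullet> \<xi>) * a (x, \<xi>) * G \<xi>)"
proof (rule Bochner_Integration.integrable_bound)
  have [measurable]: "G \<in> borel_measurable borel" using G by simp
  have [measurable]: "(\<lambda>\<xi>. cis (x \<bullet> \<xi>) * a (x, \<xi>)) \<in> borel_measurable borel"
    by (intro borel_measurable_continuous_onI continuous_intros continuous_on_compose2[OF c]) auto
  show "(\<lambda>\<xi>. cis (x \<bullet> \<xi>) * a (x, \<xi>) * G \<xi>) \<in> borel_measurable lborel" by simp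
  show "integrable lborel (\<lambda>\<xi>. C * norm (G \<xi>))" using G by simp
  show "AE \<xi> in lborel. norm (cis (x \<bullet> \<xi>) * a (x, \<xi>) * G \<xi>) \<le> norm (C * norm (G \<xi>))"
    using b by (auto simp: norm_mult abs_mult intro!: mult_right_mono order_trans[OF b abs_ge_self])
qed

lemma pd_uminus: "f differentiable at z \<Longrightarrow> pd (- v) f z = - pd v f z"
  using linear_neg[OF has_derivative_linear[OF has_derivative_pd]] .

text \<open>With w = \<open>om\<close> * v one has v = (1 + i (x.e - c)) w. On the Fourier side the
  factor x.e is a xi-derivative; integrating by parts moves it to the exponential, where it becomes
  x.e again and recombines to the reciprocal of \<open>om e c x\<close>, and to the symbol, where it
  produces the only correction. Since the factor is affine, there is no further term and no
  remainder.\<close>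

lemma psdo_om:
  fixes a :: "'n::finite symbol"
  assumes a: "continuous_on UNIV a" "\<And>z. norm (a z) \<le> C" "\<And>z. a differentiable at z"
    and da: "continuous_on UNIV (pd (0, e) a)" "\<And>z. norm (pd (0, e) a z) \<le> C"
    and v: "rapid v" and e: "norm e \<le> 1"
  shows "om e c x * psdo a v x = psdo (\<lambda>z. a z + om e c (fst z) * pd (0, e) a z) (\<lambda>x. om e c x * v x) x"
proof -
  define w where "w x = om e c x * v x" for x
  define G where "G = fourier w"
  define H where "H = fourier (\<lambda>x. complex_of_real (x \<bullet> e) * w x)"
  have w: "rapid w" unfolding w_def by (rule rapid_om[OF v e])
  have xw: "rapid (\<lambda>x. complex_of_real (x \<bullet> e) * w x)" by (rule rapid_coord[OF w e])
  have Gi: "integrable lborel G" and Hi: "integrable lborel H" unfolding G_def H_def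
    by (rule rapid_fourier_integrable[OF w], rule rapid_fourier_integrable[OF xw])
  have Gc: "continuous_on UNIV G" and Hc: "continuous_on UNIV H" unfolding G_def H_def
    by (rule rapid_fourier_continuous[OF w], rule rapid_fourier_continuous[OF xw])
  \<comment> \<open>Undoes the division by the linear factor, so that v is expressed through w and
    its product with one coordinate.\<close>
  have veq: "v = (\<lambda>x. (1 - \<i> * complex_of_real c) * w x + \<i> * (complex_of_real (x \<bullet> e) * w x))"
  proof
    fix x
    have "v x = (om e c x * (1 + \<i> * complex_of_real (x \<bullet> e - c))) * v x" by (simp only: om_mult_denom mult_1_left)
    then show "v x = (1 - \<i> * complex_of_real c) * w x + \<i> * (complex_of_real (x \<bullet> e) * w x)"
      by (simp add: w_def algebra_simps)
  qed
  have Fv: "fourier v \<xi> = (1 - \<i> * complex_of_real c) * G \<xi> + \<i> * H \<xi>" for \<xi>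
  proof -
    have "fourier v \<xi> = (\<integral>x. (1 - \<i> * complex_of_real c) * (cis (- (x \<bullet> \<xi>)) * w x)
        + \<i> * (cis (- (x \<bullet> \<xi>)) * (complex_of_real (x \<bullet> e) * w x)) \<partial>lborel)"
      unfolding fourier_def by (subst veq) (simp add: algebra_simps)
    then show ?thesis
      unfolding G_def H_def fourier_def
      using fourier_integrable(1)[OF rapid_integrable[OF w]] fourier_integrable(1)[OF rapid_integrable[OF xw]] by simp
  qed
  define Ia where "Ia = (\<integral>\<xi>. cis (x \<bullet> \<xi>) * a (x, \<xi>) * G \<xi> \<partial>lborel)"
  define Ih where "Ih = (\<integral>\<xi>. cis (x \<bullet> \<xi>) * a (x, \<xi>) * H \<xi> \<partial>lborel)"
  define Id where "Id = (\<integral>\<xi>. cis (x \<bullet> \<xi>) * pd (0, e) a (x, \<xi>) * G \<xi> \<partial>lborel)"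
  note iG = psdo_integrable[OF a(1,2) Gi, of x] and iH = psdo_integrable[OF a(1,2) Hi, of x]
    and iD = psdo_integrable[OF da Gi, of x]
  \<comment> \<open>The derivative along e of cis(x.xi) a(x, xi) G(xi); the term with H stems from
    G, whose derivative is -i H.\<close>
  let ?g' = "\<lambda>\<xi>. \<i> * complex_of_real (x \<bullet> e) * (cis (x \<bullet> \<xi>) * a (x, \<xi>) * G \<xi>)
      + cis (x \<bullet> \<xi>) * pd (0, e) a (x, \<xi>) * G \<xi> + - \<i> * (cis (x \<bullet> \<xi>) * a (x, \<xi>) * H \<xi>)"
  have "(\<integral>\<xi>. ?g' \<xi> \<partial>lborel) = 0"
  proof (rule integral_directional_derivative_zero[OF iG])
    show "integrable lborel ?g'" using iG iH iD by simp
    show "continuous_on UNIV ?g'"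
      by (intro continuous_intros continuous_on_compose2[OF a(1)] continuous_on_compose2[OF da(1)]
          continuous_on_compose2[OF Gc] continuous_on_compose2[OF Hc]) auto
    fix \<xi>
    have d1: "((\<lambda>s. cis (x \<bullet> \<xi> + s * (x \<bullet> e))) has_vector_derivative \<i> * complex_of_real (x \<bullet> e) * cis (x \<bullet> \<xi> + 0 * (x \<bullet> e))) (at 0)"
      by (rule has_vector_derivative_cis_affine)
    have d2: "((\<lambda>s. a ((x, \<xi>) + s *\<^sub>R (0, e))) has_vector_derivative pd (0, e) a ((x, \<xi>) + 0 *\<^sub>R (0, e))) (at 0)"
      by (rule has_vector_derivative_pd[OF a(3)])
    have d3: "((\<lambda>s. G (\<xi> + s *\<^sub>R e)) has_vector_derivative - \<i> * H (\<xi> + 0 *\<^sub>R e)) (at 0)"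
      unfolding G_def H_def by (rule fourier_has_vector_derivative[OF w e])
    show "((\<lambda>s. cis (x \<bullet> (\<xi> + s *\<^sub>R e)) * a (x, \<xi> + s *\<^sub>R e) * G (\<xi> + s *\<^sub>R e)) has_vector_derivative ?g' \<xi>) (at 0)"
      using has_vector_derivative_mult[OF has_vector_derivative_mult[OF d1 d2] d3]
      by (simp add: inner_add_right algebra_simps)
  qed
  then have z: "\<i> * complex_of_real (x \<bullet> e) * Ia + Id - \<i> * Ih = 0"
    unfolding Ia_def Id_def Ih_def using iG iH iD by simp
  have "(\<integral>\<xi>. cis (x \<bullet> \<xi>) * a (x, \<xi>) * fourier v \<xi> \<partial>lborel)
      = (\<integral>\<xi>. (1 - \<i> * complex_of_real c) * (cis (x \<bullet> \<xi>) * a (x, \<xi>) * G \<xi>) + \<i> * (cis (x \<bullet> \<xi>) * a (x, \<xi>) * H \<xi>) \<partial>lborel)"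
    unfolding Fv by (simp add: algebra_simps)
  also have "\<dots> = (1 - \<i> * complex_of_real c) * Ia + \<i> * Ih"
    unfolding Ia_def Ih_def using iG iH by simp
  also have "\<dots> = (1 + \<i> * complex_of_real (x \<bullet> e - c)) * Ia + Id"
    using z by (simp add: algebra_simps)
  finally have "(\<integral>\<xi>. cis (x \<bullet> \<xi>) * a (x, \<xi>) * fourier v \<xi> \<partial>lborel) = (1 + \<i> * complex_of_real (x \<bullet> e - c)) * Ia + Id" .
  then have "om e c x * (\<integral>\<xi>. cis (x \<bullet> \<xi>) * a (x, \<xi>) * fourier v \<xi> \<partial>lborel)
      = (om e c x * (1 + \<i> * complex_of_real (x \<bullet> e - c))) * Ia + om e c x * Id"
    by (simp only: distrib_left[of "om e c x" "_ * Ia"] mult.assoc)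
  also have "\<dots> = Ia + om e c x * Id" by (simp only: om_mult_denom mult_1_left)
  also have "\<dots> = (\<integral>\<xi>. cis (x \<bullet> \<xi>) * a (x, \<xi>) * G \<xi> + om e c x * (cis (x \<bullet> \<xi>) * pd (0, e) a (x, \<xi>) * G \<xi>) \<partial>lborel)"
    unfolding Ia_def Id_def using iG iD by simp
  also have "\<dots> = (\<integral>\<xi>. cis (x \<bullet> \<xi>) * (a (x, \<xi>) + om e c x * pd (0, e) a (x, \<xi>)) * G \<xi> \<partial>lborel)"
    by (simp add: algebra_simps)
  finally show ?thesis
    unfolding psdo_def G_def w_def by (simp add: mult_scaleR_right)
qed

text \<open>The recursion is \<open>psdo_om\<close> applied to the symbol already conjugated by the
  tail. The result is the symbol through which the product of the \<open>om\<close> factors passes: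
  product * Op(a) v = Op(conj_symbol) (product * v).\<close>

primrec conj_symbol :: "real^'n::finite \<Rightarrow> (real^'n) list \<Rightarrow> 'n symbol \<Rightarrow> 'n symbol" where
  "conj_symbol y [] a = a"
| "conj_symbol y (e # es) a =
     (\<lambda>z. conj_symbol y es a z + om e (y \<bullet> e) (fst z) * pd (0, e) (conj_symbol y es a) z)"

lemma basis_dirs_cases:
  fixes e :: "'a::euclidean_space"
  assumes "e \<in> set basis_dirs"
  shows "e \<in> Basis \<or> - e \<in> Basis"
proof -
  define bs where "bs = (SOME bs. set bs = (Basis::'a set) \<and> distinct bs)"
  have "\<exists>bs. set bs = (Basis::'a set) \<and> distinct bs" using finite_distinct_list[OF finite_Basis] by blast
  from someI_ex[OF this] have bs: "set bs = Basis" unfolding bs_def by blast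
  have "e \<in> set bs \<or> e \<in> uminus ` set bs"
    using assms unfolding basis_dirs_def bs_def[symmetric] by (simp only: set_append set_map Un_iff)
  then show ?thesis unfolding bs
  proof
    assume "e \<in> uminus ` Basis"
    then obtain b where "e = - b" "b \<in> Basis" by blast
    then show ?thesis by simp
  qed blast
qed

lemma wb_pd_xi:
  fixes a :: "'n::finite symbol"
  assumes a: "wb xi_deg (Suc m) C W a" and e: "e \<in> Basis \<or> - e \<in> Basis"
  shows "wb xi_deg m C (\<lambda>k. W (Suc k)) (pd (0, e) a)"
proof (cases "e \<in> Basis")
  case True
  then show ?thesis using wb_pd[OF a, of "(0, e)"] by (simp add: xi_deg_def Basis_prod_def)
next
  case False
  then have "wb xi_deg m C (\<lambda>k. W (Suc k)) (pd (0, - e) a)"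
    using wb_pd[OF a, of "(0, - e)"] e by (simp add: xi_deg_def Basis_prod_def)
  then have "wb xi_deg m (norm (-1::complex) * C) (\<lambda>k. W (Suc k)) (\<lambda>z. - 1 * pd (0, - e) a z)"
    by (rule wb_cmult)
  moreover have "- 1 * pd (0, - e) a z = pd (0, e) a z" for z
    using pd_uminus[OF wb_differentiable[OF a], of "(0, e)" z] by simp
  ultimately show ?thesis by simp
qed

lemma conj_symbol_step_wb:
  fixes a :: "'n::finite symbol"
  assumes a: "wb xi_deg (Suc m) C xi_weight a" and e: "e \<in> set basis_dirs" and C: "0 \<le> C"
  shows "wb xi_deg m (2 ^ m * (real (Suc m) ^ m * C)) (\<lambda>k. xi_weight (Suc k)) (\<lambda>z. om e c (fst z) * pd (0, e) a z)"
proof -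
  \<comment> \<open>Seen on phase space, the factor is of the type \<open>om\<close> along (e, 0),
    to which all directions of positive \<open>xi_deg\<close> are orthogonal; this is the hypothesis
    of \<open>om_wb\<close>.\<close>
  have eq: "om e c (fst z) = om (e, 0::real^'n) c z" for z by (simp add: om_def inner_prod_def)
  show ?thesis unfolding eq
  proof (rule wb_om_mult[OF wb_pd_xi[OF a basis_dirs_cases[OF e]] _ _ C])
    show "norm (e, 0::real^'n) \<le> 1" using basis_dirs_norm[OF e] by (simp add: norm_Pair)
    show "v \<bullet> (e, 0) = 0" if "v \<in> Basis" "xi_deg v \<noteq> 0" for v :: "(real^'n) \<times> (real^'n)"
      using that by (auto simp: xi_deg_def inner_prod_def split: if_splits)
  qed (simp add: less_imp_le[OF jbracket_pos])
qed

text \<open>Each direction contributes one xi-derivative of the preceding symbol, so it consumes one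
  order of differentiability and gains one power of 1 / <xi>. Thus conjugation changes a only by a
  symbol of order -1, with bounds uniform in y and linear in C.\<close>

lemma conj_symbol_wb:
  assumes "set es \<subseteq> set (basis_dirs :: (real^'n) list)"
  shows "\<exists>K\<ge>0. \<forall>y C (a :: 'n::finite symbol). 0 \<le> C \<longrightarrow> wb xi_deg (m + length es) C xi_weight a \<longrightarrow>
     wb xi_deg m (K * C) xi_weight (conj_symbol y es a) \<and>
     wb xi_deg m (K * C) (\<lambda>k. xi_weight (Suc k)) (\<lambda>z. conj_symbol y es a z - a z)"
  using assms
proof (induction es arbitrary: m)
  case Nil
  have "wb xi_deg m C (\<lambda>k. xi_weight (Suc k)) (\<lambda>z::(real^'n)\<times>(real^'n). 0)" if "0 \<le> C" for C
    by (rule wb_zero) (use that in \<open>simp add: less_imp_le[OF jbracket_pos]\<close>)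
  then show ?case by (intro exI[of _ 1]) auto
next
  case (Cons e es)
  then obtain K where K: "K \<ge> 0" and w: "\<And>y C (a :: 'n symbol). 0 \<le> C \<Longrightarrow> wb xi_deg (Suc m + length es) C xi_weight a \<Longrightarrow>
     wb xi_deg (Suc m) (K * C) xi_weight (conj_symbol y es a) \<and>
     wb xi_deg (Suc m) (K * C) (\<lambda>k. xi_weight (Suc k)) (\<lambda>z. conj_symbol y es a z - a z)"
    using Cons.IH[of "Suc m"] by auto
  define B where "B = 2 ^ m * real (Suc m) ^ m"
  have B: "B \<ge> 0" by (simp add: B_def)
  have mono: "1 / jbracket x ^ Suc k \<le> 1 / jbracket x ^ k" for k and x :: "real^'n"
    using jbracket_ge_1[of x] jbracket_pos[of x] by (simp add: field_simps)
  have "wb xi_deg m ((K + B * K) * C) xi_weight (conj_symbol y (e # es) a) \<and>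
     wb xi_deg m ((K + B * K) * C) (\<lambda>k. xi_weight (Suc k)) (\<lambda>z. conj_symbol y (e # es) a z - a z)"
    if C: "0 \<le> C" and a: "wb xi_deg (m + length (e # es)) C xi_weight a" for y C and a :: "'n symbol"
  proof -
    have a': "wb xi_deg (Suc m + length es) C xi_weight a" using a by simp
    note w1 = w[OF C a', of y, THEN conjunct1] and w2 = w[OF C a', of y, THEN conjunct2]
    have s: "wb xi_deg m (2 ^ m * (real (Suc m) ^ m * (K * C))) (\<lambda>k. xi_weight (Suc k))
        (\<lambda>z. om e (y \<bullet> e) (fst z) * pd (0, e) (conj_symbol y es a) z)"
      by (rule conj_symbol_step_wb[OF w1]) (use Cons.prems K C in auto)
    have s': "wb xi_deg m (2 ^ m * (real (Suc m) ^ m * (K * C))) xi_weight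
        (\<lambda>z. om e (y \<bullet> e) (fst z) * pd (0, e) (conj_symbol y es a) z)"
      by (rule wb_mono[OF s order_refl]) (intro mult_left_mono mono, use K C in simp)
    have eq: "K * C + 2 ^ m * (real (Suc m) ^ m * (K * C)) = (K + B * K) * C"
      by (simp add: B_def algebra_simps)
    have "wb xi_deg m (K * C) xi_weight (conj_symbol y es a)" by (rule wb_mono[OF w1]) simp_all
    from wb_add[OF this s'] have 1: "wb xi_deg m ((K + B * K) * C) xi_weight (conj_symbol y (e # es) a)"
      unfolding eq by simp
    have "wb xi_deg m (K * C) (\<lambda>k. xi_weight (Suc k)) (\<lambda>z. conj_symbol y es a z - a z)" by (rule wb_mono[OF w2]) simp_all
    from wb_add[OF this s] have "wb xi_deg m ((K + B * K) * C) (\<lambda>k. xi_weight (Suc k)) (\<lambda>z. conj_symbol y (e # es) a z - a z)"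
      unfolding eq by (simp add: algebra_simps)
    with 1 show ?thesis by blast
  qed
  then show ?case using K B by (intro exI[of _ "K + B * K"]) (auto simp del: conj_symbol.simps)
qed

lemma wb_xi_weight_bounded: "wb d m C xi_weight a \<Longrightarrow> norm (a z) \<le> C"
  using wb_bound[of d m C xi_weight a z] by simp

lemma psdo_conj_symbol:
  fixes a :: "'n::finite symbol"
  assumes "set es \<subseteq> set basis_dirs" and "wb xi_deg (length es) C xi_weight a" "0 \<le> C" and v: "rapid v"
  shows "prod_list (map (\<lambda>e. om e (y \<bullet> e) x) es) * psdo a v x
       = psdo (conj_symbol y es a) (\<lambda>x. prod_list (map (\<lambda>e. om e (y \<bullet> e) x) es) * v x) x
     \<and> rapid (\<lambda>x. prod_list (map (\<lambda>e. om e (y \<bullet> e) x) es) * v x)"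
  using assms(1,2)
proof (induction es arbitrary: x)
  case Nil
  then show ?case using v by simp
next
  case (Cons e es)
  let ?P = "\<lambda>x. prod_list (map (\<lambda>e. om e (y \<bullet> e) x) es)"
  have e: "norm e \<le> 1" using basis_dirs_norm Cons.prems by (metis list.set_intros(1) order_refl subsetD)
  have a': "wb xi_deg (length es) C xi_weight a" by (rule wb_mono[OF Cons.prems(2)]) simp_all
  have IH: "?P x * psdo a v x = psdo (conj_symbol y es a) (\<lambda>x. ?P x * v x) x" "rapid (\<lambda>x. ?P x * v x)" for x
    using Cons.IH[OF _ a', of x] Cons.prems by auto
  obtain K where K: "K \<ge> 0" "wb xi_deg (Suc 0) (K * C) xi_weight (conj_symbol y es a)"
    using conj_symbol_wb[of es "Suc 0"] Cons.prems \<open>0 \<le> C\<close> by auto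
  have d: "wb xi_deg 0 (K * C) (\<lambda>k. xi_weight (Suc k)) (pd (0, e) (conj_symbol y es a))"
    by (rule wb_pd_xi[OF K(2) basis_dirs_cases]) (use Cons.prems in simp)
  have db: "norm (pd (0, e) (conj_symbol y es a) z) \<le> K * C" for z
  proof -
    have "norm (pd (0, e) (conj_symbol y es a) z) \<le> K * C * (1 / jbracket (snd z))" using wb_bound[OF d, of z] by simp
    also have "\<dots> \<le> K * C * 1" using K \<open>0 \<le> C\<close> jbracket_ge_1[of "snd z"] by (intro mult_left_mono) (auto simp: divide_le_eq)
    finally show ?thesis by simp
  qed
  have "om e (y \<bullet> e) x * psdo (conj_symbol y es a) (\<lambda>x. ?P x * v x) x
      = psdo (conj_symbol y (e # es) a) (\<lambda>x. om e (y \<bullet> e) x * (?P x * v x)) x"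
    unfolding conj_symbol.simps
    by (rule psdo_om[OF wb_continuous[OF K(2)] wb_xi_weight_bounded[OF K(2)] wb_differentiable[OF K(2)] wb_continuous[OF d] db IH(2) e])
  then show ?case using IH(1)[of x] rapid_om[OF IH(2) e] by (simp add: mult.assoc)
qed

lemma psdo_conj_lam:
  fixes a :: "'n::finite symbol"
  assumes "wb xi_deg (length (basis_dirs :: (real^'n) list)) C xi_weight a" "0 \<le> C" "rapid v"
  shows "complex_of_real (lam y x) * psdo a v x = psdo (conj_symbol y basis_dirs a) (\<lambda>x. complex_of_real (lam y x) * v x) x"
    and "rapid (\<lambda>x. complex_of_real (lam y x) * v x)"
  using psdo_conj_symbol[OF order_refl assms, of y x] by (simp_all only: om_prod_lam)

section \<open>Fourier inversion and Plancherel\<close>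

lemma gauss_convolution:
  fixes f :: "real^'n \<Rightarrow> complex"
  assumes [measurable]: "f \<in> borel_measurable borel" and s: "s > 0"
  shows "(\<integral>y. f y * complex_of_real (exp (- (norm (y - x))\<^sup>2 / (4 * s\<^sup>2))) \<partial>lborel)
       = complex_of_real ((2 * s) ^ CARD('n)) * (\<integral>z. f (x + (2 * s) *\<^sub>R z) * complex_of_real (exp (- (norm z)\<^sup>2)) \<partial>lborel)"
proof -
  have m: "(\<lambda>y. f y * complex_of_real (exp (- (norm (y - x))\<^sup>2 / (4 * s\<^sup>2)))) \<in> borel_measurable borel"
    by measurable
  have "(\<integral>z. f (x + (2 * s) *\<^sub>R z) * complex_of_real (exp (- (norm z)\<^sup>2)) \<partial>lborel)
      = (\<integral>z. (\<lambda>y. f y * complex_of_real (exp (- (norm (y - x))\<^sup>2 / (4 * s\<^sup>2)))) (x + (2 * s) *\<^sub>R z) \<partial>lborel)"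
    using s by (simp add: power_mult_distrib)
  also have "\<dots> = (1 / \<bar>2 * s\<bar> ^ DIM(real^'n)) *\<^sub>R (\<integral>y. f y * complex_of_real (exp (- (norm (y - x))\<^sup>2 / (4 * s\<^sup>2))) \<partial>lborel)"
    by (rule lborel_integral_affine(2)[OF _ m]) (use s in simp)
  finally show ?thesis using s by (simp add: scaleR_conv_of_real)
qed

lemma gauss_approx:
  fixes f :: "real^'n \<Rightarrow> complex"
  assumes c: "continuous_on UNIV f" and b: "\<And>x. norm (f x) \<le> M" and X: "X \<longlonglongrightarrow> 0"
  shows "(\<lambda>k. \<integral>z. f (x + X k *\<^sub>R z) * complex_of_real (exp (- (norm z)\<^sup>2)) \<partial>lborel) \<longlonglongrightarrow> complex_of_real (sqrt pi ^ CARD('n)) * f x"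
proof -
  have "(\<lambda>k. \<integral>z. f (x + X k *\<^sub>R z) * complex_of_real (exp (- (norm z)\<^sup>2)) \<partial>lborel)
      \<longlonglongrightarrow> (\<integral>z. f x * complex_of_real (exp (- (norm (z::real^'n))\<^sup>2)) \<partial>lborel)"
  proof (rule integral_dominated_convergence[where w="\<lambda>z. M * exp (- (norm z)\<^sup>2)"])
    show "integrable lborel (\<lambda>z::real^'n. M * exp (- (norm z)\<^sup>2))"
      using gauss_fourier(1)[of 1, where 'a="real^'n"] by simp
    show "AE z in lborel. (\<lambda>k. f (x + X k *\<^sub>R z) * complex_of_real (exp (- (norm z)\<^sup>2))) \<longlonglongrightarrow> f x * complex_of_real (exp (- (norm z)\<^sup>2))"
    proof (rule AE_I2)
      fix z :: "real^'n"
      have "(\<lambda>k. x + X k *\<^sub>R z) \<longlonglongrightarrow> x + 0 *\<^sub>R z" by (intro tendsto_add tendsto_scaleR tendsto_const X)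
      then have "(\<lambda>k. f (x + X k *\<^sub>R z)) \<longlonglongrightarrow> f x"
        using c unfolding continuous_on_sequentially o_def by simp
      then show "(\<lambda>k. f (x + X k *\<^sub>R z) * complex_of_real (exp (- (norm z)\<^sup>2))) \<longlonglongrightarrow> f x * complex_of_real (exp (- (norm z)\<^sup>2))"
        by (intro tendsto_mult tendsto_const)
    qed
    show "AE z in lborel. norm (f (x + X k *\<^sub>R z) * complex_of_real (exp (- (norm z)\<^sup>2))) \<le> M * exp (- (norm z)\<^sup>2)" for k
      by (intro AE_I2) (simp add: norm_mult mult_right_mono b)
    have "continuous_on UNIV (\<lambda>z. f (x + X k *\<^sub>R z) * complex_of_real (exp (- (norm z)\<^sup>2)))" for k
      by (intro continuous_intros continuous_on_compose2[OF c]) auto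
    then show "(\<lambda>z. f (x + X k *\<^sub>R z) * complex_of_real (exp (- (norm z)\<^sup>2))) \<in> borel_measurable lborel" for k
      by (simp add: borel_measurable_continuous_onI)
    show "(\<lambda>z::real^'n. f x * complex_of_real (exp (- (norm z)\<^sup>2))) \<in> borel_measurable lborel"
      by simp
  qed
  also have "(\<integral>z. f x * complex_of_real (exp (- (norm (z::real^'n))\<^sup>2)) \<partial>lborel) = complex_of_real (sqrt pi ^ CARD('n)) * f x"
    using gauss_fourier(3)[of 1, where 'a="real^'n"] by simp
  finally show ?thesis .
qed

lemma sqrt_pi_power: "sqrt (pi / s\<^sup>2) ^ n * (2 * s) ^ n = (2 * sqrt pi) ^ n" if "s > 0" for s :: real
proof -
  have "sqrt (pi / s\<^sup>2) * (2 * s) = 2 * sqrt pi" using that by (simp add: real_sqrt_divide)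
  then show ?thesis by (simp only: power_mult_distrib[symmetric])
qed

lemma two_pi_power: "(2 * sqrt pi) ^ n * sqrt pi ^ n = (2 * pi) ^ n"
proof -
  have "2 * sqrt pi * sqrt pi = 2 * pi" by simp
  then show ?thesis by (simp only: power_mult_distrib[symmetric])
qed

lemma cis_inner_diff: "cis (x \<bullet> (u - v)) = cis (x \<bullet> u) * cis (- (x \<bullet> v))"
  by (simp add: cis_mult inner_diff_right)

lemma inverse_Suc_tendsto: "(\<lambda>k. 1 / real (Suc k)) \<longlonglongrightarrow> 0" "(\<lambda>k. 2 * (1 / real (Suc k))) \<longlonglongrightarrow> 0"
proof -
  show l: "(\<lambda>k. 1 / real (Suc k)) \<longlonglongrightarrow> 0"
    using LIMSEQ_inverse_real_of_nat by (simp add: inverse_eq_divide)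
  show "(\<lambda>k. 2 * (1 / real (Suc k))) \<longlonglongrightarrow> 0"
    using tendsto_mult_left[OF l, of 2] by simp
qed

text \<open>Gaussian summation: the damping exp(-s^2 |xi|^2) makes the double integral absolutely
  convergent, and Fubini turns it into a Gaussian mean of f around x at scale 2s. For s = 1 / (k +
  1) both sides converge by domination.\<close>

lemma fourier_inversion:
  fixes f :: "real^'n \<Rightarrow> complex"
  assumes c: "continuous_on UNIV f" and b: "\<And>x. norm (f x) \<le> M" and f: "integrable lborel f"
    and F: "integrable lborel (fourier f)"
  shows "(\<integral>\<xi>. cis (x \<bullet> \<xi>) * fourier f \<xi> \<partial>lborel) = complex_of_real ((2 * pi) ^ CARD('n)) * f x"
proof -
  define g where "g s \<xi> = complex_of_real (exp (- s\<^sup>2 * (norm \<xi>)\<^sup>2))" for s and \<xi> :: "real^'n"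
  have gc: "continuous_on UNIV (g s)" for s unfolding g_def by (intro continuous_intros)
  have gi: "integrable lborel (g s)" if "s > 0" for s
    using gauss_fourier(1)[of "s\<^sup>2", where 'a="real^'n"] that unfolding g_def by (simp add: complex_of_real_integrable_eq)
  have main: "(\<integral>\<xi>. cis (x \<bullet> \<xi>) * (g s \<xi> * fourier f \<xi>) \<partial>lborel)
      = complex_of_real ((2 * sqrt pi) ^ CARD('n)) * (\<integral>z. f (x + (2 * s) *\<^sub>R z) * complex_of_real (exp (- (norm z)\<^sup>2)) \<partial>lborel)"
    if s: "s > 0" for s
  proof -
    let ?P = "\<lambda>p. cis (x \<bullet> fst p) * (g s (fst p) * (cis (- (snd p \<bullet> fst p)) * f (snd p)))"
    have P: "integrable lborel ?P"
    proof (rule integrable_lborel_prod_bound[where g="\<lambda>\<xi>. norm (g s \<xi>)" and h="\<lambda>y. norm (f y)"])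
      show "?P \<in> borel_measurable borel"
        by (intro borel_measurable_continuous_onI continuous_intros continuous_on_compose2[OF gc] continuous_on_compose2[OF c]) auto
    qed (use gi[OF s] f in \<open>auto simp: norm_mult\<close>)
    have "(\<integral>\<xi>. cis (x \<bullet> \<xi>) * (g s \<xi> * fourier f \<xi>) \<partial>lborel) = (\<integral>\<xi>. \<integral>y. ?P (\<xi>, y) \<partial>lborel \<partial>lborel)"
      by (simp add: fourier_def)
    also have "\<dots> = (\<integral>y. \<integral>\<xi>. ?P (\<xi>, y) \<partial>lborel \<partial>lborel)"
      using lborel_fubini(1,2)[OF P] by simp
    also have "\<dots> = (\<integral>y. f y * (complex_of_real (sqrt (pi / s\<^sup>2) ^ CARD('n)) * complex_of_real (exp (- (norm (y - x))\<^sup>2 / (4 * s\<^sup>2)))) \<partial>lborel)"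
    proof (intro Bochner_Integration.integral_cong refl)
      fix y
      have "(\<integral>\<xi>. ?P (\<xi>, y) \<partial>lborel) = (\<integral>\<xi>. f y * (cis (\<xi> \<bullet> (x - y)) * complex_of_real (exp (- s\<^sup>2 * (norm \<xi>)\<^sup>2))) \<partial>lborel)"
        by (intro Bochner_Integration.integral_cong refl)
          (simp add: g_def inner_diff_right inner_commute cis_divide[symmetric] cis_cnj[symmetric] cis_mult[symmetric] divide_inverse cis_inverse mult_ac)
      also have "\<dots> = f y * complex_of_real (sqrt (pi / s\<^sup>2) ^ DIM(real^'n) * exp (- (norm (x - y))\<^sup>2 / (4 * s\<^sup>2)))"
        using gauss_fourier(2)[of "s\<^sup>2" "x - y"] s by simp
      finally show "(\<integral>\<xi>. ?P (\<xi>, y) \<partial>lborel) = f y * (complex_of_real (sqrt (pi / s\<^sup>2) ^ CARD('n)) * complex_of_real (exp (- (norm (y - x))\<^sup>2 / (4 * s\<^sup>2))))"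
        by (simp add: norm_minus_commute)
    qed
    also have "\<dots> = complex_of_real (sqrt (pi / s\<^sup>2) ^ CARD('n)) * (\<integral>y. f y * complex_of_real (exp (- (norm (y - x))\<^sup>2 / (4 * s\<^sup>2))) \<partial>lborel)"
      by (subst integral_mult_right_zero[symmetric]) (simp add: mult_ac)
    also have "\<dots> = complex_of_real (sqrt (pi / s\<^sup>2) ^ CARD('n) * (2 * s) ^ CARD('n)) * (\<integral>z. f (x + (2 * s) *\<^sub>R z) * complex_of_real (exp (- (norm z)\<^sup>2)) \<partial>lborel)"
      by (subst gauss_convolution[OF _ s]) (use borel_measurable_continuous_onI[OF c] in simp_all)
    finally show ?thesis by (simp only: sqrt_pi_power[OF s])
  qed
  let ?s = "\<lambda>k. 1 / real (Suc k)"
  have "(\<lambda>k. \<integral>\<xi>. cis (x \<bullet> \<xi>) * (g (?s k) \<xi> * fourier f \<xi>) \<partial>lborel) \<longlonglongrightarrow> (\<integral>\<xi>. cis (x \<bullet> \<xi>) * fourier f \<xi> \<partial>lborel)"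
  proof (rule integral_dominated_convergence[where w="\<lambda>\<xi>. norm (fourier f \<xi>)"])
    have Fc: "continuous_on UNIV (fourier f)" by (rule fourier_continuous[OF f])
    show "(\<lambda>\<xi>. cis (x \<bullet> \<xi>) * (g (?s k) \<xi> * fourier f \<xi>)) \<in> borel_measurable lborel" for k
      by (simp, intro borel_measurable_continuous_onI continuous_intros gc Fc)
    show "(\<lambda>\<xi>. cis (x \<bullet> \<xi>) * fourier f \<xi>) \<in> borel_measurable lborel"
      by (simp, intro borel_measurable_continuous_onI continuous_intros Fc)
    show "integrable lborel (\<lambda>\<xi>. norm (fourier f \<xi>))" using F by simp
    show "AE \<xi> in lborel. norm (cis (x \<bullet> \<xi>) * (g (?s k) \<xi> * fourier f \<xi>)) \<le> norm (fourier f \<xi>)" for k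
      by (intro AE_I2) (simp add: norm_mult g_def mult_left_le_one_le)
    show "AE \<xi> in lborel. (\<lambda>k. cis (x \<bullet> \<xi>) * (g (?s k) \<xi> * fourier f \<xi>)) \<longlonglongrightarrow> cis (x \<bullet> \<xi>) * fourier f \<xi>"
    proof (rule AE_I2)
      fix \<xi> :: "real^'n"
      have "(\<lambda>k. g (?s k) \<xi>) \<longlonglongrightarrow> complex_of_real (exp (- 0\<^sup>2 * (norm \<xi>)\<^sup>2))"
        unfolding g_def by (intro tendsto_intros inverse_Suc_tendsto(1))
      then have "(\<lambda>k. cis (x \<bullet> \<xi>) * (g (?s k) \<xi> * fourier f \<xi>)) \<longlonglongrightarrow> cis (x \<bullet> \<xi>) * (complex_of_real (exp (- 0\<^sup>2 * (norm \<xi>)\<^sup>2)) * fourier f \<xi>)"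
        by (intro tendsto_mult tendsto_const)
      then show "(\<lambda>k. cis (x \<bullet> \<xi>) * (g (?s k) \<xi> * fourier f \<xi>)) \<longlonglongrightarrow> cis (x \<bullet> \<xi>) * fourier f \<xi>" by simp
    qed
  qed
  moreover have "(\<lambda>k. \<integral>\<xi>. cis (x \<bullet> \<xi>) * (g (?s k) \<xi> * fourier f \<xi>) \<partial>lborel)
      \<longlonglongrightarrow> complex_of_real ((2 * sqrt pi) ^ CARD('n)) * (complex_of_real (sqrt pi ^ CARD('n)) * f x)"
    unfolding main[of "?s _", simplified zero_less_divide_1_iff of_nat_0_less_iff zero_less_Suc, OF TrueI]
    by (intro tendsto_mult tendsto_const gauss_approx[OF c b] inverse_Suc_tendsto(2))
  ultimately have "(\<integral>\<xi>. cis (x \<bullet> \<xi>) * fourier f \<xi> \<partial>lborel)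
      = complex_of_real ((2 * sqrt pi) ^ CARD('n)) * (complex_of_real (sqrt pi ^ CARD('n)) * f x)"
    by (rule LIMSEQ_unique)
  then show ?thesis by (simp only: two_pi_power mult.assoc[symmetric] of_real_mult[symmetric])
qed

text \<open>Square integrability of h is part of the claim, so the integral of |h|^2 is first damped
  by a Gaussian. The damped integral becomes, by Fubini, a Gaussian correlation of G with itself,
  whose limit is found by domination on the frequency side; monotone convergence on the x-side then
  gives integrability and value together. The factor (2 pi)^n is present because h is the inverse
  transform without normalisation.\<close>

lemma plancherel:
  fixes G :: "real^'n \<Rightarrow> complex"
  assumes c: "continuous_on UNIV G" and b: "\<And>x. norm (G x) \<le> M" and G: "integrable lborel G"
  defines "h \<equiv> \<lambda>x. \<integral>\<xi>. cis (x \<bullet> \<xi>) * G \<xi> \<partial>lborel"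
  shows "integrable lborel (\<lambda>x. (norm (h x))\<^sup>2)"
    and "(\<integral>x. (norm (h x))\<^sup>2 \<partial>lborel) = (2 * pi) ^ CARD('n) * (\<integral>\<xi>. (norm (G \<xi>))\<^sup>2 \<partial>lborel)"
proof -
  let ?s = "\<lambda>k. 1 / real (Suc k)"
  define g where "g s x = exp (- s\<^sup>2 * (norm x)\<^sup>2)" for s and x :: "real^'n"
  have gc: "continuous_on UNIV (g s)" for s unfolding g_def by (intro continuous_intros)
  have gi: "integrable lborel (g s)" if "s > 0" for s
    using gauss_fourier(1)[of "s\<^sup>2", where 'a="real^'n"] that unfolding g_def by simp
  have hc: "continuous_on UNIV h"
    unfolding h_def
    by (rule continuous_integral_dominated[where g="\<lambda>x. norm (G x)"])
      (use G c in \<open>auto simp: norm_mult intro!: continuous_intros borel_measurable_continuous_onI\<close>)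
  have hb: "norm (h x) \<le> (\<integral>\<xi>. norm (G \<xi>) \<partial>lborel)" for x
    unfolding h_def by (rule order_trans[OF integral_norm_bound]) (simp add: norm_mult)
  have cj: "continuous_on UNIV (\<lambda>x. cnj (G x))" using c by (intro continuous_intros)
  have inner: "continuous_on UNIV (\<lambda>\<xi>. \<integral>z. cnj (G (\<xi> + t *\<^sub>R z)) * complex_of_real (exp (- (norm z)\<^sup>2)) \<partial>lborel)" for t
    by (rule continuous_integral_dominated[where g="\<lambda>z. M * exp (- (norm z)\<^sup>2)"])
      (use gauss_fourier(1)[of 1, where 'a="real^'n"] b in
        \<open>auto simp: norm_mult intro!: continuous_intros borel_measurable_continuous_onI continuous_on_compose2[OF c] mult_right_mono\<close>)
  have innerb: "norm (\<integral>z. cnj (G (\<xi> + t *\<^sub>R z)) * complex_of_real (exp (- (norm z)\<^sup>2)) \<partial>lborel) \<le> M * sqrt pi ^ CARD('n)" for \<xi> t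
  proof -
    have "norm (\<integral>z. cnj (G (\<xi> + t *\<^sub>R z)) * complex_of_real (exp (- (norm z)\<^sup>2)) \<partial>lborel)
        \<le> (\<integral>z. norm (cnj (G (\<xi> + t *\<^sub>R z)) * complex_of_real (exp (- (norm z)\<^sup>2))) \<partial>lborel)" by (rule integral_norm_bound)
    also have "\<dots> \<le> (\<integral>z. M * exp (- (norm (z::real^'n))\<^sup>2) \<partial>lborel)"
      by (rule integral_mono')
        (use gauss_fourier(1)[of 1, where 'a="real^'n"] b order_trans[OF norm_ge_zero b] in \<open>auto simp: norm_mult intro!: mult_right_mono\<close>)
    also have "\<dots> = M * sqrt pi ^ CARD('n)"
      using gauss_fourier(3)[of 1, where 'a="real^'n"] by simp
    finally show ?thesis .
  qed
  have hi: "integrable lborel (\<lambda>x. (norm (h x))\<^sup>2 * g s x)" if s: "s > 0" for s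
  proof (rule Bochner_Integration.integrable_bound)
    show "integrable lborel (\<lambda>x. (\<integral>\<xi>. norm (G \<xi>) \<partial>lborel)\<^sup>2 * g s x)" using gi[OF s] by simp
    show "(\<lambda>x. (norm (h x))\<^sup>2 * g s x) \<in> borel_measurable lborel"
      by (simp, intro borel_measurable_continuous_onI continuous_intros hc gc)
    show "AE x in lborel. norm ((norm (h x))\<^sup>2 * g s x) \<le> norm ((\<integral>\<xi>. norm (G \<xi>) \<partial>lborel)\<^sup>2 * g s x)"
      by (intro AE_I2) (auto simp: abs_mult g_def intro!: mult_right_mono power_mono hb)
  qed
  have main: "complex_of_real (\<integral>x. (norm (h x))\<^sup>2 * g s x \<partial>lborel)
      = complex_of_real ((2 * sqrt pi) ^ CARD('n)) * (\<integral>\<xi>. G \<xi> * (\<integral>z. cnj (G (\<xi> + (2 * s) *\<^sub>R z)) * complex_of_real (exp (- (norm z)\<^sup>2)) \<partial>lborel) \<partial>lborel)"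
    if s: "s > 0" for s
  proof -
    let ?P = "\<lambda>q. complex_of_real (g s (fst q)) * ((cis (fst q \<bullet> fst (snd q)) * G (fst (snd q))) * cnj (cis (fst q \<bullet> snd (snd q)) * G (snd (snd q))))"
    have GG: "integrable lborel (\<lambda>p. norm (G (fst p)) * norm (G (snd p)))"
      by (rule lborel_integral_times(1)) (use G in auto)
    have P: "integrable lborel ?P"
    proof (rule integrable_lborel_prod_bound[where g="g s" and h="\<lambda>p. norm (G (fst p)) * norm (G (snd p))"])
      show "?P \<in> borel_measurable borel"
        by (intro borel_measurable_continuous_onI continuous_intros continuous_on_compose2[OF gc] continuous_on_compose2[OF c]) auto
    qed (use gi[OF s] GG in \<open>auto simp: norm_mult g_def\<close>)
    have ic: "integrable lborel (\<lambda>\<xi>. cis (x \<bullet> \<xi>) * G \<xi>)" for x by (rule fourier_integrable(2)[OF G, of x, unfolded inner_commute[of _ x]])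
    have "complex_of_real (\<integral>x. (norm (h x))\<^sup>2 * g s x \<partial>lborel) = (\<integral>x. complex_of_real (g s x) * (h x * cnj (h x)) \<partial>lborel)"
      by (subst integral_complex_of_real[symmetric]) (simp only: of_real_mult complex_norm_square mult_ac)
    also have "\<dots> = (\<integral>x. \<integral>p. ?P (x, p) \<partial>lborel \<partial>lborel)"
    proof (intro Bochner_Integration.integral_cong refl)
      fix x
      have "h x * cnj (h x) = (\<integral>p. (cis (x \<bullet> fst p) * G (fst p)) * cnj (cis (x \<bullet> snd p) * G (snd p)) \<partial>lborel)"
        using lborel_integral_times(2)[OF ic[of x] integrable_cnj[OF ic[of x]]]
        unfolding h_def by (simp only: Bochner_Integration.integral_cnj)
      then show "complex_of_real (g s x) * (h x * cnj (h x)) = (\<integral>p. ?P (x, p) \<partial>lborel)" by simp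
    qed
    also have "\<dots> = (\<integral>p. \<integral>x. ?P (x, p) \<partial>lborel \<partial>lborel)"
      using lborel_fubini(1,2)[OF P] by simp
    also have "\<dots> = (\<integral>p. G (fst p) * cnj (G (snd p)) * complex_of_real (sqrt (pi / s\<^sup>2) ^ CARD('n) * exp (- (norm (snd p - fst p))\<^sup>2 / (4 * s\<^sup>2))) \<partial>lborel)"
    proof (intro Bochner_Integration.integral_cong refl)
      fix p :: "(real^'n) \<times> (real^'n)"
      have "(\<integral>x. ?P (x, p) \<partial>lborel) = (\<integral>x. G (fst p) * cnj (G (snd p)) * (cis (x \<bullet> (fst p - snd p)) * complex_of_real (exp (- s\<^sup>2 * (norm x)\<^sup>2))) \<partial>lborel)"
        by (intro Bochner_Integration.integral_cong refl)
          (simp add: g_def cis_cnj cis_inner_diff mult_ac)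
      also have "\<dots> = G (fst p) * cnj (G (snd p)) * complex_of_real (sqrt (pi / s\<^sup>2) ^ DIM(real^'n) * exp (- (norm (fst p - snd p))\<^sup>2 / (4 * s\<^sup>2)))"
        using gauss_fourier(2)[of "s\<^sup>2" "fst p - snd p"] s by simp
      finally show "(\<integral>x. ?P (x, p) \<partial>lborel) = G (fst p) * cnj (G (snd p)) * complex_of_real (sqrt (pi / s\<^sup>2) ^ CARD('n) * exp (- (norm (snd p - fst p))\<^sup>2 / (4 * s\<^sup>2)))"
        by (simp add: norm_minus_commute)
    qed
    also have "\<dots> = (\<integral>\<xi>. \<integral>\<eta>. G \<xi> * cnj (G \<eta>) * complex_of_real (sqrt (pi / s\<^sup>2) ^ CARD('n) * exp (- (norm (\<eta> - \<xi>))\<^sup>2 / (4 * s\<^sup>2))) \<partial>lborel \<partial>lborel)"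
    proof -
      let ?Q = "\<lambda>p. G (fst p) * cnj (G (snd p)) * complex_of_real (sqrt (pi / s\<^sup>2) ^ CARD('n) * exp (- (norm (snd p - fst p))\<^sup>2 / (4 * s\<^sup>2)))"
      have Q: "integrable lborel ?Q"
      proof (rule integrable_lborel_prod_bound[where g="\<lambda>\<xi>. sqrt (pi / s\<^sup>2) ^ CARD('n) * norm (G \<xi>)" and h="\<lambda>y. norm (G y)"])
        show "?Q \<in> borel_measurable borel"
          by (intro borel_measurable_continuous_onI continuous_intros continuous_on_compose2[OF c]) (use s in auto)
        show "norm (?Q (x, y)) \<le> sqrt (pi / s\<^sup>2) ^ CARD('n) * norm (G x) * norm (G y)" for x y
        proof -
          have "norm (?Q (x, y)) = sqrt (pi / s\<^sup>2) ^ CARD('n) * norm (G x) * norm (G y) * exp (- (norm (y - x))\<^sup>2 / (4 * s\<^sup>2))"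
            by (simp add: norm_mult norm_power abs_of_nonneg flip: of_real_mult of_real_power)
          also have "\<dots> \<le> sqrt (pi / s\<^sup>2) ^ CARD('n) * norm (G x) * norm (G y) * 1"
            by (intro mult_left_mono) auto
          finally show ?thesis by simp
        qed
      qed (use G in auto)
      show ?thesis using lborel_fubini(1)[OF Q] by simp
    qed
    also have "\<dots> = (\<integral>\<xi>. complex_of_real (sqrt (pi / s\<^sup>2) ^ CARD('n) * (2 * s) ^ CARD('n)) * (G \<xi> * (\<integral>z. cnj (G (\<xi> + (2 * s) *\<^sub>R z)) * complex_of_real (exp (- (norm z)\<^sup>2)) \<partial>lborel)) \<partial>lborel)"
    proof (intro Bochner_Integration.integral_cong refl)
      fix \<xi>
      have "(\<integral>\<eta>. G \<xi> * cnj (G \<eta>) * complex_of_real (sqrt (pi / s\<^sup>2) ^ CARD('n) * exp (- (norm (\<eta> - \<xi>))\<^sup>2 / (4 * s\<^sup>2))) \<partial>lborel)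
          = (G \<xi> * complex_of_real (sqrt (pi / s\<^sup>2) ^ CARD('n))) * (\<integral>\<eta>. cnj (G \<eta>) * complex_of_real (exp (- (norm (\<eta> - \<xi>))\<^sup>2 / (4 * s\<^sup>2))) \<partial>lborel)"
        by (subst integral_mult_right_zero[symmetric]) (simp add: mult_ac)
      also have "\<dots> = (G \<xi> * complex_of_real (sqrt (pi / s\<^sup>2) ^ CARD('n))) * (complex_of_real ((2 * s) ^ CARD('n)) * (\<integral>z. cnj (G (\<xi> + (2 * s) *\<^sub>R z)) * complex_of_real (exp (- (norm z)\<^sup>2)) \<partial>lborel))"
        by (subst gauss_convolution[OF _ s]) (use borel_measurable_continuous_onI[OF cj] in simp_all)
      finally show "(\<integral>\<eta>. G \<xi> * cnj (G \<eta>) * complex_of_real (sqrt (pi / s\<^sup>2) ^ CARD('n) * exp (- (norm (\<eta> - \<xi>))\<^sup>2 / (4 * s\<^sup>2))) \<partial>lborel)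
         = complex_of_real (sqrt (pi / s\<^sup>2) ^ CARD('n) * (2 * s) ^ CARD('n)) * (G \<xi> * (\<integral>z. cnj (G (\<xi> + (2 * s) *\<^sub>R z)) * complex_of_real (exp (- (norm z)\<^sup>2)) \<partial>lborel))"
        by (simp only: of_real_mult mult_ac)
    qed
    also have "\<dots> = complex_of_real (sqrt (pi / s\<^sup>2) ^ CARD('n) * (2 * s) ^ CARD('n)) * (\<integral>\<xi>. G \<xi> * (\<integral>z. cnj (G (\<xi> + (2 * s) *\<^sub>R z)) * complex_of_real (exp (- (norm z)\<^sup>2)) \<partial>lborel) \<partial>lborel)"
      by (rule integral_mult_right_zero)
    finally show ?thesis by (simp only: sqrt_pi_power[OF s])
  qed
  have lim: "(\<lambda>k. \<integral>\<xi>. G \<xi> * (\<integral>z. cnj (G (\<xi> + (2 * ?s k) *\<^sub>R z)) * complex_of_real (exp (- (norm z)\<^sup>2)) \<partial>lborel) \<partial>lborel)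
      \<longlonglongrightarrow> (\<integral>\<xi>. G \<xi> * (complex_of_real (sqrt pi ^ CARD('n)) * cnj (G \<xi>)) \<partial>lborel)"
  proof (rule integral_dominated_convergence[where w="\<lambda>\<xi>. norm (G \<xi>) * (M * sqrt pi ^ CARD('n))"])
    show "integrable lborel (\<lambda>\<xi>. norm (G \<xi>) * (M * sqrt pi ^ CARD('n)))" using G by simp
    show "AE \<xi> in lborel. (\<lambda>k. G \<xi> * (\<integral>z. cnj (G (\<xi> + (2 * ?s k) *\<^sub>R z)) * complex_of_real (exp (- (norm z)\<^sup>2)) \<partial>lborel))
        \<longlonglongrightarrow> G \<xi> * (complex_of_real (sqrt pi ^ CARD('n)) * cnj (G \<xi>))"
      by (intro AE_I2 tendsto_mult tendsto_const gauss_approx[OF cj, of M] inverse_Suc_tendsto(2)) (simp add: b)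
    show "AE \<xi> in lborel. norm (G \<xi> * (\<integral>z. cnj (G (\<xi> + (2 * ?s k) *\<^sub>R z)) * complex_of_real (exp (- (norm z)\<^sup>2)) \<partial>lborel))
        \<le> norm (G \<xi>) * (M * sqrt pi ^ CARD('n))" for k
      unfolding norm_mult by (intro AE_I2 mult_left_mono innerb) simp
    show "(\<lambda>\<xi>. G \<xi> * (\<integral>z. cnj (G (\<xi> + (2 * ?s k) *\<^sub>R z)) * complex_of_real (exp (- (norm z)\<^sup>2)) \<partial>lborel)) \<in> borel_measurable lborel" for k
      using continuous_on_mult[OF c inner[of "2 * ?s k"]] by (simp add: borel_measurable_continuous_onI)
    show "(\<lambda>\<xi>. G \<xi> * (complex_of_real (sqrt pi ^ CARD('n)) * cnj (G \<xi>))) \<in> borel_measurable lborel"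
      by (simp, intro borel_measurable_continuous_onI continuous_intros c)
  qed
  have limv: "(\<integral>\<xi>. G \<xi> * (complex_of_real (sqrt pi ^ CARD('n)) * cnj (G \<xi>)) \<partial>lborel)
      = complex_of_real (sqrt pi ^ CARD('n) * (\<integral>\<xi>. (norm (G \<xi>))\<^sup>2 \<partial>lborel))"
  proof -
    have "(\<integral>\<xi>. G \<xi> * (complex_of_real (sqrt pi ^ CARD('n)) * cnj (G \<xi>)) \<partial>lborel)
        = (\<integral>\<xi>. complex_of_real (sqrt pi ^ CARD('n)) * complex_of_real ((norm (G \<xi>))\<^sup>2) \<partial>lborel)"
      by (intro Bochner_Integration.integral_cong refl) (simp only: complex_norm_square mult_ac)
    then show ?thesis by (simp only: integral_mult_right_zero integral_complex_of_real of_real_mult)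
  qed
  have sp: "?s k > 0" for k by simp
  have "(\<lambda>k. complex_of_real (\<integral>x. (norm (h x))\<^sup>2 * g (?s k) x \<partial>lborel))
      \<longlonglongrightarrow> complex_of_real ((2 * sqrt pi) ^ CARD('n)) * complex_of_real (sqrt pi ^ CARD('n) * (\<integral>\<xi>. (norm (G \<xi>))\<^sup>2 \<partial>lborel))"
    unfolding main[OF sp] limv[symmetric] by (intro tendsto_mult tendsto_const lim)
  then have "(\<lambda>k. complex_of_real (\<integral>x. (norm (h x))\<^sup>2 * g (?s k) x \<partial>lborel))
      \<longlonglongrightarrow> complex_of_real ((2 * pi) ^ CARD('n) * (\<integral>\<xi>. (norm (G \<xi>))\<^sup>2 \<partial>lborel))"
    by (simp only: two_pi_power mult.assoc[symmetric] of_real_mult[symmetric])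
  then have il: "(\<lambda>k. \<integral>x. (norm (h x))\<^sup>2 * g (?s k) x \<partial>lborel) \<longlonglongrightarrow> (2 * pi) ^ CARD('n) * (\<integral>\<xi>. (norm (G \<xi>))\<^sup>2 \<partial>lborel)"
    by (simp only: tendsto_of_real_iff)
  \<comment> \<open>Smaller s means less damping, so the damped squares increase with k and monotone
    convergence is available.\<close>
  have mono: "mono (\<lambda>k. (norm (h x))\<^sup>2 * g (?s k) x)" for x
  proof (rule monoI, rule mult_left_mono)
    fix k l :: nat assume "k \<le> l"
    then have "?s l \<le> ?s k" by (simp add: frac_le)
    then have "(?s l)\<^sup>2 \<le> (?s k)\<^sup>2" by (rule power_mono) simp
    then show "g (?s k) x \<le> g (?s l) x" unfolding g_def by (simp add: mult_right_mono)
  qed simp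
  have ptw: "(\<lambda>k. (norm (h x))\<^sup>2 * g (?s k) x) \<longlonglongrightarrow> (norm (h x))\<^sup>2" for x
  proof -
    have "(\<lambda>k. (norm (h x))\<^sup>2 * g (?s k) x) \<longlonglongrightarrow> (norm (h x))\<^sup>2 * exp (- 0\<^sup>2 * (norm x)\<^sup>2)"
      unfolding g_def by (intro tendsto_intros inverse_Suc_tendsto(1))
    then show ?thesis by simp
  qed
  have m: "(\<lambda>x. (norm (h x))\<^sup>2) \<in> borel_measurable lborel"
    by (simp, intro borel_measurable_continuous_onI continuous_intros hc)
  show "integrable lborel (\<lambda>x. (norm (h x))\<^sup>2)"
    by (rule integrable_monotone_convergence[OF hi[OF sp] _ _ il m]) (simp_all add: mono ptw del: of_nat_Suc)
  show "(\<integral>x. (norm (h x))\<^sup>2 \<partial>lborel) = (2 * pi) ^ CARD('n) * (\<integral>\<xi>. (norm (G \<xi>))\<^sup>2 \<partial>lborel)"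
    by (rule integral_monotone_convergence[OF hi[OF sp] _ _ il m]) (simp_all add: mono ptw del: of_nat_Suc)
qed

section \<open>Localised symbols\<close>

text \<open>The Fourier transform in x of the localised symbol, with the frequency variable as a
  parameter. At eta - xi it is the kernel of the localised form on the Fourier side.\<close>

definition locfou :: "real^'n::finite \<Rightarrow> 'n symbol \<Rightarrow> real^'n \<Rightarrow> real^'n \<Rightarrow> complex" where
  "locfou y a \<theta> \<xi> = fourier (\<lambda>x. complex_of_real (lam y x) * a (x, \<xi>)) \<theta>"

lemma continuous_on_lam_right: "continuous_on UNIV (lam y)"
  unfolding lam_def by (intro continuous_intros) (auto simp: add_nonneg_eq_0_iff)

lemma lam_mult_integrable:
  assumes c: "continuous_on UNIV f" and b: "\<And>x. norm (f x) \<le> C"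
  shows "integrable lborel (\<lambda>x. complex_of_real (lam y x) * f x)"
proof (rule Bochner_Integration.integrable_bound)
  show "integrable lborel (\<lambda>x. C * lam y x)" by (simp add: lam_integrable)
  show "(\<lambda>x. complex_of_real (lam y x) * f x) \<in> borel_measurable lborel"
    by (simp, intro borel_measurable_continuous_onI continuous_intros continuous_on_lam_right c)
  show "AE x in lborel. norm (complex_of_real (lam y x) * f x) \<le> norm (C * lam y x)"
    using b order_trans[OF norm_ge_zero b] lam_pos[of y]
    by (auto simp: norm_mult abs_mult abs_of_pos mult.commute intro!: mult_right_mono less_imp_le)
qed

lemma continuous_on_slice: "continuous_on UNIV a \<Longrightarrow> continuous_on UNIV (\<lambda>x. a (x, \<xi>))"
  by (erule continuous_on_compose2) (auto intro!: continuous_intros)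

lemma continuous_on_locfou:
  fixes a :: "'n::finite symbol"
  assumes c: "continuous_on UNIV a" and b: "\<And>z. norm (a z) \<le> C"
  shows "continuous_on UNIV (\<lambda>p. locfou y a (fst p) (snd p))"
  unfolding locfou_def fourier_def
proof (rule continuous_integral_dominated[where g="\<lambda>x. C * lam y x"])
  show "(\<lambda>x. cis (- (x \<bullet> fst p)) * (complex_of_real (lam y x) * a (x, snd p))) \<in> borel_measurable lborel" for p
    by (rule borel_measurable_integrable[OF fourier_integrable(1)[OF lam_mult_integrable]])
      (auto intro: continuous_on_slice c b)
  show "continuous_on UNIV (\<lambda>p. cis (- (x \<bullet> fst p)) * (complex_of_real (lam y x) * a (x, snd p)))" for x
    by (intro continuous_intros continuous_on_compose2[OF c]) auto
  show "norm (cis (- (x \<bullet> fst p)) * (complex_of_real (lam y x) * a (x, snd p))) \<le> C * lam y x" for p x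
    using b lam_pos[of y x] by (simp add: norm_mult abs_of_pos mult.commute mult_right_mono)
  show "integrable lborel (\<lambda>x. C * lam y x)" by (simp add: lam_integrable)
qed

lemma locfou_norm_le:
  fixes a :: "'n::finite symbol"
  assumes b: "\<And>z. norm (a z) \<le> C"
  shows "norm (locfou y a \<theta> \<xi>) \<le> C * integral\<^sup>L lborel (lam (0 :: real^'n))"
proof -
  have "norm (locfou y a \<theta> \<xi>) \<le> (\<integral>x. C * lam y x \<partial>lborel)"
    unfolding locfou_def
    by (rule fourier_norm_le)
      (use b lam_integrable lam_pos[of y] in \<open>auto simp: norm_mult abs_of_pos mult.commute intro!: mult_right_mono less_imp_le\<close>)
  then show ?thesis by (simp add: lam_integral_const[of y])
qed

text \<open>The integrand in (x, xi, eta) is dominated by the product C \<open>lam y x\<close> |G1|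
  |G2|, so Fubini permits doing the x-integral first. It collects both exponentials and the weighted
  symbol into \<open>locfou\<close> at eta - xi.\<close>

lemma bilinear_fourier:
  fixes a :: "'n::finite symbol"
  assumes c: "continuous_on UNIV a" and b: "\<And>z. norm (a z) \<le> C"
    and c1: "continuous_on UNIV G1" and i1: "integrable lborel G1"
    and c2: "continuous_on UNIV G2" and i2: "integrable lborel G2"
  shows "(\<integral>x. complex_of_real (lam y x) * (\<integral>\<xi>. cis (x \<bullet> \<xi>) * a (x, \<xi>) * G1 \<xi> \<partial>lborel) * cnj (\<integral>\<eta>. cis (x \<bullet> \<eta>) * G2 \<eta> \<partial>lborel) \<partial>lborel)
       = (\<integral>p. locfou y a (snd p - fst p) (fst p) * G1 (fst p) * cnj (G2 (snd p)) \<partial>lborel)" (is ?eq)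
    and "integrable lborel (\<lambda>p. locfou y a (snd p - fst p) (fst p) * G1 (fst p) * cnj (G2 (snd p)))" (is ?int)
    and "integrable lborel (\<lambda>x. complex_of_real (lam y x) * (\<integral>\<xi>. cis (x \<bullet> \<xi>) * a (x, \<xi>) * G1 \<xi> \<partial>lborel) * cnj (\<integral>\<eta>. cis (x \<bullet> \<eta>) * G2 \<eta> \<partial>lborel))" (is ?int2)
proof -
  let ?P = "\<lambda>q. complex_of_real (lam y (fst q)) * ((cis (fst q \<bullet> fst (snd q)) * a (fst q, fst (snd q)) * G1 (fst (snd q)))
      * cnj (cis (fst q \<bullet> snd (snd q)) * G2 (snd (snd q))))"
  have C: "0 \<le> C" using order_trans[OF norm_ge_zero b] .
  have GG: "integrable lborel (\<lambda>p. norm (G1 (fst p)) * norm (G2 (snd p)))"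
    by (rule lborel_integral_times(1)) (use i1 i2 in auto)
  have P: "integrable lborel ?P"
  proof (rule integrable_lborel_prod_bound[where g="\<lambda>x. C * lam y x" and h="\<lambda>p. norm (G1 (fst p)) * norm (G2 (snd p))"])
    show "?P \<in> borel_measurable borel"
      by (intro borel_measurable_continuous_onI continuous_intros continuous_on_compose2[OF continuous_on_lam_right]
          continuous_on_compose2[OF c] continuous_on_compose2[OF c1] continuous_on_compose2[OF c2]) auto
    show "norm (?P (x, p)) \<le> C * lam y x * (norm (G1 (fst p)) * norm (G2 (snd p)))" for x p
    proof -
      have "norm (?P (x, p)) = norm (a (x, fst p)) * (lam y x * (norm (G1 (fst p)) * norm (G2 (snd p))))"
        using lam_pos[of y x] by (simp add: norm_mult abs_of_pos)
      also have "\<dots> \<le> C * (lam y x * (norm (G1 (fst p)) * norm (G2 (snd p))))"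
        using lam_pos[of y x] by (intro mult_right_mono b) simp
      finally show ?thesis by (simp only: mult.assoc)
    qed
  qed (use lam_integrable GG in auto)
  have i1': "integrable lborel (\<lambda>\<xi>. cis (x \<bullet> \<xi>) * a (x, \<xi>) * G1 \<xi>)" for x
    by (rule psdo_integrable[OF c b i1])
  have i2': "integrable lborel (\<lambda>\<xi>. cis (x \<bullet> \<xi>) * G2 \<xi>)" for x
    by (rule fourier_integrable(2)[OF i2, of x, unfolded inner_commute[of _ x]])
  have e1: "(\<integral>p. ?P (x, p) \<partial>lborel) = complex_of_real (lam y x) * (\<integral>\<xi>. cis (x \<bullet> \<xi>) * a (x, \<xi>) * G1 \<xi> \<partial>lborel) * cnj (\<integral>\<eta>. cis (x \<bullet> \<eta>) * G2 \<eta> \<partial>lborel)" for x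
  proof -
    have "(\<integral>p. (cis (x \<bullet> fst p) * a (x, fst p) * G1 (fst p)) * cnj (cis (x \<bullet> snd p) * G2 (snd p)) \<partial>lborel)
       = (\<integral>\<xi>. cis (x \<bullet> \<xi>) * a (x, \<xi>) * G1 \<xi> \<partial>lborel) * cnj (\<integral>\<eta>. cis (x \<bullet> \<eta>) * G2 \<eta> \<partial>lborel)"
      using lborel_integral_times(2)[OF i1'[of x] integrable_cnj[OF i2'[of x]]]
      by (simp only: Bochner_Integration.integral_cnj)
    moreover have "(\<integral>p. ?P (x, p) \<partial>lborel) = complex_of_real (lam y x) * (\<integral>p. (cis (x \<bullet> fst p) * a (x, fst p) * G1 (fst p)) * cnj (cis (x \<bullet> snd p) * G2 (snd p)) \<partial>lborel)"
      unfolding fst_conv snd_conv by (rule integral_mult_right_zero)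
    ultimately show ?thesis by (simp only: mult.assoc)
  qed
  have e2: "(\<integral>x. ?P (x, p) \<partial>lborel) = locfou y a (snd p - fst p) (fst p) * G1 (fst p) * cnj (G2 (snd p))" for p
  proof -
    have "(\<integral>x. ?P (x, p) \<partial>lborel) = (\<integral>x. (cis (- (x \<bullet> (snd p - fst p))) * (complex_of_real (lam y x) * a (x, fst p))) * (G1 (fst p) * cnj (G2 (snd p))) \<partial>lborel)"
    proof (intro Bochner_Integration.integral_cong refl)
      fix x
      have "cis (- (x \<bullet> (snd p - fst p))) = cis (x \<bullet> fst p) * cnj (cis (x \<bullet> snd p))"
        by (simp add: cis_cnj cis_mult inner_diff_right)
      then show "?P (x, p) = (cis (- (x \<bullet> (snd p - fst p))) * (complex_of_real (lam y x) * a (x, fst p))) * (G1 (fst p) * cnj (G2 (snd p)))"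
        by (simp only: fst_conv snd_conv complex_cnj_mult mult_ac)
    qed
    also have "\<dots> = (\<integral>x. cis (- (x \<bullet> (snd p - fst p))) * (complex_of_real (lam y x) * a (x, fst p)) \<partial>lborel) * (G1 (fst p) * cnj (G2 (snd p)))"
      by (rule integral_mult_left_zero)
    finally show ?thesis unfolding locfou_def fourier_def by (simp only: mult.assoc)
  qed
  show ?eq using lborel_fubini(1,2)[OF P] unfolding e1 e2 by simp
  show ?int using lborel_fubini(4)[OF P] unfolding e2 .
  show ?int2 using lborel_fubini(3)[OF P] unfolding e1 .
qed

lemma lam_fourier_decay:
  "\<exists>K\<ge>0. \<forall>y C b \<theta>. 0 \<le> C \<longrightarrow> wb (\<lambda>_. 0) N C (\<lambda>_ _. 1) b \<longrightarrow>
     norm (fourier (\<lambda>x::real^'n. complex_of_real (lam y x) * b x) \<theta>) \<le> K * C / jbracket \<theta> ^ N"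
proof -
  obtain L where L: "L \<ge> 0" "\<And>y::real^'n. wb (\<lambda>_. 0) N L (\<lambda>_. lam y) (\<lambda>x. complex_of_real (lam y x))"
    using lam_wb[of N] by blast
  let ?I = "integral\<^sup>L lborel (lam (0 :: real^'n))"
  let ?K = "2 ^ N * (1 + real CARD('n) ^ N) * (2 ^ N * L * ?I)"
  have "norm (fourier (\<lambda>x::real^'n. complex_of_real (lam y x) * b x) \<theta>) \<le> ?K * C / jbracket \<theta> ^ N"
    if C: "0 \<le> C" and b: "wb (\<lambda>_. 0) N C (\<lambda>_ _. 1) b" for y C b \<theta>
  proof -
    have "wb (\<lambda>_. 0) N (2 ^ N * (L * C)) (\<lambda>_. lam y) (\<lambda>x. complex_of_real (lam y x) * b x)"
      by (rule wb_mult[OF L(2) b L(1) C]) (simp_all add: less_imp_le[OF lam_pos])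
    from fourier_decay[OF this lam_integrable, of \<theta>] show ?thesis
      by (simp add: lam_integral_const[of y] mult_ac)
  qed
  moreover have "0 \<le> ?I" by (rule integral_nonneg_AE) (simp add: less_imp_le[OF lam_pos])
  ultimately show ?thesis using L(1) by (intro exI[of _ ?K]) auto
qed

lemma slice_has_derivative:
  fixes a :: "'n::finite symbol"
  assumes "a differentiable at (x, \<xi>)"
  shows "((\<lambda>x. a (x, \<xi>)) has_derivative (\<lambda>v. pd (v, 0) a (x, \<xi>))) (at x)"
proof -
  have "((\<lambda>x. (x, \<xi>)) has_derivative (\<lambda>v. (v, 0))) (at x)" by (auto intro!: derivative_eq_intros)
  from has_derivative_compose[OF this has_derivative_pd[OF assms]] show ?thesis .
qed

lemma wb_slice:
  fixes a :: "'n::finite symbol"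
  shows "wb xi_deg m C W a \<Longrightarrow> wb (\<lambda>_. 0) m C (\<lambda>_ x. W 0 (x, \<xi>)) (\<lambda>x. a (x, \<xi>))"
proof (induction m arbitrary: a)
  case 0
  then show ?case by (auto intro: continuous_on_slice)
next
  case (Suc m)
  have "wb (\<lambda>_. 0) m C (\<lambda>_ x. W 0 (x, \<xi>)) (pd v (\<lambda>x. a (x, \<xi>)))" if v: "v \<in> Basis" for v
  proof -
    have "pd v (\<lambda>x. a (x, \<xi>)) = (\<lambda>x. pd (v, 0) a (x, \<xi>))"
      using pd_eq[OF slice_has_derivative[OF wb_differentiable[OF Suc.prems]]] by (simp add: fun_eq_iff)
    moreover have "xi_deg (v, 0::real^'n) = 0" using v nonzero_Basis by (auto simp: xi_deg_def)
    then have "wb xi_deg m C W (pd (v, 0) a)"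
      using wb_pd[OF Suc.prems, of "(v, 0)"] v by (simp add: Basis_prod_def)
    ultimately show ?thesis using Suc.IH by simp
  qed
  moreover have "(\<lambda>x. a (x, \<xi>)) differentiable at x" for x
    using slice_has_derivative[OF wb_differentiable[OF Suc.prems]] unfolding differentiable_def by blast
  ultimately show ?case
    using continuous_on_slice[OF wb_continuous[OF Suc.prems]] wb_bound[OF Suc.prems] by simp
qed

text \<open>An x-derivative of a symbol is a symbol of the same class with the same constant.
  Therefore a bound for a fixed combination of xi-slices, if known for all symbols of the class,
  holds for all x-derivatives of the combination as well. This transfers the finite-difference
  estimates to x-derivatives without repeating their proofs.\<close>

lemma wb_slice_combination:
  fixes a :: "'n::finite symbol"
  assumes B: "\<And>a :: 'n symbol. wb xi_deg M C xi_weight a \<Longrightarrow> \<forall>x. norm (\<Sum>i\<in>I. c i * a (x, \<xi> i)) \<le> B"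
  shows "wb xi_deg (m + M) C xi_weight a \<Longrightarrow> wb (\<lambda>_. 0) m B (\<lambda>_ _. 1) (\<lambda>x. \<Sum>i\<in>I. c i * a (x, \<xi> i))"
proof (induction m arbitrary: a)
  case 0
  then have w: "wb xi_deg M C xi_weight a" by simp
  have "continuous_on UNIV (\<lambda>x. \<Sum>i\<in>I. c i * a (x, \<xi> i))"
    by (intro continuous_on_sum continuous_on_mult_left continuous_on_slice wb_continuous[OF w])
  then show ?case using B[OF w] by simp
next
  case (Suc m)
  have w: "wb xi_deg (Suc (m + M)) C xi_weight a" using Suc.prems by simp
  have d: "((\<lambda>x. \<Sum>i\<in>I. c i * a (x, \<xi> i)) has_derivative (\<lambda>v. \<Sum>i\<in>I. c i * pd (v, 0) a (x, \<xi> i))) (at x)" for x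
    by (intro has_derivative_sum has_derivative_mult_right slice_has_derivative wb_differentiable[OF w])
  have "wb (\<lambda>_. 0) m B (\<lambda>_ _. 1) (pd v (\<lambda>x. \<Sum>i\<in>I. c i * a (x, \<xi> i)))" if v: "v \<in> Basis" for v
  proof -
    have "pd v (\<lambda>x. \<Sum>i\<in>I. c i * a (x, \<xi> i)) = (\<lambda>x. \<Sum>i\<in>I. c i * pd (v, 0) a (x, \<xi> i))"
      using pd_eq[OF d] by (simp add: fun_eq_iff)
    moreover have "xi_deg (v, 0::real^'n) = 0" using v nonzero_Basis by (auto simp: xi_deg_def)
    then have "wb xi_deg (m + M) C xi_weight (pd (v, 0) a)"
      using wb_pd[OF w, of "(v, 0)"] v by (simp add: Basis_prod_def)
    ultimately show ?thesis using Suc.IH by simp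
  qed
  moreover have "(\<lambda>x. \<Sum>i\<in>I. c i * a (x, \<xi> i)) differentiable at x" for x
    using d unfolding differentiable_def by blast
  moreover have "wb xi_deg M C xi_weight a" by (rule wb_mono[OF Suc.prems]) simp_all
  then have "norm (\<Sum>i\<in>I. c i * a (x, \<xi> i)) \<le> B" for x using B by blast
  moreover have "continuous_on UNIV (\<lambda>x. \<Sum>i\<in>I. c i * a (x, \<xi> i))"
    by (intro continuous_intros continuous_on_slice wb_continuous[OF w])
  ultimately show ?case by simp
qed

section \<open>Finite differences of symbols in the frequency variable\<close>

lemma pd_xi_expand:
  fixes a :: "'n::finite symbol"
  assumes "a differentiable at z"
  shows "pd (0, t) a z = (\<Sum>b\<in>Basis. complex_of_real (t \<bullet> b) * pd (0, b) a z)"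
proof -
  have l: "linear (\<lambda>v. pd v a z)" by (rule has_derivative_linear[OF has_derivative_pd[OF assms]])
  have "(0::real^'n, t) = (\<Sum>b\<in>Basis. (t \<bullet> b) *\<^sub>R (0, b))"
    by (simp add: prod_eq_iff fst_sum snd_sum euclidean_representation)
  then have "pd (0, t) a z = pd (\<Sum>b\<in>Basis. (t \<bullet> b) *\<^sub>R (0, b)) a z" by simp
  also have "\<dots> = (\<Sum>b\<in>Basis. complex_of_real (t \<bullet> b) * pd (0, b) a z)"
    unfolding linear_sum[OF l] linear_scale[OF l] by (simp add: scaleR_conv_of_real)
  finally show ?thesis .
qed

lemma sum_inner_Basis_le: "(\<Sum>b\<in>Basis. \<bar>t \<bullet> b\<bar> * B) \<le> real CARD('n) * norm t * B"
  if "0 \<le> B" for t :: "real^'n"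
proof -
  have "(\<Sum>b\<in>Basis. \<bar>t \<bullet> b\<bar> * B) \<le> (\<Sum>b\<in>(Basis :: (real^'n) set). norm t * B)"
    by (intro sum_mono mult_right_mono Basis_le_norm that)
  then show ?thesis by (simp add: mult.assoc)
qed

lemma has_vector_derivative_bound_01:
  fixes f :: "real \<Rightarrow> complex"
  assumes d: "\<And>s. s \<in> {0..1} \<Longrightarrow> (f has_vector_derivative f' s) (at s within {0..1})"
    and b: "\<And>s. s \<in> {0..1} \<Longrightarrow> norm (f' s) \<le> B"
  shows "norm (f 1 - f 0) \<le> B"
proof -
  have "norm (f 1 - f 0) \<le> B * norm (1 - 0 :: real)"
  proof (rule differentiable_bound[of "{0..1}" f "\<lambda>s h. h *\<^sub>R f' s" B 1 0])
    show "onorm (\<lambda>h. h *\<^sub>R f' s) \<le> B" if "s \<in> {0..1}" for s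
      by (rule onorm_le) (simp add: mult.commute[of B] mult_left_mono[OF b[OF that]])
  qed (use d in \<open>auto simp: has_vector_derivative_def\<close>)
  then show ?thesis by simp
qed

lemma symbol_mvt:
  fixes a :: "'n::finite symbol"
  assumes d: "\<And>z. a differentiable at z"
    and b: "\<And>s b. 0 \<le> s \<Longrightarrow> s \<le> 1 \<Longrightarrow> b \<in> Basis \<Longrightarrow> norm (pd (0, b) a (x, \<xi> + s *\<^sub>R u)) \<le> B"
  shows "norm (a (x, \<xi> + u) - a (x, \<xi>)) \<le> real CARD('n) * norm u * B"
proof -
  obtain b0 :: "real^'n" where "b0 \<in> Basis" using nonempty_Basis by blast
  then have B: "0 \<le> B" using b[of 0 b0] order_trans[OF norm_ge_zero] by auto
  have D: "((\<lambda>s. a ((x, \<xi>) + s *\<^sub>R (0, u))) has_vector_derivative pd (0, u) a ((x, \<xi>) + s *\<^sub>R (0, u))) (at s)" for s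
    by (rule has_vector_derivative_pd[OF d])
  have "norm (a ((x, \<xi>) + 1 *\<^sub>R (0, u)) - a ((x, \<xi>) + 0 *\<^sub>R (0, u))) \<le> (real CARD('n) * norm u * B)"
  proof (rule has_vector_derivative_bound_01)
    fix s :: real assume s: "s \<in> {0..1}"
    show "((\<lambda>s. a ((x, \<xi>) + s *\<^sub>R (0, u))) has_vector_derivative pd (0, u) a ((x, \<xi>) + s *\<^sub>R (0, u))) (at s within {0..1})"
      by (rule has_vector_derivative_at_within[OF D])
    have "norm (pd (0, u) a (x, \<xi> + s *\<^sub>R u)) \<le> (\<Sum>b\<in>Basis. \<bar>u \<bullet> b\<bar> * B)"
      unfolding pd_xi_expand[OF d, of u]
      by (rule sum_norm_le) (use s b in \<open>auto simp: norm_mult intro!: mult_left_mono\<close>)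
    also have "\<dots> \<le> real CARD('n) * norm u * B" by (rule sum_inner_Basis_le[OF B])
    finally show "norm (pd (0, u) a ((x, \<xi>) + s *\<^sub>R (0, u))) \<le> real CARD('n) * norm u * B" by simp
  qed
  then show ?thesis by simp
qed

lemma jbracket_segment:
  assumes "norm t \<le> jbracket \<xi> / 2" "\<bar>s\<bar> \<le> 1"
  shows "1 / jbracket (\<xi> + s *\<^sub>R t) \<le> 2 / jbracket \<xi>"
proof -
  have "jbracket \<xi> \<le> jbracket (\<xi> + s *\<^sub>R t) + norm (- (s *\<^sub>R t))"
    using jbracket_add_le[of "\<xi> + s *\<^sub>R t" "- (s *\<^sub>R t)"] by simp
  also have "norm (- (s *\<^sub>R t)) \<le> jbracket \<xi> / 2"
    using mult_right_mono[OF assms(2), of "norm t"] assms(1) by simp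
  finally have "jbracket \<xi> / 2 \<le> jbracket (\<xi> + s *\<^sub>R t)" by simp
  then show ?thesis using jbracket_pos[of \<xi>] jbracket_pos[of "\<xi> + s *\<^sub>R t"] by (simp add: field_simps)
qed

lemma card_ge_1: "1 \<le> real CARD('n::finite)"
  using zero_less_card_finite[where 'a='n] by linarith

text \<open>Two regimes. For |t| at most <xi> / 2 the bracket is comparable to <xi> along the whole
  segment and the mean value inequality applies; for larger t the quotient |t| / <xi> exceeds 1/2
  and the trivial bound 2 C suffices.\<close>

lemma first_difference:
  fixes a :: "'n::finite symbol"
  assumes a: "wb xi_deg (Suc 0) C xi_weight a" and C: "0 \<le> C"
  shows "norm (a (x, \<xi> + t) - a (x, \<xi>)) \<le> 4 * real CARD('n) * C * (norm t / jbracket \<xi>)"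
proof (cases "norm t \<le> jbracket \<xi> / 2")
  case True
  have "norm (a (x, \<xi> + t) - a (x, \<xi>)) \<le> real CARD('n) * norm t * (C * (2 / jbracket \<xi>))"
  proof (rule symbol_mvt)
    fix s :: real and b :: "real^'n" assume "0 \<le> s" "s \<le> 1" "b \<in> Basis"
    then have "norm (pd (0, b) a (x, \<xi> + s *\<^sub>R t)) \<le> C * (1 / jbracket (\<xi> + s *\<^sub>R t))"
      using wb_bound[OF wb_pd[OF a, of "(0, b)"], of "(x, \<xi> + s *\<^sub>R t)"] by (simp add: Basis_prod_def xi_deg_def)
    also have "\<dots> \<le> C * (2 / jbracket \<xi>)"
      using jbracket_segment[OF True, of s] \<open>0 \<le> s\<close> \<open>s \<le> 1\<close> by (intro mult_left_mono C) simp
    finally show "norm (pd (0, b) a (x, \<xi> + s *\<^sub>R t)) \<le> C * (2 / jbracket \<xi>)" .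
  qed (rule wb_differentiable[OF a])
  also have "\<dots> = 2 * real CARD('n) * C * (norm t / jbracket \<xi>)" by simp
  also have "\<dots> \<le> 4 * real CARD('n) * C * (norm t / jbracket \<xi>)"
    using C jbracket_pos[of \<xi>] by (intro mult_right_mono) auto
  finally show ?thesis .
next
  case False
  have b: "norm (a z) \<le> C" for z using wb_xi_weight_bounded[OF a] .
  have "norm (a (x, \<xi> + t) - a (x, \<xi>)) \<le> C + C" by (rule order_trans[OF norm_triangle_ineq4 add_mono[OF b b]])
  also have "\<dots> = 4 * C * (1 / 2)" by simp
  also have "\<dots> \<le> 4 * C * (norm t / jbracket \<xi>)"
    using False jbracket_pos[of \<xi>] C by (intro mult_left_mono) (auto simp: field_simps)
  also have "\<dots> = 1 * (4 * C * (norm t / jbracket \<xi>))" by simp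
  also have "\<dots> \<le> real CARD('n) * (4 * C * (norm t / jbracket \<xi>))"
    using C jbracket_pos[of \<xi>] card_ge_1[where 'n='n] by (intro mult_right_mono) auto
  finally show ?thesis by (simp add: mult_ac)
qed

text \<open>The same two regimes as for the first difference; for large t the trivial bound is 4 C =
  16 C (1/2)^2.\<close>

lemma second_difference:
  fixes a :: "'n::finite symbol"
  assumes a: "wb xi_deg (Suc (Suc 0)) C xi_weight a" and C: "0 \<le> C"
  shows "norm (a (x, \<xi> + t) + a (x, \<xi> - t) - 2 * a (x, \<xi>)) \<le> 16 * (real CARD('n))\<^sup>2 * C * (norm t / jbracket \<xi>)\<^sup>2"
proof (cases "norm t \<le> jbracket \<xi> / 2")
  case True
  let ?n = "real CARD('n)"
  have a1: "wb xi_deg (Suc 0) C (\<lambda>k. xi_weight (Suc k)) (pd (0, b) a)" if "b \<in> Basis" for b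
    using wb_pd[OF a, of "(0, b)"] that by (simp add: Basis_prod_def xi_deg_def)
  have dd: "norm (pd (0, b) a (x, \<xi> + s *\<^sub>R t) - pd (0, b) a (x, \<xi> - s *\<^sub>R t)) \<le> ?n * (2 * norm t) * (C * (2 / jbracket \<xi>)\<^sup>2)"
    if s: "0 \<le> s" "s \<le> 1" and b: "b \<in> Basis" for s b
  proof -
    have main: "norm (pd (0, b) a (x, (\<xi> - s *\<^sub>R t) + (2 * s) *\<^sub>R t) - pd (0, b) a (x, \<xi> - s *\<^sub>R t))
        \<le> ?n * norm ((2 * s) *\<^sub>R t) * (C * (2 / jbracket \<xi>)\<^sup>2)"
    proof (rule symbol_mvt)
      fix r :: real and b' :: "real^'n" assume r: "0 \<le> r" "r \<le> 1" and b': "b' \<in> Basis"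
      have eq: "\<xi> - s *\<^sub>R t + r *\<^sub>R (2 * s) *\<^sub>R t = \<xi> + (s * (2 * r - 1)) *\<^sub>R t"
        by (simp add: algebra_simps)
      have "\<bar>s * (2 * r - 1)\<bar> \<le> 1 * 1" unfolding abs_mult using s r by (intro mult_mono) auto
      then have w: "1 / jbracket (\<xi> + (s * (2 * r - 1)) *\<^sub>R t) \<le> 2 / jbracket \<xi>"
        using jbracket_segment[OF True] by simp
      have "norm (pd (0, b') (pd (0, b) a) (x, \<xi> + (s * (2 * r - 1)) *\<^sub>R t)) \<le> C * (1 / jbracket (\<xi> + (s * (2 * r - 1)) *\<^sub>R t))\<^sup>2"
        using wb_bound[OF wb_pd[OF a1[OF b], of "(0, b')"], of "(x, \<xi> + (s * (2 * r - 1)) *\<^sub>R t)"] b'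
        by (simp add: Basis_prod_def xi_deg_def power_divide power2_eq_square)
      also have "\<dots> \<le> C * (2 / jbracket \<xi>)\<^sup>2"
        using w jbracket_pos by (intro mult_left_mono power_mono C) (auto simp: less_imp_le[OF jbracket_pos])
      finally show "norm (pd (0, b') (pd (0, b) a) (x, \<xi> - s *\<^sub>R t + r *\<^sub>R (2 * s) *\<^sub>R t)) \<le> C * (2 / jbracket \<xi>)\<^sup>2"
        unfolding eq .
    qed (rule wb_differentiable[OF a1[OF b]])
    have "(2 * s) *\<^sub>R t = s *\<^sub>R t + s *\<^sub>R t" by (simp add: scaleR_left_distrib[symmetric])
    then have eq: "(\<xi> - s *\<^sub>R t) + (2 * s) *\<^sub>R t = \<xi> + s *\<^sub>R t" by simp
    have le: "?n * norm ((2 * s) *\<^sub>R t) * (C * (2 / jbracket \<xi>)\<^sup>2) \<le> ?n * (2 * norm t) * (C * (2 / jbracket \<xi>)\<^sup>2)"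
      using s C mult_right_mono[of s 1 "norm t"] by (intro mult_right_mono mult_left_mono) auto
    show ?thesis using order_trans[OF main[unfolded eq] le] .
  qed
  let ?B = "?n * norm t * (?n * (2 * norm t) * (C * (2 / jbracket \<xi>)\<^sup>2))"
  \<comment> \<open>Symmetrising makes the derivative in s a difference of first derivatives at the
    points xi + s t and xi - s t. The mean value inequality in \<open>dd\<close> applies to it once
    more and supplies the second factor |t| / <xi>.\<close>
  let ?f = "\<lambda>s. a ((x, \<xi>) + s *\<^sub>R (0, t)) + a ((x, \<xi>) + s *\<^sub>R (0, - t))"
  let ?f' = "\<lambda>s. pd (0, t) a ((x, \<xi>) + s *\<^sub>R (0, t)) + pd (0, - t) a ((x, \<xi>) + s *\<^sub>R (0, - t))"
  have main: "norm (?f 1 - ?f 0) \<le> ?B"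
  proof (rule has_vector_derivative_bound_01)
    fix s :: real assume s: "s \<in> {0..1}"
    show "(?f has_vector_derivative ?f' s) (at s within {0..1})"
      by (intro has_vector_derivative_at_within[OF has_vector_derivative_add] has_vector_derivative_pd wb_differentiable[OF a])
    have "?f' s = (\<Sum>b\<in>Basis. complex_of_real (t \<bullet> b) * (pd (0, b) a (x, \<xi> + s *\<^sub>R t) - pd (0, b) a (x, \<xi> - s *\<^sub>R t)))"
      by (simp add: pd_xi_expand[OF wb_differentiable[OF a], of t] pd_xi_expand[OF wb_differentiable[OF a], of "- t"]
          right_diff_distrib sum_subtractf sum_negf)
    also have "norm \<dots> \<le> (\<Sum>b\<in>Basis. \<bar>t \<bullet> b\<bar> * (?n * (2 * norm t) * (C * (2 / jbracket \<xi>)\<^sup>2)))"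
      by (rule sum_norm_le) (use s dd in \<open>auto simp: norm_mult intro!: mult_left_mono\<close>)
    also have "\<dots> \<le> ?B" by (rule sum_inner_Basis_le) (use C in auto)
    finally show "norm (?f' s) \<le> ?B" .
  qed
  have "?B = 8 * ?n\<^sup>2 * C * (norm t / jbracket \<xi>)\<^sup>2"
    by (simp add: power2_eq_square)
  also have "\<dots> \<le> 16 * ?n\<^sup>2 * C * (norm t / jbracket \<xi>)\<^sup>2"
    using C by (intro mult_right_mono) auto
  finally have "norm (?f 1 - ?f 0) \<le> 16 * ?n\<^sup>2 * C * (norm t / jbracket \<xi>)\<^sup>2"
    by (rule order_trans[OF main])
  moreover have "?f 1 - ?f 0 = a (x, \<xi> + t) + a (x, \<xi> - t) - 2 * a (x, \<xi>)" by simp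
  ultimately show ?thesis by (simp only:)
next
  case False
  have b: "norm (a z) \<le> C" for z using wb_xi_weight_bounded[OF a] .
  have "norm (a (x, \<xi> + t) + a (x, \<xi> - t) - 2 * a (x, \<xi>)) \<le> (C + C) + 2 * C"
    by (rule order_trans[OF norm_triangle_ineq4 add_mono[OF order_trans[OF norm_triangle_ineq add_mono[OF b b]]]])
      (use b in \<open>simp add: norm_mult\<close>)
  also have "\<dots> = 16 * 1\<^sup>2 * C * (1 / 2)\<^sup>2" by (simp add: power2_eq_square)
  also have "\<dots> \<le> 16 * (real CARD('n))\<^sup>2 * C * (norm t / jbracket \<xi>)\<^sup>2"
    using False jbracket_pos[of \<xi>] C card_ge_1[where 'n='n]
    by (intro mult_mono power_mono mult_nonneg_nonneg) (auto simp: field_simps)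
  finally show ?thesis .
qed

text \<open>N derivatives in x give the decay in \<open>\<theta>\<close>, two in xi give the
  differences. Since \<open>locfou\<close> is linear in the symbol, its differences in xi are
  transforms of differences of slices.\<close>

lemma locfou_bounds:
  "\<exists>K\<ge>0. \<forall>y C (a :: 'n::finite symbol) \<theta> \<xi> t. 0 \<le> C \<longrightarrow> wb xi_deg (N + 2) C xi_weight a \<longrightarrow>
     norm (locfou y a \<theta> \<xi>) \<le> K * C / jbracket \<theta> ^ N \<and>
     norm (locfou y a \<theta> (\<xi> + t) - locfou y a \<theta> \<xi>) \<le> K * C / jbracket \<theta> ^ N * (norm t / jbracket \<xi>) \<and>
     norm (locfou y a \<theta> (\<xi> + t) + locfou y a \<theta> (\<xi> - t) - 2 * locfou y a \<theta> \<xi>) \<le> K * C / jbracket \<theta> ^ N * (norm t / jbracket \<xi>)\<^sup>2"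
proof -
  obtain L where L: "L \<ge> 0" and F: "\<And>y C b \<theta>. 0 \<le> C \<Longrightarrow> wb (\<lambda>_. 0) N C (\<lambda>_ _. 1) b \<Longrightarrow>
     norm (fourier (\<lambda>x::real^'n. complex_of_real (lam y x) * b x) \<theta>) \<le> L * C / jbracket \<theta> ^ N"
    using lam_fourier_decay[of N, where 'n='n] by blast
  define n where "n = real CARD('n)"
  have n: "1 \<le> n" unfolding n_def by (rule card_ge_1)
  define K where "K = 16 * n\<^sup>2 * L"
  have n1: "1 \<le> n\<^sup>2" using n by (rule one_le_power)
  have n2: "n \<le> n\<^sup>2" using mult_left_mono[OF n, of n] n by (simp add: power2_eq_square)
  have K: "L \<le> K" "4 * n * L \<le> K" unfolding K_def
    using mult_right_mono[of 1 "16 * n\<^sup>2" L] mult_right_mono[of "4 * n" "16 * n\<^sup>2" L] n1 n2 L by auto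
  have "norm (locfou y a \<theta> \<xi>) \<le> K * C / jbracket \<theta> ^ N \<and>
     norm (locfou y a \<theta> (\<xi> + t) - locfou y a \<theta> \<xi>) \<le> K * C / jbracket \<theta> ^ N * (norm t / jbracket \<xi>) \<and>
     norm (locfou y a \<theta> (\<xi> + t) + locfou y a \<theta> (\<xi> - t) - 2 * locfou y a \<theta> \<xi>) \<le> K * C / jbracket \<theta> ^ N * (norm t / jbracket \<xi>)\<^sup>2"
    if C: "0 \<le> C" and a: "wb xi_deg (N + 2) C xi_weight a" for y C and a :: "'n symbol" and \<theta> \<xi> t
  proof -
    have jN: "0 < jbracket \<theta> ^ N" by (rule zero_less_power[OF jbracket_pos])
    have q: "0 \<le> norm t / jbracket \<xi>" using jbracket_pos[of \<xi>] by simp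
    have i: "integrable lborel (\<lambda>x. cis (- (x \<bullet> \<theta>)) * (complex_of_real (lam y x) * a (x, \<zeta>)))" for \<zeta>
      by (rule fourier_integrable(1)[OF lam_mult_integrable[OF continuous_on_slice[OF wb_continuous[OF a]] wb_xi_weight_bounded[OF a]]])
    have "wb (\<lambda>_. 0) (N + 2) C (\<lambda>_ _. 1) (\<lambda>x. a (x, \<xi>))" using wb_slice[OF a, of \<xi>] by simp
    then have "wb (\<lambda>_. 0) N C (\<lambda>_ _. 1) (\<lambda>x. a (x, \<xi>))" by (rule wb_mono) simp_all
    from F[OF C this] have "norm (locfou y a \<theta> \<xi>) \<le> L * C / jbracket \<theta> ^ N" unfolding locfou_def .
    also have "\<dots> \<le> K * C / jbracket \<theta> ^ N" using K C jN by (intro divide_right_mono mult_right_mono) auto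
    finally have 1: "norm (locfou y a \<theta> \<xi>) \<le> K * C / jbracket \<theta> ^ N" .
    \<comment> \<open>The difference is written as a combination of two slices to fit
      \<open>wb_slice_combination\<close>.\<close>
    have "wb (\<lambda>_. 0) N (4 * n * C * (norm t / jbracket \<xi>)) (\<lambda>_ _. 1)
        (\<lambda>x. \<Sum>i\<in>{0, 1::nat}. (if i = 0 then 1 else - 1) * a (x, if i = 0 then \<xi> + t else \<xi>))"
    proof (rule wb_slice_combination)
      show "wb xi_deg (N + Suc 0) C xi_weight a" by (rule wb_mono[OF a]) simp_all
      show "\<forall>x. norm (\<Sum>i\<in>{0, 1::nat}. (if i = 0 then 1 else - 1) * a (x, if i = 0 then \<xi> + t else \<xi>))
          \<le> 4 * n * C * (norm t / jbracket \<xi>)" if "wb xi_deg (Suc 0) C xi_weight a" for a :: "'n symbol"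
        using first_difference[OF that C, of _ \<xi> t] by (simp add: n_def del: wb.simps)
    qed
    then have "wb (\<lambda>_. 0) N (4 * n * C * (norm t / jbracket \<xi>)) (\<lambda>_ _. 1) (\<lambda>x. a (x, \<xi> + t) - a (x, \<xi>))" by simp
    moreover have "0 \<le> 4 * n * C * (norm t / jbracket \<xi>)" by (intro mult_nonneg_nonneg q C) (use n in auto)
    ultimately have "norm (fourier (\<lambda>x. complex_of_real (lam y x) * (a (x, \<xi> + t) - a (x, \<xi>))) \<theta>)
       \<le> L * (4 * n * C * (norm t / jbracket \<xi>)) / jbracket \<theta> ^ N" by (intro F)
    also have "\<dots> = (4 * n * L) * (C / jbracket \<theta> ^ N * (norm t / jbracket \<xi>))" by (simp add: mult_ac)
    also have "\<dots> \<le> K * (C / jbracket \<theta> ^ N * (norm t / jbracket \<xi>))"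
      by (intro mult_right_mono K mult_nonneg_nonneg divide_nonneg_nonneg)
        (use C jN jbracket_pos[of \<xi>] in auto)
    also have "fourier (\<lambda>x. complex_of_real (lam y x) * (a (x, \<xi> + t) - a (x, \<xi>))) \<theta> = locfou y a \<theta> (\<xi> + t) - locfou y a \<theta> \<xi>"
      unfolding locfou_def fourier_def using i by (simp add: right_diff_distrib)
    finally have 2: "norm (locfou y a \<theta> (\<xi> + t) - locfou y a \<theta> \<xi>) \<le> K * C / jbracket \<theta> ^ N * (norm t / jbracket \<xi>)" by simp
    have "wb (\<lambda>_. 0) N (16 * n\<^sup>2 * C * (norm t / jbracket \<xi>)\<^sup>2) (\<lambda>_ _. 1)
        (\<lambda>x. \<Sum>i\<in>{0, 1, 2::nat}. (if i = 2 then - 2 else 1) * a (x, if i = 0 then \<xi> + t else if i = 1 then \<xi> - t else \<xi>))"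
    proof (rule wb_slice_combination)
      show "wb xi_deg (N + Suc (Suc 0)) C xi_weight a" using a by simp
      show "\<forall>x. norm (\<Sum>i\<in>{0, 1, 2::nat}. (if i = 2 then - 2 else 1) * a (x, if i = 0 then \<xi> + t else if i = 1 then \<xi> - t else \<xi>))
          \<le> 16 * n\<^sup>2 * C * (norm t / jbracket \<xi>)\<^sup>2" if "wb xi_deg (Suc (Suc 0)) C xi_weight a" for a :: "'n symbol"
        using second_difference[OF that C, of _ \<xi> t] by (simp add: n_def add_diff_eq[symmetric] del: wb.simps)
    qed
    then have "wb (\<lambda>_. 0) N (16 * n\<^sup>2 * C * (norm t / jbracket \<xi>)\<^sup>2) (\<lambda>_ _. 1) (\<lambda>x. a (x, \<xi> + t) + a (x, \<xi> - t) - 2 * a (x, \<xi>))"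
      by (simp add: algebra_simps)
    moreover have "0 \<le> 16 * n\<^sup>2 * C * (norm t / jbracket \<xi>)\<^sup>2" by (intro mult_nonneg_nonneg C) auto
    ultimately have "norm (fourier (\<lambda>x. complex_of_real (lam y x) * (a (x, \<xi> + t) + a (x, \<xi> - t) - 2 * a (x, \<xi>))) \<theta>)
       \<le> L * (16 * n\<^sup>2 * C * (norm t / jbracket \<xi>)\<^sup>2) / jbracket \<theta> ^ N" by (intro F)
    also have "\<dots> = K * C / jbracket \<theta> ^ N * (norm t / jbracket \<xi>)\<^sup>2" by (simp add: K_def)
    also have "fourier (\<lambda>x. complex_of_real (lam y x) * (a (x, \<xi> + t) + a (x, \<xi> - t) - 2 * a (x, \<xi>))) \<theta>
        = (\<integral>x. cis (- (x \<bullet> \<theta>)) * (complex_of_real (lam y x) * a (x, \<xi> + t)) + cis (- (x \<bullet> \<theta>)) * (complex_of_real (lam y x) * a (x, \<xi> - t))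
            - 2 * (cis (- (x \<bullet> \<theta>)) * (complex_of_real (lam y x) * a (x, \<xi>))) \<partial>lborel)"
      unfolding fourier_def by (intro Bochner_Integration.integral_cong refl) (simp add: algebra_simps)
    also have "\<dots> = locfou y a \<theta> (\<xi> + t) + locfou y a \<theta> (\<xi> - t) - 2 * locfou y a \<theta> \<xi>"
      unfolding locfou_def fourier_def using i by simp
    finally show ?thesis using 1 2 by blast
  qed
  moreover have "0 \<le> K" using L K(1) by linarith
  ultimately show ?thesis by blast
qed

lemma locfou_lower_order:
  "\<exists>K\<ge>0. \<forall>y C (a :: 'n::finite symbol) \<theta> \<xi>. 0 \<le> C \<longrightarrow> wb xi_deg N C (\<lambda>k. xi_weight (Suc k)) a \<longrightarrow>
     norm (locfou y a \<theta> \<xi>) \<le> K * C / jbracket \<theta> ^ N * (1 / jbracket \<xi>)"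
proof -
  obtain L where L: "L \<ge> 0" and F: "\<And>y C b \<theta>. 0 \<le> C \<Longrightarrow> wb (\<lambda>_. 0) N C (\<lambda>_ _. 1) b \<Longrightarrow>
     norm (fourier (\<lambda>x::real^'n. complex_of_real (lam y x) * b x) \<theta>) \<le> L * C / jbracket \<theta> ^ N"
    using lam_fourier_decay[of N, where 'n='n] by blast
  have "norm (locfou y a \<theta> \<xi>) \<le> L * C / jbracket \<theta> ^ N * (1 / jbracket \<xi>)"
    if C: "0 \<le> C" and a: "wb xi_deg N C (\<lambda>k. xi_weight (Suc k)) a" for y C and a :: "'n symbol" and \<theta> \<xi>
  proof -
    have "wb (\<lambda>_. 0) N (C / jbracket \<xi>) (\<lambda>_ _. 1) (\<lambda>x. a (x, \<xi>))"
      by (rule wb_mono[OF wb_slice[OF a, of \<xi>]]) simp_all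
    from F[OF _ this, of y \<theta>] show ?thesis
      unfolding locfou_def using C jbracket_pos[of \<xi>] by (simp add: mult.commute)
  qed
  then show ?thesis using L by blast
qed

section \<open>Gaussian frequency windows\<close>

lemma gauss_integral_shift:
  fixes m :: "real^'n"
  assumes "\<alpha> > 0"
  shows "integrable lborel (\<lambda>x. exp (- \<alpha> * (norm (x - m))\<^sup>2))"
    and "(\<integral>x. exp (- \<alpha> * (norm (x - m))\<^sup>2) \<partial>lborel) = sqrt (pi / \<alpha>) ^ CARD('n)"
  using lborel_integral_shift(2,5)[of "\<lambda>x::real^'n. exp (- \<alpha> * (norm x)\<^sup>2)" m] gauss_fourier(1,3)[OF assms, where 'a="real^'n"]
  by simp_all

text \<open>The square of \<open>fr \<xi>\<close> is the density in \<open>\<zeta>\<close> of the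
  normal distribution with mean \<open>\<xi>\<close> and variance <xi> in each coordinate. The
  square root in the normalisation makes the window a unit vector of L^2 in
  \<open>\<zeta>\<close>.\<close>

definition fr :: "real^'n \<Rightarrow> real^'n \<Rightarrow> real" where
  "fr \<xi> \<zeta> = exp (- (norm (\<zeta> - \<xi>))\<^sup>2 / (4 * jbracket \<xi>)) / sqrt (sqrt (2 * pi * jbracket \<xi>) ^ CARD('n))"

lemma fr_pos: "0 < fr \<xi> \<zeta>"
  unfolding fr_def using jbracket_pos[of \<xi>] by simp

lemma continuous_on_fr: "continuous_on UNIV (\<lambda>p. fr (fst p) (snd p))"
  unfolding fr_def using jbracket_pos
  by (intro continuous_intros) (auto simp: less_imp_neq[symmetric])

lemma continuous_on_fr_left: "continuous_on UNIV (\<lambda>\<xi>. fr \<xi> \<zeta>)"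
proof -
  have "continuous_on UNIV (\<lambda>\<xi>. (\<xi>, \<zeta>))" by (intro continuous_intros)
  from continuous_on_compose2[OF continuous_on_fr this] show ?thesis by simp
qed

lemma continuous_on_fr_right: "continuous_on UNIV (fr \<xi>)"
proof -
  have "continuous_on UNIV (\<lambda>\<zeta>. (\<xi>, \<zeta>))" by (intro continuous_intros)
  from continuous_on_compose2[OF continuous_on_fr this] show ?thesis by simp
qed

lemma fr_le_1: "fr \<xi> \<zeta> \<le> 1"
proof -
  have "1 * 1 \<le> (2 * pi) * jbracket \<xi>"
    using pi_ge_two by (intro mult_mono jbracket_ge_1) auto
  then have s: "1 \<le> sqrt (sqrt (2 * pi * jbracket \<xi>) ^ CARD('a))"
    by (simp add: one_le_power)
  have "exp (- (norm (\<zeta> - \<xi>))\<^sup>2 / (4 * jbracket \<xi>)) \<le> 1" using jbracket_pos[of \<xi>] by simp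
  from frac_le[OF zero_le_one this zero_less_one s] show ?thesis unfolding fr_def by (simp only: div_by_1)
qed

lemma fr_sq: "(fr \<xi> \<zeta>)\<^sup>2 = exp (- (1 / (2 * jbracket \<xi>)) * (norm (\<zeta> - \<xi>))\<^sup>2) / sqrt (2 * pi * jbracket \<xi>) ^ CARD('n)" for \<xi> :: "real^'n"
proof -
  have "(exp (- (norm (\<zeta> - \<xi>))\<^sup>2 / (4 * jbracket \<xi>)))\<^sup>2 = exp (- (1 / (2 * jbracket \<xi>)) * (norm (\<zeta> - \<xi>))\<^sup>2)"
    by (simp add: exp_double[symmetric] field_simps)
  then show ?thesis unfolding fr_def power_divide using jbracket_pos[of \<xi>] by simp
qed

lemma fr_sq_integral: "integrable lborel (\<lambda>\<zeta>. (fr \<xi> \<zeta>)\<^sup>2)" "(\<integral>\<zeta>. (fr \<xi> \<zeta>)\<^sup>2 \<partial>lborel) = 1"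
proof -
  have s: "1 / (2 * jbracket \<xi>) > 0" using jbracket_pos[of \<xi>] by simp
  show "integrable lborel (\<lambda>\<zeta>. (fr \<xi> \<zeta>)\<^sup>2)"
    unfolding fr_sq using gauss_integral_shift(1)[OF s, of \<xi>] by simp
  have e: "pi / (1 / (2 * jbracket \<xi>)) = 2 * pi * jbracket \<xi>" by simp
  show "(\<integral>\<zeta>. (fr \<xi> \<zeta>)\<^sup>2 \<partial>lborel) = 1"
    unfolding fr_sq integral_divide_zero gauss_integral_shift(2)[OF s, of \<xi>] e
    using jbracket_pos[of \<xi>] by simp
qed

lemma fr_mult_le: "fr \<xi> \<zeta> * fr \<eta> \<zeta> \<le> ((fr \<xi> \<zeta>)\<^sup>2 + (fr \<eta> \<zeta>)\<^sup>2) / 2"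
  using sum_squares_bound[of "fr \<xi> \<zeta>" "fr \<eta> \<zeta>"] by simp

lemma fr_mult_integrable: "integrable lborel (\<lambda>\<zeta>. fr \<xi> \<zeta> * fr \<eta> \<zeta>)"
proof (rule Bochner_Integration.integrable_bound)
  show "integrable lborel (\<lambda>\<zeta>. ((fr \<xi> \<zeta>)\<^sup>2 + (fr \<eta> \<zeta>)\<^sup>2) / 2)" by (simp add: fr_sq_integral(1))
  show "(\<lambda>\<zeta>. fr \<xi> \<zeta> * fr \<eta> \<zeta>) \<in> borel_measurable lborel"
    by (simp, intro borel_measurable_continuous_onI continuous_intros continuous_on_fr_right)
  show "AE \<zeta> in lborel. norm (fr \<xi> \<zeta> * fr \<eta> \<zeta>) \<le> norm (((fr \<xi> \<zeta>)\<^sup>2 + (fr \<eta> \<zeta>)\<^sup>2) / 2)"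
    by (intro AE_I2) (simp only: real_norm_def abs_mult abs_of_pos[OF fr_pos], rule order_trans[OF fr_mult_le abs_ge_self])
qed

text \<open>The Hellinger affinity of the two normal densities: 2 (1 -
  \<open>overlap \<xi> \<eta>\<close>) is the squared L^2 distance of the windows.\<close>

definition overlap :: "real^'n \<Rightarrow> real^'n \<Rightarrow> real" where
  "overlap \<xi> \<eta> = (\<integral>\<zeta>. fr \<xi> \<zeta> * fr \<eta> \<zeta> \<partial>lborel)"

lemma overlap_le_1: "overlap \<xi> \<eta> \<le> 1"
proof -
  have "overlap \<xi> \<eta> \<le> (\<integral>\<zeta>. ((fr \<xi> \<zeta>)\<^sup>2 + (fr \<eta> \<zeta>)\<^sup>2) / 2 \<partial>lborel)"
    unfolding overlap_def
    by (rule integral_mono) (simp_all add: fr_mult_integrable fr_sq_integral(1) fr_mult_le del: le_divide_eq_numeral1)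
  then show ?thesis using fr_sq_integral[of \<xi>] fr_sq_integral[of \<eta>] by simp
qed

text \<open>Completing the square for a product of two Gaussians. With A = zeta - xi and B = zeta -
  eta, the last term no longer depends on zeta, since A - B = eta - xi.\<close>

lemma gauss_product_exponent:
  fixes A B :: "'a::real_inner"
  assumes "s > 0" "t > 0"
  shows "(norm A)\<^sup>2 / (4 * s) + (norm B)\<^sup>2 / (4 * t)
       = (s + t) / (4 * s * t) * (norm ((1 / (s + t)) *\<^sub>R (t *\<^sub>R A + s *\<^sub>R B)))\<^sup>2 + (norm (A - B))\<^sup>2 / (4 * (s + t))"
proof -
  define a where "a = A \<bullet> A" define b where "b = B \<bullet> B" define c where "c = A \<bullet> B"
  have n: "(norm (t *\<^sub>R A + s *\<^sub>R B))\<^sup>2 = t\<^sup>2 * a + 2 * s * t * c + s\<^sup>2 * b"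
    unfolding power2_norm_eq_inner a_def b_def c_def
    by (simp add: inner_add_left inner_add_right inner_commute power2_eq_square algebra_simps)
  have d: "(norm (A - B))\<^sup>2 = a + b - 2 * c"
    unfolding power2_norm_eq_inner a_def b_def c_def
    by (simp add: inner_diff_left inner_diff_right inner_commute)
  have nn: "(norm ((1 / (s + t)) *\<^sub>R (t *\<^sub>R A + s *\<^sub>R B)))\<^sup>2 = (t\<^sup>2 * a + 2 * s * t * c + s\<^sup>2 * b) / (s + t)\<^sup>2"
    unfolding norm_scaleR power_mult_distrib n by (simp add: power_divide)
  have st: "s + t > 0" using assms by simp
  have "(s + t) / (4 * s * t) * ((t\<^sup>2 * a + 2 * s * t * c + s\<^sup>2 * b) / (s + t)\<^sup>2) = (t\<^sup>2 * a + 2 * s * t * c + s\<^sup>2 * b) / (4 * s * t * (s + t))"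
    using st assms by (simp add: power2_eq_square)
  moreover have "(a + b - 2 * c) / (4 * (s + t)) = (s * t * (a + b - 2 * c)) / (4 * s * t * (s + t))"
    using assms by simp
  moreover have "(t\<^sup>2 * a + 2 * s * t * c + s\<^sup>2 * b) + s * t * (a + b - 2 * c) = (s + t) * (t * a + s * b)"
    by (simp add: power2_eq_square algebra_simps)
  moreover have "(s + t) * (t * a + s * b) / (4 * s * t * (s + t)) = a / (4 * s) + b / (4 * t)"
  proof -
    have "(s + t) * (t * a + s * b) / (4 * s * t * (s + t)) = (t * a + s * b) / (4 * s * t)" using st by simp
    also have "\<dots> = a / (4 * s) + b / (4 * t)" using assms by (simp add: add_divide_distrib)
    finally show ?thesis .
  qed
  ultimately have "a / (4 * s) + b / (4 * t) = (s + t) / (4 * s * t) * ((t\<^sup>2 * a + 2 * s * t * c + s\<^sup>2 * b) / (s + t)\<^sup>2) + (a + b - 2 * c) / (4 * (s + t))"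
    by (simp only: add_divide_distrib[symmetric])
  then show ?thesis unfolding nn d by (simp only: a_def b_def power2_norm_eq_inner)
qed

text \<open>The exponential accounts for the distance of the centres; the prefactor, a power of the
  quotient of geometric and arithmetic mean of the two brackets, accounts for the different
  widths.\<close>

lemma overlap_eq:
  fixes \<xi> \<eta> :: "real^'n"
  defines "s \<equiv> jbracket \<xi>" and "t \<equiv> jbracket \<eta>"
  shows "overlap \<xi> \<eta> = sqrt (2 * sqrt (s * t) / (s + t)) ^ CARD('n) * exp (- (norm (\<xi> - \<eta>))\<^sup>2 / (4 * (s + t)))"
proof -
  have s: "s > 0" and t: "t > 0" unfolding s_def t_def by (rule jbracket_pos)+
  define \<alpha> where "\<alpha> = (s + t) / (4 * s * t)"
  define m where "m = (1 / (s + t)) *\<^sub>R (t *\<^sub>R \<xi> + s *\<^sub>R \<eta>)"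
  define E where "E = exp (- (norm (\<xi> - \<eta>))\<^sup>2 / (4 * (s + t)))"
  define N where "N = sqrt (sqrt (2 * pi * s) ^ CARD('n)) * sqrt (sqrt (2 * pi * t) ^ CARD('n))"
  have \<alpha>: "\<alpha> > 0" using s t unfolding \<alpha>_def by simp
  have "fr \<xi> \<zeta> * fr \<eta> \<zeta> = E / N * exp (- \<alpha> * (norm (\<zeta> - m))\<^sup>2)" for \<zeta>
  proof -
    have eq: "t *\<^sub>R (\<zeta> - \<xi>) + s *\<^sub>R (\<zeta> - \<eta>) = (s + t) *\<^sub>R \<zeta> - (t *\<^sub>R \<xi> + s *\<^sub>R \<eta>)"
      by (simp add: algebra_simps)
    have zm: "(1 / (s + t)) *\<^sub>R (t *\<^sub>R (\<zeta> - \<xi>) + s *\<^sub>R (\<zeta> - \<eta>)) = \<zeta> - m"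
      unfolding m_def eq by (subst scaleR_diff_right) (use s t in simp)
    have "(norm (\<zeta> - \<xi>))\<^sup>2 / (4 * s) + (norm (\<zeta> - \<eta>))\<^sup>2 / (4 * t) = \<alpha> * (norm (\<zeta> - m))\<^sup>2 + (norm (\<xi> - \<eta>))\<^sup>2 / (4 * (s + t))"
      using gauss_product_exponent[OF s t, of "\<zeta> - \<xi>" "\<zeta> - \<eta>"] unfolding zm \<alpha>_def by (simp add: norm_minus_commute)
    then have "exp (- (norm (\<zeta> - \<xi>))\<^sup>2 / (4 * s)) * exp (- (norm (\<zeta> - \<eta>))\<^sup>2 / (4 * t)) = E * exp (- \<alpha> * (norm (\<zeta> - m))\<^sup>2)"
      unfolding E_def by (simp add: exp_add[symmetric])
    then show ?thesis unfolding fr_def s_def[symmetric] t_def[symmetric] N_def by simp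
  qed
  then have ov: "overlap \<xi> \<eta> = E / N * sqrt (pi / \<alpha>) ^ CARD('n)"
    unfolding overlap_def using gauss_integral_shift(2)[OF \<alpha>, of m] by simp
  have r: "sqrt (pi / \<alpha>) ^ CARD('n) / N = sqrt (2 * sqrt (s * t) / (s + t)) ^ CARD('n)"
  proof -
    have "N = sqrt (sqrt (2 * pi * s) * sqrt (2 * pi * t)) ^ CARD('n)"
      unfolding N_def by (simp only: real_sqrt_mult[symmetric] power_mult_distrib[symmetric] real_sqrt_power)
    also have "sqrt (2 * pi * s) * sqrt (2 * pi * t) = 2 * pi * sqrt (s * t)"
    proof -
      have "sqrt (2 * pi * s) * sqrt (2 * pi * t) = sqrt ((2 * pi)\<^sup>2 * (s * t))"
        unfolding real_sqrt_mult[symmetric] by (simp add: power2_eq_square mult_ac)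
      then show ?thesis by (simp add: real_sqrt_mult)
    qed
    finally have N: "N = sqrt (2 * pi * sqrt (s * t)) ^ CARD('n)" .
    have "pi / \<alpha> / (2 * pi * sqrt (s * t)) = 2 * sqrt (s * t) / (s + t)"
    proof -
      define r where "r = sqrt (s * t)"
      have r: "r > 0" "r * r = s * t" using s t by (simp_all add: r_def)
      have "pi / \<alpha> = 4 * pi * (r * r) / (s + t)" unfolding \<alpha>_def r by (simp add: mult_ac)
      then have "pi / \<alpha> = 2 * r / (s + t) * (2 * pi * r)" by simp
      then have "pi / \<alpha> / (2 * pi * r) = 2 * r / (s + t)"
        using nonzero_mult_div_cancel_right[of "2 * pi * r" "2 * r / (s + t)"] r(1) by (simp only:) simp
      then show ?thesis by (simp only: r_def)
    qed
    then show ?thesis unfolding N by (simp only: power_divide[symmetric] real_sqrt_divide[symmetric])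
  qed
  have "overlap \<xi> \<eta> = sqrt (pi / \<alpha>) ^ CARD('n) / N * E" unfolding ov by simp
  then show ?thesis unfolding r E_def .
qed

lemma jbracket_diff_le: "\<bar>jbracket \<xi> - jbracket \<eta>\<bar> \<le> norm (\<xi> - \<eta>)"
  using jbracket_add_le[of \<xi> "\<eta> - \<xi>"] jbracket_add_le[of \<eta> "\<xi> - \<eta>"] by (simp add: norm_minus_commute)

lemma one_minus_power_le: "1 - q ^ n \<le> real n * (1 - q)" if "0 \<le> q" "q \<le> 1" for q :: real
proof (induction n)
  case (Suc n)
  have "1 - q ^ Suc n = (1 - q) + q * (1 - q ^ n)" by (simp add: algebra_simps)
  also have "q * (1 - q ^ n) \<le> 1 * (1 - q ^ n)" using that by (intro mult_right_mono) (auto simp: power_le_one)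
  finally show ?case using Suc by (simp add: algebra_simps)
qed simp

text \<open>With d = |eta - xi| the two factors of \<open>overlap_eq\<close> are treated separately.
  The exponential differs from 1 by at most d^2 / <xi>. For the prefactor q^n, Bernoulli reduces to
  1 - q <= 1 - q^2, and 1 - q^2 = (sqrt s - sqrt t)^2 / (s + t), which is small because the bracket
  is Lipschitz.\<close>

lemma overlap_ge: "1 - overlap \<xi> \<eta> \<le> (real CARD('n) + 1) * (norm (\<eta> - \<xi>))\<^sup>2 / jbracket \<xi>" for \<xi> \<eta> :: "real^'n"
proof -
  define s where "s = jbracket \<xi>" define t where "t = jbracket \<eta>"
  define d where "d = norm (\<eta> - \<xi>)"
  define q where "q = sqrt (2 * sqrt (s * t) / (s + t))"
  define e where "e = exp (- d\<^sup>2 / (4 * (s + t)))"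
  have s: "s \<ge> 1" and t: "t \<ge> 1" unfolding s_def t_def by (rule jbracket_ge_1)+
  have st: "s + t > 0" using s t by simp
  have dq: "1 - 2 * sqrt (s * t) / (s + t) = (sqrt s - sqrt t)\<^sup>2 / (s + t)"
  proof -
    have "(sqrt s - sqrt t)\<^sup>2 = s + t - 2 * sqrt (s * t)"
      using s t by (simp add: power2_diff real_sqrt_mult)
    then show ?thesis using st by (simp add: diff_divide_distrib)
  qed
  then have q2: "2 * sqrt (s * t) / (s + t) \<le> 1" using st zero_le_divide_iff[of "(sqrt s - sqrt t)\<^sup>2" "s + t"] by (smt (verit) zero_le_power2)
  have q0: "0 \<le> 2 * sqrt (s * t) / (s + t)" using s t by simp
  have q: "0 \<le> q" "q \<le> 1" "q\<^sup>2 = 2 * sqrt (s * t) / (s + t)" unfolding q_def using q0 q2 by simp_all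
  have e: "0 < e" "e \<le> 1" unfolding e_def using st by simp_all
  have "1 - e \<le> d\<^sup>2 / (4 * (s + t))" using exp_ge_add_one_self[of "- d\<^sup>2 / (4 * (s + t))"] unfolding e_def by simp
  also have "\<dots> \<le> d\<^sup>2 / s" using s t by (intro divide_left_mono) auto
  finally have e1: "1 - e \<le> d\<^sup>2 / s" .
  \<comment> \<open>Both brackets are at least 1, so dividing s - t by sqrt s + sqrt t does not
    enlarge it.\<close>
  have "(sqrt s - sqrt t)\<^sup>2 \<le> d\<^sup>2"
  proof -
    have "\<bar>sqrt s - sqrt t\<bar> * 1 \<le> \<bar>sqrt s - sqrt t\<bar> * (sqrt s + sqrt t)"
      using s t real_sqrt_ge_one[of s] real_sqrt_ge_zero[of t] by (intro mult_left_mono) linarith+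
    also have "\<dots> = \<bar>(sqrt s - sqrt t) * (sqrt s + sqrt t)\<bar>"
      using s t by (simp add: abs_mult)
    also have "(sqrt s - sqrt t) * (sqrt s + sqrt t) = s - t"
      using s t by (simp add: algebra_simps)
    also have "\<bar>s - t\<bar> \<le> d" unfolding s_def t_def d_def using jbracket_diff_le[of \<xi> \<eta>] by (simp add: norm_minus_commute)
    finally have "\<bar>sqrt s - sqrt t\<bar> \<le> d" by simp
    then show ?thesis by (metis abs_le_square_iff abs_of_nonneg d_def norm_ge_zero)
  qed
  then have "1 - q\<^sup>2 \<le> d\<^sup>2 / (s + t)" unfolding q(3) dq using st by (intro divide_right_mono) auto
  also have "\<dots> \<le> d\<^sup>2 / s" using s t by (intro divide_left_mono) auto
  finally have "1 - q\<^sup>2 \<le> d\<^sup>2 / s" .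
  moreover have "q\<^sup>2 \<le> q" using mult_left_mono[OF q(2) q(1)] by (simp add: power2_eq_square)
  ultimately have "1 - q \<le> d\<^sup>2 / s" by linarith
  define X where "X = 1 - q ^ CARD('n)"
  have "X \<le> real CARD('n) * (1 - q)" unfolding X_def by (rule one_minus_power_le[OF q(1,2)])
  also have "\<dots> \<le> real CARD('n) * (d\<^sup>2 / s)" using \<open>1 - q \<le> d\<^sup>2 / s\<close> by (rule mult_left_mono) simp
  finally have X: "X \<le> real CARD('n) * (d\<^sup>2 / s)" .
  have "1 - overlap \<xi> \<eta> = (1 - e) + e * X"
    unfolding overlap_eq e_def q_def s_def t_def d_def X_def by (simp add: algebra_simps norm_minus_commute)
  moreover have "e * X \<le> 1 * X"
    using e q by (intro mult_right_mono) (auto simp: X_def power_le_one)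
  ultimately have "1 - overlap \<xi> \<eta> \<le> d\<^sup>2 / s + real CARD('n) * (d\<^sup>2 / s)" using e1 X by linarith
  then show ?thesis unfolding d_def s_def by (simp add: algebra_simps add_divide_distrib)
qed

text \<open>Origin of the constant: with x = |zeta - xi|^2 / (4 <xi>) the estimate x exp(-2 x) <=
  exp(-x) replaces the quadratic factor by 4 <xi> and doubles the variance, which multiplies the
  mass of the Gaussian by (sqrt 2)^n. The exact second moment would be n <xi>; only its order in
  <xi> matters.\<close>

definition fr_moment_const :: "'n::finite itself \<Rightarrow> real" where
  "fr_moment_const _ = 4 * sqrt 2 ^ CARD('n)"

lemma fr_moment:
  fixes \<xi> :: "real^'n"
  shows "integrable lborel (\<lambda>\<zeta>. (fr \<xi> \<zeta>)\<^sup>2 * (norm (\<zeta> - \<xi>))\<^sup>2)"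
    and "(\<integral>\<zeta>. (fr \<xi> \<zeta>)\<^sup>2 * (norm (\<zeta> - \<xi>))\<^sup>2 \<partial>lborel) \<le> fr_moment_const TYPE('n) * jbracket \<xi>"
proof -
  let ?s = "jbracket \<xi>"
  have s: "?s > 0" by (rule jbracket_pos)
  have s4: "1 / (4 * ?s) > 0" using s by simp
  define N where "N = sqrt (2 * pi * ?s) ^ CARD('n)"
  have N: "N > 0" unfolding N_def using s by simp
  have le: "(fr \<xi> \<zeta>)\<^sup>2 * (norm (\<zeta> - \<xi>))\<^sup>2 \<le> 4 * ?s / N * exp (- (1 / (4 * ?s)) * (norm (\<zeta> - \<xi>))\<^sup>2)" for \<zeta>
  proof -
    define x where "x = (norm (\<zeta> - \<xi>))\<^sup>2 / (4 * ?s)"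
    have "x \<le> exp x" using exp_ge_add_one_self[of x] by linarith
    then have "x * exp (- x) \<le> 1" by (simp add: exp_minus field_simps)
    then have x1: "x * exp (- x) * exp (- x) \<le> 1 * exp (- x)" by (intro mult_right_mono) auto
    have nx: "(norm (\<zeta> - \<xi>))\<^sup>2 = 4 * ?s * x" unfolding x_def using s by simp
    have "exp (- (1 / (2 * ?s)) * (norm (\<zeta> - \<xi>))\<^sup>2) = exp (- x) * exp (- x)"
      unfolding nx using s by (simp add: exp_add[symmetric])
    then have "(fr \<xi> \<zeta>)\<^sup>2 * (norm (\<zeta> - \<xi>))\<^sup>2 = 4 * ?s / N * (x * exp (- x) * exp (- x))"
      unfolding fr_sq N_def[symmetric] nx by simp
    also have "\<dots> \<le> 4 * ?s / N * exp (- x)" using x1 s N by (intro mult_left_mono) auto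
    finally show ?thesis by (simp add: x_def)
  qed
  have gi: "integrable lborel (\<lambda>\<zeta>. 4 * ?s / N * exp (- (1 / (4 * ?s)) * (norm (\<zeta> - \<xi>))\<^sup>2))"
    using gauss_integral_shift(1)[OF s4, of \<xi>] by simp
  show i: "integrable lborel (\<lambda>\<zeta>. (fr \<xi> \<zeta>)\<^sup>2 * (norm (\<zeta> - \<xi>))\<^sup>2)"
  proof (rule Bochner_Integration.integrable_bound[OF gi])
    show "(\<lambda>\<zeta>. (fr \<xi> \<zeta>)\<^sup>2 * (norm (\<zeta> - \<xi>))\<^sup>2) \<in> borel_measurable lborel"
      by (simp, intro borel_measurable_continuous_onI continuous_intros continuous_on_fr_right)
    show "AE \<zeta> in lborel. norm ((fr \<xi> \<zeta>)\<^sup>2 * (norm (\<zeta> - \<xi>))\<^sup>2) \<le> norm (4 * ?s / N * exp (- (1 / (4 * ?s)) * (norm (\<zeta> - \<xi>))\<^sup>2))"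
      using order_trans[OF le abs_ge_self] by (intro AE_I2) (simp add: abs_mult)
  qed
  have "(\<integral>\<zeta>. (fr \<xi> \<zeta>)\<^sup>2 * (norm (\<zeta> - \<xi>))\<^sup>2 \<partial>lborel) \<le> (\<integral>\<zeta>. 4 * ?s / N * exp (- (1 / (4 * ?s)) * (norm (\<zeta> - \<xi>))\<^sup>2) \<partial>lborel)"
    by (rule integral_mono[OF i gi]) (rule le)
  also have "\<dots> = 4 * ?s / N * sqrt (pi / (1 / (4 * ?s))) ^ CARD('n)"
    using gauss_integral_shift(2)[OF s4, of \<xi>] by simp
  also have "\<dots> = 4 * ?s * (sqrt (pi / (1 / (4 * ?s))) / sqrt (2 * pi * ?s)) ^ CARD('n)"
    unfolding N_def by (simp add: power_divide)
  also have "sqrt (pi / (1 / (4 * ?s))) / sqrt (2 * pi * ?s) = sqrt 2"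
    unfolding real_sqrt_divide[symmetric] using s by simp
  finally show "(\<integral>\<zeta>. (fr \<xi> \<zeta>)\<^sup>2 * (norm (\<zeta> - \<xi>))\<^sup>2 \<partial>lborel) \<le> fr_moment_const TYPE('n) * ?s"
    by (simp add: fr_moment_const_def mult_ac)
qed

lemma fr_moment_const_nonneg: "0 \<le> fr_moment_const TYPE('n::finite)"
  by (simp add: fr_moment_const_def)

text \<open>Near xi, up to distance <xi> / 2, the brackets are comparable. Farther away 1 / <zeta>
  is at most 1, which in turn is at most 4 |zeta - xi|^2 / <xi>^2, and the second moment of order
  <xi> turns this into 1 / <xi>.\<close>

lemma fr_low:
  fixes \<xi> :: "real^'n"
  shows "integrable lborel (\<lambda>\<zeta>. (fr \<xi> \<zeta>)\<^sup>2 / jbracket \<zeta>)"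
    and "(\<integral>\<zeta>. (fr \<xi> \<zeta>)\<^sup>2 / jbracket \<zeta> \<partial>lborel) \<le> (2 + 4 * fr_moment_const TYPE('n)) / jbracket \<xi>"
proof -
  let ?s = "jbracket \<xi>"
  have s: "?s > 0" by (rule jbracket_pos)
  have le: "(fr \<xi> \<zeta>)\<^sup>2 / jbracket \<zeta> \<le> 2 / ?s * (fr \<xi> \<zeta>)\<^sup>2 + 4 / ?s\<^sup>2 * ((fr \<xi> \<zeta>)\<^sup>2 * (norm (\<zeta> - \<xi>))\<^sup>2)" for \<zeta>
  proof -
    have "1 / jbracket \<zeta> \<le> 2 / ?s + 4 / ?s\<^sup>2 * (norm (\<zeta> - \<xi>))\<^sup>2"
    proof (cases "norm (\<zeta> - \<xi>) \<le> ?s / 2")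
      case True
      then have "1 / jbracket \<zeta> \<le> 2 / ?s" using jbracket_segment[of "\<zeta> - \<xi>" \<xi> 1] by simp
      moreover have "0 \<le> 4 / ?s\<^sup>2 * (norm (\<zeta> - \<xi>))\<^sup>2" by simp
      ultimately show ?thesis by linarith
    next
      case False
      have "1 / jbracket \<zeta> \<le> 1" using jbracket_ge_1[of \<zeta>] by simp
      also have "1 = 4 / ?s\<^sup>2 * (?s / 2)\<^sup>2" using s by (simp add: power2_eq_square)
      also have "\<dots> \<le> 4 / ?s\<^sup>2 * (norm (\<zeta> - \<xi>))\<^sup>2"
        using False s by (intro mult_left_mono power_mono) auto
      also have "\<dots> \<le> 2 / ?s + 4 / ?s\<^sup>2 * (norm (\<zeta> - \<xi>))\<^sup>2" using s by simp
      finally show ?thesis .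
    qed
    from mult_left_mono[OF this, of "(fr \<xi> \<zeta>)\<^sup>2"] show ?thesis by (simp add: algebra_simps)
  qed
  have gi: "integrable lborel (\<lambda>\<zeta>. 2 / ?s * (fr \<xi> \<zeta>)\<^sup>2 + 4 / ?s\<^sup>2 * ((fr \<xi> \<zeta>)\<^sup>2 * (norm (\<zeta> - \<xi>))\<^sup>2))"
    by (intro Bochner_Integration.integrable_add integrable_mult_right fr_sq_integral(1) fr_moment(1))
  show i: "integrable lborel (\<lambda>\<zeta>. (fr \<xi> \<zeta>)\<^sup>2 / jbracket \<zeta>)"
  proof (rule Bochner_Integration.integrable_bound[OF gi])
    show "(\<lambda>\<zeta>. (fr \<xi> \<zeta>)\<^sup>2 / jbracket \<zeta>) \<in> borel_measurable lborel"
      by (simp, intro borel_measurable_continuous_onI continuous_intros continuous_on_fr_right) simp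
    show "AE \<zeta> in lborel. norm ((fr \<xi> \<zeta>)\<^sup>2 / jbracket \<zeta>) \<le> norm (2 / ?s * (fr \<xi> \<zeta>)\<^sup>2 + 4 / ?s\<^sup>2 * ((fr \<xi> \<zeta>)\<^sup>2 * (norm (\<zeta> - \<xi>))\<^sup>2))"
      using order_trans[OF le abs_ge_self] by (intro AE_I2) (simp add: abs_of_pos[OF jbracket_pos])
  qed
  have "(\<integral>\<zeta>. (fr \<xi> \<zeta>)\<^sup>2 / jbracket \<zeta> \<partial>lborel) \<le> (\<integral>\<zeta>. 2 / ?s * (fr \<xi> \<zeta>)\<^sup>2 + 4 / ?s\<^sup>2 * ((fr \<xi> \<zeta>)\<^sup>2 * (norm (\<zeta> - \<xi>))\<^sup>2) \<partial>lborel)"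
    by (rule integral_mono[OF i gi]) (rule le)
  also have "\<dots> = 2 / ?s * 1 + 4 / ?s\<^sup>2 * (\<integral>\<zeta>. (fr \<xi> \<zeta>)\<^sup>2 * (norm (\<zeta> - \<xi>))\<^sup>2 \<partial>lborel)"
    using fr_sq_integral[of \<xi>] fr_moment(1)[of \<xi>] by simp
  also have "\<dots> \<le> 2 / ?s * 1 + 4 / ?s\<^sup>2 * (fr_moment_const TYPE('n) * ?s)"
    by (intro add_left_mono mult_left_mono fr_moment(2)) simp
  also have "\<dots> = (2 + 4 * fr_moment_const TYPE('n)) / ?s" using s by (simp add: power2_eq_square add_divide_distrib)
  finally show "(\<integral>\<zeta>. (fr \<xi> \<zeta>)\<^sup>2 / jbracket \<zeta> \<partial>lborel) \<le> (2 + 4 * fr_moment_const TYPE('n)) / ?s" .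
qed

text \<open>
  Averaging \<open>H\<close> against \<open>fr \<xi> * fr \<eta>\<close> costs only a factor \<open>1 / \<langle>\<xi>\<rangle>\<close>: the first-order term
  cancels because \<open>(fr \<xi>)\<^sup>2\<close> is even about \<open>\<xi>\<close>, and \<open>fr \<eta>\<close> differs from \<open>fr \<xi>\<close> by
  \<open>|\<eta> - \<xi>| / \<langle>\<xi>\<rangle>\<^sup>1\<^sup>/\<^sup>2\<close> in \<open>L\<^sup>2\<close>.
\<close>

lemma friedrichs_kernel:
  fixes \<xi> \<eta> :: "real^'n"
  assumes c: "continuous_on UNIV H" and B: "0 \<le> B" and b0: "\<And>\<zeta>. norm (H \<zeta>) \<le> B"
    and b1: "\<And>t. norm (H (\<xi> + t) - H \<xi>) \<le> B * (norm t / jbracket \<xi>)"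
    and b2: "\<And>t. norm (H (\<xi> + t) + H (\<xi> - t) - 2 * H \<xi>) \<le> B * (norm t / jbracket \<xi>)\<^sup>2"
  shows "norm ((\<integral>\<zeta>. H \<zeta> * complex_of_real (fr \<xi> \<zeta> * fr \<eta> \<zeta>) \<partial>lborel) - H \<xi>)
    \<le> (2 * (real CARD('n) + 1) + fr_moment_const TYPE('n)) * B * (jbracket (\<eta> - \<xi>))\<^sup>2 / jbracket \<xi>"
proof -
  let ?s = "jbracket \<xi>" let ?M = "fr_moment_const TYPE('n)" let ?n = "real CARD('n) + 1"
  define d where "d = norm (\<eta> - \<xi>)"
  have s: "?s > 0" by (rule jbracket_pos)
  define D where "D \<zeta> = H \<zeta> - H \<xi>" for \<zeta>
  have Dc: "continuous_on UNIV D" unfolding D_def by (intro continuous_intros c)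
  have Db: "norm (D \<zeta>) \<le> 2 * B" for \<zeta>
    unfolding D_def using norm_triangle_ineq4[of "H \<zeta>" "H \<xi>"] b0[of \<zeta>] b0[of \<xi>] by linarith
  have D1: "norm (D \<zeta>) \<le> B * (norm (\<zeta> - \<xi>) / ?s)" for \<zeta> unfolding D_def using b1[of "\<zeta> - \<xi>"] by simp
  have ov: "1 - overlap \<xi> \<eta> \<le> ?n * d\<^sup>2 / ?s" unfolding d_def by (rule overlap_ge)
  have ifr: "integrable lborel (\<lambda>\<zeta>. f \<zeta> * complex_of_real (fr \<xi> \<zeta> * fr \<eta>' \<zeta>))"
    if f: "continuous_on UNIV f" "\<And>\<zeta>. norm (f \<zeta>) \<le> C" for f C \<eta>'
  proof (rule Bochner_Integration.integrable_bound)
    show "integrable lborel (\<lambda>\<zeta>. C * (fr \<xi> \<zeta> * fr \<eta>' \<zeta>))" by (simp add: fr_mult_integrable)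
    show "(\<lambda>\<zeta>. f \<zeta> * complex_of_real (fr \<xi> \<zeta> * fr \<eta>' \<zeta>)) \<in> borel_measurable lborel"
      by (simp, intro borel_measurable_continuous_onI continuous_intros continuous_on_fr_right f)
    show "AE \<zeta> in lborel. norm (f \<zeta> * complex_of_real (fr \<xi> \<zeta> * fr \<eta>' \<zeta>)) \<le> norm (C * (fr \<xi> \<zeta> * fr \<eta>' \<zeta>))"
      using fr_pos by (intro AE_I2) (auto simp: norm_mult abs_mult abs_of_pos intro!: mult_right_mono order_trans[OF f(2) abs_ge_self])
  qed
  \<comment> \<open>\<open>T1\<close> is the cost of exchanging the window at eta for the one at xi,
    \<open>T2\<close> the average of the increment D against the even density; the third term in
    \<open>split\<close> is the deficit of the overlap from 1.\<close>
  define T1 where "T1 = (\<integral>\<zeta>. D \<zeta> * complex_of_real (fr \<xi> \<zeta> * fr \<eta> \<zeta>) - D \<zeta> * complex_of_real (fr \<xi> \<zeta> * fr \<xi> \<zeta>) \<partial>lborel)"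
  define T2 where "T2 = (\<integral>\<zeta>. D \<zeta> * complex_of_real (fr \<xi> \<zeta> * fr \<xi> \<zeta>) \<partial>lborel)"
  have split: "(\<integral>\<zeta>. H \<zeta> * complex_of_real (fr \<xi> \<zeta> * fr \<eta> \<zeta>) \<partial>lborel) - H \<xi> = T1 + T2 - H \<xi> * complex_of_real (1 - overlap \<xi> \<eta>)"
  proof -
    have "(\<integral>\<zeta>. H \<zeta> * complex_of_real (fr \<xi> \<zeta> * fr \<eta> \<zeta>) \<partial>lborel)
        = (\<integral>\<zeta>. D \<zeta> * complex_of_real (fr \<xi> \<zeta> * fr \<eta> \<zeta>) + H \<xi> * complex_of_real (fr \<xi> \<zeta> * fr \<eta> \<zeta>) \<partial>lborel)"
      unfolding D_def by (simp add: algebra_simps)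
    also have "\<dots> = (\<integral>\<zeta>. D \<zeta> * complex_of_real (fr \<xi> \<zeta> * fr \<eta> \<zeta>) \<partial>lborel) + H \<xi> * complex_of_real (overlap \<xi> \<eta>)"
      unfolding overlap_def
      by (subst Bochner_Integration.integral_add[OF ifr[OF Dc Db] ifr[of "\<lambda>_. H \<xi>" "norm (H \<xi>)"]])
        (simp_all only: continuous_on_const order_refl integral_mult_right_zero integral_complex_of_real)
    also have "(\<integral>\<zeta>. D \<zeta> * complex_of_real (fr \<xi> \<zeta> * fr \<eta> \<zeta>) \<partial>lborel) = T1 + T2"
      unfolding T1_def T2_def by (subst Bochner_Integration.integral_diff[OF ifr[OF Dc Db] ifr[OF Dc Db]]) simp
    finally show ?thesis by (simp add: algebra_simps)
  qed
  have sqi: "integrable lborel (\<lambda>\<zeta>. (fr \<eta> \<zeta> - fr \<xi> \<zeta>)\<^sup>2)"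
    and sq: "(\<integral>\<zeta>. (fr \<eta> \<zeta> - fr \<xi> \<zeta>)\<^sup>2 \<partial>lborel) = 2 * (1 - overlap \<xi> \<eta>)"
  proof -
    have eq: "(fr \<eta> \<zeta> - fr \<xi> \<zeta>)\<^sup>2 = (fr \<eta> \<zeta>)\<^sup>2 + (fr \<xi> \<zeta>)\<^sup>2 - 2 * (fr \<xi> \<zeta> * fr \<eta> \<zeta>)" for \<zeta>
      by (simp add: power2_diff)
    show "integrable lborel (\<lambda>\<zeta>. (fr \<eta> \<zeta> - fr \<xi> \<zeta>)\<^sup>2)" "(\<integral>\<zeta>. (fr \<eta> \<zeta> - fr \<xi> \<zeta>)\<^sup>2 \<partial>lborel) = 2 * (1 - overlap \<xi> \<eta>)"
      unfolding eq overlap_def using fr_sq_integral[of \<xi>] fr_sq_integral[of \<eta>] fr_mult_integrable[of \<xi> \<eta>] by simp_all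
  qed
  have "norm T1 \<le> (\<integral>\<zeta>. B / 2 * (fr \<eta> \<zeta> - fr \<xi> \<zeta>)\<^sup>2 + B / (2 * ?s\<^sup>2) * ((fr \<xi> \<zeta>)\<^sup>2 * (norm (\<zeta> - \<xi>))\<^sup>2) \<partial>lborel)"
    unfolding T1_def
  proof (rule order_trans[OF integral_norm_bound], rule integral_mono')
    show "integrable lborel (\<lambda>\<zeta>. B / 2 * (fr \<eta> \<zeta> - fr \<xi> \<zeta>)\<^sup>2 + B / (2 * ?s\<^sup>2) * ((fr \<xi> \<zeta>)\<^sup>2 * (norm (\<zeta> - \<xi>))\<^sup>2))"
      by (intro Bochner_Integration.integrable_add integrable_mult_right sqi fr_moment(1))
    fix \<zeta>
    \<comment> \<open>The inequality 2 u v <= u^2 + v^2 plays the part of Cauchy-Schwarz: the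
      squares integrate to the L^2 distance of the windows and to the second moment divided by
      <xi>^2.\<close>
    define u where "u = \<bar>fr \<eta> \<zeta> - fr \<xi> \<zeta>\<bar>" define v where "v = fr \<xi> \<zeta> * norm (\<zeta> - \<xi>) / ?s"
    have "D \<zeta> * complex_of_real (fr \<xi> \<zeta> * fr \<eta> \<zeta>) - D \<zeta> * complex_of_real (fr \<xi> \<zeta> * fr \<xi> \<zeta>)
        = D \<zeta> * complex_of_real (fr \<xi> \<zeta> * (fr \<eta> \<zeta> - fr \<xi> \<zeta>))" by (simp add: algebra_simps)
    then have "norm (D \<zeta> * complex_of_real (fr \<xi> \<zeta> * fr \<eta> \<zeta>) - D \<zeta> * complex_of_real (fr \<xi> \<zeta> * fr \<xi> \<zeta>)) = norm (D \<zeta>) * (fr \<xi> \<zeta> * u)"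
      unfolding u_def using fr_pos[of \<xi> \<zeta>] by (simp only: norm_mult norm_of_real abs_mult abs_of_pos)
    also have "\<dots> \<le> (B * (norm (\<zeta> - \<xi>) / ?s)) * (fr \<xi> \<zeta> * u)"
      using fr_pos[of \<xi> \<zeta>] by (intro mult_right_mono D1) (simp add: u_def)
    also have "\<dots> = B * (v * u)" by (simp add: v_def)
    also have "\<dots> \<le> B * ((u\<^sup>2 + v\<^sup>2) / 2)"
      using sum_squares_bound[of u v] by (intro mult_left_mono B) (simp add: mult_ac)
    also have "\<dots> = B / 2 * (fr \<eta> \<zeta> - fr \<xi> \<zeta>)\<^sup>2 + B / (2 * ?s\<^sup>2) * ((fr \<xi> \<zeta>)\<^sup>2 * (norm (\<zeta> - \<xi>))\<^sup>2)"
      by (simp add: u_def v_def power_divide power_mult_distrib algebra_simps add_divide_distrib)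
    finally show "norm (D \<zeta> * complex_of_real (fr \<xi> \<zeta> * fr \<eta> \<zeta>) - D \<zeta> * complex_of_real (fr \<xi> \<zeta> * fr \<xi> \<zeta>)) \<le> \<dots>" .
    then show "0 \<le> B / 2 * (fr \<eta> \<zeta> - fr \<xi> \<zeta>)\<^sup>2 + B / (2 * ?s\<^sup>2) * ((fr \<xi> \<zeta>)\<^sup>2 * (norm (\<zeta> - \<xi>))\<^sup>2)"
      by (rule order_trans[OF norm_ge_zero])
  qed
  also have "\<dots> = B * (1 - overlap \<xi> \<eta>) + B / (2 * ?s\<^sup>2) * (\<integral>\<zeta>. (fr \<xi> \<zeta>)\<^sup>2 * (norm (\<zeta> - \<xi>))\<^sup>2 \<partial>lborel)"
    using sqi fr_moment(1)[of \<xi>] by (simp add: sq)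
  also have "\<dots> \<le> B * (?n * d\<^sup>2 / ?s) + B / (2 * ?s\<^sup>2) * (?M * ?s)"
    using B by (intro add_mono mult_left_mono ov fr_moment(2)) auto
  also have "\<dots> = B / ?s * (?n * d\<^sup>2 + ?M / 2)" using s by (simp add: power2_eq_square field_simps)
  finally have t1: "norm T1 \<le> B / ?s * (?n * d\<^sup>2 + ?M / 2)" .
  let ?g = "\<lambda>\<zeta>. D \<zeta> * complex_of_real (fr \<xi> \<zeta> * fr \<xi> \<zeta>)"
  have gm: "?g \<in> borel_measurable borel"
    by (intro borel_measurable_continuous_onI continuous_intros continuous_on_fr_right Dc)
  have gi: "integrable lborel ?g" by (rule ifr[OF Dc Db])
  have e1: "T2 = (\<integral>t. ?g (t + \<xi>) \<partial>lborel)" and i1: "integrable lborel (\<lambda>t. ?g (t + \<xi>))"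
    and e2: "T2 = (\<integral>t. ?g (\<xi> - t) \<partial>lborel)" and i2: "integrable lborel (\<lambda>t. ?g (\<xi> - t))"
    unfolding T2_def using lborel_integral_shift(1,3,4,6)[OF gm, of \<xi>] gi by simp_all
  have mm: "(\<lambda>\<zeta>. (fr \<xi> \<zeta>)\<^sup>2 * (norm (\<zeta> - \<xi>))\<^sup>2) \<in> borel_measurable borel"
    by (intro borel_measurable_continuous_onI continuous_intros continuous_on_fr_right)
  have mi: "integrable lborel (\<lambda>t. (fr \<xi> (t + \<xi>))\<^sup>2 * (norm t)\<^sup>2)"
    and me: "(\<integral>t. (fr \<xi> (t + \<xi>))\<^sup>2 * (norm t)\<^sup>2 \<partial>lborel) = (\<integral>\<zeta>. (fr \<xi> \<zeta>)\<^sup>2 * (norm (\<zeta> - \<xi>))\<^sup>2 \<partial>lborel)"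
    using lborel_integral_shift(1,4)[OF mm, of \<xi>] fr_moment(1)[of \<xi>] by simp_all
  \<comment> \<open>Averaging over t and -t cancels the first-order term and leaves the second
    difference of H, against the second moment.\<close>
  have "2 * T2 = (\<integral>t. ?g (t + \<xi>) + ?g (\<xi> - t) \<partial>lborel)"
    using Bochner_Integration.integral_add[OF i1 i2] e1 e2 by simp
  then have "norm (2 * T2) \<le> (\<integral>t. norm (?g (t + \<xi>) + ?g (\<xi> - t)) \<partial>lborel)"
    using integral_norm_bound[of lborel "\<lambda>t. ?g (t + \<xi>) + ?g (\<xi> - t)"] by simp
  also have "\<dots> \<le> (\<integral>t. B / ?s\<^sup>2 * ((fr \<xi> (t + \<xi>))\<^sup>2 * (norm t)\<^sup>2) \<partial>lborel)"
  proof (rule integral_mono')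
    show "integrable lborel (\<lambda>t. B / ?s\<^sup>2 * ((fr \<xi> (t + \<xi>))\<^sup>2 * (norm t)\<^sup>2))" using mi by simp
    fix t :: "real^'n"
    have fe: "fr \<xi> (\<xi> - t) = fr \<xi> (t + \<xi>)" by (simp add: fr_def)
    have "?g (t + \<xi>) + ?g (\<xi> - t) = (H (\<xi> + t) + H (\<xi> - t) - 2 * H \<xi>) * complex_of_real ((fr \<xi> (t + \<xi>))\<^sup>2)"
      unfolding fe D_def by (simp add: power2_eq_square algebra_simps)
    then have "norm (?g (t + \<xi>) + ?g (\<xi> - t)) = norm (H (\<xi> + t) + H (\<xi> - t) - 2 * H \<xi>) * (fr \<xi> (t + \<xi>))\<^sup>2"
      by (simp only: norm_mult norm_of_real abs_power2)
    also have "\<dots> \<le> (B * (norm t / ?s)\<^sup>2) * (fr \<xi> (t + \<xi>))\<^sup>2" by (intro mult_right_mono b2) simp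
    finally show "norm (?g (t + \<xi>) + ?g (\<xi> - t)) \<le> B / ?s\<^sup>2 * ((fr \<xi> (t + \<xi>))\<^sup>2 * (norm t)\<^sup>2)"
      by (simp add: power_divide mult_ac)
    show "0 \<le> B / ?s\<^sup>2 * ((fr \<xi> (t + \<xi>))\<^sup>2 * (norm t)\<^sup>2)" using B by simp
  qed
  also have "\<dots> = B / ?s\<^sup>2 * (\<integral>\<zeta>. (fr \<xi> \<zeta>)\<^sup>2 * (norm (\<zeta> - \<xi>))\<^sup>2 \<partial>lborel)" by (simp add: me)
  also have "\<dots> \<le> B / ?s\<^sup>2 * (?M * ?s)" using B by (intro mult_left_mono fr_moment(2)) auto
  also have "\<dots> = B / ?s * ?M" using s by (simp add: power2_eq_square)
  finally have t2: "norm T2 \<le> B / ?s * (?M / 2)" by (simp add: norm_mult)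
  have t3: "norm (H \<xi> * complex_of_real (1 - overlap \<xi> \<eta>)) \<le> B / ?s * (?n * d\<^sup>2)"
  proof -
    have "norm (H \<xi> * complex_of_real (1 - overlap \<xi> \<eta>)) = norm (H \<xi>) * (1 - overlap \<xi> \<eta>)"
      using overlap_le_1[of \<xi> \<eta>] by (simp only: norm_mult norm_of_real abs_of_nonneg diff_ge_0_iff_ge)
    also have "\<dots> \<le> B * (?n * d\<^sup>2 / ?s)" using overlap_le_1[of \<xi> \<eta>] by (intro mult_mono b0 ov B) auto
    finally show ?thesis by simp
  qed
  have "norm ((\<integral>\<zeta>. H \<zeta> * complex_of_real (fr \<xi> \<zeta> * fr \<eta> \<zeta>) \<partial>lborel) - H \<xi>)
      \<le> B / ?s * (?n * d\<^sup>2 + ?M / 2) + B / ?s * (?M / 2) + B / ?s * (?n * d\<^sup>2)"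
    unfolding split using norm_triangle_ineq4[of "T1 + T2" "H \<xi> * complex_of_real (1 - overlap \<xi> \<eta>)"] norm_triangle_ineq[of T1 T2] t1 t2 t3
    by linarith
  also have "\<dots> = B / ?s * (2 * ?n * d\<^sup>2 + ?M)" by (simp add: algebra_simps)
  also have "\<dots> \<le> B / ?s * ((2 * ?n + ?M) * (jbracket (\<eta> - \<xi>))\<^sup>2)"
  proof (rule mult_left_mono)
    have "d\<^sup>2 \<le> (jbracket (\<eta> - \<xi>))\<^sup>2" "1 \<le> (jbracket (\<eta> - \<xi>))\<^sup>2" by (simp_all add: d_def jbracket_def)
    then have "2 * ?n * d\<^sup>2 \<le> 2 * ?n * (jbracket (\<eta> - \<xi>))\<^sup>2" "?M * 1 \<le> ?M * (jbracket (\<eta> - \<xi>))\<^sup>2"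
      using fr_moment_const_nonneg[where 'n='n] by (intro mult_left_mono; simp)+
    then show "2 * ?n * d\<^sup>2 + ?M \<le> (2 * ?n + ?M) * (jbracket (\<eta> - \<xi>))\<^sup>2" by (simp add: algebra_simps)
  qed (use B s in simp)
  finally show ?thesis by (simp add: mult_ac)
qed

section \<open>Schur estimates\<close>

text \<open>For the Fourier transform G of u this is (2 pi)^n times the square of the Sobolev norm
  of order -1/2.\<close>

definition energy :: "(real^'n \<Rightarrow> complex) \<Rightarrow> real" where
  "energy G = (\<integral>\<xi>. (norm (G \<xi>))\<^sup>2 / jbracket \<xi> \<partial>lborel)"

lemma energy_nonneg: "0 \<le> energy G"
  unfolding energy_def by (rule integral_nonneg_AE) (simp add: less_imp_le[OF jbracket_pos])

lemma square_integrable: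
  fixes G :: "real^'n \<Rightarrow> complex"
  assumes c: "continuous_on UNIV G" and b: "\<And>x. norm (G x) \<le> M" and G: "integrable lborel G"
  shows "integrable lborel (\<lambda>\<xi>. (norm (G \<xi>))\<^sup>2)"
proof (rule Bochner_Integration.integrable_bound)
  show "integrable lborel (\<lambda>\<xi>. M * norm (G \<xi>))" using G by simp
  show "(\<lambda>\<xi>. (norm (G \<xi>))\<^sup>2) \<in> borel_measurable lborel"
    by (simp, intro borel_measurable_continuous_onI continuous_intros c)
  show "AE \<xi> in lborel. norm ((norm (G \<xi>))\<^sup>2) \<le> norm (M * norm (G \<xi>))"
    using order_trans[OF b abs_ge_self] by (intro AE_I2) (simp add: power2_eq_square abs_mult mult_right_mono)
qed

lemma energy_integrable:
  fixes G :: "real^'n \<Rightarrow> complex"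
  assumes c: "continuous_on UNIV G" and b: "\<And>x. norm (G x) \<le> M" and G: "integrable lborel G"
  shows "integrable lborel (\<lambda>\<xi>. (norm (G \<xi>))\<^sup>2 / jbracket \<xi>)"
proof (rule Bochner_Integration.integrable_bound[OF square_integrable[OF assms]])
  show "(\<lambda>\<xi>. (norm (G \<xi>))\<^sup>2 / jbracket \<xi>) \<in> borel_measurable lborel"
    by (simp, intro borel_measurable_continuous_onI continuous_intros c) simp
  have "(norm (G \<xi>))\<^sup>2 / jbracket \<xi> \<le> (norm (G \<xi>))\<^sup>2 / 1" for \<xi>
    by (intro divide_left_mono jbracket_ge_1) (simp_all add: jbracket_pos)
  then show "AE \<xi> in lborel. norm ((norm (G \<xi>))\<^sup>2 / jbracket \<xi>) \<le> norm ((norm (G \<xi>))\<^sup>2)"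
    by (intro AE_I2) (simp add: abs_of_pos[OF jbracket_pos])
qed

lemma integral_convolution:
  fixes f g :: "real^'n \<Rightarrow> real"
  assumes f: "integrable lborel f" and g: "integrable lborel g"
  shows "integrable lborel (\<lambda>p. f (fst p) * g (snd p - fst p))"
    and "(\<integral>p. f (fst p) * g (snd p - fst p) \<partial>lborel) = integral\<^sup>L lborel f * integral\<^sup>L lborel g"
    and "integrable lborel (\<lambda>p. f (snd p) * g (snd p - fst p))"
    and "(\<integral>p. f (snd p) * g (snd p - fst p) \<partial>lborel) = integral\<^sup>L lborel f * integral\<^sup>L lborel g"
proof -
  have [measurable]: "f \<in> borel_measurable borel" "g \<in> borel_measurable borel" using f g by auto
  have n: "integrable lborel (\<lambda>x. norm (f x))" "integrable lborel (\<lambda>x. norm (g x))" using f g by auto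
  have "integrable (lborel \<Otimes>\<^sub>M lborel) (\<lambda>p. f (fst p) * g (snd p - fst p))"
  proof (rule lborel_pair.Fubini_integrable)
    show "integrable lborel (\<lambda>x. \<integral>y. norm (f (fst (x, y)) * g (snd (x, y) - fst (x, y))) \<partial>lborel)"
      using n by (simp add: abs_mult lborel_integral_shift(5)[of "\<lambda>y. \<bar>g y\<bar>"])
    show "AE x in lborel. integrable lborel (\<lambda>y. f (fst (x, y)) * g (snd (x, y) - fst (x, y)))"
      using lborel_integral_shift(2)[of g] g by (intro AE_I2) simp
  qed simp
  then show 1: "integrable lborel (\<lambda>p. f (fst p) * g (snd p - fst p))" by (simp add: lborel_prod)
  show "(\<integral>p. f (fst p) * g (snd p - fst p) \<partial>lborel) = integral\<^sup>L lborel f * integral\<^sup>L lborel g"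
    using lborel_fubini(1)[OF 1] by (simp add: lborel_integral_shift(5)[of g])
  have "integrable (lborel \<Otimes>\<^sub>M lborel) (\<lambda>(y, x). f y * g (y - x))"
  proof (rule lborel_pair.Fubini_integrable)
    show "integrable lborel (\<lambda>y. \<integral>x. norm (case (y, x) of (y, x) \<Rightarrow> f y * g (y - x)) \<partial>lborel)"
      using n by (simp add: abs_mult lborel_integral_shift(6)[of "\<lambda>y. \<bar>g y\<bar>"])
    show "AE y in lborel. integrable lborel (\<lambda>x. case (y, x) of (y, x) \<Rightarrow> f y * g (y - x))"
      using lborel_integral_shift(3)[of g] g by (intro AE_I2) simp
  qed simp
  from lborel_pair.integrable_product_swap[OF this]
  have "integrable (lborel \<Otimes>\<^sub>M lborel) (\<lambda>p. f (snd p) * g (snd p - fst p))"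
    by (simp add: case_prod_beta')
  then show 2: "integrable lborel (\<lambda>p. f (snd p) * g (snd p - fst p))" by (simp add: lborel_prod)
  show "(\<integral>p. f (snd p) * g (snd p - fst p) \<partial>lborel) = integral\<^sup>L lborel f * integral\<^sup>L lborel g"
    using lborel_fubini(2)[OF 2] by (simp add: lborel_integral_shift(6)[of g])
qed

text \<open>The inequality 2 |G1| |G2| <= |G1|^2 + |G2|^2 splits the integrand. The half with G1 can
  use 1 / <xi> as it stands; in the half with G2, Peetre's inequality replaces 1 / <xi> by 2 <eta -
  xi> / <eta>, and the power of decay beyond 2n pays for the extra factor. Both halves are then
  convolutions of an energy density with an integrable weight.\<close>

lemma schur_estimate:
  fixes G1 G2 :: "real^'n \<Rightarrow> complex"
  assumes k: "\<And>p. norm (k p) \<le> B / jbracket (snd p - fst p) ^ (2 * CARD('n) + 1) * (1 / jbracket (fst p))" and B: "0 \<le> B"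
    and e1: "integrable lborel (\<lambda>\<xi>. (norm (G1 \<xi>))\<^sup>2 / jbracket \<xi>)"
    and e2: "integrable lborel (\<lambda>\<xi>. (norm (G2 \<xi>))\<^sup>2 / jbracket \<xi>)"
  shows "norm (\<integral>p. k p * G1 (fst p) * cnj (G2 (snd p)) \<partial>lborel)
     \<le> B * (\<integral>\<theta>. 1 / jbracket (\<theta>::real^'n) ^ (2 * CARD('n)) \<partial>lborel) * (energy G1 + energy G2)"
proof -
  let ?w = "\<lambda>\<theta>::real^'n. 1 / jbracket \<theta> ^ (2 * CARD('n))"
  let ?f1 = "\<lambda>\<xi>. (norm (G1 \<xi>))\<^sup>2 / jbracket \<xi>" and ?f2 = "\<lambda>\<xi>. (norm (G2 \<xi>))\<^sup>2 / jbracket \<xi>"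
  have w: "integrable lborel ?w" by (rule integrable_jbracket) simp
  note c1 = integral_convolution(1,2)[OF e1 w] and c2 = integral_convolution(3,4)[OF e2 w]
  have "norm (\<integral>p. k p * G1 (fst p) * cnj (G2 (snd p)) \<partial>lborel)
     \<le> (\<integral>p. B * (?f1 (fst p) * ?w (snd p - fst p)) + B * (?f2 (snd p) * ?w (snd p - fst p)) \<partial>lborel)"
  proof (rule order_trans[OF integral_norm_bound], rule integral_mono')
    show "integrable lborel (\<lambda>p. B * (?f1 (fst p) * ?w (snd p - fst p)) + B * (?f2 (snd p) * ?w (snd p - fst p)))"
      by (intro Bochner_Integration.integrable_add integrable_mult_right c1(1) c2(1))
    fix p :: "(real^'n) \<times> (real^'n)"
    obtain \<xi> \<eta> where p: "p = (\<xi>, \<eta>)" by (cases p)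
    let ?j = "jbracket (\<eta> - \<xi>)" let ?N = "2 * CARD('n)"
    have j: "1 \<le> ?j" "0 < ?j" "0 < jbracket \<xi>" "0 < jbracket \<eta>" by (simp_all add: jbracket_ge_1 jbracket_pos)
    have jN: "0 < ?j ^ ?N" using j by simp
    have p1: "1 / (?j ^ Suc ?N * jbracket \<xi>) \<le> 1 / (?j ^ ?N * jbracket \<xi>)"
    proof (rule divide_left_mono)
      show "?j ^ ?N * jbracket \<xi> \<le> ?j ^ Suc ?N * jbracket \<xi>"
        using j by (intro mult_right_mono power_increasing) auto
    qed (use j jN in auto)
    have "jbracket \<eta> \<le> 2 * (?j * jbracket \<xi>)" using jbracket_peetre[of \<eta> \<xi>] by simp
    then have p2: "1 / (?j ^ Suc ?N * jbracket \<xi>) \<le> 2 * (1 / (?j ^ ?N * jbracket \<eta>))"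
    proof -
      assume h: "jbracket \<eta> \<le> 2 * (?j * jbracket \<xi>)"
      have "1 / (?j * jbracket \<xi>) \<le> 2 / jbracket \<eta>"
        using h j by (simp add: field_simps)
      from divide_right_mono[OF this less_imp_le[OF jN]] show ?thesis by (simp add: mult_ac)
    qed
    have "norm (k p * G1 (fst p) * cnj (G2 (snd p))) = norm (k p) * (norm (G1 \<xi>) * norm (G2 \<eta>))"
      by (simp add: p norm_mult)
    also have "\<dots> \<le> (B * (1 / (?j ^ Suc ?N * jbracket \<xi>))) * (((norm (G1 \<xi>))\<^sup>2 + (norm (G2 \<eta>))\<^sup>2) / 2)"
      using k[of p] sum_squares_bound[of "norm (G1 \<xi>)" "norm (G2 \<eta>)"] B j
      by (intro mult_mono) (simp_all add: p)
    also have "\<dots> = B * ((1 / (?j ^ Suc ?N * jbracket \<xi>)) * ((norm (G1 \<xi>))\<^sup>2 / 2) + (1 / (?j ^ Suc ?N * jbracket \<xi>)) * ((norm (G2 \<eta>))\<^sup>2 / 2))"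
      by (simp only: add_divide_distrib distrib_left mult.assoc)
    also have "\<dots> \<le> B * ((1 / (?j ^ ?N * jbracket \<xi>)) * (norm (G1 \<xi>))\<^sup>2 + (2 * (1 / (?j ^ ?N * jbracket \<eta>))) * ((norm (G2 \<eta>))\<^sup>2 / 2))"
    proof (intro mult_left_mono[OF _ B] add_mono)
      show "(1 / (?j ^ Suc ?N * jbracket \<xi>)) * ((norm (G1 \<xi>))\<^sup>2 / 2) \<le> (1 / (?j ^ ?N * jbracket \<xi>)) * (norm (G1 \<xi>))\<^sup>2"
        by (rule mult_mono[OF p1]) (use j jN in auto)
      show "(1 / (?j ^ Suc ?N * jbracket \<xi>)) * ((norm (G2 \<eta>))\<^sup>2 / 2) \<le> (2 * (1 / (?j ^ ?N * jbracket \<eta>))) * ((norm (G2 \<eta>))\<^sup>2 / 2)"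
        by (rule mult_right_mono[OF p2]) simp
    qed
    also have "\<dots> = B * (?f1 (fst p) * ?w (snd p - fst p)) + B * (?f2 (snd p) * ?w (snd p - fst p))"
      by (simp add: p algebra_simps)
    finally show "norm (k p * G1 (fst p) * cnj (G2 (snd p))) \<le> \<dots>" .
    then show "0 \<le> B * (?f1 (fst p) * ?w (snd p - fst p)) + B * (?f2 (snd p) * ?w (snd p - fst p))"
      by (rule order_trans[OF norm_ge_zero])
  qed
  also have "\<dots> = B * (energy G1 * integral\<^sup>L lborel ?w) + B * (energy G2 * integral\<^sup>L lborel ?w)"
    unfolding energy_def
    by (subst Bochner_Integration.integral_add[OF integrable_mult_right[OF c1(1)] integrable_mult_right[OF c2(1)]])
      (simp only: integral_mult_right_zero c1(2) c2(2))
  finally show ?thesis by (simp add: algebra_simps)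
qed

section \<open>Averaging over the localisation\<close>

lemma rapid_inversion:
  fixes u :: "real^'n \<Rightarrow> complex"
  assumes u: "rapid u"
  shows "(\<integral>\<xi>. cis (x \<bullet> \<xi>) * fourier u \<xi> \<partial>lborel) = complex_of_real ((2 * pi) ^ CARD('n)) * u x"
proof -
  obtain M where M: "\<forall>x. norm (u x) \<le> M / jbracket x ^ 0" using rapid_bound[OF u] by blast
  then have b: "norm (u x) \<le> M" for x by simp
  show ?thesis
    by (rule fourier_inversion[OF rapid_continuous[OF u] b rapid_integrable[OF u] rapid_fourier_integrable[OF u]])
qed

lemma rapid_fourier_bounded:
  assumes "rapid u" obtains M where "\<And>\<xi>. norm (fourier u \<xi>) \<le> M"
  using rapid_fourier_bound[OF assms, of 0] by auto

lemma rapid_energy_integrable: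
  assumes "rapid u" shows "integrable lborel (\<lambda>\<xi>. (norm (fourier u \<xi>))\<^sup>2 / jbracket \<xi>)"
proof -
  obtain M where M: "\<And>\<xi>. norm (fourier u \<xi>) \<le> M" using rapid_fourier_bounded[OF assms] by blast
  show ?thesis
    by (rule energy_integrable[OF rapid_fourier_continuous[OF assms] M rapid_fourier_integrable[OF assms]])
qed

lemma fourier_lam_translate:
  "fourier (\<lambda>x. complex_of_real (lam y x)) \<theta> = cis (- (y \<bullet> \<theta>)) * fourier (\<lambda>x. complex_of_real (lam 0 x)) \<theta>"
proof -
  have m: "(\<lambda>x. cis (- (x \<bullet> \<theta>)) * complex_of_real (lam y x)) \<in> borel_measurable borel"
    by (intro borel_measurable_continuous_onI continuous_intros continuous_on_lam_right)
  have "fourier (\<lambda>x. complex_of_real (lam y x)) \<theta> = (\<integral>x. cis (- ((x + y) \<bullet> \<theta>)) * complex_of_real (lam y (x + y)) \<partial>lborel)"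
    unfolding fourier_def by (rule lborel_integral_shift(4)[OF m, symmetric])
  also have "\<dots> = (\<integral>x. cis (- (y \<bullet> \<theta>)) * (cis (- (x \<bullet> \<theta>)) * complex_of_real (lam 0 x)) \<partial>lborel)"
  proof (intro Bochner_Integration.integral_cong refl)
    fix x
    have "lam y (x + y) = lam 0 x" by (simp add: lam_translate(1)[of y])
    moreover have "cis (- ((x + y) \<bullet> \<theta>)) = cis (- (y \<bullet> \<theta>)) * cis (- (x \<bullet> \<theta>))"
      by (simp add: cis_mult inner_add_left algebra_simps)
    ultimately show "cis (- ((x + y) \<bullet> \<theta>)) * complex_of_real (lam y (x + y)) = cis (- (y \<bullet> \<theta>)) * (cis (- (x \<bullet> \<theta>)) * complex_of_real (lam 0 x))"
      by simp
  qed
  also have "\<dots> = cis (- (y \<bullet> \<theta>)) * fourier (\<lambda>x. complex_of_real (lam 0 x)) \<theta>"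
    unfolding fourier_def by (rule integral_mult_right_zero)
  finally show ?thesis .
qed

text \<open>The product in x becomes a convolution in frequency, and the translation of the weight
  by y becomes oscillation in y. Apart from a unimodular factor the right side is thus an inverse
  Fourier transform with y as the space variable, ready for Plancherel in y.\<close>

lemma fourier_lam_mult:
  fixes u :: "real^'n \<Rightarrow> complex"
  assumes u: "rapid u"
  shows "complex_of_real ((2 * pi) ^ CARD('n)) * fourier (\<lambda>x. complex_of_real (lam y x) * u x) \<xi>
    = cis (- (y \<bullet> \<xi>)) * (\<integral>\<eta>. cis (y \<bullet> \<eta>) * (fourier (\<lambda>x. complex_of_real (lam 0 x)) (\<xi> - \<eta>) * fourier u \<eta>) \<partial>lborel)"
proof -
  let ?F = "fourier u"
  let ?P = "\<lambda>p. cis (- (fst p \<bullet> (\<xi> - snd p))) * complex_of_real (lam y (fst p)) * ?F (snd p)"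
  have P: "integrable lborel ?P"
  proof (rule integrable_lborel_prod_bound[where g="lam y" and h="\<lambda>\<eta>. norm (?F \<eta>)"])
    show "?P \<in> borel_measurable borel"
      by (intro borel_measurable_continuous_onI continuous_intros continuous_on_compose2[OF continuous_on_lam_right]
          continuous_on_compose2[OF rapid_fourier_continuous[OF u]]) auto
  qed (use rapid_fourier_integrable[OF u] in \<open>simp_all add: lam_integrable norm_mult abs_of_pos[OF lam_pos]\<close>)
  have "complex_of_real ((2 * pi) ^ CARD('n)) * fourier (\<lambda>x. complex_of_real (lam y x) * u x) \<xi>
     = (\<integral>x. complex_of_real ((2 * pi) ^ CARD('n)) * (cis (- (x \<bullet> \<xi>)) * (complex_of_real (lam y x) * u x)) \<partial>lborel)"
    unfolding fourier_def by (rule integral_mult_right_zero[symmetric])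
  also have "\<dots> = (\<integral>x. \<integral>\<eta>. ?P (x, \<eta>) \<partial>lborel \<partial>lborel)"
  proof (intro Bochner_Integration.integral_cong refl)
    fix x
    have "(\<integral>\<eta>. ?P (x, \<eta>) \<partial>lborel) = (\<integral>\<eta>. (cis (- (x \<bullet> \<xi>)) * complex_of_real (lam y x)) * (cis (x \<bullet> \<eta>) * ?F \<eta>) \<partial>lborel)"
    proof (intro Bochner_Integration.integral_cong refl)
      fix \<eta>
      have "cis (- (x \<bullet> (\<xi> - \<eta>))) = cis (- (x \<bullet> \<xi>)) * cis (x \<bullet> \<eta>)" by (simp add: cis_mult inner_diff_right)
      then show "?P (x, \<eta>) = (cis (- (x \<bullet> \<xi>)) * complex_of_real (lam y x)) * (cis (x \<bullet> \<eta>) * ?F \<eta>)" by simp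
    qed
    also have "\<dots> = (cis (- (x \<bullet> \<xi>)) * complex_of_real (lam y x)) * (complex_of_real ((2 * pi) ^ CARD('n)) * u x)"
      unfolding rapid_inversion[OF u, symmetric] by (rule integral_mult_right_zero)
    finally show "complex_of_real ((2 * pi) ^ CARD('n)) * (cis (- (x \<bullet> \<xi>)) * (complex_of_real (lam y x) * u x)) = (\<integral>\<eta>. ?P (x, \<eta>) \<partial>lborel)"
      by (simp only: mult_ac)
  qed
  also have "\<dots> = (\<integral>\<eta>. \<integral>x. ?P (x, \<eta>) \<partial>lborel \<partial>lborel)"
    using lborel_fubini(1,2)[OF P] by simp
  also have "\<dots> = (\<integral>\<eta>. cis (- (y \<bullet> \<xi>)) * (cis (y \<bullet> \<eta>) * (fourier (\<lambda>x. complex_of_real (lam 0 x)) (\<xi> - \<eta>) * ?F \<eta>)) \<partial>lborel)"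
  proof (intro Bochner_Integration.integral_cong refl)
    fix \<eta>
    have "(\<integral>x. ?P (x, \<eta>) \<partial>lborel) = fourier (\<lambda>x. complex_of_real (lam y x)) (\<xi> - \<eta>) * ?F \<eta>"
      unfolding fourier_def[of "\<lambda>x. complex_of_real (lam y x)"] fst_conv snd_conv by (rule integral_mult_left_zero)
    also have "cis (- (y \<bullet> (\<xi> - \<eta>))) = cis (- (y \<bullet> \<xi>)) * cis (y \<bullet> \<eta>)" by (simp add: cis_mult inner_diff_right)
    then have "fourier (\<lambda>x. complex_of_real (lam y x)) (\<xi> - \<eta>) = cis (- (y \<bullet> \<xi>)) * cis (y \<bullet> \<eta>) * fourier (\<lambda>x. complex_of_real (lam 0 x)) (\<xi> - \<eta>)"
      unfolding fourier_lam_translate[of y] by simp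
    finally show "(\<integral>x. ?P (x, \<eta>) \<partial>lborel) = cis (- (y \<bullet> \<xi>)) * (cis (y \<bullet> \<eta>) * (fourier (\<lambda>x. complex_of_real (lam 0 x)) (\<xi> - \<eta>) * ?F \<eta>))"
      by (simp only: mult.assoc)
  qed
  also have "\<dots> = cis (- (y \<bullet> \<xi>)) * (\<integral>\<eta>. cis (y \<bullet> \<eta>) * (fourier (\<lambda>x. complex_of_real (lam 0 x)) (\<xi> - \<eta>) * ?F \<eta>) \<partial>lborel)"
    by (rule integral_mult_right_zero)
  finally show ?thesis .
qed

text \<open>Plancherel in y at fixed xi gives the convolution of |L|^2 with the squared transform of
  u. Peetre's inequality exchanges 1 / <xi> for 1 / <eta> at the cost of one power of <xi - eta>,
  and the remaining xi-integral is a constant.\<close>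

lemma energy_average:
  "\<exists>K\<ge>0. \<forall>u :: real^'n \<Rightarrow> complex. rapid u \<longrightarrow>
     integrable lborel (\<lambda>y. energy (fourier (\<lambda>x. complex_of_real (lam y x) * u x))) \<and>
     (\<integral>y. energy (fourier (\<lambda>x. complex_of_real (lam y x) * u x)) \<partial>lborel) \<le> K * energy (fourier u)"
proof -
  let ?n = "CARD('n)"
  define L where "L = fourier (\<lambda>x::real^'n. complex_of_real (lam 0 x))"
  \<comment> \<open>Decay of order n + 1 gives order 2n + 2 for the square of L; one power goes to
    Peetre's inequality, and more than the 2n needed for integrability remain.\<close>
  obtain K0 where K0: "\<And>\<theta>. norm (L \<theta>) \<le> K0 / jbracket \<theta> ^ (?n + 1)"
  proof -
    obtain C where "\<forall>y::real^'n. wb (\<lambda>_. 0) (?n + 1) C (\<lambda>_. lam y) (\<lambda>x. complex_of_real (lam y x))"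
      using lam_wb[of "?n + 1", where 'a="real^'n"] by blast
    then have w: "wb (\<lambda>_. 0) (?n + 1) C (\<lambda>_. lam 0) (\<lambda>x::real^'n. complex_of_real (lam 0 x))" by blast
    show ?thesis
      using fourier_decay[OF w lam_integrable] that unfolding L_def by blast
  qed
  have Lc: "continuous_on UNIV L" unfolding L_def
    by (rule fourier_continuous) (simp add: complex_of_real_integrable_eq lam_integrable)
  have L1: "norm (L \<theta>) \<le> \<bar>K0\<bar>" for \<theta>
  proof -
    have "norm (L \<theta>) \<le> \<bar>K0\<bar> / jbracket \<theta> ^ (?n + 1)"
      by (rule order_trans[OF K0]) (simp add: divide_right_mono less_imp_le[OF jbracket_pos])
    also have "\<dots> \<le> \<bar>K0\<bar> / 1"
      by (intro divide_left_mono one_le_power jbracket_ge_1) (simp_all add: jbracket_pos)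
    finally show ?thesis by simp
  qed
  let ?w = "\<lambda>\<theta>::real^'n. 1 / jbracket \<theta> ^ (2 * ?n)"
  have wi: "integrable lborel ?w" by (rule integrable_jbracket) simp
  define c where "c = (2 * pi) ^ ?n"
  have c: "c > 0" unfolding c_def by simp
  define K where "K = (2 * K0\<^sup>2 * integral\<^sup>L lborel ?w) / c"
  have main: "integrable lborel (\<lambda>y. energy (fourier (\<lambda>x. complex_of_real (lam y x) * u x))) \<and>
     (\<integral>y. energy (fourier (\<lambda>x. complex_of_real (lam y x) * u x)) \<partial>lborel) \<le> K * energy (fourier u)"
    if u: "rapid u" for u :: "real^'n \<Rightarrow> complex"
  proof -
    let ?F = "fourier u"
    obtain M where M: "\<And>\<xi>. norm (?F \<xi>) \<le> M" using rapid_fourier_bounded[OF u] by blast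
    have Fc: "continuous_on UNIV ?F" by (rule rapid_fourier_continuous[OF u])
    have Fi: "integrable lborel ?F" by (rule rapid_fourier_integrable[OF u])
    define J where "J p = (\<integral>\<eta>. cis (snd p \<bullet> \<eta>) * (L (fst p - \<eta>) * ?F \<eta>) \<partial>lborel)" for p :: "(real^'n) \<times> (real^'n)"
    have Gc: "continuous_on UNIV (\<lambda>\<eta>. L (\<xi> - \<eta>) * ?F \<eta>)" for \<xi>
      by (intro continuous_intros continuous_on_compose2[OF Lc] Fc) auto
    have Gb: "norm (L (\<xi> - \<eta>) * ?F \<eta>) \<le> \<bar>K0\<bar> * norm (?F \<eta>)" for \<xi> \<eta>
      unfolding norm_mult by (rule mult_right_mono[OF L1]) simp
    have Gb': "norm (L (\<xi> - \<eta>) * ?F \<eta>) \<le> \<bar>K0\<bar> * M" for \<xi> \<eta>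
      by (rule order_trans[OF Gb]) (intro mult_left_mono M, simp)
    have Gi: "integrable lborel (\<lambda>\<eta>. L (\<xi> - \<eta>) * ?F \<eta>)" for \<xi>
    proof (rule Bochner_Integration.integrable_bound)
      show "integrable lborel (\<lambda>\<eta>. \<bar>K0\<bar> * norm (?F \<eta>))" using Fi by simp
      show "(\<lambda>\<eta>. L (\<xi> - \<eta>) * ?F \<eta>) \<in> borel_measurable lborel"
        using borel_measurable_continuous_onI[OF Gc] by simp
      show "AE \<eta> in lborel. norm (L (\<xi> - \<eta>) * ?F \<eta>) \<le> norm (\<bar>K0\<bar> * norm (?F \<eta>))"
        by (intro AE_I2 order_trans[OF Gb]) simp
    qed
    have Jc: "continuous_on UNIV J"
      unfolding J_def
    proof (rule continuous_integral_dominated[where g="\<lambda>\<eta>. \<bar>K0\<bar> * norm (?F \<eta>)"])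
      show "(\<lambda>\<eta>. cis (snd p \<bullet> \<eta>) * (L (fst p - \<eta>) * ?F \<eta>)) \<in> borel_measurable lborel" for p
        by (simp, intro borel_measurable_continuous_onI continuous_intros continuous_on_compose2[OF Lc] Fc) auto
      show "continuous_on UNIV (\<lambda>p. cis (snd p \<bullet> \<eta>) * (L (fst p - \<eta>) * ?F \<eta>))" for \<eta>
        by (intro continuous_intros continuous_on_compose2[OF Lc]) auto
      show "norm (cis (snd p \<bullet> \<eta>) * (L (fst p - \<eta>) * ?F \<eta>)) \<le> \<bar>K0\<bar> * norm (?F \<eta>)" for p \<eta>
        using Gb[of "fst p" \<eta>] by (simp add: norm_mult)
      show "integrable lborel (\<lambda>\<eta>. \<bar>K0\<bar> * norm (?F \<eta>))" using Fi by simp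
    qed
    have wy: "c * norm (fourier (\<lambda>x. complex_of_real (lam y x) * u x) \<xi>) = norm (J (\<xi>, y))" for y \<xi>
      using arg_cong[OF fourier_lam_mult[OF u, of y \<xi>], of norm] c
      unfolding norm_mult norm_of_real c_def[symmetric] norm_cis J_def fst_conv snd_conv L_def by (simp only: abs_of_pos mult_1_left)
    define \<Psi> where "\<Psi> p = (norm (J p))\<^sup>2 / (c\<^sup>2 * jbracket (fst p))" for p
    have \<Psi>: "(norm (fourier (\<lambda>x. complex_of_real (lam y x) * u x) \<xi>))\<^sup>2 / jbracket \<xi> = \<Psi> (\<xi>, y)" for y \<xi>
      unfolding \<Psi>_def wy[symmetric] using c by (simp add: power_mult_distrib)
    have \<Psi>m: "\<Psi> \<in> borel_measurable borel"
      unfolding \<Psi>_def using c by (intro borel_measurable_continuous_onI continuous_intros Jc) auto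
    define \<Phi> where "\<Phi> p = (norm (L (snd p - fst p) * ?F (fst p)))\<^sup>2 / jbracket (snd p)" for p
    have \<Phi>c: "continuous_on UNIV \<Phi>" unfolding \<Phi>_def
      by (intro continuous_intros continuous_on_compose2[OF Lc] continuous_on_compose2[OF Fc]) auto
    note conv = integral_convolution(1,2)[OF rapid_energy_integrable[OF u] wi]
    have \<Phi>le: "\<Phi> p \<le> (2 * K0\<^sup>2) * ((norm (?F (fst p)))\<^sup>2 / jbracket (fst p) * ?w (snd p - fst p))" for p
    proof -
      obtain \<eta> \<xi> where p: "p = (\<eta>, \<xi>)" by (cases p)
      let ?j = "jbracket (\<xi> - \<eta>)"
      have j: "1 \<le> ?j" "0 < ?j" "0 < jbracket \<xi>" "0 < jbracket \<eta>" by (simp_all add: jbracket_ge_1 jbracket_pos)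
      have "jbracket \<eta> \<le> 2 * (?j * jbracket \<xi>)"
        using jbracket_peetre[of \<eta> \<xi>] jbracket_minus[of \<eta> \<xi>] by simp
      then have i: "1 / jbracket \<xi> \<le> 2 * ?j / jbracket \<eta>" using j by (simp add: field_simps)
      have "(norm (L (\<xi> - \<eta>)))\<^sup>2 \<le> (K0 / ?j ^ (?n + 1))\<^sup>2" by (intro power_mono K0) simp
      also have "\<dots> = K0\<^sup>2 * (1 / ?j ^ (2 * ?n + 2))"
      proof -
        have "(?n + 1) * 2 = 2 * ?n + 2" by simp
        then have "(?j ^ (?n + 1))\<^sup>2 = ?j ^ (2 * ?n + 2)" by (metis power_mult)
        then show ?thesis by (simp only: power_divide times_divide_eq_right mult_1_right)
      qed
      finally have l: "(norm (L (\<xi> - \<eta>)))\<^sup>2 \<le> K0\<^sup>2 * (1 / ?j ^ (2 * ?n + 2))" .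
      have "\<Phi> p = (norm (L (\<xi> - \<eta>)))\<^sup>2 * (1 / jbracket \<xi>) * (norm (?F \<eta>))\<^sup>2"
        by (simp add: \<Phi>_def p norm_mult power_mult_distrib)
      also have "\<dots> \<le> (K0\<^sup>2 * (1 / ?j ^ (2 * ?n + 2))) * (2 * ?j / jbracket \<eta>) * (norm (?F \<eta>))\<^sup>2"
        using j by (intro mult_right_mono mult_mono l i) auto
      also have "\<dots> = (2 * K0\<^sup>2) * ((norm (?F \<eta>))\<^sup>2 / jbracket \<eta> * (1 / ?j ^ (2 * ?n + 1)))"
        using j by (simp add: field_simps)
      also have "\<dots> \<le> (2 * K0\<^sup>2) * ((norm (?F \<eta>))\<^sup>2 / jbracket \<eta> * (1 / ?j ^ (2 * ?n)))"
      proof (intro mult_left_mono divide_left_mono power_increasing)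
        show "0 < ?j ^ (2 * ?n + 1) * ?j ^ (2 * ?n)" using j by (intro mult_pos_pos zero_less_power) auto
      qed (use j in auto)
      finally show ?thesis by (simp add: p)
    qed
    have \<Phi>0: "0 \<le> \<Phi> p" for p by (simp add: \<Phi>_def less_imp_le[OF jbracket_pos])
    have \<Phi>i: "integrable lborel \<Phi>"
    proof (rule Bochner_Integration.integrable_bound[OF integrable_mult_right[OF conv(1)]])
      show "\<Phi> \<in> borel_measurable lborel" using borel_measurable_continuous_onI[OF \<Phi>c] by simp
      show "AE p in lborel. norm (\<Phi> p) \<le> norm ((2 * K0\<^sup>2) * ((norm (?F (fst p)))\<^sup>2 / jbracket (fst p) * ?w (snd p - fst p)))"
        using order_trans[OF \<Phi>le abs_ge_self] \<Phi>0 by (intro AE_I2) (simp only: real_norm_def abs_of_nonneg)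
    qed
    have \<Phi>I: "integral\<^sup>L lborel \<Phi> \<le> (2 * K0\<^sup>2) * (energy ?F * integral\<^sup>L lborel ?w)"
    proof -
      have "integral\<^sup>L lborel \<Phi> \<le> (\<integral>p. (2 * K0\<^sup>2) * ((norm (?F (fst p)))\<^sup>2 / jbracket (fst p) * ?w (snd p - fst p)) \<partial>lborel)"
        by (rule integral_mono[OF \<Phi>i integrable_mult_right[OF conv(1)]]) (rule \<Phi>le)
      also have "\<dots> = (2 * K0\<^sup>2) * (\<integral>p. (norm (?F (fst p)))\<^sup>2 / jbracket (fst p) * ?w (snd p - fst p) \<partial>lborel)"
        by (rule integral_mult_right_zero)
      finally show ?thesis unfolding conv(2) energy_def .
    qed
    have pl: "integrable lborel (\<lambda>y. (norm (J (\<xi>, y)))\<^sup>2)"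
      "(\<integral>y. (norm (J (\<xi>, y)))\<^sup>2 \<partial>lborel) = c * (\<integral>\<eta>. (norm (L (\<xi> - \<eta>) * ?F \<eta>))\<^sup>2 \<partial>lborel)" for \<xi>
      using plancherel[OF Gc Gb' Gi, of \<xi>] unfolding J_def c_def by simp_all
    have inner: "(\<integral>y. \<Psi> (\<xi>, y) \<partial>lborel) = (\<integral>\<eta>. \<Phi> (\<eta>, \<xi>) \<partial>lborel) / c" for \<xi>
    proof -
      have "(\<integral>y. \<Psi> (\<xi>, y) \<partial>lborel) = c * (\<integral>\<eta>. (norm (L (\<xi> - \<eta>) * ?F \<eta>))\<^sup>2 \<partial>lborel) / (c\<^sup>2 * jbracket \<xi>)"
        unfolding \<Psi>_def fst_conv by (simp only: integral_divide_zero pl(2))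
      also have "\<dots> = (\<integral>\<eta>. (norm (L (\<xi> - \<eta>) * ?F \<eta>))\<^sup>2 \<partial>lborel) / jbracket \<xi> / c"
        using c by (simp add: power2_eq_square)
      also have "(\<integral>\<eta>. (norm (L (\<xi> - \<eta>) * ?F \<eta>))\<^sup>2 \<partial>lborel) / jbracket \<xi> = (\<integral>\<eta>. \<Phi> (\<eta>, \<xi>) \<partial>lborel)"
        unfolding \<Phi>_def fst_conv snd_conv by (simp only: integral_divide_zero)
      finally show ?thesis .
    qed
    have \<Psi>0: "0 \<le> \<Psi> p" for p using c by (simp add: \<Psi>_def less_imp_le[OF jbracket_pos])
    have "integrable (lborel \<Otimes>\<^sub>M lborel) \<Psi>"
    proof (rule lborel_pair.Fubini_integrable)
      show "\<Psi> \<in> borel_measurable (lborel \<Otimes>\<^sub>M lborel)" using \<Psi>m by (simp add: lborel_prod)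
      have "(\<lambda>\<xi>. \<integral>y. norm (\<Psi> (\<xi>, y)) \<partial>lborel) = (\<lambda>\<xi>. (\<integral>\<eta>. \<Phi> (\<eta>, \<xi>) \<partial>lborel) / c)"
        using \<Psi>0 inner by simp
      then show "integrable lborel (\<lambda>\<xi>. \<integral>y. norm (\<Psi> (\<xi>, y)) \<partial>lborel)"
        using lborel_fubini(4)[OF \<Phi>i] by simp
      show "AE \<xi> in lborel. integrable lborel (\<lambda>y. \<Psi> (\<xi>, y))"
        using pl(1) by (intro AE_I2) (simp add: \<Psi>_def)
    qed
    then have \<Psi>i: "integrable lborel \<Psi>" by (simp add: lborel_prod)
    have en: "energy (fourier (\<lambda>x. complex_of_real (lam y x) * u x)) = (\<integral>\<xi>. \<Psi> (\<xi>, y) \<partial>lborel)" for y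
      unfolding energy_def \<Psi> ..
    have "(\<integral>y. energy (fourier (\<lambda>x. complex_of_real (lam y x) * u x)) \<partial>lborel) = (\<integral>\<xi>. (\<integral>\<eta>. \<Phi> (\<eta>, \<xi>) \<partial>lborel) / c \<partial>lborel)"
      unfolding en inner[symmetric] using lborel_fubini(1,2)[OF \<Psi>i] by simp
    also have "\<dots> = integral\<^sup>L lborel \<Phi> / c"
      using lborel_fubini(2)[OF \<Phi>i] by simp
    also have "\<dots> \<le> (2 * K0\<^sup>2) * (energy ?F * integral\<^sup>L lborel ?w) / c"
      using \<Phi>I c by (intro divide_right_mono) auto
    also have "\<dots> = K * energy ?F" by (simp add: K_def)
    finally show ?thesis
      unfolding en using lborel_fubini(4)[OF \<Psi>i] by blast
  qed
  have "0 \<le> integral\<^sup>L lborel ?w" by (rule integral_nonneg_AE) (simp add: less_imp_le[OF jbracket_pos])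
  then have "0 \<le> K" unfolding K_def using c by simp
  with main show ?thesis by blast
qed

section \<open>The localised form and its Friedrichs symmetrisation\<close>

definition loc_form :: "real^'n::finite \<Rightarrow> 'n symbol \<Rightarrow> (real^'n \<Rightarrow> complex) \<Rightarrow> (real^'n \<Rightarrow> complex) \<Rightarrow> complex" where
  "loc_form y a G1 G2 = (\<integral>x. complex_of_real (lam y x) * (\<integral>\<xi>. cis (x \<bullet> \<xi>) * a (x, \<xi>) * G1 \<xi> \<partial>lborel)
      * cnj (\<integral>\<eta>. cis (x \<bullet> \<eta>) * G2 \<eta> \<partial>lborel) \<partial>lborel)"

text \<open>The contribution of the window at \<open>\<zeta>\<close> to the Friedrichs
  symmetrisation. The symbol is frozen at the frequency \<open>\<zeta>\<close>, so its quantisation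
  is multiplication by a function of x and pointwise positivity carries over to the form.\<close>

definition sym_form :: "real^'n::finite \<Rightarrow> 'n symbol \<Rightarrow> (real^'n \<Rightarrow> complex) \<Rightarrow> (real^'n \<Rightarrow> complex) \<Rightarrow> real^'n \<Rightarrow> complex" where
  "sym_form y a G1 G2 \<zeta> = loc_form y (\<lambda>z. a (fst z, \<zeta>))
      (\<lambda>\<xi>. complex_of_real (fr \<xi> \<zeta>) * G1 \<xi>) (\<lambda>\<xi>. complex_of_real (fr \<xi> \<zeta>) * G2 \<xi>)"

lemma fr_mult_G:
  fixes G :: "real^'n \<Rightarrow> complex"
  assumes c: "continuous_on UNIV G" and i: "integrable lborel G"
  shows "continuous_on UNIV (\<lambda>\<xi>. complex_of_real (fr \<xi> \<zeta>) * G \<xi>)" "integrable lborel (\<lambda>\<xi>. complex_of_real (fr \<xi> \<zeta>) * G \<xi>)"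
    "norm (complex_of_real (fr \<xi> \<zeta>) * G \<xi>) \<le> norm (G \<xi>)"
proof -
  have le: "norm (complex_of_real (fr \<xi> \<zeta>) * G \<xi>) \<le> norm (G \<xi>)" for \<xi>
    using mult_right_mono[OF fr_le_1[of \<xi> \<zeta>] norm_ge_zero[of "G \<xi>"]] by (simp add: norm_mult abs_of_pos[OF fr_pos])
  show "norm (complex_of_real (fr \<xi> \<zeta>) * G \<xi>) \<le> norm (G \<xi>)" by (rule le)
  show cc: "continuous_on UNIV (\<lambda>\<xi>. complex_of_real (fr \<xi> \<zeta>) * G \<xi>)"
    by (intro continuous_intros continuous_on_fr_left c)
  show "integrable lborel (\<lambda>\<xi>. complex_of_real (fr \<xi> \<zeta>) * G \<xi>)"
    by (rule Bochner_Integration.integrable_bound[OF i]) (use borel_measurable_continuous_onI[OF cc] le in auto)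
qed

text \<open>Exchanging the \<open>\<zeta>\<close>-integral with the frequency integrals shows that
  symmetrisation replaces the kernel \<open>locfou\<close> at xi by its mean against
  \<open>fr \<xi> * fr \<eta>\<close>. Absolute convergence comes from
  \<open>overlap_le_1\<close>.\<close>

lemma sym_form_integral:
  fixes a :: "'n::finite symbol"
  assumes c: "continuous_on UNIV a" and b: "\<And>z. norm (a z) \<le> C"
    and c1: "continuous_on UNIV G1" and i1: "integrable lborel G1"
    and c2: "continuous_on UNIV G2" and i2: "integrable lborel G2"
  shows "integrable lborel (sym_form y a G1 G2)"
    and "(\<integral>\<zeta>. sym_form y a G1 G2 \<zeta> \<partial>lborel)
      = (\<integral>p. (\<integral>\<zeta>. locfou y a (snd p - fst p) \<zeta> * complex_of_real (fr (fst p) \<zeta> * fr (snd p) \<zeta>) \<partial>lborel) * G1 (fst p) * cnj (G2 (snd p)) \<partial>lborel)"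
    and "integrable lborel (\<lambda>p. (\<integral>\<zeta>. locfou y a (snd p - fst p) \<zeta> * complex_of_real (fr (fst p) \<zeta> * fr (snd p) \<zeta>) \<partial>lborel) * G1 (fst p) * cnj (G2 (snd p)))"
proof -
  define M where "M = C * integral\<^sup>L lborel (lam (0 :: real^'n))"
  have Hb: "norm (locfou y a \<theta> \<zeta>) \<le> M" for \<theta> \<zeta> unfolding M_def by (rule locfou_norm_le[OF b])
  have M: "0 \<le> M" using order_trans[OF norm_ge_zero Hb] .
  define P where "P q = locfou y a (snd (fst q) - fst (fst q)) (snd q) * complex_of_real (fr (fst (fst q)) (snd q) * fr (snd (fst q)) (snd q))
      * (G1 (fst (fst q)) * cnj (G2 (snd (fst q))))" for q
  have Pm: "P \<in> borel_measurable borel"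
    unfolding P_def
    by (intro borel_measurable_continuous_onI continuous_intros
        continuous_on_compose2[OF continuous_on_locfou[OF c b], of UNIV "\<lambda>q. (snd (fst q) - fst (fst q), snd q)", simplified]
        continuous_on_compose2[OF continuous_on_fr, of UNIV "\<lambda>q. (fst (fst q), snd q)", simplified]
        continuous_on_compose2[OF continuous_on_fr, of UNIV "\<lambda>q. (snd (fst q), snd q)", simplified]
        continuous_on_compose2[OF c1] continuous_on_compose2[OF c2]) auto
  have GG: "integrable lborel (\<lambda>p. norm (G1 (fst p)) * norm (G2 (snd p)))"
    by (rule lborel_integral_times(1)) (use i1 i2 in auto)
  have Pb: "norm (P (p, \<zeta>)) \<le> M * (norm (G1 (fst p)) * norm (G2 (snd p))) * (fr (fst p) \<zeta> * fr (snd p) \<zeta>)" for p \<zeta>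
  proof -
    have "norm (P (p, \<zeta>)) = norm (locfou y a (snd p - fst p) \<zeta>) * ((fr (fst p) \<zeta> * fr (snd p) \<zeta>) * (norm (G1 (fst p)) * norm (G2 (snd p))))"
      by (simp add: P_def norm_mult abs_of_pos[OF fr_pos])
    also have "\<dots> \<le> M * ((fr (fst p) \<zeta> * fr (snd p) \<zeta>) * (norm (G1 (fst p)) * norm (G2 (snd p))))"
      using fr_pos by (intro mult_right_mono Hb mult_nonneg_nonneg) (auto intro: less_imp_le)
    finally show ?thesis by (simp only: mult_ac)
  qed
  have Pi1: "integrable lborel (\<lambda>\<zeta>. P (p, \<zeta>))" for p
  proof (rule Bochner_Integration.integrable_bound)
    show "integrable lborel (\<lambda>\<zeta>. M * (norm (G1 (fst p)) * norm (G2 (snd p))) * (fr (fst p) \<zeta> * fr (snd p) \<zeta>))"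
      by (rule integrable_mult_right[OF fr_mult_integrable])
    show "(\<lambda>\<zeta>. P (p, \<zeta>)) \<in> borel_measurable lborel"
    proof -
      have "(\<lambda>\<zeta>. (p, \<zeta>)) \<in> borel_measurable borel" by (intro borel_measurable_continuous_onI continuous_intros)
      from measurable_compose[OF this Pm] show ?thesis by simp
    qed
    show "AE \<zeta> in lborel. norm (P (p, \<zeta>)) \<le> norm (M * (norm (G1 (fst p)) * norm (G2 (snd p))) * (fr (fst p) \<zeta> * fr (snd p) \<zeta>))"
      using order_trans[OF Pb abs_ge_self] by (intro AE_I2) (simp only: real_norm_def)
  qed
  have "integrable (lborel \<Otimes>\<^sub>M lborel) P"
  proof (rule lborel_pair.Fubini_integrable)
    show Pm': "P \<in> borel_measurable (lborel \<Otimes>\<^sub>M lborel)" using Pm by (simp add: lborel_prod)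
    show "AE p in lborel. integrable lborel (\<lambda>\<zeta>. P (p, \<zeta>))" using Pi1 by simp
    show "integrable lborel (\<lambda>p. \<integral>\<zeta>. norm (P (p, \<zeta>)) \<partial>lborel)"
    proof (rule Bochner_Integration.integrable_bound)
      show "integrable lborel (\<lambda>p. M * (norm (G1 (fst p)) * norm (G2 (snd p))))" using GG by simp
      show "(\<lambda>p. \<integral>\<zeta>. norm (P (p, \<zeta>)) \<partial>lborel) \<in> borel_measurable lborel"
        using Pm' by (intro lborel.borel_measurable_lebesgue_integral) simp
      have "(\<integral>\<zeta>. norm (P (p, \<zeta>)) \<partial>lborel) \<le> M * (norm (G1 (fst p)) * norm (G2 (snd p)))" for p
      proof -
        have "(\<integral>\<zeta>. norm (P (p, \<zeta>)) \<partial>lborel) \<le> (\<integral>\<zeta>. M * (norm (G1 (fst p)) * norm (G2 (snd p))) * (fr (fst p) \<zeta> * fr (snd p) \<zeta>) \<partial>lborel)"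
          by (rule integral_mono[OF integrable_norm[OF Pi1] integrable_mult_right[OF fr_mult_integrable]]) (rule Pb)
        also have "\<dots> = M * (norm (G1 (fst p)) * norm (G2 (snd p))) * overlap (fst p) (snd p)"
          unfolding overlap_def by (rule integral_mult_right_zero)
        also have "\<dots> \<le> M * (norm (G1 (fst p)) * norm (G2 (snd p))) * 1"
          using M by (intro mult_left_mono overlap_le_1) simp
        finally show ?thesis by simp
      qed
      then show "AE p in lborel. norm (\<integral>\<zeta>. norm (P (p, \<zeta>)) \<partial>lborel) \<le> norm (M * (norm (G1 (fst p)) * norm (G2 (snd p))))"
        using M by (intro AE_I2) simp
    qed
  qed
  then have Pi: "integrable lborel P" by (simp add: lborel_prod)
  have e1: "(\<integral>\<zeta>. P (p, \<zeta>) \<partial>lborel) = (\<integral>\<zeta>. locfou y a (snd p - fst p) \<zeta> * complex_of_real (fr (fst p) \<zeta> * fr (snd p) \<zeta>) \<partial>lborel) * G1 (fst p) * cnj (G2 (snd p))" for p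
    unfolding P_def fst_conv snd_conv mult.assoc[of _ "G1 _"] by (rule integral_mult_left_zero)
  have e2: "(\<integral>p. P (p, \<zeta>) \<partial>lborel) = sym_form y a G1 G2 \<zeta>" for \<zeta>
  proof -
    have c': "continuous_on UNIV (\<lambda>z::(real^'n)\<times>(real^'n). a (fst z, \<zeta>))"
      by (intro continuous_on_compose2[OF c] continuous_intros) auto
    have lf: "locfou y (\<lambda>z. a (fst z, \<zeta>)) \<theta> \<xi> = locfou y a \<theta> \<zeta>" for \<theta> \<xi> by (simp add: locfou_def)
    have "sym_form y a G1 G2 \<zeta> = (\<integral>p. locfou y a (snd p - fst p) \<zeta> * (complex_of_real (fr (fst p) \<zeta>) * G1 (fst p)) * cnj (complex_of_real (fr (snd p) \<zeta>) * G2 (snd p)) \<partial>lborel)"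
      unfolding sym_form_def loc_form_def
      by (subst bilinear_fourier(1)[OF c' b fr_mult_G(1,2)[OF c1 i1] fr_mult_G(1,2)[OF c2 i2]]) (simp only: lf)
    also have "\<dots> = (\<integral>p. P (p, \<zeta>) \<partial>lborel)"
      by (intro Bochner_Integration.integral_cong refl) (simp add: P_def mult_ac)
    finally show ?thesis ..
  qed
  show "integrable lborel (sym_form y a G1 G2)" using lborel_fubini(4)[OF Pi] unfolding e2 .
  show "(\<integral>\<zeta>. sym_form y a G1 G2 \<zeta> \<partial>lborel)
      = (\<integral>p. (\<integral>\<zeta>. locfou y a (snd p - fst p) \<zeta> * complex_of_real (fr (fst p) \<zeta> * fr (snd p) \<zeta>) \<partial>lborel) * G1 (fst p) * cnj (G2 (snd p)) \<partial>lborel)"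
    using lborel_fubini(1,2)[OF Pi] unfolding e1 e2 by simp
  show "integrable lborel (\<lambda>p. (\<integral>\<zeta>. locfou y a (snd p - fst p) \<zeta> * complex_of_real (fr (fst p) \<zeta> * fr (snd p) \<zeta>) \<partial>lborel) * G1 (fst p) * cnj (G2 (snd p)))"
    using lborel_fubini(3)[OF Pi] unfolding e1 .
qed

text \<open>The count of derivatives: 2n + 1 powers of <eta - xi> for \<open>schur_estimate\<close>,
  2 more for the quadratic loss in \<open>friedrichs_kernel\<close>, 2 for second differences in xi,
  and one for each direction consumed by \<open>conj_symbol\<close>.\<close>

definition smoothness_order :: "'n::finite itself \<Rightarrow> nat" where
  "smoothness_order _ = (2 * CARD('n) + 5) + length (basis_dirs :: (real^'n) list)"

text \<open>The localised form carries the conjugated symbol, while the symmetrisation is formed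
  with a itself, for which positivity is known. This is allowed because the two symbols differ by
  order -1, the size of the error of symmetrisation.\<close>

lemma form_difference:
  "\<exists>K\<ge>0. \<forall>y C (a :: 'n::finite symbol) w1 w2. 0 \<le> C \<longrightarrow> wb xi_deg (smoothness_order TYPE('n)) C xi_weight a \<longrightarrow> rapid w1 \<longrightarrow> rapid w2 \<longrightarrow>
     norm (loc_form y (conj_symbol y basis_dirs a) (fourier w1) (fourier w2) - (\<integral>\<zeta>. sym_form y a (fourier w1) (fourier w2) \<zeta> \<partial>lborel))
       \<le> K * C * (energy (fourier w1) + energy (fourier w2))"
proof -
  let ?n = "CARD('n)"
  let ?bs = "basis_dirs :: (real^'n) list"
  obtain K1 where K1: "K1 \<ge> 0" and cs: "\<And>y C (a :: 'n symbol). 0 \<le> C \<Longrightarrow> wb xi_deg ((2 * ?n + 5) + length ?bs) C xi_weight a \<Longrightarrow>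
     wb xi_deg (2 * ?n + 5) (K1 * C) xi_weight (conj_symbol y ?bs a) \<and>
     wb xi_deg (2 * ?n + 5) (K1 * C) (\<lambda>k. xi_weight (Suc k)) (\<lambda>z. conj_symbol y ?bs a z - a z)"
    using conj_symbol_wb[of ?bs "2 * ?n + 5"] by blast
  obtain K2 where K2: "K2 \<ge> 0" and lb: "\<And>y C (a :: 'n symbol) \<theta> \<xi> t. 0 \<le> C \<Longrightarrow> wb xi_deg ((2 * ?n + 3) + 2) C xi_weight a \<Longrightarrow>
     norm (locfou y a \<theta> \<xi>) \<le> K2 * C / jbracket \<theta> ^ (2 * ?n + 3) \<and>
     norm (locfou y a \<theta> (\<xi> + t) - locfou y a \<theta> \<xi>) \<le> K2 * C / jbracket \<theta> ^ (2 * ?n + 3) * (norm t / jbracket \<xi>) \<and>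
     norm (locfou y a \<theta> (\<xi> + t) + locfou y a \<theta> (\<xi> - t) - 2 * locfou y a \<theta> \<xi>) \<le> K2 * C / jbracket \<theta> ^ (2 * ?n + 3) * (norm t / jbracket \<xi>)\<^sup>2"
    using locfou_bounds[of "2 * ?n + 3", where 'n='n] by blast
  obtain K3 where K3: "K3 \<ge> 0" and lo: "\<And>y C (a :: 'n symbol) \<theta> \<xi>. 0 \<le> C \<Longrightarrow> wb xi_deg (2 * ?n + 1) C (\<lambda>k. xi_weight (Suc k)) a \<Longrightarrow>
     norm (locfou y a \<theta> \<xi>) \<le> K3 * C / jbracket \<theta> ^ (2 * ?n + 1) * (1 / jbracket \<xi>)"
    using locfou_lower_order[of "2 * ?n + 1", where 'n='n] by blast
  define K4 where "K4 = 2 * (real ?n + 1) + fr_moment_const TYPE('n)"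
  have K4: "K4 \<ge> 0" unfolding K4_def using fr_moment_const_nonneg[where 'n='n] by simp
  define W where "W = (\<integral>\<theta>. 1 / jbracket (\<theta>::real^'n) ^ (2 * ?n) \<partial>lborel)"
  have W: "0 \<le> W" unfolding W_def by (rule integral_nonneg_AE) (simp add: less_imp_le[OF jbracket_pos])
  define K where "K = (K3 * K1 + K4 * K2) * W"
  have main: "norm (loc_form y (conj_symbol y ?bs a) (fourier w1) (fourier w2) - (\<integral>\<zeta>. sym_form y a (fourier w1) (fourier w2) \<zeta> \<partial>lborel))
       \<le> K * C * (energy (fourier w1) + energy (fourier w2))"
    if C: "0 \<le> C" and a: "wb xi_deg ((2 * ?n + 5) + length ?bs) C xi_weight a" and w1: "rapid w1" and w2: "rapid w2"
    for y C and a :: "'n symbol" and w1 w2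
  proof -
    let ?G1 = "fourier w1" and ?G2 = "fourier w2"
    define b where "b = conj_symbol y ?bs a"
    have b: "wb xi_deg (2 * ?n + 5) (K1 * C) xi_weight b"
      and ba: "wb xi_deg (2 * ?n + 5) (K1 * C) (\<lambda>k. xi_weight (Suc k)) (\<lambda>z. b z - a z)"
      unfolding b_def using cs[OF C a] by blast+
    have ba': "wb xi_deg (2 * ?n + 1) (K1 * C) (\<lambda>k. xi_weight (Suc k)) (\<lambda>z. b z - a z)"
      by (rule wb_mono[OF ba]) simp_all
    have a': "wb xi_deg ((2 * ?n + 3) + 2) C xi_weight a" by (rule wb_mono[OF a]) simp_all
    note G = rapid_fourier_continuous[OF w1] rapid_fourier_integrable[OF w1] rapid_fourier_continuous[OF w2] rapid_fourier_integrable[OF w2]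
    note ac = wb_continuous[OF a] and bc = wb_continuous[OF b]
    note bf = bilinear_fourier[OF bc wb_xi_weight_bounded[OF b] G, of y]
    note sf = sym_form_integral[OF ac wb_xi_weight_bounded[OF a] G, of y]
    \<comment> \<open>The kernel of the difference. Writing b = a + (b - a), it splits into the
      transform of the symbol b - a of order -1 and the Friedrichs error for a; each carries the
      factor 1 / <xi>.\<close>
    define k where "k p = locfou y b (snd p - fst p) (fst p)
        - (\<integral>\<zeta>. locfou y a (snd p - fst p) \<zeta> * complex_of_real (fr (fst p) \<zeta> * fr (snd p) \<zeta>) \<partial>lborel)" for p
    have eq: "loc_form y b ?G1 ?G2 - (\<integral>\<zeta>. sym_form y a ?G1 ?G2 \<zeta> \<partial>lborel) = (\<integral>p. k p * ?G1 (fst p) * cnj (?G2 (snd p)) \<partial>lborel)"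
      unfolding loc_form_def bf(1) sf(2) k_def left_diff_distrib
      by (rule Bochner_Integration.integral_diff[OF bf(2) sf(3), symmetric])
    have kb: "norm (k p) \<le> ((K3 * K1 + K4 * K2) * C) / jbracket (snd p - fst p) ^ (2 * ?n + 1) * (1 / jbracket (fst p))" for p
    proof -
      obtain \<xi> \<eta> where p: "p = (\<xi>, \<eta>)" by (cases p)
      let ?\<theta> = "\<eta> - \<xi>"
      have j: "0 < jbracket ?\<theta>" "0 < jbracket \<xi>" by (rule jbracket_pos)+
      have split: "locfou y b ?\<theta> \<xi> = locfou y (\<lambda>z. b z - a z) ?\<theta> \<xi> + locfou y a ?\<theta> \<xi>"
      proof -
        have "integrable lborel (\<lambda>x. cis (- (x \<bullet> ?\<theta>)) * (complex_of_real (lam y x) * b (x, \<xi>)))"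
          "integrable lborel (\<lambda>x. cis (- (x \<bullet> ?\<theta>)) * (complex_of_real (lam y x) * a (x, \<xi>)))"
          by (rule fourier_integrable(1)[OF lam_mult_integrable[OF continuous_on_slice[OF bc] wb_xi_weight_bounded[OF b]]],
              rule fourier_integrable(1)[OF lam_mult_integrable[OF continuous_on_slice[OF ac] wb_xi_weight_bounded[OF a]]])
        then show ?thesis unfolding locfou_def fourier_def by (simp add: right_diff_distrib)
      qed
      define B where "B = K2 * C / jbracket ?\<theta> ^ (2 * ?n + 3)"
      have B: "0 \<le> B" unfolding B_def using K2 C j by simp
      have hc: "continuous_on UNIV (locfou y a ?\<theta>)"
        using continuous_on_compose2[OF continuous_on_locfou[OF ac wb_xi_weight_bounded[OF a], of y], of UNIV "\<lambda>\<zeta>. (?\<theta>, \<zeta>)"]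
        by (simp add: continuous_on_Pair)
      have fk: "norm ((\<integral>\<zeta>. locfou y a ?\<theta> \<zeta> * complex_of_real (fr \<xi> \<zeta> * fr \<eta> \<zeta>) \<partial>lborel) - locfou y a ?\<theta> \<xi>) \<le> K4 * B * (jbracket ?\<theta>)\<^sup>2 / jbracket \<xi>"
        unfolding K4_def
        by (rule friedrichs_kernel[OF hc B]) (use lb[OF C a'] in \<open>simp_all add: B_def\<close>)
      have "K4 * B * (jbracket ?\<theta>)\<^sup>2 / jbracket \<xi> = (K4 * K2 * C) / jbracket ?\<theta> ^ (2 * ?n + 1) * (1 / jbracket \<xi>)"
      proof -
        have "jbracket ?\<theta> ^ (2 * ?n + 3) = jbracket ?\<theta> ^ (2 * ?n + 1) * (jbracket ?\<theta>)\<^sup>2"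
        proof -
          have e: "2 * ?n + 3 = (2 * ?n + 1) + 2" by simp
          show ?thesis by (subst e) (rule power_add)
        qed
        then show ?thesis unfolding B_def using j by (simp add: power2_eq_square)
      qed
      note fk = fk[unfolded this]
      have lo': "norm (locfou y (\<lambda>z. b z - a z) ?\<theta> \<xi>) \<le> K3 * (K1 * C) / jbracket ?\<theta> ^ (2 * ?n + 1) * (1 / jbracket \<xi>)"
        by (rule lo[OF _ ba']) (use K1 C in simp)
      have "norm (k p) = norm (locfou y (\<lambda>z. b z - a z) ?\<theta> \<xi> - ((\<integral>\<zeta>. locfou y a ?\<theta> \<zeta> * complex_of_real (fr \<xi> \<zeta> * fr \<eta> \<zeta>) \<partial>lborel) - locfou y a ?\<theta> \<xi>))"
        unfolding k_def p fst_conv snd_conv split by (simp only: diff_diff_eq2)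
      also have "\<dots> \<le> K3 * (K1 * C) / jbracket ?\<theta> ^ (2 * ?n + 1) * (1 / jbracket \<xi>) + (K4 * K2 * C) / jbracket ?\<theta> ^ (2 * ?n + 1) * (1 / jbracket \<xi>)"
        by (rule order_trans[OF norm_triangle_ineq4 add_mono[OF lo' fk]])
      also have "\<dots> = ((K3 * K1 + K4 * K2) * C) / jbracket ?\<theta> ^ (2 * ?n + 1) * (1 / jbracket \<xi>)"
        by (simp only: distrib_right add_divide_distrib mult.assoc)
      finally show ?thesis unfolding p fst_conv snd_conv .
    qed
    have "norm (\<integral>p. k p * ?G1 (fst p) * cnj (?G2 (snd p)) \<partial>lborel) \<le> (K3 * K1 + K4 * K2) * C * W * (energy ?G1 + energy ?G2)"
      unfolding W_def
      by (rule schur_estimate[OF kb _ rapid_energy_integrable[OF w1] rapid_energy_integrable[OF w2]])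
        (use K1 K2 K3 K4 C in simp)
    then show ?thesis unfolding eq[symmetric] b_def[symmetric] K_def by (simp only: mult_ac)
  qed
  have "0 \<le> K" unfolding K_def using K1 K2 K3 K4 W by simp
  with main show ?thesis unfolding smoothness_order_def by blast
qed

section \<open>Positivity of the symmetrised form\<close>

lemma plancherel_fr:
  fixes G :: "real^'n \<Rightarrow> complex" and \<zeta> :: "real^'n"
  assumes c: "continuous_on UNIV G" and b: "\<And>x. norm (G x) \<le> M" and i: "integrable lborel G"
  defines "W \<equiv> \<lambda>x. \<integral>\<xi>. cis (x \<bullet> \<xi>) * (complex_of_real (fr \<xi> \<zeta>) * G \<xi>) \<partial>lborel"
  shows "integrable lborel (\<lambda>x. (norm (W x))\<^sup>2)"
    and "(\<integral>x. (norm (W x))\<^sup>2 \<partial>lborel) = (2 * pi) ^ CARD('n) * (\<integral>\<xi>. (norm (G \<xi>))\<^sup>2 * (fr \<xi> \<zeta>)\<^sup>2 \<partial>lborel)"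
  using plancherel[OF fr_mult_G(1)[OF c i] order_trans[OF fr_mult_G(3)[OF c i] b] fr_mult_G(2)[OF c i], of \<zeta>]
  unfolding W_def by (simp_all add: norm_mult power_mult_distrib mult.commute)

lemma sym_form_lower_bound:
  fixes a :: "'m::finite \<Rightarrow> 'm \<Rightarrow> 'n::finite symbol" and G :: "'m \<Rightarrow> real^'n \<Rightarrow> complex"
  assumes ac: "\<And>i j. continuous_on UNIV (a i j)" and ab: "\<And>i j z. norm (a i j z) \<le> C"
    and c: "\<And>j. continuous_on UNIV (G j)" and b: "\<And>j x. norm (G j x) \<le> M j" and i: "\<And>j. integrable lborel (G j)"
    and \<kappa>: "0 \<le> \<kappa>"
    and pos: "\<And>x \<zeta> z. - (\<kappa> / jbracket \<zeta> * (\<Sum>j\<in>UNIV. (norm (z j))\<^sup>2)) \<le> Re (\<Sum>i\<in>UNIV. \<Sum>j\<in>UNIV. cnj (z i) * a i j (x, \<zeta>) * z j)"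
  shows "- (\<kappa> * (2 * pi) ^ CARD('n) * (\<Sum>j\<in>UNIV. (\<integral>\<xi>. (norm (G j \<xi>))\<^sup>2 * (fr \<xi> \<zeta>)\<^sup>2 \<partial>lborel) / jbracket \<zeta>))
       \<le> Re (\<Sum>i\<in>UNIV. \<Sum>j\<in>UNIV. sym_form y (a i j) (G j) (G i) \<zeta>)"
proof -
  define W where "W j x = (\<integral>\<xi>. cis (x \<bullet> \<xi>) * (complex_of_real (fr \<xi> \<zeta>) * G j \<xi>) \<partial>lborel)" for j x
  define T where "T i j x = complex_of_real (lam y x) * (a i j (x, \<zeta>) * W j x) * cnj (W i x)" for i j x
  have pull: "(\<integral>\<xi>. cis (x \<bullet> \<xi>) * a i j (x, \<zeta>) * (complex_of_real (fr \<xi> \<zeta>) * G j \<xi>) \<partial>lborel) = a i j (x, \<zeta>) * W j x" for i j x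
    unfolding W_def integral_mult_right_zero[symmetric] by (simp add: mult_ac)
  have ac': "continuous_on UNIV (\<lambda>z::(real^'n)\<times>(real^'n). a i j (fst z, \<zeta>))" for i j
    by (intro continuous_on_compose2[OF ac] continuous_intros) auto
  have Ti: "integrable lborel (T i j)" for i j
  proof -
    have "integrable lborel (\<lambda>x. complex_of_real (lam y x) * (\<integral>\<xi>. cis (x \<bullet> \<xi>) * a i j (fst (x, \<xi>), \<zeta>) * (complex_of_real (fr \<xi> \<zeta>) * G j \<xi>) \<partial>lborel)
        * cnj (\<integral>\<xi>. cis (x \<bullet> \<xi>) * (complex_of_real (fr \<xi> \<zeta>) * G i \<xi>) \<partial>lborel))"
      by (rule bilinear_fourier(3)[OF ac' ab fr_mult_G(1,2)[OF c i] fr_mult_G(1,2)[OF c i]])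
    then show ?thesis unfolding fst_conv pull W_def[symmetric] T_def[abs_def] .
  qed
  have Te: "sym_form y (a i j) (G j) (G i) \<zeta> = integral\<^sup>L lborel (T i j)" for i j
    unfolding sym_form_def loc_form_def fst_conv pull W_def[symmetric] T_def[abs_def] ..
  note pl = plancherel_fr[OF c b i, where \<zeta>=\<zeta>, folded W_def]
  have "- (\<kappa> * (2 * pi) ^ CARD('n) * (\<Sum>j\<in>UNIV. (\<integral>\<xi>. (norm (G j \<xi>))\<^sup>2 * (fr \<xi> \<zeta>)\<^sup>2 \<partial>lborel) / jbracket \<zeta>))
      = - (\<kappa> / jbracket \<zeta> * (\<Sum>j\<in>UNIV. \<integral>x. (norm (W j x))\<^sup>2 \<partial>lborel))"
    unfolding pl(2) by (simp add: sum_divide_distrib[symmetric] sum_distrib_left[symmetric])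
  also have "\<dots> = (\<integral>x. - (\<kappa> / jbracket \<zeta> * (\<Sum>j\<in>UNIV. (norm (W j x))\<^sup>2)) \<partial>lborel)"
    using pl(1) by simp
  also have "\<dots> \<le> (\<integral>x. Re (\<Sum>i\<in>UNIV. \<Sum>j\<in>UNIV. T i j x) \<partial>lborel)"
  proof (rule integral_mono)
    show "integrable lborel (\<lambda>x. - (\<kappa> / jbracket \<zeta> * (\<Sum>j\<in>UNIV. (norm (W j x))\<^sup>2)))" using pl(1) by simp
    show "integrable lborel (\<lambda>x. Re (\<Sum>i\<in>UNIV. \<Sum>j\<in>UNIV. T i j x))" using Ti by simp
    fix x
    let ?q = "\<kappa> / jbracket \<zeta> * (\<Sum>j\<in>UNIV. (norm (W j x))\<^sup>2)"
    let ?r = "\<Sum>i\<in>UNIV. \<Sum>j\<in>UNIV. cnj (W i x) * a i j (x, \<zeta>) * W j x"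
    have q: "0 \<le> ?q" using \<kappa> jbracket_pos[of \<zeta>] by (intro mult_nonneg_nonneg sum_nonneg) auto
    have "(\<Sum>i\<in>UNIV. \<Sum>j\<in>UNIV. T i j x) = complex_of_real (lam y x) * ?r"
      unfolding T_def sum_distrib_left by (simp add: mult_ac)
    then have "Re (\<Sum>i\<in>UNIV. \<Sum>j\<in>UNIV. T i j x) = lam y x * Re ?r" by simp
    moreover have "lam y x * - ?q \<le> lam y x * Re ?r"
      by (rule mult_left_mono[OF pos less_imp_le[OF lam_pos]])
    moreover have "lam y x * ?q \<le> 1 * ?q" by (rule mult_right_mono[OF lam_le_1 q])
    ultimately show "- ?q \<le> Re (\<Sum>i\<in>UNIV. \<Sum>j\<in>UNIV. T i j x)" by linarith
  qed
  also have "\<dots> = Re (\<Sum>i\<in>UNIV. \<Sum>j\<in>UNIV. sym_form y (a i j) (G j) (G i) \<zeta>)"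
    unfolding Te using Ti by (simp add: integral_Re[symmetric] del: integral_Re)
  finally show ?thesis .
qed

lemma low_energy:
  fixes G :: "real^'n \<Rightarrow> complex"
  assumes c: "continuous_on UNIV G" and b: "\<And>x. norm (G x) \<le> M" and i: "integrable lborel G"
  shows "integrable lborel (\<lambda>\<zeta>. (\<integral>\<xi>. (norm (G \<xi>))\<^sup>2 * (fr \<xi> \<zeta>)\<^sup>2 \<partial>lborel) / jbracket \<zeta>)"
    and "(\<integral>\<zeta>. (\<integral>\<xi>. (norm (G \<xi>))\<^sup>2 * (fr \<xi> \<zeta>)\<^sup>2 \<partial>lborel) / jbracket \<zeta> \<partial>lborel) \<le> (2 + 4 * fr_moment_const TYPE('n)) * energy G"
proof -
  define N where "N = 2 + 4 * fr_moment_const TYPE('n)"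
  have N: "0 \<le> N" unfolding N_def using fr_moment_const_nonneg[where 'n='n] by simp
  define P where "P q = (norm (G (fst q)))\<^sup>2 * ((fr (fst q) (snd q))\<^sup>2 / jbracket (snd q))" for q
  have Pm: "P \<in> borel_measurable borel"
    unfolding P_def by (intro borel_measurable_continuous_onI continuous_intros continuous_on_compose2[OF c] continuous_on_fr) auto
  have P0: "0 \<le> P q" for q by (simp add: P_def less_imp_le[OF jbracket_pos])
  have inner: "(\<integral>\<zeta>. P (\<xi>, \<zeta>) \<partial>lborel) = (norm (G \<xi>))\<^sup>2 * (\<integral>\<zeta>. (fr \<xi> \<zeta>)\<^sup>2 / jbracket \<zeta> \<partial>lborel)" for \<xi>
    unfolding P_def fst_conv snd_conv by (rule integral_mult_right_zero)
  have le: "(\<integral>\<zeta>. P (\<xi>, \<zeta>) \<partial>lborel) \<le> N * ((norm (G \<xi>))\<^sup>2 / jbracket \<xi>)" for \<xi>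
    using mult_left_mono[OF fr_low(2)[of \<xi>], of "(norm (G \<xi>))\<^sup>2"] unfolding inner N_def by (simp add: mult_ac)
  have ei: "integrable lborel (\<lambda>\<xi>. N * ((norm (G \<xi>))\<^sup>2 / jbracket \<xi>))"
    by (rule integrable_mult_right[OF energy_integrable[OF c b i]])
  have "integrable (lborel \<Otimes>\<^sub>M lborel) P"
  proof (rule lborel_pair.Fubini_integrable)
    show Pm': "P \<in> borel_measurable (lborel \<Otimes>\<^sub>M lborel)" using Pm by (simp add: lborel_prod)
    show "AE \<xi> in lborel. integrable lborel (\<lambda>\<zeta>. P (\<xi>, \<zeta>))"
      unfolding P_def fst_conv snd_conv by (intro AE_I2 integrable_mult_right fr_low(1))
    show "integrable lborel (\<lambda>\<xi>. \<integral>\<zeta>. norm (P (\<xi>, \<zeta>)) \<partial>lborel)"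
    proof (rule Bochner_Integration.integrable_bound[OF ei])
      show "(\<lambda>\<xi>. \<integral>\<zeta>. norm (P (\<xi>, \<zeta>)) \<partial>lborel) \<in> borel_measurable lborel"
        using Pm' by (intro lborel.borel_measurable_lebesgue_integral) simp
      have "0 \<le> (\<integral>\<zeta>. P (\<xi>, \<zeta>) \<partial>lborel)" for \<xi> by (rule integral_nonneg_AE) (simp add: P0)
      then show "AE \<xi> in lborel. norm (\<integral>\<zeta>. norm (P (\<xi>, \<zeta>)) \<partial>lborel) \<le> norm (N * ((norm (G \<xi>))\<^sup>2 / jbracket \<xi>))"
        using order_trans[OF le abs_ge_self] P0 by (intro AE_I2) (simp add: abs_of_nonneg)
    qed
  qed
  then have Pi: "integrable lborel P" by (simp add: lborel_prod)
  have e: "(\<integral>\<xi>. P (\<xi>, \<zeta>) \<partial>lborel) = (\<integral>\<xi>. (norm (G \<xi>))\<^sup>2 * (fr \<xi> \<zeta>)\<^sup>2 \<partial>lborel) / jbracket \<zeta>" for \<zeta>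
    unfolding P_def fst_conv snd_conv times_divide_eq_right by (rule integral_divide_zero)
  show "integrable lborel (\<lambda>\<zeta>. (\<integral>\<xi>. (norm (G \<xi>))\<^sup>2 * (fr \<xi> \<zeta>)\<^sup>2 \<partial>lborel) / jbracket \<zeta>)"
    using lborel_fubini(4)[OF Pi] unfolding e .
  have "(\<integral>\<zeta>. (\<integral>\<xi>. (norm (G \<xi>))\<^sup>2 * (fr \<xi> \<zeta>)\<^sup>2 \<partial>lborel) / jbracket \<zeta> \<partial>lborel) = (\<integral>\<xi>. (\<integral>\<zeta>. P (\<xi>, \<zeta>) \<partial>lborel) \<partial>lborel)"
    unfolding e[symmetric] using lborel_fubini(1,2)[OF Pi] by simp
  also have "\<dots> \<le> (\<integral>\<xi>. N * ((norm (G \<xi>))\<^sup>2 / jbracket \<xi>) \<partial>lborel)"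
    by (rule integral_mono[OF lborel_fubini(3)[OF Pi] ei]) (rule le)
  also have "\<dots> = N * energy G" unfolding energy_def by (rule integral_mult_right_zero)
  finally show "(\<integral>\<zeta>. (\<integral>\<xi>. (norm (G \<xi>))\<^sup>2 * (fr \<xi> \<zeta>)\<^sup>2 \<partial>lborel) / jbracket \<zeta> \<partial>lborel) \<le> (2 + 4 * fr_moment_const TYPE('n)) * energy G"
    unfolding N_def .
qed

text \<open>The integrated symmetrisation is bounded below by positivity and
  \<open>low_energy\<close>, and the localised form differs from it by at most the Schur bound. K is
  independent of y, so the estimate can be integrated over y.\<close>

lemma loc_form_lower_bound:
  "\<exists>K\<ge>0. \<forall>y C \<kappa> (a :: 'm::finite \<Rightarrow> 'm \<Rightarrow> 'n::finite symbol) w. 0 \<le> C \<longrightarrow> 0 \<le> \<kappa> \<longrightarrow>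
     (\<forall>i j. wb xi_deg (smoothness_order TYPE('n)) C xi_weight (a i j)) \<longrightarrow> (\<forall>j. rapid (w j)) \<longrightarrow>
     (\<forall>x \<zeta> z. - (\<kappa> / jbracket \<zeta> * (\<Sum>j\<in>UNIV. (norm (z j))\<^sup>2)) \<le> Re (\<Sum>i\<in>UNIV. \<Sum>j\<in>UNIV. cnj (z i) * a i j (x, \<zeta>) * z j)) \<longrightarrow>
     - (K * (C + \<kappa>) * (\<Sum>j\<in>UNIV. energy (fourier (w j))))
       \<le> Re (\<Sum>i\<in>UNIV. \<Sum>j\<in>UNIV. loc_form y (conj_symbol y basis_dirs (a i j)) (fourier (w j)) (fourier (w i)))"
proof -
  obtain K0 where K0: "K0 \<ge> 0" and fd: "\<And>y C (a :: 'n symbol) w1 w2. 0 \<le> C \<Longrightarrow> wb xi_deg (smoothness_order TYPE('n)) C xi_weight a \<Longrightarrow> rapid w1 \<Longrightarrow> rapid w2 \<Longrightarrow>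
     norm (loc_form y (conj_symbol y basis_dirs a) (fourier w1) (fourier w2) - (\<integral>\<zeta>. sym_form y a (fourier w1) (fourier w2) \<zeta> \<partial>lborel))
       \<le> K0 * C * (energy (fourier w1) + energy (fourier w2))"
    using form_difference[where 'n='n] by blast
  define N where "N = (2 * pi) ^ CARD('n) * (2 + 4 * fr_moment_const TYPE('n))"
  have N: "0 \<le> N" unfolding N_def using fr_moment_const_nonneg[where 'n='n] by simp
  \<comment> \<open>The sum over all pairs (i, j) of the two energies is 2 CARD('m) times the total
    energy; N combines the Plancherel factor with the constant of \<open>low_energy\<close>.\<close>
  define K where "K = 2 * real CARD('m) * K0 + N"
  have main: "- (K * (C + \<kappa>) * (\<Sum>j\<in>UNIV. energy (fourier (w j))))
       \<le> Re (\<Sum>i\<in>UNIV. \<Sum>j\<in>UNIV. loc_form y (conj_symbol y basis_dirs (a i j)) (fourier (w j)) (fourier (w i)))"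
    if C: "0 \<le> C" and \<kappa>: "0 \<le> \<kappa>" and a: "\<forall>i j. wb xi_deg (smoothness_order TYPE('n)) C xi_weight (a i j)" and w: "\<forall>j. rapid (w j)"
      and pos: "\<forall>x \<zeta> z. - (\<kappa> / jbracket \<zeta> * (\<Sum>j\<in>UNIV. (norm (z j))\<^sup>2)) \<le> Re (\<Sum>i\<in>UNIV. \<Sum>j\<in>UNIV. cnj (z i) * a i j (x, \<zeta>) * z j)"
    for y C \<kappa> and a :: "'m \<Rightarrow> 'm \<Rightarrow> 'n symbol" and w
  proof -
    let ?G = "\<lambda>j. fourier (w j)"
    let ?E = "\<Sum>j\<in>UNIV. energy (?G j)"
    define L where "L i j = loc_form y (conj_symbol y basis_dirs (a i j)) (?G j) (?G i)" for i j
    define S where "S i j = (\<integral>\<zeta>. sym_form y (a i j) (?G j) (?G i) \<zeta> \<partial>lborel)" for i j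
    have E: "0 \<le> ?E" by (intro sum_nonneg energy_nonneg)
    have "\<forall>j. \<exists>M. \<forall>\<xi>. norm (?G j \<xi>) \<le> M" using w rapid_fourier_bounded by metis
    then obtain M where M: "\<And>j \<xi>. norm (?G j \<xi>) \<le> M j" by metis
    note ac = wb_continuous[OF a[rule_format]] and ab = wb_xi_weight_bounded[OF a[rule_format]]
    note Gc = rapid_fourier_continuous[OF w[rule_format]] and Gi = rapid_fourier_integrable[OF w[rule_format]]
    have si: "integrable lborel (sym_form y (a i j) (?G j) (?G i))" for i j
      by (rule sym_form_integral(1)[OF ac ab Gc Gi Gc Gi])
    note le = low_energy[OF Gc M Gi]
    have lb: "integrable lborel (\<lambda>\<zeta>. \<kappa> * (2 * pi) ^ CARD('n) * (\<Sum>j\<in>UNIV. (\<integral>\<xi>. (norm (?G j \<xi>))\<^sup>2 * (fr \<xi> \<zeta>)\<^sup>2 \<partial>lborel) / jbracket \<zeta>))"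
      by (intro integrable_mult_right Bochner_Integration.integrable_sum le(1))
    have "\<kappa> * N * ?E = \<kappa> * (2 * pi) ^ CARD('n) * (\<Sum>j\<in>UNIV. (2 + 4 * fr_moment_const TYPE('n)) * energy (?G j))"
      by (simp add: N_def sum_distrib_left[symmetric])
    also have "\<dots> \<ge> \<kappa> * (2 * pi) ^ CARD('n) * (\<Sum>j\<in>UNIV. \<integral>\<zeta>. (\<integral>\<xi>. (norm (?G j \<xi>))\<^sup>2 * (fr \<xi> \<zeta>)\<^sup>2 \<partial>lborel) / jbracket \<zeta> \<partial>lborel)"
      using \<kappa> by (intro mult_left_mono sum_mono le(2)) simp
    also have "\<kappa> * (2 * pi) ^ CARD('n) * (\<Sum>j\<in>UNIV. \<integral>\<zeta>. (\<integral>\<xi>. (norm (?G j \<xi>))\<^sup>2 * (fr \<xi> \<zeta>)\<^sup>2 \<partial>lborel) / jbracket \<zeta> \<partial>lborel)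
       = (\<integral>\<zeta>. \<kappa> * (2 * pi) ^ CARD('n) * (\<Sum>j\<in>UNIV. (\<integral>\<xi>. (norm (?G j \<xi>))\<^sup>2 * (fr \<xi> \<zeta>)\<^sup>2 \<partial>lborel) / jbracket \<zeta>) \<partial>lborel)"
      by (subst integral_mult_right_zero) (subst Bochner_Integration.integral_sum, rule le(1), rule refl)
    finally have "- (\<kappa> * N * ?E) \<le> (\<integral>\<zeta>. - (\<kappa> * (2 * pi) ^ CARD('n) * (\<Sum>j\<in>UNIV. (\<integral>\<xi>. (norm (?G j \<xi>))\<^sup>2 * (fr \<xi> \<zeta>)\<^sup>2 \<partial>lborel) / jbracket \<zeta>)) \<partial>lborel)"
      using lb by simp
    also have "\<dots> \<le> (\<integral>\<zeta>. Re (\<Sum>i\<in>UNIV. \<Sum>j\<in>UNIV. sym_form y (a i j) (?G j) (?G i) \<zeta>) \<partial>lborel)"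
    proof (rule integral_mono)
      show "integrable lborel (\<lambda>\<zeta>. - (\<kappa> * (2 * pi) ^ CARD('n) * (\<Sum>j\<in>UNIV. (\<integral>\<xi>. (norm (?G j \<xi>))\<^sup>2 * (fr \<xi> \<zeta>)\<^sup>2 \<partial>lborel) / jbracket \<zeta>)))"
        by (rule Bochner_Integration.integrable_minus[OF lb])
      show "integrable lborel (\<lambda>\<zeta>. Re (\<Sum>i\<in>UNIV. \<Sum>j\<in>UNIV. sym_form y (a i j) (?G j) (?G i) \<zeta>))" using si by simp
      show "- (\<kappa> * (2 * pi) ^ CARD('n) * (\<Sum>j\<in>UNIV. (\<integral>\<xi>. (norm (?G j \<xi>))\<^sup>2 * (fr \<xi> \<zeta>)\<^sup>2 \<partial>lborel) / jbracket \<zeta>))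
          \<le> Re (\<Sum>i\<in>UNIV. \<Sum>j\<in>UNIV. sym_form y (a i j) (?G j) (?G i) \<zeta>)" for \<zeta>
        by (rule sym_form_lower_bound[OF ac ab Gc M Gi \<kappa>]) (use pos in blast)
    qed
    also have "\<dots> = Re (\<Sum>i\<in>UNIV. \<Sum>j\<in>UNIV. S i j)"
      unfolding S_def using si by (simp add: integral_Re[symmetric] del: integral_Re)
    finally have S: "- (\<kappa> * N * ?E) \<le> Re (\<Sum>i\<in>UNIV. \<Sum>j\<in>UNIV. S i j)" .
    have "norm ((\<Sum>i\<in>UNIV. \<Sum>j\<in>UNIV. L i j) - (\<Sum>i\<in>UNIV. \<Sum>j\<in>UNIV. S i j)) \<le> (\<Sum>i\<in>UNIV. \<Sum>j\<in>UNIV. K0 * C * (energy (?G j) + energy (?G i)))"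
      unfolding sum_subtractf[symmetric]
      by (intro sum_norm_le) (use fd[OF C a[rule_format] w[rule_format] w[rule_format]] in \<open>simp add: L_def S_def\<close>)
    also have "\<dots> = K0 * C * (real CARD('m) * ?E + real CARD('m) * ?E)"
    proof -
      have "(\<Sum>i\<in>UNIV. \<Sum>j\<in>UNIV. K0 * C * (energy (?G j) + energy (?G i))) = K0 * C * (\<Sum>i\<in>UNIV. \<Sum>j\<in>UNIV. energy (?G j) + energy (?G i))"
        by (simp only: sum_distrib_left)
      also have "(\<Sum>i\<in>UNIV. \<Sum>j\<in>UNIV. energy (?G j) + energy (?G i)) = real CARD('m) * ?E + real CARD('m) * ?E"
        by (simp add: sum.distrib sum_distrib_left[symmetric])
      finally show ?thesis .
    qed
    finally have LS: "norm ((\<Sum>i\<in>UNIV. \<Sum>j\<in>UNIV. L i j) - (\<Sum>i\<in>UNIV. \<Sum>j\<in>UNIV. S i j)) \<le> 2 * real CARD('m) * K0 * (C * ?E)"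
      by (simp add: algebra_simps)
    have "- norm ((\<Sum>i\<in>UNIV. \<Sum>j\<in>UNIV. L i j) - (\<Sum>i\<in>UNIV. \<Sum>j\<in>UNIV. S i j))
       \<le> Re (\<Sum>i\<in>UNIV. \<Sum>j\<in>UNIV. L i j) - Re (\<Sum>i\<in>UNIV. \<Sum>j\<in>UNIV. S i j)"
      using abs_Re_le_cmod[of "(\<Sum>i\<in>UNIV. \<Sum>j\<in>UNIV. L i j) - (\<Sum>i\<in>UNIV. \<Sum>j\<in>UNIV. S i j)"] by (simp only: minus_complex.sel abs_le_iff) linarith
    with LS S have "- (2 * real CARD('m) * K0 * (C * ?E) + \<kappa> * N * ?E) \<le> Re (\<Sum>i\<in>UNIV. \<Sum>j\<in>UNIV. L i j)" by linarith
    moreover have "2 * real CARD('m) * K0 * (C * ?E) + \<kappa> * N * ?E \<le> K * (C + \<kappa>) * ?E"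
    proof -
      have "0 \<le> 2 * real CARD('m) * K0 * (\<kappa> * ?E) + N * (C * ?E)" using K0 N C \<kappa> E by simp
      then show ?thesis unfolding K_def by (simp add: algebra_simps)
    qed
    ultimately show ?thesis unfolding L_def by linarith
  qed
  have "0 \<le> K" unfolding K_def using K0 N by simp
  with main show ?thesis by blast
qed

section \<open>The sharp Garding inequality for a fixed symbol\<close>

lemma psdo_continuous:
  fixes a :: "'n::finite symbol"
  assumes c: "continuous_on UNIV a" and b: "\<And>z. norm (a z) \<le> C" and u: "rapid u"
  shows "continuous_on UNIV (psdo a u)"
    and "norm (psdo a u x) \<le> (1 / (2 * pi) ^ CARD('n)) * (C * (\<integral>\<xi>. norm (fourier u \<xi>) \<partial>lborel))"
proof -
  have Fi: "integrable lborel (fourier u)" by (rule rapid_fourier_integrable[OF u])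
  have C: "0 \<le> C" using order_trans[OF norm_ge_zero b] .
  have le: "norm (cis (x \<bullet> \<xi>) * a (x, \<xi>) * fourier u \<xi>) \<le> C * norm (fourier u \<xi>)" for x \<xi>
    using b by (simp add: norm_mult mult_right_mono)
  have "continuous_on UNIV (\<lambda>x. \<integral>\<xi>. cis (x \<bullet> \<xi>) * a (x, \<xi>) * fourier u \<xi> \<partial>lborel)"
  proof (rule continuous_integral_dominated[where g="\<lambda>\<xi>. C * norm (fourier u \<xi>)"])
    show "(\<lambda>\<xi>. cis (x \<bullet> \<xi>) * a (x, \<xi>) * fourier u \<xi>) \<in> borel_measurable lborel" for x
      by (rule borel_measurable_integrable[OF psdo_integrable[OF c b Fi]])
    show "continuous_on UNIV (\<lambda>x. cis (x \<bullet> \<xi>) * a (x, \<xi>) * fourier u \<xi>)" for \<xi>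
      by (intro continuous_intros continuous_on_slice c)
  qed (use le Fi in auto)
  then show "continuous_on UNIV (psdo a u)" unfolding psdo_def[abs_def] by (intro continuous_intros)
  have "norm (\<integral>\<xi>. cis (x \<bullet> \<xi>) * a (x, \<xi>) * fourier u \<xi> \<partial>lborel) \<le> (\<integral>\<xi>. C * norm (fourier u \<xi>) \<partial>lborel)"
    by (rule order_trans[OF integral_norm_bound integral_mono'])
      (use le Fi C in auto)
  then have "(1 / (2 * pi) ^ CARD('n)) * norm (\<integral>\<xi>. cis (x \<bullet> \<xi>) * a (x, \<xi>) * fourier u \<xi> \<partial>lborel)
      \<le> (1 / (2 * pi) ^ CARD('n)) * (C * (\<integral>\<xi>. norm (fourier u \<xi>) \<partial>lborel))"
    by (intro mult_left_mono) simp_all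
  then show "norm (psdo a u x) \<le> (1 / (2 * pi) ^ CARD('n)) * (C * (\<integral>\<xi>. norm (fourier u \<xi>) \<partial>lborel))"
    unfolding psdo_def by simp
qed

lemma psdo_mult_integrable:
  fixes a :: "'n::finite symbol"
  assumes c: "continuous_on UNIV a" and b: "\<And>z. norm (a z) \<le> C" and u: "rapid u" and v: "rapid v"
  shows "integrable lborel (\<lambda>x. psdo a u x * cnj (v x))"
proof (rule Bochner_Integration.integrable_bound)
  let ?B = "(1 / (2 * pi) ^ CARD('n)) * (C * (\<integral>\<xi>. norm (fourier u \<xi>) \<partial>lborel))"
  show "integrable lborel (\<lambda>x. ?B * norm (v x))" using rapid_integrable[OF v] by simp
  show "(\<lambda>x. psdo a u x * cnj (v x)) \<in> borel_measurable lborel"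
    by (simp, intro borel_measurable_continuous_onI continuous_intros psdo_continuous[OF c b u] rapid_continuous[OF v])
  show "AE x in lborel. norm (psdo a u x * cnj (v x)) \<le> norm (?B * norm (v x))"
    using order_trans[OF mult_right_mono[OF psdo_continuous(2)[OF c b u] norm_ge_zero] abs_ge_self]
    by (intro AE_I2) (simp only: norm_mult complex_mod_cnj real_norm_def)
qed

text \<open>The third power occurs because the weight enters the localised form three times: once
  explicitly and once in each of the two functions.\<close>

lemma lam_cube_integrable: "integrable lborel (\<lambda>x::real^'n. (lam 0 x) ^ 3)"
proof (rule Bochner_Integration.integrable_bound[OF lam_integrable[of 0]])
  have "(lam 0 x) ^ 3 \<le> lam 0 x" for x :: "real^'n"
    using power_decreasing[of 1 3 "lam 0 x"] lam_pos[of 0 x] lam_le_1[of 0 x] by simp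
  then show "AE x in lborel. norm ((lam 0 (x::real^'n)) ^ 3) \<le> norm (lam 0 x)"
    by (intro AE_I2) (simp only: real_norm_def abs_of_pos[OF zero_less_power[OF lam_pos]] abs_of_pos[OF lam_pos])
qed simp

lemma lam_cube_pos: "0 < (\<integral>x. (lam (0::real^'n) x) ^ 3 \<partial>lborel)"
proof -
  note i = lam_cube_integrable[where 'n='n]
  have "(\<integral>x. (lam (0::real^'n) x) ^ 3 \<partial>lborel) \<noteq> 0"
  proof
    assume "(\<integral>x. (lam (0::real^'n) x) ^ 3 \<partial>lborel) = 0"
    then have "AE x in lborel. (lam 0 (x::real^'n)) ^ 3 = 0"
      by (subst (asm) integral_nonneg_eq_0_iff_AE[OF i]) (auto simp: less_imp_le[OF lam_pos])
    then have "AE x in (lborel :: (real^'n) measure). False"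
    proof eventually_elim
      case (elim x)
      then show ?case using lam_pos[of 0 x] by simp
    qed
    then show False by (simp add: eventually_False trivial_limit_def[symmetric] ae_filter_eq_bot_iff)
  qed
  moreover have "0 \<le> (\<integral>x. (lam (0::real^'n) x) ^ 3 \<partial>lborel)"
    by (rule integral_nonneg_AE) (simp add: less_imp_le[OF lam_pos])
  ultimately show ?thesis by simp
qed

text \<open>By the exact conjugation identity and Fourier inversion the localised form equals (2
  pi)^(2n) times the integral of \<open>lam y\<close>^3 against Op(a) u times the conjugate of v.
  Integrating over y by translation invariance removes the weight and leaves its cube integral, a
  positive constant, as a factor.\<close>

lemma loc_form_average:
  fixes a :: "'n::finite symbol"
  assumes a: "wb xi_deg (smoothness_order TYPE('n)) C xi_weight a" and C: "0 \<le> C" and u: "rapid u" and v: "rapid v"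
  defines "f \<equiv> \<lambda>y. loc_form y (conj_symbol y basis_dirs a) (fourier (\<lambda>x. complex_of_real (lam y x) * u x)) (fourier (\<lambda>x. complex_of_real (lam y x) * v x))"
  shows "integrable lborel f"
    and "integral\<^sup>L lborel f = complex_of_real (((2 * pi) ^ CARD('n))\<^sup>2 * (\<integral>x. (lam (0::real^'n) x) ^ 3 \<partial>lborel)) * (\<integral>x. psdo a u x * cnj (v x) \<partial>lborel)"
proof -
  define c where "c = (2 * pi) ^ CARD('n)"
  have c: "c > 0" unfolding c_def by simp
  have a': "wb xi_deg (length (basis_dirs :: (real^'n) list)) C xi_weight a"
    by (rule wb_mono[OF a]) (simp_all add: smoothness_order_def)
  note ac = wb_continuous[OF a] and ab = wb_xi_weight_bounded[OF a]
  define q where "q x = psdo a u x * cnj (v x)" for x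
  have qi: "integrable lborel q" unfolding q_def[abs_def] by (rule psdo_mult_integrable[OF ac ab u v])
  have feq: "f y = complex_of_real (c\<^sup>2) * (\<integral>x. complex_of_real ((lam y x) ^ 3) * q x \<partial>lborel)" for y
  proof -
    let ?u = "\<lambda>x. complex_of_real (lam y x) * u x" and ?v = "\<lambda>x. complex_of_real (lam y x) * v x"
    let ?b = "conj_symbol y basis_dirs a"
    have p: "(\<integral>\<xi>. cis (x \<bullet> \<xi>) * ?b (x, \<xi>) * fourier ?u \<xi> \<partial>lborel) = complex_of_real c * (complex_of_real (lam y x) * psdo a u x)" for x
      unfolding psdo_conj_lam(1)[OF a' C u] unfolding psdo_def c_def[symmetric] using c by (simp add: scaleR_conv_of_real)
    have i: "(\<integral>\<eta>. cis (x \<bullet> \<eta>) * fourier ?v \<eta> \<partial>lborel) = complex_of_real c * ?v x" for x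
      unfolding c_def by (rule rapid_inversion[OF psdo_conj_lam(2)[OF a' C v]])
    have "f y = (\<integral>x. complex_of_real (c\<^sup>2) * (complex_of_real ((lam y x) ^ 3) * q x) \<partial>lborel)"
      unfolding f_def loc_form_def p i
      by (intro Bochner_Integration.integral_cong refl) (simp add: q_def power2_eq_square power3_eq_cube mult_ac)
    then show ?thesis by simp
  qed
  let ?l3 = "\<lambda>x::real^'n. (lam 0 x) ^ 3"
  note l3i = lam_cube_integrable[where 'n='n]
  define P where "P p = complex_of_real ((lam 0 (snd p - fst p)) ^ 3) * q (fst p)" for p :: "(real^'n) \<times> (real^'n)"
  have Pi: "integrable lborel P"
  proof (rule Bochner_Integration.integrable_bound)
    show "integrable lborel (\<lambda>p. norm (q (fst p)) * (lam 0 (snd p - fst p)) ^ 3)"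
      by (rule integral_convolution(1)[of "\<lambda>x. norm (q x)", OF _ l3i]) (use qi in simp)
    have qc: "continuous_on UNIV q" unfolding q_def[abs_def]
      by (intro continuous_intros psdo_continuous[OF ac ab u] rapid_continuous[OF v])
    have "continuous_on UNIV P"
      unfolding P_def[abs_def]
      by (intro continuous_intros continuous_on_compose2[OF continuous_on_lam_right] continuous_on_compose2[OF qc]) auto
    then show "P \<in> borel_measurable lborel" by (simp add: borel_measurable_continuous_onI)
    show "AE p in lborel. norm (P p) \<le> norm (norm (q (fst p)) * (lam 0 (snd p - fst p)) ^ 3)"
      by (intro AE_I2) (simp add: P_def norm_mult norm_power abs_mult power_abs)
  qed
  have e1: "(\<integral>x. P (x, y) \<partial>lborel) = (\<integral>x. complex_of_real ((lam y x) ^ 3) * q x \<partial>lborel)" for y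
    unfolding P_def fst_conv snd_conv lam_translate(2)[of y, symmetric] ..
  have e2: "(\<integral>y. P (x, y) \<partial>lborel) = complex_of_real (integral\<^sup>L lborel ?l3) * q x" for x
  proof -
    have "(\<integral>y. P (x, y) \<partial>lborel) = (\<integral>y. complex_of_real ((lam 0 (y - x)) ^ 3) \<partial>lborel) * q x"
      unfolding P_def fst_conv snd_conv by (rule integral_mult_left_zero)
    also have "(\<integral>y. complex_of_real ((lam 0 (y - x)) ^ 3) \<partial>lborel) = complex_of_real (\<integral>y. (lam 0 (y - x)) ^ 3 \<partial>lborel)"
      by (rule integral_complex_of_real)
    also have "(\<integral>y. (lam 0 (y - x)) ^ 3 \<partial>lborel) = integral\<^sup>L lborel ?l3"
      by (rule lborel_integral_shift(5)) simp
    finally show ?thesis .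
  qed
  have "integrable lborel (\<lambda>y. complex_of_real (c\<^sup>2) * (\<integral>x. complex_of_real ((lam y x) ^ 3) * q x \<partial>lborel))"
    using lborel_fubini(4)[OF Pi] unfolding e1 by (rule integrable_mult_right)
  then show "integrable lborel f" unfolding feq[symmetric] .
  have "integral\<^sup>L lborel f = complex_of_real (c\<^sup>2) * (\<integral>y. \<integral>x. P (x, y) \<partial>lborel \<partial>lborel)"
    unfolding e1 feq by (rule integral_mult_right_zero)
  also have "(\<integral>y. \<integral>x. P (x, y) \<partial>lborel \<partial>lborel) = (\<integral>x. \<integral>y. P (x, y) \<partial>lborel \<partial>lborel)"
    using lborel_fubini(1,2)[OF Pi] by simp
  also have "\<dots> = complex_of_real (integral\<^sup>L lborel ?l3) * integral\<^sup>L lborel q"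
    unfolding e2 by (rule integral_mult_right_zero)
  finally show "integral\<^sup>L lborel f = complex_of_real (((2 * pi) ^ CARD('n))\<^sup>2 * (\<integral>x. (lam (0::real^'n) x) ^ 3 \<partial>lborel)) * (\<integral>x. psdo a u x * cnj (v x) \<partial>lborel)"
    unfolding c_def q_def[abs_def] by (simp only: of_real_mult mult.assoc)
qed

text \<open>Integration over y of the localised estimate: \<open>loc_form_average\<close>
  reassembles the left side without error, and \<open>energy_average\<close> controls the right
  side. K depends on the dimensions only, and the bound is linear in C + \<kappa>.\<close>

lemma sharp_garding:
  "\<exists>K\<ge>0. \<forall>C \<kappa> (a :: 'm::finite \<Rightarrow> 'm \<Rightarrow> 'n::finite symbol) u. 0 \<le> C \<longrightarrow> 0 \<le> \<kappa> \<longrightarrow>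
     (\<forall>i j. wb xi_deg (smoothness_order TYPE('n)) C xi_weight (a i j)) \<longrightarrow> (\<forall>j. rapid (u j)) \<longrightarrow>
     (\<forall>x \<zeta> z. - (\<kappa> / jbracket \<zeta> * (\<Sum>j\<in>UNIV. (norm (z j))\<^sup>2)) \<le> Re (\<Sum>i\<in>UNIV. \<Sum>j\<in>UNIV. cnj (z i) * a i j (x, \<zeta>) * z j)) \<longrightarrow>
     - (K * (C + \<kappa>) * (\<Sum>j\<in>UNIV. energy (fourier (u j)))) \<le> Re (\<Sum>i\<in>UNIV. \<Sum>j\<in>UNIV. \<integral>x. psdo (a i j) (u j) x * cnj (u i x) \<partial>lborel)"
proof -
  obtain K0 where K0: "K0 \<ge> 0" and lf: "\<And>y C \<kappa> (a :: 'm \<Rightarrow> 'm \<Rightarrow> 'n symbol) w. 0 \<le> C \<Longrightarrow> 0 \<le> \<kappa> \<Longrightarrow>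
     (\<forall>i j. wb xi_deg (smoothness_order TYPE('n)) C xi_weight (a i j)) \<Longrightarrow> (\<forall>j. rapid (w j)) \<Longrightarrow>
     (\<forall>x \<zeta> z. - (\<kappa> / jbracket \<zeta> * (\<Sum>j\<in>UNIV. (norm (z j))\<^sup>2)) \<le> Re (\<Sum>i\<in>UNIV. \<Sum>j\<in>UNIV. cnj (z i) * a i j (x, \<zeta>) * z j)) \<Longrightarrow>
     - (K0 * (C + \<kappa>) * (\<Sum>j\<in>UNIV. energy (fourier (w j))))
       \<le> Re (\<Sum>i\<in>UNIV. \<Sum>j\<in>UNIV. loc_form y (conj_symbol y basis_dirs (a i j)) (fourier (w j)) (fourier (w i)))"
    using loc_form_lower_bound[where 'm='m and 'n='n] by blast
  obtain K1 where K1: "K1 \<ge> 0" and av: "\<And>u :: real^'n \<Rightarrow> complex. rapid u \<Longrightarrow>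
     integrable lborel (\<lambda>y. energy (fourier (\<lambda>x. complex_of_real (lam y x) * u x))) \<and>
     (\<integral>y. energy (fourier (\<lambda>x. complex_of_real (lam y x) * u x)) \<partial>lborel) \<le> K1 * energy (fourier u)"
    using energy_average[where 'n='n] by blast
  define k where "k = ((2 * pi) ^ CARD('n))\<^sup>2 * (\<integral>x. (lam (0::real^'n) x) ^ 3 \<partial>lborel)"
  have k: "k > 0" unfolding k_def using lam_cube_pos[where 'n='n] by simp
  define K where "K = K0 * K1 / k"
  have main: "- (K * (C + \<kappa>) * (\<Sum>j\<in>UNIV. energy (fourier (u j)))) \<le> Re (\<Sum>i\<in>UNIV. \<Sum>j\<in>UNIV. \<integral>x. psdo (a i j) (u j) x * cnj (u i x) \<partial>lborel)"
    if C: "0 \<le> C" and \<kappa>: "0 \<le> \<kappa>" and a: "\<forall>i j. wb xi_deg (smoothness_order TYPE('n)) C xi_weight (a i j)" and u: "\<forall>j. rapid (u j)"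
      and pos: "\<forall>x \<zeta> z. - (\<kappa> / jbracket \<zeta> * (\<Sum>j\<in>UNIV. (norm (z j))\<^sup>2)) \<le> Re (\<Sum>i\<in>UNIV. \<Sum>j\<in>UNIV. cnj (z i) * a i j (x, \<zeta>) * z j)"
    for C \<kappa> and a :: "'m \<Rightarrow> 'm \<Rightarrow> 'n symbol" and u
  proof -
    define w where "w y j x = complex_of_real (lam y x) * u j x" for y j x
    define f where "f i j y = loc_form y (conj_symbol y basis_dirs (a i j)) (fourier (w y j)) (fourier (w y i))" for i j y
    define Q where "Q i j = (\<integral>x. psdo (a i j) (u j) x * cnj (u i x) \<partial>lborel)" for i j
    have a': "wb xi_deg (length (basis_dirs :: (real^'n) list)) C xi_weight (a i j)" for i j
      by (rule wb_mono[OF a[rule_format]]) (simp_all add: smoothness_order_def)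
    have wr: "\<forall>j. rapid (w y j)" for y unfolding w_def using psdo_conj_lam(2)[OF a' C] u by blast
    have fi: "integrable lborel (f i j)" and fe: "integral\<^sup>L lborel (f i j) = complex_of_real k * Q i j" for i j
      unfolding f_def w_def Q_def k_def
      by (rule loc_form_average(1)[OF a[rule_format] C u[rule_format] u[rule_format]],
          rule loc_form_average(2)[OF a[rule_format] C u[rule_format] u[rule_format]])
    have ei: "integrable lborel (\<lambda>y. energy (fourier (w y j)))" and ee: "(\<integral>y. energy (fourier (w y j)) \<partial>lborel) \<le> K1 * energy (fourier (u j))" for j
      unfolding w_def using av u by blast+
    have "- (K0 * (C + \<kappa>) * (K1 * (\<Sum>j\<in>UNIV. energy (fourier (u j))))) \<le> - (K0 * (C + \<kappa>) * (\<Sum>j\<in>UNIV. \<integral>y. energy (fourier (w y j)) \<partial>lborel))"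
      unfolding sum_distrib_left[of K1] neg_le_iff_le using K0 C \<kappa> by (intro mult_left_mono sum_mono ee) simp
    also have "\<dots> = (\<integral>y. - (K0 * (C + \<kappa>) * (\<Sum>j\<in>UNIV. energy (fourier (w y j)))) \<partial>lborel)"
      using ei by simp
    also have "\<dots> \<le> (\<integral>y. Re (\<Sum>i\<in>UNIV. \<Sum>j\<in>UNIV. f i j y) \<partial>lborel)"
    proof (rule integral_mono)
      show "integrable lborel (\<lambda>y. - (K0 * (C + \<kappa>) * (\<Sum>j\<in>UNIV. energy (fourier (w y j)))))" using ei by simp
      show "integrable lborel (\<lambda>y. Re (\<Sum>i\<in>UNIV. \<Sum>j\<in>UNIV. f i j y))" using fi by simp
      show "- (K0 * (C + \<kappa>) * (\<Sum>j\<in>UNIV. energy (fourier (w y j)))) \<le> Re (\<Sum>i\<in>UNIV. \<Sum>j\<in>UNIV. f i j y)" for y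
        unfolding f_def by (rule lf[OF C \<kappa> a wr pos])
    qed
    also have "\<dots> = Re (\<Sum>i\<in>UNIV. \<Sum>j\<in>UNIV. complex_of_real k * Q i j)"
      unfolding fe[symmetric] using fi by (simp add: integral_Re[symmetric] del: integral_Re)
    also have "\<dots> = k * Re (\<Sum>i\<in>UNIV. \<Sum>j\<in>UNIV. Q i j)"
      by (simp add: sum_distrib_left[symmetric])
    finally have "- (K0 * (C + \<kappa>) * (K1 * (\<Sum>j\<in>UNIV. energy (fourier (u j))))) / k \<le> Re (\<Sum>i\<in>UNIV. \<Sum>j\<in>UNIV. Q i j)"
      by (simp only: pos_divide_le_eq[OF k] mult.commute[of _ k])
    then show ?thesis unfolding Q_def K_def by (simp add: mult_ac)
  qed
  have "0 \<le> K" unfolding K_def using K0 K1 k by simp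
  with main show ?thesis by blast
qed

section \<open>Sobolev norms\<close>

text \<open>For s <= 0 the multiplier is at most 1, so boundedness and integrability of the
  transform of u pass to the multiplied transform and \<open>plancherel\<close> applies directly.
  The orders of interest are 0 and -1/2.\<close>

lemma sobolev_norm_sq:
  fixes u :: "real^'n::finite \<Rightarrow> complex^'m"
  assumes u: "\<And>j. rapid (\<lambda>x. u x $ j)" and s: "s \<le> 0"
  shows "(sobolev_norm s u)\<^sup>2 = (\<Sum>j\<in>UNIV. \<integral>\<xi>. (jbracket \<xi> powr s)\<^sup>2 * (norm (fourier (\<lambda>x. u x $ j) \<xi>))\<^sup>2 \<partial>lborel) / (2 * pi) ^ CARD('n)"
proof -
  define c where "c = (2 * pi) ^ CARD('n)"
  have c: "c > 0" unfolding c_def by simp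
  define F where "F j = fourier (\<lambda>x. u x $ j)" for j
  define G where "G j \<xi> = complex_of_real (jbracket \<xi> powr s) * F j \<xi>" for j \<xi>
  define h where "h j x = (\<integral>\<xi>. cis (x \<bullet> \<xi>) * G j \<xi> \<partial>lborel)" for j x
  have le: "norm (G j \<xi>) \<le> norm (F j \<xi>)" for j \<xi>
  proof -
    have "jbracket \<xi> powr s \<le> jbracket \<xi> powr 0" by (rule powr_mono[OF s jbracket_ge_1])
    then have "jbracket \<xi> powr s \<le> 1" by simp
    then show ?thesis using mult_right_mono[of "jbracket \<xi> powr s" 1 "norm (F j \<xi>)"] by (simp add: G_def norm_mult)
  qed
  have Gc: "continuous_on UNIV (G j)" for j
    unfolding G_def[abs_def] F_def
    by (intro continuous_intros rapid_fourier_continuous u) simp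
  have Gi: "integrable lborel (G j)" for j
  proof (rule Bochner_Integration.integrable_bound)
    show "integrable lborel (F j)" unfolding F_def by (rule rapid_fourier_integrable[OF u])
    show "G j \<in> borel_measurable lborel" using borel_measurable_continuous_onI[OF Gc] by simp
    show "AE \<xi> in lborel. norm (G j \<xi>) \<le> norm (F j \<xi>)" by (intro AE_I2 le)
  qed
  have "\<exists>M. \<forall>\<xi>. norm (F j \<xi>) \<le> M" for j unfolding F_def using rapid_fourier_bounded[OF u[of j]] by blast
  then obtain M where "\<And>j \<xi>. norm (F j \<xi>) \<le> M j" by metis
  then have Gb: "norm (G j \<xi>) \<le> M j" for j \<xi> using order_trans[OF le] by blast
  note pl = plancherel[OF Gc Gb Gi, folded h_def c_def]
  have v: "psdo (\<lambda>(y, \<xi>). complex_of_real (jbracket \<xi> powr s)) (\<lambda>y. u y $ j) x = (1 / c) *\<^sub>R h j x" for j x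
    unfolding psdo_def c_def h_def G_def F_def by (simp add: mult.assoc)
  have n: "(norm (\<chi> j. (1 / c) *\<^sub>R h j x))\<^sup>2 = (\<Sum>j\<in>UNIV. (1 / c)\<^sup>2 * (norm (h j x))\<^sup>2)" for x
    unfolding norm_vec_def L2_set_def by (simp add: sum_nonneg power_mult_distrib power_divide)
  have "(sobolev_norm s u)\<^sup>2 = (\<integral>x. (\<Sum>j\<in>UNIV. (1 / c)\<^sup>2 * (norm (h j x))\<^sup>2) \<partial>lborel)"
    unfolding sobolev_norm_def L2_norm_def v n
    by (rule real_sqrt_pow2) (intro integral_nonneg_AE AE_I2 sum_nonneg, simp)
  also have "\<dots> = (\<Sum>j\<in>UNIV. (1 / c)\<^sup>2 * (c * (\<integral>\<xi>. (norm (G j \<xi>))\<^sup>2 \<partial>lborel)))"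
    using pl by simp
  also have "\<dots> = (\<Sum>j\<in>UNIV. (\<integral>\<xi>. (norm (G j \<xi>))\<^sup>2 \<partial>lborel)) / c"
    unfolding sum_divide_distrib using c by (intro sum.cong refl) (simp add: power2_eq_square)
  finally show ?thesis unfolding G_def F_def c_def by (simp add: norm_mult power_mult_distrib)
qed

lemma sobolev_norm_half:
  fixes u :: "real^'n::finite \<Rightarrow> complex^'m"
  assumes u: "\<And>j. rapid (\<lambda>x. u x $ j)"
  shows "(sobolev_norm (- 1 / 2) u)\<^sup>2 = (\<Sum>j\<in>UNIV. energy (fourier (\<lambda>x. u x $ j))) / (2 * pi) ^ CARD('n)"
proof -
  have "(jbracket \<xi> powr (- 1 / 2))\<^sup>2 = 1 / jbracket \<xi>" for \<xi> :: "real^'n"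
    using jbracket_pos[of \<xi>] by (simp add: power2_eq_square powr_add[symmetric] powr_minus_divide)
  then show ?thesis using sobolev_norm_sq[OF u, of "- 1 / 2"] unfolding energy_def by simp
qed

lemma sobolev_norm_0:
  fixes u :: "real^'n::finite \<Rightarrow> complex^'m"
  assumes u: "\<And>j. rapid (\<lambda>x. u x $ j)"
  shows "(sobolev_norm 0 u)\<^sup>2 = (\<Sum>j\<in>UNIV. \<integral>x. (norm (u x $ j))\<^sup>2 \<partial>lborel)"
    and "integrable lborel (\<lambda>x. (norm (u x $ j))\<^sup>2)"
proof -
  define c where "c = (2 * pi) ^ CARD('n)"
  have c: "c > 0" unfolding c_def by simp
  have *: "integrable lborel (\<lambda>x. (norm (u x $ j))\<^sup>2) \<and> (\<integral>\<xi>. (norm (fourier (\<lambda>x. u x $ j) \<xi>))\<^sup>2 \<partial>lborel) / c = (\<integral>x. (norm (u x $ j))\<^sup>2 \<partial>lborel)" for j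
  proof -
    obtain M where M: "\<And>\<xi>. norm (fourier (\<lambda>x. u x $ j) \<xi>) \<le> M" using rapid_fourier_bounded[OF u[of j]] by blast
    note pl = plancherel[OF rapid_fourier_continuous[OF u] M rapid_fourier_integrable[OF u], unfolded rapid_inversion[OF u], folded c_def]
    have e: "(norm (complex_of_real c * u x $ j))\<^sup>2 = c\<^sup>2 * (norm (u x $ j))\<^sup>2" for x
      using c by (simp add: norm_mult power_mult_distrib)
    have "integrable lborel (\<lambda>x. (1 / c\<^sup>2) * (c\<^sup>2 * (norm (u x $ j))\<^sup>2))"
      using pl(1) unfolding e by (rule integrable_mult_right)
    then show ?thesis using pl(2) c unfolding e by (simp add: power2_eq_square field_simps)
  qed
  show "integrable lborel (\<lambda>x. (norm (u x $ j))\<^sup>2)" using * by blast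
  have "(sobolev_norm 0 u)\<^sup>2 = (\<Sum>j\<in>UNIV. \<integral>\<xi>. (norm (fourier (\<lambda>x. u x $ j) \<xi>))\<^sup>2 \<partial>lborel) / c"
    unfolding sobolev_norm_sq[OF u order_refl] c_def by simp
  then show "(sobolev_norm 0 u)\<^sup>2 = (\<Sum>j\<in>UNIV. \<integral>x. (norm (u x $ j))\<^sup>2 \<partial>lborel)"
    unfolding sum_divide_distrib using * by simp
qed

section \<open>Moderate nets\<close>

text \<open>Stated without the norm, this fits both \<open>moderate\<close> for real nets and the
  seminorm condition of \<open>M_S0\<close>.\<close>

definition poly_growth :: "(real \<Rightarrow> real) \<Rightarrow> bool" where
  "poly_growth f \<longleftrightarrow> (\<exists>N::nat. f \<in> O[at_right 0](\<lambda>\<epsilon>. \<epsilon> powr (- real N)))"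

lemma moderate_real_iff: "moderate (f :: real \<Rightarrow> real) \<longleftrightarrow> poly_growth f"
  unfolding moderate_def poly_growth_def by simp

lemma powr_minus_bigo_mono: "N \<le> M \<Longrightarrow> (\<lambda>\<epsilon>. \<epsilon> powr (- real N)) \<in> O[at_right 0](\<lambda>\<epsilon>. \<epsilon> powr (- real M))"
proof (rule bigoI[of _ 1])
  assume NM: "N \<le> M"
  have "eventually (\<lambda>\<epsilon>::real. \<epsilon> \<in> {0<..<1}) (at_right 0)" by (rule eventually_at_right_real) simp
  then show "eventually (\<lambda>\<epsilon>. norm (\<epsilon> powr (- real N)) \<le> 1 * norm (\<epsilon> powr (- real M))) (at_right 0)"
    by eventually_elim (use NM in \<open>auto intro: powr_mono'\<close>)
qed

lemma poly_growth_add: "poly_growth f \<Longrightarrow> poly_growth g \<Longrightarrow> poly_growth (\<lambda>\<epsilon>. f \<epsilon> + g \<epsilon>)"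
proof -
  assume "poly_growth f" "poly_growth g"
  then obtain N M :: nat where "f \<in> O[at_right 0](\<lambda>\<epsilon>. \<epsilon> powr (- real N))" "g \<in> O[at_right 0](\<lambda>\<epsilon>. \<epsilon> powr (- real M))"
    unfolding poly_growth_def by blast
  then have "f \<in> O[at_right 0](\<lambda>\<epsilon>. \<epsilon> powr (- real (max N M)))" "g \<in> O[at_right 0](\<lambda>\<epsilon>. \<epsilon> powr (- real (max N M)))"
    using landau_o.big_trans[OF _ powr_minus_bigo_mono] by (meson max.cobounded1 max.cobounded2)+
  then show ?thesis unfolding poly_growth_def using sum_in_bigo(1) by blast
qed

lemma poly_growth_mult: "poly_growth f \<Longrightarrow> poly_growth g \<Longrightarrow> poly_growth (\<lambda>\<epsilon>. f \<epsilon> * g \<epsilon>)"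
proof -
  assume "poly_growth f" "poly_growth g"
  then obtain N M :: nat where "f \<in> O[at_right 0](\<lambda>\<epsilon>. \<epsilon> powr (- real N))" "g \<in> O[at_right 0](\<lambda>\<epsilon>. \<epsilon> powr (- real M))"
    unfolding poly_growth_def by blast
  then have "(\<lambda>\<epsilon>. f \<epsilon> * g \<epsilon>) \<in> O[at_right 0](\<lambda>\<epsilon>. \<epsilon> powr (- real N) * \<epsilon> powr (- real M))"
    by (rule landau_o.big.mult)
  then have "(\<lambda>\<epsilon>. f \<epsilon> * g \<epsilon>) \<in> O[at_right 0](\<lambda>\<epsilon>. \<epsilon> powr (- real (N + M)))"
    by (simp add: powr_add[symmetric])
  then show ?thesis unfolding poly_growth_def by blast
qed

lemma poly_growth_const: "poly_growth (\<lambda>\<epsilon>. c)"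
proof -
  have "(\<lambda>\<epsilon>. c) \<in> O[at_right 0](\<lambda>\<epsilon>::real. \<epsilon> powr (- real 0))"
  proof (rule bigoI[of _ "\<bar>c\<bar>"])
    have "eventually (\<lambda>\<epsilon>::real. \<epsilon> \<in> {0<..<1}) (at_right 0)" by (rule eventually_at_right_real) simp
    then show "eventually (\<lambda>\<epsilon>. norm c \<le> \<bar>c\<bar> * norm (\<epsilon> powr (- real 0))) (at_right 0)"
      by eventually_elim simp
  qed
  then show ?thesis unfolding poly_growth_def by blast
qed

lemma poly_growth_sum: "finite I \<Longrightarrow> (\<And>i. i \<in> I \<Longrightarrow> poly_growth (f i)) \<Longrightarrow> poly_growth (\<lambda>\<epsilon>. \<Sum>i\<in>I. f i \<epsilon>)"
  by (induction I rule: finite_induct) (auto intro: poly_growth_const poly_growth_add)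

lemma poly_growth_abs: "poly_growth f \<Longrightarrow> poly_growth (\<lambda>\<epsilon>. \<bar>f \<epsilon>\<bar>)"
  unfolding poly_growth_def by simp

section \<open>Matrix symbols\<close>

lemma sum_norm_mult_le:
  fixes z :: "'m::finite \<Rightarrow> complex"
  assumes "\<And>i j. norm (A i j) \<le> s i j"
  shows "norm (\<Sum>i\<in>UNIV. \<Sum>j\<in>UNIV. cnj (z i) * A i j * z j) \<le> (\<Sum>i\<in>UNIV. \<Sum>j\<in>UNIV. s i j) * (\<Sum>j\<in>UNIV. (norm (z j))\<^sup>2)"
proof -
  let ?n = "\<Sum>j\<in>UNIV. (norm (z j))\<^sup>2"
  have zz: "norm (z i) * norm (z j) \<le> ?n" for i j
  proof -
    have "(norm (z i))\<^sup>2 \<le> ?n" "(norm (z j))\<^sup>2 \<le> ?n"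
      by (rule member_le_sum; simp)+
    then show ?thesis using sum_squares_bound[of "norm (z i)" "norm (z j)"] by linarith
  qed
  have "norm (\<Sum>i\<in>UNIV. \<Sum>j\<in>UNIV. cnj (z i) * A i j * z j) \<le> (\<Sum>i\<in>UNIV. \<Sum>j\<in>UNIV. s i j * ?n)"
  proof (intro sum_norm_le)
    fix i j
    have "norm (cnj (z i) * A i j * z j) = norm (A i j) * (norm (z i) * norm (z j))" by (simp add: norm_mult)
    also have "\<dots> \<le> s i j * ?n"
      by (rule mult_mono[OF assms zz order_trans[OF norm_ge_zero assms]]) simp
    finally show "norm (cnj (z i) * A i j * z j) \<le> s i j * ?n" .
  qed
  then show ?thesis by (simp add: sum_distrib_right)
qed

text \<open>The form of the adjoint is the complex conjugate of the form Q of M, so the form of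
  \<open>Re_mat M\<close> is the real part of Q. Passing to functions z, with z = 0 included, gives
  the shape of the positivity hypothesis in \<open>sharp_garding\<close>.\<close>

lemma mat_ge_Re_mat:
  fixes M :: "complex^'m^'m"
  assumes "mat_ge (Re_mat M) (c *\<^sub>R mat 1)"
  shows "c * (\<Sum>j\<in>UNIV. (norm (z j))\<^sup>2) \<le> Re (\<Sum>i\<in>UNIV. \<Sum>j\<in>UNIV. cnj (z i) * M $ i $ j * z j)"
proof (cases "(\<chi> i. z i) = (0 :: complex^'m)")
  case True
  then have "z i = 0" for i by (simp add: vec_eq_iff)
  then show ?thesis by simp
next
  case False
  let ?Q = "\<Sum>i\<in>UNIV. \<Sum>j\<in>UNIV. cnj (z i) * M $ i $ j * z j"
  have "(\<Sum>i\<in>UNIV. cnj (z i) * (((Re_mat M - c *\<^sub>R mat 1) *v (\<chi> i. z i)) $ i)) \<in> \<real>\<^sub>\<ge>\<^sub>0"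
    using assms False unfolding mat_ge_def by (metis (no_types, lifting) sum.cong vec_lambda_beta)
  then have ge: "0 \<le> Re (\<Sum>i\<in>UNIV. cnj (z i) * (((Re_mat M - c *\<^sub>R mat 1) *v (\<chi> i. z i)) $ i))"
    by (simp add: complex_nonneg_Reals_iff)
  have comp: "(Re_mat M - c *\<^sub>R mat 1) $ i $ j = (1/2) * M $ i $ j + (1/2) * cnj (M $ j $ i) - (if i = j then complex_of_real c else 0)" for i j
    by (simp add: Re_mat_def adjoint_mat_def mat_def) (simp add: scaleR_conv_of_real)
  have "(\<Sum>i\<in>UNIV. cnj (z i) * (((Re_mat M - c *\<^sub>R mat 1) *v (\<chi> i. z i)) $ i))
      = (\<Sum>i\<in>UNIV. \<Sum>j\<in>UNIV. (1/2) * (cnj (z i) * M $ i $ j * z j) + (1/2) * (cnj (z i) * cnj (M $ j $ i) * z j)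
          - (if i = j then complex_of_real c * (cnj (z i) * z j) else 0))"
    unfolding matrix_vector_mult_def sum_distrib_left vec_lambda_beta comp
    by (intro sum.cong refl) (simp add: algebra_simps)
  also have "\<dots> = (1/2) * ?Q + (1/2) * (\<Sum>i\<in>UNIV. \<Sum>j\<in>UNIV. cnj (z i) * cnj (M $ j $ i) * z j)
          - (\<Sum>i\<in>UNIV. complex_of_real c * (cnj (z i) * z i))"
    by (simp add: sum.distrib sum_subtractf sum_distrib_left[symmetric] sum_divide_distrib)
  also have "(\<Sum>i\<in>UNIV. \<Sum>j\<in>UNIV. cnj (z i) * cnj (M $ j $ i) * z j) = cnj ?Q"
    by (subst sum.swap) (simp add: mult_ac)
  also have "(\<Sum>i\<in>UNIV. complex_of_real c * (cnj (z i) * z i)) = complex_of_real (c * (\<Sum>j\<in>UNIV. (norm (z j))\<^sup>2))"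
    unfolding of_real_mult of_real_sum complex_norm_square sum_distrib_left by (simp only: mult_ac)
  finally have eq: "(\<Sum>i\<in>UNIV. cnj (z i) * (((Re_mat M - c *\<^sub>R mat 1) *v (\<chi> i. z i)) $ i))
      = (1/2) * ?Q + (1/2) * cnj ?Q - complex_of_real (c * (\<Sum>j\<in>UNIV. (norm (z j))\<^sup>2))" .
  have "Re ((1/2) * q + (1/2) * cnj q - complex_of_real t) = Re q - t" for q t by simp
  then have "Re (\<Sum>i\<in>UNIV. cnj (z i) * (((Re_mat M - c *\<^sub>R mat 1) *v (\<chi> i. z i)) $ i)) = Re ?Q - c * (\<Sum>j\<in>UNIV. (norm (z j))\<^sup>2)"
    unfolding eq .
  then show ?thesis using ge by linarith
qed

lemma psdo_diff_const:
  fixes a :: "'n::finite symbol"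
  assumes a: "continuous_on UNIV a" "\<And>z. norm (a z) \<le> C" and u: "rapid u"
  shows "psdo (\<lambda>z. a z - k) u x = psdo a u x - k * u x"
proof -
  have Fi: "integrable lborel (fourier u)" by (rule rapid_fourier_integrable[OF u])
  have i: "integrable lborel (\<lambda>\<xi>. k * (cis (x \<bullet> \<xi>) * fourier u \<xi>))"
    using fourier_integrable(2)[OF Fi, of x] by (simp add: inner_commute)
  have "(\<integral>\<xi>. cis (x \<bullet> \<xi>) * (a (x, \<xi>) - k) * fourier u \<xi> \<partial>lborel)
      = (\<integral>\<xi>. cis (x \<bullet> \<xi>) * a (x, \<xi>) * fourier u \<xi> - k * (cis (x \<bullet> \<xi>) * fourier u \<xi>) \<partial>lborel)"
    by (simp add: algebra_simps)
  also have "\<dots> = (\<integral>\<xi>. cis (x \<bullet> \<xi>) * a (x, \<xi>) * fourier u \<xi> \<partial>lborel) - k * (complex_of_real ((2 * pi) ^ CARD('n)) * u x)"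
    unfolding rapid_inversion[OF u, symmetric] integral_mult_right_zero[symmetric]
    by (rule Bochner_Integration.integral_diff[OF psdo_integrable[OF a Fi] i])
  finally show ?thesis unfolding psdo_def by (simp add: scaleR_diff_right) (simp add: scaleR_conv_of_real)
qed

lemma represents_S0:
  assumes "\<And>i j. A $ i $ j \<in> G_S0" and "represents A\<epsilon> A"
  shows "(\<lambda>\<epsilon> z. A\<epsilon> \<epsilon> z $ i $ j) \<in> M_S0"
proof -
  obtain b where "A $ i $ j = S0_rel `` {b}"
    using assms(1)[of i j] unfolding G_S0_def by (auto elim: quotientE)
  moreover have "(\<lambda>\<epsilon> z. A\<epsilon> \<epsilon> z $ i $ j) \<in> A $ i $ j" using assms(2) unfolding represents_def by blast
  ultimately show ?thesis unfolding S0_rel_def by auto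
qed

text \<open>K is chosen before the matrix, so that for a net of symbols the whole dependence on the
  parameter lies in S and r. The factor S (4 + 2 |r|) is the sum of the symbol bound 2 S and of
  \<kappa> = 2 S (1 + |r|).\<close>

lemma garding_matrix:
  "\<exists>K\<ge>0. \<forall>(A :: (real^'n::finite) \<times> (real^'n) \<Rightarrow> complex^'m^'m) S c r u.
     (\<forall>i j. (\<lambda>z. A z $ i $ j) \<in> S0) \<longrightarrow> S = (\<Sum>i\<in>UNIV. \<Sum>j\<in>UNIV. S0_seminorm (smoothness_order TYPE('n)) (\<lambda>z. A z $ i $ j)) \<longrightarrow>
     (\<forall>x \<xi>. norm \<xi> \<ge> r \<longrightarrow> mat_ge (Re_mat (A (x, \<xi>))) (c *\<^sub>R mat 1)) \<longrightarrow>
     (\<forall>j. schwartz (\<lambda>x. u x $ j)) \<longrightarrow>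
     Re (L2_inner (psdo_mat A u) u) \<ge> c * (sobolev_norm 0 u)\<^sup>2 - K * (S * (4 + 2 * \<bar>r\<bar>)) * (sobolev_norm (- 1 / 2) u)\<^sup>2"
proof -
  let ?L = "smoothness_order TYPE('n)"
  obtain K0 where K0: "K0 \<ge> 0" and sg: "\<And>C \<kappa> (a :: 'm \<Rightarrow> 'm \<Rightarrow> 'n symbol) u. 0 \<le> C \<Longrightarrow> 0 \<le> \<kappa> \<Longrightarrow>
     (\<forall>i j. wb xi_deg ?L C xi_weight (a i j)) \<Longrightarrow> (\<forall>j. rapid (u j)) \<Longrightarrow>
     (\<forall>x \<zeta> z. - (\<kappa> / jbracket \<zeta> * (\<Sum>j\<in>UNIV. (norm (z j))\<^sup>2)) \<le> Re (\<Sum>i\<in>UNIV. \<Sum>j\<in>UNIV. cnj (z i) * a i j (x, \<zeta>) * z j)) \<Longrightarrow>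
     - (K0 * (C + \<kappa>) * (\<Sum>j\<in>UNIV. energy (fourier (u j)))) \<le> Re (\<Sum>i\<in>UNIV. \<Sum>j\<in>UNIV. \<integral>x. psdo (a i j) (u j) x * cnj (u i x) \<partial>lborel)"
    using sharp_garding[where 'm='m and 'n='n] by blast
  define K where "K = K0 * (2 * pi) ^ CARD('n)"
  have main: "Re (L2_inner (psdo_mat A u) u) \<ge> c * (sobolev_norm 0 u)\<^sup>2 - K * (S * (4 + 2 * \<bar>r\<bar>)) * (sobolev_norm (- 1 / 2) u)\<^sup>2"
    if A: "\<forall>i j. (\<lambda>z. A z $ i $ j) \<in> S0" and Sdef: "S = (\<Sum>i\<in>UNIV. \<Sum>j\<in>UNIV. S0_seminorm ?L (\<lambda>z. A z $ i $ j))"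
      and ell: "\<forall>x \<xi>. norm \<xi> \<ge> r \<longrightarrow> mat_ge (Re_mat (A (x, \<xi>))) (c *\<^sub>R mat 1)"
      and sch: "\<forall>j. schwartz (\<lambda>x. u x $ j)"
    for A :: "(real^'n) \<times> (real^'n) \<Rightarrow> complex^'m^'m" and S c r u
  proof -
    let ?n2 = "\<lambda>z::'m \<Rightarrow> complex. \<Sum>j\<in>UNIV. (norm (z j))\<^sup>2"
    let ?Q = "\<lambda>p z. \<Sum>i\<in>UNIV. \<Sum>j\<in>UNIV. cnj (z i) * A p $ i $ j * z j"
    define s where "s i j = S0_seminorm ?L (\<lambda>z. A z $ i $ j)" for i j
    have s0: "0 \<le> s i j" for i j unfolding s_def using A by (intro S0_seminorm_nonneg) blast
    have S: "S = (\<Sum>i\<in>UNIV. \<Sum>j\<in>UNIV. s i j)" unfolding Sdef s_def ..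
    have S0: "0 \<le> S" unfolding S by (intro sum_nonneg s0)
    have sS: "s i j \<le> S" for i j
    proof -
      have "s i j \<le> (\<Sum>j\<in>UNIV. s i j)" by (rule member_le_sum) (auto simp: s0)
      also have "\<dots> \<le> S" unfolding S by (rule member_le_sum[of i UNIV "\<lambda>i. \<Sum>j\<in>UNIV. s i j"]) (auto intro: sum_nonneg s0)
      finally show ?thesis .
    qed
    have wA: "wb xi_deg ?L (s i j) xi_weight (\<lambda>z. A z $ i $ j)" for i j
      unfolding s_def using A by (intro S0_wb) blast
    have wA': "wb xi_deg ?L S xi_weight (\<lambda>z. A z $ i $ j)" for i j
      by (rule wb_mono[OF wA order_refl mult_right_mono[OF sS]]) (simp add: less_imp_le[OF jbracket_pos])
    have Qb: "norm (?Q p z) \<le> S * ?n2 z" for p z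
      unfolding S by (rule sum_norm_mult_le) (rule wb_xi_weight_bounded[OF wA])
    have n2: "0 \<le> ?n2 z" for z by (intro sum_nonneg) simp
    have QS: "- (S * ?n2 z) \<le> Re (?Q p z)" "Re (?Q p z) \<le> S * ?n2 z" for p z
      using abs_Re_le_cmod[of "?Q p z"] Qb[of z p] by linarith+
    \<comment> \<open>Since the form of A is everywhere at least -S |z|^2, truncating below at -S
      keeps the lower bound for large frequencies. It secures |c'| <= S, so that subtracting c' does
      not spoil the symbol bound.\<close>
    define c' where "c' = max c (- S)"
    have cS: "c \<le> S"
    proof -
      obtain b :: "real^'n" where b: "b \<in> Basis" using nonempty_Basis by blast
      \<comment> \<open>A unit coordinate vector, tested at a frequency of norm |r|, which lies in
        the elliptic region also when r is negative; comparison with the upper bound S gives c <=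
        S.\<close>
      obtain i0 :: 'm where True by blast
      define z :: "'m \<Rightarrow> complex" where "z i = (if i = i0 then 1 else 0)" for i
      have "(norm (z j))\<^sup>2 = (if j = i0 then 1 else 0)" for j by (simp add: z_def)
      then have "?n2 z = 1" by simp
      moreover have "c * ?n2 z \<le> Re (?Q (0, \<bar>r\<bar> *\<^sub>R b) z)"
        by (rule mat_ge_Re_mat) (use ell b in simp)
      ultimately show ?thesis using QS(2)[where z=z and p="(0, \<bar>r\<bar> *\<^sub>R b)"] by simp
    qed
    have c': "c \<le> c'" "\<bar>c'\<bar> \<le> S" using cS S0 unfolding c'_def by auto
    have Qc: "c' * ?n2 z \<le> Re (?Q (x, \<xi>) z)" if "norm \<xi> \<ge> r" for x \<xi> z
    proof -
      have "c * ?n2 z \<le> Re (?Q (x, \<xi>) z)" by (rule mat_ge_Re_mat) (use ell that in blast)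
      then show ?thesis using QS(1)[where z=z and p="(x, \<xi>)"] unfolding c'_def max_def by simp
    qed
    define k where "k i j = (if i = j then complex_of_real c' else 0)" for i j :: 'm
    define a where "a i j = (\<lambda>z. A z $ i $ j - k i j)" for i j
    \<comment> \<open>For |zeta| < r only the bound -2 S |z|^2 is available. There <zeta> is at most
      1 + |r|, so 2 S <= \<kappa> / <zeta> with this choice.\<close>
    define \<kappa> where "\<kappa> = 2 * S * (1 + \<bar>r\<bar>)"
    have \<kappa>: "0 \<le> \<kappa>" unfolding \<kappa>_def using S0 by simp
    have wa: "\<forall>i j. wb xi_deg ?L (S + S) xi_weight (a i j)"
    proof (intro allI)
      fix i j
      have "wb xi_deg ?L S xi_weight (\<lambda>z. - k i j)"
        by (rule wb_const) (use c' S0 in \<open>auto simp: k_def less_imp_le[OF jbracket_pos]\<close>)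
      from wb_add[OF wA'[of i j] this] show "wb xi_deg ?L (S + S) xi_weight (a i j)" by (simp add: a_def)
    qed
    have u: "\<forall>j. rapid (\<lambda>x. u x $ j)" using sch schwartz_rapid by blast
    have Qa: "(\<Sum>i\<in>UNIV. \<Sum>j\<in>UNIV. cnj (z i) * a i j p * z j) = ?Q p z - complex_of_real (c' * ?n2 z)" for p z
    proof -
      have "(\<Sum>i\<in>UNIV. \<Sum>j\<in>UNIV. cnj (z i) * a i j p * z j) = ?Q p z - (\<Sum>i\<in>UNIV. \<Sum>j\<in>UNIV. cnj (z i) * k i j * z j)"
        unfolding sum_subtractf[symmetric] a_def by (simp add: algebra_simps)
      also have "(\<Sum>i\<in>UNIV. \<Sum>j\<in>UNIV. cnj (z i) * k i j * z j) = (\<Sum>i\<in>UNIV. complex_of_real c' * (z i * cnj (z i)))"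
        unfolding k_def by (intro sum.cong refl) (simp add: if_distrib if_distribR sum.delta mult_ac cong: if_cong)
      also have "\<dots> = complex_of_real (c' * ?n2 z)"
        unfolding of_real_mult of_real_sum complex_norm_square sum_distrib_left ..
      finally show ?thesis .
    qed
    have pos: "\<forall>x \<zeta> z. - (\<kappa> / jbracket \<zeta> * ?n2 z) \<le> Re (\<Sum>i\<in>UNIV. \<Sum>j\<in>UNIV. cnj (z i) * a i j (x, \<zeta>) * z j)"
    proof (intro allI)
      fix x \<zeta> and z :: "'m \<Rightarrow> complex"
      have e: "Re (\<Sum>i\<in>UNIV. \<Sum>j\<in>UNIV. cnj (z i) * a i j (x, \<zeta>) * z j) = Re (?Q (x, \<zeta>) z) - c' * ?n2 z"
        unfolding Qa by simp
      show "- (\<kappa> / jbracket \<zeta> * ?n2 z) \<le> Re (\<Sum>i\<in>UNIV. \<Sum>j\<in>UNIV. cnj (z i) * a i j (x, \<zeta>) * z j)"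
      proof (cases "norm \<zeta> \<ge> r")
        case True
        have "0 \<le> \<kappa> / jbracket \<zeta> * ?n2 z" using \<kappa> n2[of z] jbracket_pos[of \<zeta>] by simp
        then show ?thesis unfolding e using Qc[OF True, of z x] by linarith
      next
        case False
        have "c' * ?n2 z \<le> S * ?n2 z" using c'(2) by (intro mult_right_mono n2) simp
        with QS(1)[where z=z and p="(x, \<zeta>)"] have "- (2 * S * ?n2 z) \<le> Re (?Q (x, \<zeta>) z) - c' * ?n2 z" by simp
        moreover have "2 * S * ?n2 z \<le> \<kappa> / jbracket \<zeta> * ?n2 z"
        proof (rule mult_right_mono[OF _ n2])
          have "jbracket \<zeta> \<le> 1 + \<bar>r\<bar>" using False jbracket_le[of \<zeta>] by linarith
          then have "2 * S * jbracket \<zeta> \<le> \<kappa>" unfolding \<kappa>_def using S0 by (intro mult_left_mono) simp_all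
          then show "2 * S \<le> \<kappa> / jbracket \<zeta>" using jbracket_pos[of \<zeta>] by (simp add: pos_le_divide_eq)
        qed
        ultimately show ?thesis unfolding e by linarith
      qed
    qed
    have G: "- (K0 * (S + S + \<kappa>) * (\<Sum>j\<in>UNIV. energy (fourier (\<lambda>x. u x $ j))))
        \<le> Re (\<Sum>i\<in>UNIV. \<Sum>j\<in>UNIV. \<integral>x. psdo (a i j) (\<lambda>x. u x $ j) x * cnj (u x $ i) \<partial>lborel)"
      by (rule sg[OF _ \<kappa> wa u pos]) (use S0 in simp)
    note un = u[rule_format]
    define q where "q i j x = psdo (\<lambda>z. A z $ i $ j) (\<lambda>x. u x $ j) x * cnj (u x $ i)" for i j x
    have qi: "integrable lborel (q i j)" for i j
      unfolding q_def[abs_def] by (rule psdo_mult_integrable[OF wb_continuous[OF wA'] wb_xi_weight_bounded[OF wA'] un un])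
    have ui: "integrable lborel (\<lambda>x. (norm (u x $ j))\<^sup>2)" for j by (rule sobolev_norm_0(2)[OF un])
    have ki: "integrable lborel (\<lambda>x. k i j * (u x $ j * cnj (u x $ i)))" for i j
    proof (cases "i = j")
      case True
      then have "(\<lambda>x. k i j * (u x $ j * cnj (u x $ i))) = (\<lambda>x. complex_of_real (c' * (norm (u x $ j))\<^sup>2))"
        by (simp only: k_def of_real_mult complex_norm_square if_True simp_thms)
      then show ?thesis using ui[of j] by (simp only:) (intro integrable_of_real integrable_mult_right)
    qed (simp add: k_def)
    have pa: "psdo (a i j) (\<lambda>x. u x $ j) x * cnj (u x $ i) = q i j x - k i j * (u x $ j * cnj (u x $ i))" for i j x
      unfolding a_def psdo_diff_const[OF wb_continuous[OF wA'] wb_xi_weight_bounded[OF wA'] un] q_def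
      by (simp add: algebra_simps)
    have "(\<Sum>i\<in>UNIV. \<Sum>j\<in>UNIV. \<integral>x. psdo (a i j) (\<lambda>x. u x $ j) x * cnj (u x $ i) \<partial>lborel)
        = (\<Sum>i\<in>UNIV. \<Sum>j\<in>UNIV. integral\<^sup>L lborel (q i j)) - (\<Sum>i\<in>UNIV. \<Sum>j\<in>UNIV. k i j * (\<integral>x. u x $ j * cnj (u x $ i) \<partial>lborel))"
      unfolding pa sum_subtractf[symmetric] integral_mult_right_zero[symmetric]
      by (intro sum.cong refl Bochner_Integration.integral_diff qi ki)
    also have "(\<Sum>i\<in>UNIV. \<Sum>j\<in>UNIV. integral\<^sup>L lborel (q i j)) = L2_inner (psdo_mat A u) u"
      unfolding L2_inner_def psdo_mat_def vec_lambda_beta sum_distrib_right q_def[symmetric]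
      using qi by simp
    also have "(\<Sum>i\<in>UNIV. \<Sum>j\<in>UNIV. k i j * (\<integral>x. u x $ j * cnj (u x $ i) \<partial>lborel)) = complex_of_real (c' * (sobolev_norm 0 u)\<^sup>2)"
    proof -
      have "(\<Sum>i\<in>UNIV. \<Sum>j\<in>UNIV. k i j * (\<integral>x. u x $ j * cnj (u x $ i) \<partial>lborel)) = (\<Sum>i\<in>UNIV. complex_of_real c' * (\<integral>x. u x $ i * cnj (u x $ i) \<partial>lborel))"
        unfolding k_def by (intro sum.cong refl) (simp add: if_distrib if_distribR sum.delta cong: if_cong)
      also have "\<dots> = (\<Sum>i\<in>UNIV. complex_of_real c' * complex_of_real (\<integral>x. (norm (u x $ i))\<^sup>2 \<partial>lborel))"
        unfolding integral_complex_of_real[symmetric] complex_norm_square ..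
      also have "\<dots> = complex_of_real (c' * (sobolev_norm 0 u)\<^sup>2)"
        unfolding sobolev_norm_0(1)[OF un] of_real_mult of_real_sum sum_distrib_left ..
      finally show ?thesis .
    qed
    finally have "- (K0 * (S + S + \<kappa>) * (\<Sum>j\<in>UNIV. energy (fourier (\<lambda>x. u x $ j)))) \<le> Re (L2_inner (psdo_mat A u) u) - c' * (sobolev_norm 0 u)\<^sup>2"
      using G by simp
    moreover have "K0 * (S + S + \<kappa>) * (\<Sum>j\<in>UNIV. energy (fourier (\<lambda>x. u x $ j))) = K * (S * (4 + 2 * \<bar>r\<bar>)) * (sobolev_norm (- 1 / 2) u)\<^sup>2"
      unfolding sobolev_norm_half[OF un] K_def \<kappa>_def by (simp add: algebra_simps)
    moreover have "c * (sobolev_norm 0 u)\<^sup>2 \<le> c' * (sobolev_norm 0 u)\<^sup>2" by (rule mult_right_mono[OF c'(1)]) simp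
    ultimately show ?thesis by linarith
  qed
  have "0 \<le> K" unfolding K_def using K0 by simp
  with main show ?thesis by blast
qed

theorem theoremA4:
  fixes A :: "((real \<Rightarrow> 'n::finite symbol) set)^'m^'m"
    and A\<epsilon> :: "real \<Rightarrow> (real^'n) \<times> (real^'n) \<Rightarrow> complex^'m^'m"
    and c r :: "real \<Rightarrow> real"
  assumes "\<And>i j. A $ i $ j \<in> G_S0"
    and "represents A\<epsilon> A"
    and "strictly_nonzero c"
    and "strictly_nonzero r" and "moderate r"
    and "\<And>\<epsilon> x \<xi>. \<epsilon> \<in> {0<..1} \<Longrightarrow> norm \<xi> \<ge> r \<epsilon> \<Longrightarrow>
           mat_ge (Re_mat (A\<epsilon> \<epsilon> (x, \<xi>))) (c \<epsilon> *\<^sub>R mat 1)"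
  shows "\<exists>c1 :: real \<Rightarrow> real. moderate c1 \<and>
           (\<forall>\<epsilon>\<in>{0<..1}. \<forall>u :: real^'n \<Rightarrow> complex^'m. (\<forall>j. schwartz (\<lambda>x. u x $ j)) \<longrightarrow>
              Re (L2_inner (psdo_mat (A\<epsilon> \<epsilon>) u) u)
                \<ge> c \<epsilon> * (sobolev_norm 0 u)\<^sup>2 - c1 \<epsilon> * (sobolev_norm (- 1 / 2) u)\<^sup>2)"
proof -
  let ?L = "smoothness_order TYPE('n)"
  obtain K where gm: "\<And>(A :: (real^'n) \<times> (real^'n) \<Rightarrow> complex^'m^'m) S c r u.
     (\<forall>i j. (\<lambda>z. A z $ i $ j) \<in> S0) \<Longrightarrow> S = (\<Sum>i\<in>UNIV. \<Sum>j\<in>UNIV. S0_seminorm ?L (\<lambda>z. A z $ i $ j)) \<Longrightarrow>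
     (\<forall>x \<xi>. norm \<xi> \<ge> r \<longrightarrow> mat_ge (Re_mat (A (x, \<xi>))) (c *\<^sub>R mat 1)) \<Longrightarrow>
     (\<forall>j. schwartz (\<lambda>x. u x $ j)) \<Longrightarrow>
     Re (L2_inner (psdo_mat A u) u) \<ge> c * (sobolev_norm 0 u)\<^sup>2 - K * (S * (4 + 2 * \<bar>r\<bar>)) * (sobolev_norm (- 1 / 2) u)\<^sup>2"
    using garding_matrix[where 'n='n and 'm='m] by blast
  define S where "S \<epsilon> = (\<Sum>i\<in>UNIV. \<Sum>j\<in>UNIV. S0_seminorm ?L (\<lambda>z. A\<epsilon> \<epsilon> z $ i $ j))" for \<epsilon>
  have M: "(\<lambda>\<epsilon> z. A\<epsilon> \<epsilon> z $ i $ j) \<in> M_S0" for i j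
    by (rule represents_S0[OF assms(1,2)])
  have "poly_growth (\<lambda>\<epsilon>. S0_seminorm ?L (\<lambda>z. A\<epsilon> \<epsilon> z $ i $ j))" for i j
    using M[of i j] unfolding M_S0_def poly_growth_def by blast
  then have "poly_growth S" unfolding S_def by (intro poly_growth_sum) simp_all
  moreover have "poly_growth (\<lambda>\<epsilon>. \<bar>r \<epsilon>\<bar>)"
    using assms(5) unfolding moderate_real_iff by (rule poly_growth_abs)
  \<comment> \<open>This is the witness: a finite sum of seminorm nets of the representative,
    moderate by \<open>M_S0\<close>, times an affine function of |r|, moderate by the hypothesis on
    r.\<close>
  ultimately have "moderate (\<lambda>\<epsilon>. K * (S \<epsilon> * (4 + 2 * \<bar>r \<epsilon>\<bar>)))"
    unfolding moderate_real_iff by (intro poly_growth_mult poly_growth_add poly_growth_const)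
  moreover have "Re (L2_inner (psdo_mat (A\<epsilon> \<epsilon>) u) u)
      \<ge> c \<epsilon> * (sobolev_norm 0 u)\<^sup>2 - K * (S \<epsilon> * (4 + 2 * \<bar>r \<epsilon>\<bar>)) * (sobolev_norm (- 1 / 2) u)\<^sup>2"
    if e: "\<epsilon> \<in> {0<..1}" and u: "\<forall>j. schwartz (\<lambda>x. u x $ j)" for \<epsilon> and u :: "real^'n \<Rightarrow> complex^'m"
    unfolding S_def
  proof (rule gm[OF _ refl _ u])
    show "\<forall>i j. (\<lambda>z. A\<epsilon> \<epsilon> z $ i $ j) \<in> S0" using M e unfolding M_S0_def by blast
    show "\<forall>x \<xi>. norm \<xi> \<ge> r \<epsilon> \<longrightarrow> mat_ge (Re_mat (A\<epsilon> \<epsilon> (x, \<xi>))) (c \<epsilon> *\<^sub>R mat 1)" using assms(6)[OF e] by blast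
  qed
  ultimately show ?thesis by blast
qed

end
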